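(* Let $d\ge 1$ and let $G$ be a non-amenable generalized Baumslag-Solitar group of rank $d$ defined by a reduced graph of groups $\mathscr{H}$, and let $\mathcal{T}$ be the Bass-Serre tree of $\mathscr{H}$. Then \[\mathcal{K}(G) = \{H \leq G \mid \text{the quotient graph } H \backslash \mathcal{T} \text{ is infinite}\}.\]
   Context: Graphs are in the sense of Serre: each edge $e$ has a source $\mathbf{s}(e)$, a target $\mathbf{t}(e)$ and an opposite edge $\overline{e}\neq e$. A generalized Baumslag-Solitar (GBS) group of rank $d$ is the fundamental group of a finite connected graph of groups $\mathscr{H}$ all of whose vertex and edge groups are isomorphic to $\mathbb{Z}^d$ (equivalently, a group acting cocompactly, without inversion, on an oriented tree with all vertex and edge stabilizers isomorphic to $\mathbb{Z}^d$). Identifying the vertex and edge groups with $\mathbb{Z}^d$, the inclusion of the edge group $G_e$ in $G_{\mathbf{s}(e)}$ (resp. in $G_{\mathbf{t}(e)}$) is given by a matrix $M_{e,\mathbf{s}}$ (resp. $M_{e,\mathbf{t}}$) in $\mathrm{M}_d(\mathbb{Z})\cap \mathrm{GL}_d(\mathbb{Q})$, with $M_{\overline{e},\mathbf{t}}=M_{e,\mathbf{s}}$; these two matrices are the labels of $e$. The graph of groups $\mathscr{H}$ is reduced if every edge having at least one label in $\mathrm{GL}_d(\mathbb{Z})$ is a loop. For a countable group $G$, $\mathrm{Sub}(G)$ is the set of subgroups of $G$ with the Chabauty topology (the topology induced from $\{0,1\}^G$). The perfect kernel $\mathcal{K}(G)$ is the largest closed subset of $\mathrm{Sub}(G)$ without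 isolated points; equivalently, the set of subgroups all of whose neighborhoods in $\mathrm{Sub}(G)$ are uncountable. *)

theory Defs
  imports "HOL-Analysis.Analysis" "HOL-Algebra.Coset"
begin

section \<open>Graphs in the sense of Serre\<close>

record ('v, 'e) sgraph =
  verts :: "'v set"
  edges :: "'e set"
  src :: "'e \<Rightarrow> 'v"
  tgt :: "'e \<Rightarrow> 'v"
  opp :: "'e \<Rightarrow> 'e"

locale serre_graph =
  fixes \<Gamma> :: "('v, 'e, 'z) sgraph_scheme"
  assumes src_in: "e \<in> edges \<Gamma> \<Longrightarrow> src \<Gamma> e \<in> verts \<Gamma>"
    and opp_in: "e \<in> edges \<Gamma> \<Longrightarrow> opp \<Gamma> e \<in> edges \<Gamma>"
    and opp_opp: "e \<in> edges \<Gamma> \<Longrightarrow> opp \<Gamma> (opp \<Gamma> e) = e"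
    and opp_neq: "e \<in> edges \<Gamma> \<Longrightarrow> opp \<Gamma> e \<noteq> e"
    and tgt_opp: "e \<in> edges \<Gamma> \<Longrightarrow> tgt \<Gamma> (opp \<Gamma> e) = src \<Gamma> e"
begin

lemma src_opp: "e \<in> edges \<Gamma> \<Longrightarrow> src \<Gamma> (opp \<Gamma> e) = tgt \<Gamma> e"
  by (metis opp_in opp_opp tgt_opp)

lemma tgt_in: "e \<in> edges \<Gamma> \<Longrightarrow> tgt \<Gamma> e \<in> verts \<Gamma>"
  by (metis src_opp src_in opp_in)

end

definition connected_graph :: "('v, 'e, 'z) sgraph_scheme \<Rightarrow> bool" where
  "connected_graph \<Gamma> \<longleftrightarrow> verts \<Gamma> \<noteq> {} \<and>
     (\<forall>u\<in>verts \<Gamma>. \<forall>v\<in>verts \<Gamma>. (u, v) \<in> {(src \<Gamma> e, tgt \<Gamma> e) | e. e \<in> edges \<Gamma>}\<^sup>*)"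

definition infinite_graph :: "('v, 'e, 'z) sgraph_scheme \<Rightarrow> bool" where
  "infinite_graph \<Gamma> \<longleftrightarrow> \<not> (finite (verts \<Gamma>) \<and> finite (edges \<Gamma>))"

text \<open>The quotient by a set \<open>H\<close> of transformations, acting by \<open>av\<close> on vertices and by \<open>ae\<close> on
  edges. As the structure maps are equivariant, the image of an orbit under one of them is again an
  orbit.\<close>

definition quotient_graph ::
  "'h set \<Rightarrow> ('h \<Rightarrow> 'v \<Rightarrow> 'v) \<Rightarrow> ('h \<Rightarrow> 'e \<Rightarrow> 'e) \<Rightarrow> ('v, 'e, 'z) sgraph_scheme \<Rightarrow>
    ('v set, 'e set) sgraph" where
  "quotient_graph H av ae \<Gamma> =
     \<lparr> verts = (\<lambda>v. (\<lambda>h. av h v) ` H) ` verts \<Gamma>,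
       edges = (\<lambda>e. (\<lambda>h. ae h e) ` H) ` edges \<Gamma>,
       src = (\<lambda>B. src \<Gamma> ` B),
       tgt = (\<lambda>B. tgt \<Gamma> ` B),
       opp = (\<lambda>B. opp \<Gamma> ` B) \<rparr>"


section \<open>Finite connected graphs of groups with all local groups \<open>\<int>\<^sup>d\<close>\<close>

text \<open>The rank \<open>d\<close> is \<open>CARD('d)\<close>. The inclusion of the edge group of \<open>e\<close> in the vertex group of
  \<open>src e\<close> (resp. \<open>tgt e\<close>) is \<open>x \<mapsto> lab_src e *v x\<close> (resp. \<open>x \<mapsto> lab_tgt e *v x\<close>).\<close>

record ('v, 'e, 'd::finite) zd_graph = "('v, 'e) sgraph" +
  lab_src :: "'e \<Rightarrow> int ^ 'd ^ 'd"
  lab_tgt :: "'e \<Rightarrow> int ^ 'd ^ 'd"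

locale gbs_graph = serre_graph \<Gamma>
  for \<Gamma> :: "('v, 'e, 'd::finite) zd_graph" +
  assumes finite_verts: "finite (verts \<Gamma>)"
    and finite_edges: "finite (edges \<Gamma>)"
    and connected: "connected_graph \<Gamma>"
    and lab_src_GL: "e \<in> edges \<Gamma> \<Longrightarrow>
      invertible (\<chi> i j. rat_of_int (lab_src \<Gamma> e $ i $ j) :: rat ^ 'd ^ 'd)"
    and lab_tgt_GL: "e \<in> edges \<Gamma> \<Longrightarrow>
      invertible (\<chi> i j. rat_of_int (lab_tgt \<Gamma> e $ i $ j) :: rat ^ 'd ^ 'd)"
    and lab_tgt_opp: "e \<in> edges \<Gamma> \<Longrightarrow> lab_tgt \<Gamma> (opp \<Gamma> e) = lab_src \<Gamma> e"
begin

lemma lab_src_opp: "e \<in> edges \<Gamma> \<Longrightarrow> lab_src \<Gamma> (opp \<Gamma> e) = lab_tgt \<Gamma> e"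
  by (metis opp_in opp_opp lab_tgt_opp)

end

text \<open>Here \<open>invertible\<close> is invertibility over the integers, i.e. membership in \<open>GL\<^sub>d(\<int>)\<close>.\<close>

definition reduced_graph :: "('v, 'e, 'd::finite) zd_graph \<Rightarrow> bool" where
  "reduced_graph \<Gamma> \<longleftrightarrow> (\<forall>e\<in>edges \<Gamma>.
     invertible (lab_src \<Gamma> e) \<or> invertible (lab_tgt \<Gamma> e) \<longrightarrow> src \<Gamma> e = tgt \<Gamma> e)"


section \<open>The fundamental group\<close>

text \<open>Following Serre, \<open>path_group \<Gamma>\<close> is the group generated by the vertex groups and the edges
  subject to the relations \<open>opp e = e\<^sup>-\<^sup>1\<close> and \<open>e \<cdot> \<iota>\<^sub>t(x) \<cdot> e\<^sup>-\<^sup>1 = \<iota>\<^sub>s(x)\<close> for \<open>x\<close> in the edge group of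
  \<open>e\<close>, where \<open>\<iota>\<^sub>s\<close> and \<open>\<iota>\<^sub>t\<close> are the inclusions in the vertex groups of \<open>src e\<close> and \<open>tgt e\<close>. Its
  elements are congruence classes of words. No formal inverses of letters are needed, because the
  relations make \<open>Vtx v (- a)\<close> inverse to \<open>Vtx v a\<close> and \<open>Edg (opp e)\<close> inverse to \<open>Edg e\<close>.\<close>

datatype ('v, 'e, 'd::finite) letter = Vtx 'v "int ^ 'd" | Edg 'e

type_synonym ('v, 'e, 'd) word = "('v, 'e, 'd) letter list"

definition words :: "('v, 'e, 'd::finite) zd_graph \<Rightarrow> ('v, 'e, 'd) word set" where
  "words \<Gamma> = lists ({Vtx v a | v a. v \<in> verts \<Gamma>} \<union> Edg ` edges \<Gamma>)"

inductive_set word_cong ::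
  "('v, 'e, 'd::finite) zd_graph \<Rightarrow> (('v, 'e, 'd) word \<times> ('v, 'e, 'd) word) set"
  for \<Gamma> :: "('v, 'e, 'd) zd_graph" where
  refl: "x \<in> words \<Gamma> \<Longrightarrow> (x, x) \<in> word_cong \<Gamma>"
| sym: "(x, y) \<in> word_cong \<Gamma> \<Longrightarrow> (y, x) \<in> word_cong \<Gamma>"
| trans: "(x, y) \<in> word_cong \<Gamma> \<Longrightarrow> (y, z) \<in> word_cong \<Gamma> \<Longrightarrow> (x, z) \<in> word_cong \<Gamma>"
| ctxt: "(x, y) \<in> word_cong \<Gamma> \<Longrightarrow> l \<in> words \<Gamma> \<Longrightarrow> r \<in> words \<Gamma> \<Longrightarrow>
    (l @ x @ r, l @ y @ r) \<in> word_cong \<Gamma>"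
| unit: "v \<in> verts \<Gamma> \<Longrightarrow> ([Vtx v 0], []) \<in> word_cong \<Gamma>"
| add: "v \<in> verts \<Gamma> \<Longrightarrow> ([Vtx v a, Vtx v b], [Vtx v (a + b)]) \<in> word_cong \<Gamma>"
| opp: "e \<in> edges \<Gamma> \<Longrightarrow> ([Edg e, Edg (opp \<Gamma> e)], []) \<in> word_cong \<Gamma>"
| edge: "e \<in> edges \<Gamma> \<Longrightarrow>
    ([Edg e, Vtx (tgt \<Gamma> e) (lab_tgt \<Gamma> e *v x)], [Vtx (src \<Gamma> e) (lab_src \<Gamma> e *v x), Edg e])
      \<in> word_cong \<Gamma>"

definition word_class ::
  "('v, 'e, 'd::finite) zd_graph \<Rightarrow> ('v, 'e, 'd) word \<Rightarrow> ('v, 'e, 'd) word set" where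
  "word_class \<Gamma> x = word_cong \<Gamma> `` {x}"

definition path_group :: "('v, 'e, 'd::finite) zd_graph \<Rightarrow> ('v, 'e, 'd) word set monoid" where
  "path_group \<Gamma> =
     \<lparr> carrier = words \<Gamma> // word_cong \<Gamma>,
       mult = (\<lambda>X Y. \<Union>x\<in>X. \<Union>y\<in>Y. word_class \<Gamma> (x @ y)),
       one = word_class \<Gamma> [] \<rparr>"

text \<open>\<open>path_word \<Gamma> u x v\<close>: the word \<open>x\<close> has the form \<open>r\<^sub>0 e\<^sub>1 r\<^sub>1 \<dots> e\<^sub>n r\<^sub>n\<close> where \<open>e\<^sub>1, \<dots>, e\<^sub>n\<close> is an
  edge path from \<open>u\<close> to \<open>v\<close>, and each \<open>r\<^sub>i\<close> is a word in the group of the vertex reached after \<open>e\<^sub>i\<close>.\<close>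

inductive path_word ::
  "('v, 'e, 'd::finite) zd_graph \<Rightarrow> 'v \<Rightarrow> ('v, 'e, 'd) word \<Rightarrow> 'v \<Rightarrow> bool"
  for \<Gamma> :: "('v, 'e, 'd) zd_graph" where
  Nil: "v \<in> verts \<Gamma> \<Longrightarrow> path_word \<Gamma> v [] v"
| Vtx: "u \<in> verts \<Gamma> \<Longrightarrow> path_word \<Gamma> u x v \<Longrightarrow> path_word \<Gamma> u (Vtx u a # x) v"
| Edg: "e \<in> edges \<Gamma> \<Longrightarrow> path_word \<Gamma> (tgt \<Gamma> e) x v \<Longrightarrow> path_word \<Gamma> (src \<Gamma> e) (Edg e # x) v"

definition path_classes ::
  "('v, 'e, 'd::finite) zd_graph \<Rightarrow> 'v \<Rightarrow> 'v \<Rightarrow> ('v, 'e, 'd) word set set" where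
  "path_classes \<Gamma> u v = {word_class \<Gamma> x | x. path_word \<Gamma> u x v}"

definition fundamental_group ::
  "('v, 'e, 'd::finite) zd_graph \<Rightarrow> 'v \<Rightarrow> ('v, 'e, 'd) word set monoid" where
  "fundamental_group \<Gamma> v\<^sub>0 = (path_group \<Gamma>)\<lparr>carrier := path_classes \<Gamma> v\<^sub>0 v\<^sub>0\<rparr>"


section \<open>The Bass-Serre tree\<close>

definition vertex_group ::
  "('v, 'e, 'd::finite) zd_graph \<Rightarrow> 'v \<Rightarrow> ('v, 'e, 'd) word set set" where
  "vertex_group \<Gamma> v = {word_class \<Gamma> [Vtx v a] | a. True}"

definition edge_group ::
  "('v, 'e, 'd::finite) zd_graph \<Rightarrow> 'e \<Rightarrow> ('v, 'e, 'd) word set set" where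
  "edge_group \<Gamma> e = {word_class \<Gamma> [Vtx (src \<Gamma> e) (lab_src \<Gamma> e *v x)] | x. True}"

text \<open>A vertex over \<open>v\<close> is a coset \<open>p G\<^sub>v\<close> with \<open>p\<close> a path class from \<open>v\<^sub>0\<close> to \<open>v\<close>; an edge over \<open>e\<close>
  is a coset \<open>p A\<^sub>e\<close> with \<open>p\<close> a path class from \<open>v\<^sub>0\<close> to \<open>src e\<close>, where \<open>A\<^sub>e\<close> is the image of the edge
  group in the group of \<open>src e\<close>. The edge \<open>p A\<^sub>e\<close> goes from \<open>p G\<^bsub>src e\<^esub>\<close> to \<open>p e G\<^bsub>tgt e\<^esub>\<close>, and its
  opposite is \<open>p e A\<^bsub>opp e\<^esub> = (p A\<^sub>e) e\<close>.\<close>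

definition bass_serre_tree ::
  "('v, 'e, 'd::finite) zd_graph \<Rightarrow> 'v \<Rightarrow>
    ('v \<times> ('v, 'e, 'd) word set set, 'e \<times> ('v, 'e, 'd) word set set) sgraph" where
  "bass_serre_tree \<Gamma> v\<^sub>0 =
     \<lparr> verts = {(v, p <#\<^bsub>path_group \<Gamma>\<^esub> vertex_group \<Gamma> v) | v p.
          v \<in> verts \<Gamma> \<and> p \<in> path_classes \<Gamma> v\<^sub>0 v},
       edges = {(e, p <#\<^bsub>path_group \<Gamma>\<^esub> edge_group \<Gamma> e) | e p.
          e \<in> edges \<Gamma> \<and> p \<in> path_classes \<Gamma> v\<^sub>0 (src \<Gamma> e)},
       src = (\<lambda>(e, C). (src \<Gamma> e, C <#>\<^bsub>path_group \<Gamma>\<^esub> vertex_group \<Gamma> (src \<Gamma> e))),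
       tgt = (\<lambda>(e, C). (tgt \<Gamma> e,
          (C #>\<^bsub>path_group \<Gamma>\<^esub> word_class \<Gamma> [Edg e]) <#>\<^bsub>path_group \<Gamma>\<^esub> vertex_group \<Gamma> (tgt \<Gamma> e))),
       opp = (\<lambda>(e, C). (opp \<Gamma> e, C #>\<^bsub>path_group \<Gamma>\<^esub> word_class \<Gamma> [Edg e])) \<rparr>"

text \<open>Left translation, used both on vertices and on edges of the tree.\<close>

definition tree_action ::
  "('v, 'e, 'd::finite) zd_graph \<Rightarrow> ('v, 'e, 'd) word set \<Rightarrow>
    'x \<times> ('v, 'e, 'd) word set set \<Rightarrow> 'x \<times> ('v, 'e, 'd) word set set" where
  "tree_action \<Gamma> g = (\<lambda>(x, C). (x, g <#\<^bsub>path_group \<Gamma>\<^esub> C))"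

definition tree_quotient ::
  "('v, 'e, 'd::finite) zd_graph \<Rightarrow> 'v \<Rightarrow> ('v, 'e, 'd) word set set \<Rightarrow>
    (('v \<times> ('v, 'e, 'd) word set set) set, ('e \<times> ('v, 'e, 'd) word set set) set) sgraph" where
  "tree_quotient \<Gamma> v\<^sub>0 H =
     quotient_graph H (tree_action \<Gamma>) (tree_action \<Gamma>) (bass_serre_tree \<Gamma> v\<^sub>0)"


section \<open>Amenability and the perfect kernel\<close>

definition amenable :: "('a, 'b) monoid_scheme \<Rightarrow> bool" where
  "amenable G \<longleftrightarrow> (\<exists>\<mu> :: 'a set \<Rightarrow> real.
     (\<forall>A. A \<subseteq> carrier G \<longrightarrow> 0 \<le> \<mu> A) \<and>
     \<mu> (carrier G) = 1 \<and>
     (\<forall>A B. A \<subseteq> carrier G \<longrightarrow> B \<subseteq> carrier G \<longrightarrow> A \<inter> B = {} \<longrightarrow> \<mu> (A \<union> B) = \<mu> A + \<mu> B) \<and>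
     (\<forall>g\<in>carrier G. \<forall>A. A \<subseteq> carrier G \<longrightarrow> \<mu> (g <#\<^bsub>G\<^esub> A) = \<mu> A))"

definition chabauty :: "('a, 'b) monoid_scheme \<Rightarrow> 'a set topology" where
  "chabauty G = pullback_topology {H. subgroup H G} (\<lambda>H. \<lambda>g\<in>carrier G. g \<in> H)
     (product_topology (\<lambda>_. discrete_topology (UNIV :: bool set)) (carrier G))"

definition perfect_kernel_of :: "'a topology \<Rightarrow> 'a set" where
  "perfect_kernel_of X = \<Union>{C. closedin X C \<and> C \<subseteq> X derived_set_of C}"

abbreviation perfect_kernel :: "('a, 'b) monoid_scheme \<Rightarrow> 'a set set" where
  "perfect_kernel G \<equiv> perfect_kernel_of (chabauty G)"


section \<open>Well-definedness\<close>

lemma topspace_chabauty: "topspace (chabauty G) = {H. subgroup H G}"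
  by (auto simp: chabauty_def topspace_pullback_topology)

lemma
  shows closedin_perfect_kernel_of: "closedin X (perfect_kernel_of X)"
    and perfect_kernel_of_subset_derived:
      "perfect_kernel_of X \<subseteq> X derived_set_of (perfect_kernel_of X)"
    and perfect_kernel_of_greatest:
      "closedin X C \<Longrightarrow> C \<subseteq> X derived_set_of C \<Longrightarrow> C \<subseteq> perfect_kernel_of X"
proof -
  let ?K = "perfect_kernel_of X"
  show gr: "C \<subseteq> ?K" if "closedin X C" "C \<subseteq> X derived_set_of C" for C
    using that by (auto simp: perfect_kernel_of_def)
  show der: "?K \<subseteq> X derived_set_of ?K"
  proof
    fix x assume "x \<in> ?K"
    then obtain C where C: "closedin X C" "C \<subseteq> X derived_set_of C" "x \<in> C"
      by (auto simp: perfect_kernel_of_def)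
    then show "x \<in> X derived_set_of ?K"
      using derived_set_of_mono[OF gr[OF C(1,2)], of X] by blast
  qed
  have "X closure_of ?K \<subseteq> X derived_set_of (X closure_of ?K)"
  proof -
    have "X closure_of ?K \<subseteq> X derived_set_of ?K"
      using der by (auto simp: closure_of)
    also have "\<dots> \<subseteq> X derived_set_of (X closure_of ?K)"
    proof (rule derived_set_of_mono)
      show "?K \<subseteq> X closure_of ?K"
        by (rule closure_of_subset) (auto simp: perfect_kernel_of_def dest: closedin_subset)
    qed
    finally show ?thesis .
  qed
  then have "X closure_of ?K \<subseteq> ?K"
    by (intro gr) auto
  moreover have "?K \<subseteq> topspace X"
    by (auto simp: perfect_kernel_of_def dest: closedin_subset)
  ultimately show "closedin X ?K"
    using closure_of_subset_eq[of ?K X] by blast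
qed

lemma words_append [simp]: "x @ y \<in> words \<Gamma> \<longleftrightarrow> x \<in> words \<Gamma> \<and> y \<in> words \<Gamma>"
  by (auto simp: words_def)

lemma words_Nil [simp]: "[] \<in> words \<Gamma>"
  by (simp add: words_def)

lemma words_Cons [simp]:
  "Vtx v a # x \<in> words \<Gamma> \<longleftrightarrow> v \<in> verts \<Gamma> \<and> x \<in> words \<Gamma>"
  "Edg e # x \<in> words \<Gamma> \<longleftrightarrow> e \<in> edges \<Gamma> \<and> x \<in> words \<Gamma>"
  by (auto simp: words_def)

context gbs_graph
begin

lemma word_cong_words: "(x, y) \<in> word_cong \<Gamma> \<Longrightarrow> x \<in> words \<Gamma> \<and> y \<in> words \<Gamma>"
  by (induction rule: word_cong.induct) (auto simp: src_in tgt_in opp_in)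

lemma equiv_word_cong: "equiv (words \<Gamma>) (word_cong \<Gamma>)"
proof (rule equivI)
  show "word_cong \<Gamma> \<subseteq> words \<Gamma> \<times> words \<Gamma>" by (auto dest: word_cong_words)
  show "refl_on (words \<Gamma>) (word_cong \<Gamma>)" by (rule refl_onI) (rule word_cong.refl)
  show "sym (word_cong \<Gamma>)" by (rule symI) (rule word_cong.sym)
  show "trans (word_cong \<Gamma>)" by (rule transI) (rule word_cong.trans)
qed

lemma word_class_eq_iff:
  "x \<in> words \<Gamma> \<Longrightarrow> y \<in> words \<Gamma> \<Longrightarrow> word_class \<Gamma> x = word_class \<Gamma> y \<longleftrightarrow> (x, y) \<in> word_cong \<Gamma>"
  unfolding word_class_def by (rule eq_equiv_class_iff[OF equiv_word_cong])

lemma word_class_eqI: "(x, y) \<in> word_cong \<Gamma> \<Longrightarrow> word_class \<Gamma> x = word_class \<Gamma> y"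
  using word_class_eq_iff[of x y] word_cong_words[of x y] by simp

lemma word_cong_append:
  assumes "(x, x') \<in> word_cong \<Gamma>" "(y, y') \<in> word_cong \<Gamma>"
  shows "(x @ y, x' @ y') \<in> word_cong \<Gamma>"
proof -
  have "(x @ y, x' @ y) \<in> word_cong \<Gamma>"
    using word_cong.ctxt[OF assms(1), of "[]" y] word_cong_words[OF assms(2)] by simp
  moreover have "(x' @ y, x' @ y') \<in> word_cong \<Gamma>"
    using word_cong.ctxt[OF assms(2), of x' "[]"] word_cong_words[OF assms(1)] by simp
  ultimately show ?thesis by (rule word_cong.trans)
qed

lemma mult_word_class:
  assumes "x \<in> words \<Gamma>" "y \<in> words \<Gamma>"
  shows "word_class \<Gamma> x \<otimes>\<^bsub>path_group \<Gamma>\<^esub> word_class \<Gamma> y = word_class \<Gamma> (x @ y)"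
proof -
  have "word_class \<Gamma> (x' @ y') = word_class \<Gamma> (x @ y)"
    if "x' \<in> word_class \<Gamma> x" "y' \<in> word_class \<Gamma> y" for x' y'
  proof -
    have "(x @ y, x' @ y') \<in> word_cong \<Gamma>"
      using that by (intro word_cong_append) (simp_all add: word_class_def)
    then show ?thesis using word_class_eqI by simp
  qed
  then have "word_class \<Gamma> x \<otimes>\<^bsub>path_group \<Gamma>\<^esub> word_class \<Gamma> y =
      (\<Union>x'\<in>word_class \<Gamma> x. \<Union>y'\<in>word_class \<Gamma> y. word_class \<Gamma> (x @ y))"
    unfolding path_group_def by simp
  also have "\<dots> = word_class \<Gamma> (x @ y)"
  proof -
    have "x \<in> word_class \<Gamma> x" "y \<in> word_class \<Gamma> y"
      using assms by (simp_all add: word_class_def word_cong.refl)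
    then have "word_class \<Gamma> x \<noteq> {}" "word_class \<Gamma> y \<noteq> {}" by blast+
    then show ?thesis by simp
  qed
  finally show ?thesis .
qed

lemma carrier_path_group: "carrier (path_group \<Gamma>) = word_class \<Gamma> ` words \<Gamma>"
  by (auto simp: path_group_def quotient_def word_class_def)

lemma one_path_group: "\<one>\<^bsub>path_group \<Gamma>\<^esub> = word_class \<Gamma> []"
  by (simp add: path_group_def)

lemma word_cong_cancel:
  assumes "(a, []) \<in> word_cong \<Gamma>" "l \<in> words \<Gamma>" "r \<in> words \<Gamma>"
  shows "(l @ a @ r, l @ r) \<in> word_cong \<Gamma>"
  using word_cong.ctxt[OF assms] by simp

lemma path_word_words: "path_word \<Gamma> u x v \<Longrightarrow> u \<in> verts \<Gamma> \<and> v \<in> verts \<Gamma> \<and> x \<in> words \<Gamma>"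
  by (induction rule: path_word.induct) (auto simp: src_in)

lemma path_word_append:
  "path_word \<Gamma> u x v \<Longrightarrow> path_word \<Gamma> v y w \<Longrightarrow> path_word \<Gamma> u (x @ y) w"
  by (induction rule: path_word.induct) (auto intro: path_word.intros)

lemma Vtx_cancel: "v \<in> verts \<Gamma> \<Longrightarrow> ([Vtx v a, Vtx v (- a)], []) \<in> word_cong \<Gamma>"
  using word_cong.trans[OF word_cong.add[of v \<Gamma> a "- a"]] word_cong.unit[of v \<Gamma>] by simp

text \<open>An inverse word, which reverses paths.\<close>

primrec inv_letter :: "('v, 'e, 'd) letter \<Rightarrow> ('v, 'e, 'd) letter" where
  "inv_letter (Vtx v a) = Vtx v (- a)"
| "inv_letter (Edg e) = Edg (opp \<Gamma> e)"

lemma letter_cancel: "[a] \<in> words \<Gamma> \<Longrightarrow> ([a, inv_letter a], []) \<in> word_cong \<Gamma>"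
  by (cases a) (auto simp: Vtx_cancel word_cong.opp)

lemma letter_cancel': "[a] \<in> words \<Gamma> \<Longrightarrow> ([inv_letter a, a], []) \<in> word_cong \<Gamma>"
proof (cases a)
  case (Vtx v b)
  then show "[a] \<in> words \<Gamma> \<Longrightarrow> ?thesis" using Vtx_cancel[of v "- b"] by simp
next
  case (Edg e)
  then show "[a] \<in> words \<Gamma> \<Longrightarrow> ?thesis"
    using word_cong.opp[of "opp \<Gamma> e" \<Gamma>] by (simp add: opp_in opp_opp)
qed

lemma inv_letter_words: "[a] \<in> words \<Gamma> \<Longrightarrow> [inv_letter a] \<in> words \<Gamma>"
  by (cases a) (auto simp: opp_in)

definition inv_word :: "('v, 'e, 'd) word \<Rightarrow> ('v, 'e, 'd) word" where
  "inv_word x = rev (map inv_letter x)"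

lemma inv_word_words: "x \<in> words \<Gamma> \<Longrightarrow> inv_word x \<in> words \<Gamma>"
proof (induction x)
  case (Cons a x)
  then have "[a] \<in> words \<Gamma>" "x \<in> words \<Gamma>"
    using words_append[of "[a]" x \<Gamma>] by auto
  then show ?case using Cons.IH inv_letter_words by (simp add: inv_word_def)
qed (simp add: inv_word_def)

lemma inv_word_cancel: "x \<in> words \<Gamma> \<Longrightarrow> (inv_word x @ x, []) \<in> word_cong \<Gamma>"
proof (induction x)
  case (Cons a x)
  then have a: "[a] \<in> words \<Gamma>" and x: "x \<in> words \<Gamma>"
    using words_append[of "[a]" x \<Gamma>] by auto
  have "(inv_word x @ [inv_letter a, a] @ x, inv_word x @ x) \<in> word_cong \<Gamma>"
    by (intro word_cong_cancel letter_cancel' inv_word_words a x)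
  then show ?case using Cons.IH[OF x] by (auto simp: inv_word_def intro: word_cong.trans)
qed (simp add: inv_word_def word_cong.refl)

lemma path_word_inv: "path_word \<Gamma> u x v \<Longrightarrow> path_word \<Gamma> v (inv_word x) u"
proof (induction rule: path_word.induct)
  case (Vtx u x v a)
  have "path_word \<Gamma> u [Vtx u (- a)] u" using Vtx by (auto intro: path_word.intros)
  then show ?case using Vtx path_word_append by (fastforce simp: inv_word_def)
next
  case (Edg e x v)
  have "path_word \<Gamma> (tgt \<Gamma> e) [Edg (opp \<Gamma> e)] (src \<Gamma> e)"
    using path_word.Edg[of "opp \<Gamma> e" \<Gamma> "[]" "src \<Gamma> e"] path_word.Nil[of "src \<Gamma> e" \<Gamma>] Edg
    by (simp add: opp_in src_opp tgt_opp src_in)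
  then show ?case using Edg path_word_append by (fastforce simp: inv_word_def)
qed (auto simp: inv_word_def intro: path_word.intros)

lemma group_path_group: "group (path_group \<Gamma>)"
proof (rule groupI)
  fix X assume "X \<in> carrier (path_group \<Gamma>)"
  then obtain x where x: "x \<in> words \<Gamma>" "X = word_class \<Gamma> x"
    by (auto simp: carrier_path_group)
  have "word_class \<Gamma> (inv_word x) \<otimes>\<^bsub>path_group \<Gamma>\<^esub> X = \<one>\<^bsub>path_group \<Gamma>\<^esub>"
    using x by (simp add: mult_word_class inv_word_words one_path_group word_class_eqI inv_word_cancel)
  then show "\<exists>Y\<in>carrier (path_group \<Gamma>). Y \<otimes>\<^bsub>path_group \<Gamma>\<^esub> X = \<one>\<^bsub>path_group \<Gamma>\<^esub>"
    using x inv_word_words by (auto simp: carrier_path_group)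
qed (auto simp: carrier_path_group one_path_group mult_word_class)

lemma subgroup_path_classes:
  assumes "v \<in> verts \<Gamma>"
  shows "subgroup (path_classes \<Gamma> v v) (path_group \<Gamma>)"
proof -
  interpret group "path_group \<Gamma>" by (rule group_path_group)
  show ?thesis
  proof (rule subgroupI)
    show "path_classes \<Gamma> v v \<subseteq> carrier (path_group \<Gamma>)"
      by (auto simp: path_classes_def carrier_path_group dest: path_word_words)
    show "path_classes \<Gamma> v v \<noteq> {}"
      using assms by (auto simp: path_classes_def intro: path_word.intros)
    fix X assume "X \<in> path_classes \<Gamma> v v"
    then obtain x where x: "path_word \<Gamma> v x v" "X = word_class \<Gamma> x"
      by (auto simp: path_classes_def)
    then have "x \<in> words \<Gamma>" using path_word_words by blast
    then have "inv\<^bsub>path_group \<Gamma>\<^esub> X = word_class \<Gamma> (inv_word x)"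
      using x by (intro inv_equality)
        (auto simp: mult_word_class inv_word_words one_path_group carrier_path_group
          word_class_eqI inv_word_cancel)
    then show "inv\<^bsub>path_group \<Gamma>\<^esub> X \<in> path_classes \<Gamma> v v"
      using path_word_inv[OF x(1)] by (auto simp: path_classes_def)
    fix Y assume "Y \<in> path_classes \<Gamma> v v"
    then show "X \<otimes>\<^bsub>path_group \<Gamma>\<^esub> Y \<in> path_classes \<Gamma> v v"
      using x by (force simp: path_classes_def mult_word_class path_word_words
          dest: path_word_words intro: path_word_append)
  qed
qed

lemma group_fundamental_group: "v \<in> verts \<Gamma> \<Longrightarrow> group (fundamental_group \<Gamma> v)"
  unfolding fundamental_group_def
  by (rule subgroup.subgroup_is_group[OF subgroup_path_classes group_path_group])

lemma edge_group_conj: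
  assumes e: "e \<in> edges \<Gamma>"
  shows "edge_group \<Gamma> e #>\<^bsub>path_group \<Gamma>\<^esub> word_class \<Gamma> [Edg e] =
    word_class \<Gamma> [Edg e] <#\<^bsub>path_group \<Gamma>\<^esub> edge_group \<Gamma> (opp \<Gamma> e)"
proof -
  have "word_class \<Gamma> [Vtx (src \<Gamma> e) (lab_src \<Gamma> e *v x)] \<otimes>\<^bsub>path_group \<Gamma>\<^esub> word_class \<Gamma> [Edg e] =
    word_class \<Gamma> [Edg e] \<otimes>\<^bsub>path_group \<Gamma>\<^esub> word_class \<Gamma> [Vtx (tgt \<Gamma> e) (lab_tgt \<Gamma> e *v x)]" for x
    using e word_class_eqI[OF word_cong.edge[OF e, of x]]
    by (simp add: mult_word_class src_in tgt_in)
  then show ?thesis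
    using e by (auto simp: r_coset_def l_coset_def edge_group_def src_opp lab_src_opp)
qed

lemma serre_graph_bass_serre_tree:
  assumes "v\<^sub>0 \<in> verts \<Gamma>"
  shows "serre_graph (bass_serre_tree \<Gamma> v\<^sub>0)"
proof -
  interpret F: group "path_group \<Gamma>" by (rule group_path_group)
  note lr [simp] = carrier_path_group
  have path_carr: "path_classes \<Gamma> u v \<subseteq> carrier (path_group \<Gamma>)" for u v
    by (auto simp: path_classes_def dest: path_word_words)
  have eg: "edge_group \<Gamma> e \<subseteq> vertex_group \<Gamma> (src \<Gamma> e)" for e
    by (auto simp: edge_group_def vertex_group_def)
  have vg: "vertex_group \<Gamma> v \<subseteq> carrier (path_group \<Gamma>)" if "v \<in> verts \<Gamma>" for v
    using that by (auto simp: vertex_group_def)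
  have one_eg: "word_class \<Gamma> [] \<in> edge_group \<Gamma> e" if "e \<in> edges \<Gamma>" for e
    using word_class_eqI[OF word_cong.unit[OF src_in[OF that]]]
    by (force simp: edge_group_def intro: exI[of _ 0])
  have vg_mult: "X \<otimes>\<^bsub>path_group \<Gamma>\<^esub> Y \<in> vertex_group \<Gamma> v"
    if "v \<in> verts \<Gamma>" "X \<in> vertex_group \<Gamma> v" "Y \<in> vertex_group \<Gamma> v" for X Y v
    using that word_class_eqI[OF word_cong.add[OF that(1)]]
    by (force simp: vertex_group_def mult_word_class)
  have egvg: "edge_group \<Gamma> e <#>\<^bsub>path_group \<Gamma>\<^esub> vertex_group \<Gamma> (src \<Gamma> e) = vertex_group \<Gamma> (src \<Gamma> e)"
    if e: "e \<in> edges \<Gamma>" for e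
  proof
    show "edge_group \<Gamma> e <#>\<^bsub>path_group \<Gamma>\<^esub> vertex_group \<Gamma> (src \<Gamma> e) \<subseteq> vertex_group \<Gamma> (src \<Gamma> e)"
      using vg_mult[OF src_in[OF e]] eg[of e] by (auto simp: set_mult_def)
    show "vertex_group \<Gamma> (src \<Gamma> e) \<subseteq> edge_group \<Gamma> e <#>\<^bsub>path_group \<Gamma>\<^esub> vertex_group \<Gamma> (src \<Gamma> e)"
    proof
      fix X assume X: "X \<in> vertex_group \<Gamma> (src \<Gamma> e)"
      then have "word_class \<Gamma> [] \<otimes>\<^bsub>path_group \<Gamma>\<^esub> X = X"
        using F.l_one[OF subsetD[OF vg[OF src_in[OF e]]]] by (simp add: one_path_group)
      then show "X \<in> edge_group \<Gamma> e <#>\<^bsub>path_group \<Gamma>\<^esub> vertex_group \<Gamma> (src \<Gamma> e)"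
        unfolding set_mult_def
        by (intro UN_I[OF one_eg[OF e]] UN_I[OF X]) simp
    qed
  qed
  have Edg_carr: "word_class \<Gamma> [Edg e] \<in> carrier (path_group \<Gamma>)" if "e \<in> edges \<Gamma>" for e
    using that by auto
  have sub: "edge_group \<Gamma> e \<subseteq> carrier (path_group \<Gamma>)" if "e \<in> edges \<Gamma>" for e
    using eg vg src_in that by blast
  have coset_e: "(p <#\<^bsub>path_group \<Gamma>\<^esub> edge_group \<Gamma> e) #>\<^bsub>path_group \<Gamma>\<^esub> word_class \<Gamma> [Edg e] =
      (p \<otimes>\<^bsub>path_group \<Gamma>\<^esub> word_class \<Gamma> [Edg e]) <#\<^bsub>path_group \<Gamma>\<^esub> edge_group \<Gamma> (opp \<Gamma> e)"
    if e: "e \<in> edges \<Gamma>" and p: "p \<in> carrier (path_group \<Gamma>)" for e p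
  proof -
    have "(p <#\<^bsub>path_group \<Gamma>\<^esub> edge_group \<Gamma> e) #>\<^bsub>path_group \<Gamma>\<^esub> word_class \<Gamma> [Edg e] =
      p <#\<^bsub>path_group \<Gamma>\<^esub> (edge_group \<Gamma> e #>\<^bsub>path_group \<Gamma>\<^esub> word_class \<Gamma> [Edg e])"
      using F.coset_assoc[OF p Edg_carr[OF e] sub[OF e]] by simp
    also have "\<dots> = p <#\<^bsub>path_group \<Gamma>\<^esub> (word_class \<Gamma> [Edg e] <#\<^bsub>path_group \<Gamma>\<^esub> edge_group \<Gamma> (opp \<Gamma> e))"
      using edge_group_conj[OF e] by simp
    also have "\<dots> = (p \<otimes>\<^bsub>path_group \<Gamma>\<^esub> word_class \<Gamma> [Edg e]) <#\<^bsub>path_group \<Gamma>\<^esub> edge_group \<Gamma> (opp \<Gamma> e)"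
      using F.lcos_m_assoc[OF sub[OF opp_in[OF e]] p Edg_carr[OF e]] by simp
    finally show ?thesis .
  qed
  have step: "p \<otimes>\<^bsub>path_group \<Gamma>\<^esub> word_class \<Gamma> [Edg e] \<in> path_classes \<Gamma> v\<^sub>0 (tgt \<Gamma> e)"
    if e: "e \<in> edges \<Gamma>" and p: "p \<in> path_classes \<Gamma> v\<^sub>0 (src \<Gamma> e)" for e p
  proof -
    obtain x where x: "path_word \<Gamma> v\<^sub>0 x (src \<Gamma> e)" "p = word_class \<Gamma> x"
      using p by (auto simp: path_classes_def)
    have "path_word \<Gamma> (src \<Gamma> e) [Edg e] (tgt \<Gamma> e)"
      using e tgt_in by (auto intro: path_word.intros)
    then have "path_word \<Gamma> v\<^sub>0 (x @ [Edg e]) (tgt \<Gamma> e)"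
      using x path_word_append by blast
    then show ?thesis
      using x e path_word_words[OF x(1)] by (auto simp: path_classes_def mult_word_class)
  qed
  have coset_v: "(p <#\<^bsub>path_group \<Gamma>\<^esub> edge_group \<Gamma> e) <#>\<^bsub>path_group \<Gamma>\<^esub> vertex_group \<Gamma> (src \<Gamma> e) =
      p <#\<^bsub>path_group \<Gamma>\<^esub> vertex_group \<Gamma> (src \<Gamma> e)"
    if e: "e \<in> edges \<Gamma>" and p: "p \<in> carrier (path_group \<Gamma>)" for e p
    using F.set_mult_assoc[of "{p}" "edge_group \<Gamma> e" "vertex_group \<Gamma> (src \<Gamma> e)"]
      egvg[OF e] p sub[OF e] vg[OF src_in[OF e]]
    by (simp add: l_coset_eq_set_mult del: lr)
  have Edg_cancel: "p \<otimes>\<^bsub>path_group \<Gamma>\<^esub> word_class \<Gamma> [Edg e] \<otimes>\<^bsub>path_group \<Gamma>\<^esub> word_class \<Gamma> [Edg (opp \<Gamma> e)] = p"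
    if e: "e \<in> edges \<Gamma>" and p: "p \<in> carrier (path_group \<Gamma>)" for e p
  proof -
    obtain x where x: "x \<in> words \<Gamma>" "p = word_class \<Gamma> x" using p by auto
    show ?thesis
      using x e word_class_eqI[OF word_cong_cancel[OF word_cong.opp[OF e] x(1), of "[]"]]
      by (simp add: mult_word_class opp_in)
  qed
  show ?thesis
  proof (unfold_locales)
    fix ee assume "ee \<in> edges (bass_serre_tree \<Gamma> v\<^sub>0)"
    then obtain e p where ee: "ee = (e, p <#\<^bsub>path_group \<Gamma>\<^esub> edge_group \<Gamma> e)"
      and e: "e \<in> edges \<Gamma>" and p: "p \<in> path_classes \<Gamma> v\<^sub>0 (src \<Gamma> e)"
      by (auto simp: bass_serre_tree_def)
    have pc: "p \<in> carrier (path_group \<Gamma>)" using p path_carr by blast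
    let ?q = "p \<otimes>\<^bsub>path_group \<Gamma>\<^esub> word_class \<Gamma> [Edg e]"
    have q: "?q \<in> path_classes \<Gamma> v\<^sub>0 (src \<Gamma> (opp \<Gamma> e))" using step[OF e p] src_opp[OF e] by simp
    have opp_ee: "opp (bass_serre_tree \<Gamma> v\<^sub>0) ee =
        (opp \<Gamma> e, ?q <#\<^bsub>path_group \<Gamma>\<^esub> edge_group \<Gamma> (opp \<Gamma> e))"
      using coset_e[OF e pc] by (simp add: bass_serre_tree_def ee)
    have qc: "?q \<in> carrier (path_group \<Gamma>)" using q path_carr by blast
    show "src (bass_serre_tree \<Gamma> v\<^sub>0) ee \<in> verts (bass_serre_tree \<Gamma> v\<^sub>0)"
      using coset_v[OF e pc] p src_in[OF e] by (auto simp: bass_serre_tree_def ee)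
    show "opp (bass_serre_tree \<Gamma> v\<^sub>0) ee \<in> edges (bass_serre_tree \<Gamma> v\<^sub>0)"
      unfolding opp_ee using q opp_in[OF e] by (auto simp: bass_serre_tree_def)
    show "opp (bass_serre_tree \<Gamma> v\<^sub>0) (opp (bass_serre_tree \<Gamma> v\<^sub>0) ee) = ee"
      unfolding opp_ee using coset_e[OF opp_in[OF e] qc] Edg_cancel[OF e pc]
      by (simp add: bass_serre_tree_def ee opp_opp[OF e])
    show "opp (bass_serre_tree \<Gamma> v\<^sub>0) ee \<noteq> ee"
      unfolding opp_ee using opp_neq[OF e] by (simp add: ee)
    show "tgt (bass_serre_tree \<Gamma> v\<^sub>0) (opp (bass_serre_tree \<Gamma> v\<^sub>0) ee) = src (bass_serre_tree \<Gamma> v\<^sub>0) ee"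
      unfolding opp_ee using coset_e[OF opp_in[OF e] qc] Edg_cancel[OF e pc]
      by (simp add: bass_serre_tree_def ee opp_opp[OF e] tgt_opp[OF e])
  qed
qed

end

end

theory Submission
  imports Defs
begin

text \<open>The complement of the right hand side is open and countable: a subgroup \<open>H\<close> with finite quotient is
  finitely generated, and so is every group containing it, so \<open>H\<close> has a countable open neighbourhood in the
  complement. It remains to show that a subgroup \<open>H\<close> with infinite quotient is a limit of others. Given finitely
  many words, some edge orbit of \<open>H\<close> in the tree is crossed by none of them. Cut the coset space of \<open>H\<close> at this
  edge and glue in the coset space of the stabilizer of the edge; inside the new piece, a further pair of edges
  with the same stabilizer can be cut and glued crosswise or not. Both choices give point stabilizers which have
  infinite quotient and agree with \<open>H\<close> on the given words, and they are different. The pair of edges exists by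
  a case distinction: a reduced graph of groups without it is a segment with two labels of index 2 or a loop with
  an invertible label, and then the group is amenable, by averaging over Folner sets. The only exception are
  the graphs with all labels invertible: there the vertex group is normal, and if \<open>H\<close> contains no multiple
  \<open>m\<int>\<^sup>d\<close> of it, one replaces \<open>H\<close> by \<open>H\<cdot>m\<int>\<^sup>d\<close> instead.\<close>

subsection \<open>The space of subgroups\<close>

text \<open>Two edges can be exchanged only if their stabilizers in the edge group agree, and the
  stabilizer that \<open>H\<close> leaves behind may be any subgroup of \<int>^d. So the second edge
  of the pair is reached along a detour that goes back and forth through the same edges: a vertex
  element that survives the detour comes back unchanged, and the stabilizers agree whatever the
  subgroup is. If all labels are invertible, no reduced path can turn back. Going around a loop then
  acts on \<int>^d by an automorphism, and some power of it preserves the given subgroup if that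
  contains m\<int>^d, since only finitely many subgroups do. Two glued spaces are needed because the
  first alone can return \<open>H\<close>: this happens if the part of the quotient beyond the cut
  already is the new piece. One of two different stabilizers cannot be \<open>H\<close>. The new
  quotients stay infinite because the new piece contains arbitrarily long paths that avoid the
  exchanged edges. That paths in the tree differ is always decided by normal forms, obtained from
  the parity of the number of times that a word crosses a given edge.\<close>

lemma openin_chabauty_mem:
  assumes "g \<in> carrier G"
  shows "openin (chabauty G) {H. subgroup H G \<and> (g \<in> H \<longleftrightarrow> b)}"
proof -
  let ?T = "product_topology (\<lambda>_. discrete_topology (UNIV :: bool set)) (carrier G)"
  have "openin ?T {\<phi> \<in> topspace ?T. \<phi> g \<in> {b}}"
    by (rule openin_continuous_map_preimage[OF continuous_map_product_projection[OF assms]]) simp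
  moreover have "{H. subgroup H G \<and> (g \<in> H \<longleftrightarrow> b)} =
      (\<lambda>H. \<lambda>g\<in>carrier G. g \<in> H) -` {\<phi> \<in> topspace ?T. \<phi> g \<in> {b}} \<inter> {H. subgroup H G}"
    using assms by auto
  ultimately show ?thesis unfolding chabauty_def openin_pullback_topology by blast
qed

lemma openin_chabauty_supersets:
  assumes "finite P" "P \<subseteq> carrier G"
  shows "openin (chabauty G) {H. subgroup H G \<and> P \<subseteq> H}"
proof -
  have all: "openin (chabauty G) {H. subgroup H G}"
    using openin_topspace[of "chabauty G"] by (simp add: topspace_chabauty)
  show ?thesis using assms
  proof (induction P rule: finite_induct)
    case empty
    then show ?case using all by simp
  next
    case (insert p P)
    then have "openin (chabauty G) ({H. subgroup H G \<and> P \<subseteq> H} \<inter> {H. subgroup H G \<and> (p \<in> H \<longleftrightarrow> True)})"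
      by (intro openin_Int openin_chabauty_mem) auto
    moreover have "{H. subgroup H G \<and> P \<subseteq> H} \<inter> {H. subgroup H G \<and> (p \<in> H \<longleftrightarrow> True)} =
      {H. subgroup H G \<and> insert p P \<subseteq> H}" by auto
    ultimately show ?case by simp
  qed
qed

lemma closedin_chabauty_supersets:
  assumes "P \<subseteq> carrier G"
  shows "closedin (chabauty G) {H. subgroup H G \<and> P \<subseteq> H}"
proof -
  have "openin (chabauty G) (\<Union>p\<in>P. {H. subgroup H G \<and> (p \<in> H \<longleftrightarrow> False)})"
    using assms by (intro openin_Union) (auto intro!: openin_chabauty_mem[of _ G False, simplified])
  moreover have "topspace (chabauty G) - {H. subgroup H G \<and> P \<subseteq> H} = (\<Union>p\<in>P. {H. subgroup H G \<and> (p \<in> H \<longleftrightarrow> False)})"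
    by (auto simp: topspace_chabauty)
  ultimately show ?thesis unfolding closedin_def by (auto simp: topspace_chabauty)
qed

text \<open>A basic open set of the product restricts only finitely many coordinates, and
  \<open>W\<close> collects them. The search for limit points thus becomes a search for subgroups
  with a prescribed trace on a finite set.\<close>

lemma chabauty_neighbourhood:
  assumes "openin (chabauty G) U" "H \<in> U"
  obtains W where "finite W" "W \<subseteq> carrier G" "\<And>K. subgroup K G \<Longrightarrow> K \<inter> W = H \<inter> W \<Longrightarrow> K \<in> U"
proof -
  let ?f = "\<lambda>H. \<lambda>g\<in>carrier G. g \<in> H"
  obtain V where V: "openin (product_topology (\<lambda>_. discrete_topology (UNIV :: bool set)) (carrier G)) V"
    "U = ?f -` V \<inter> {H. subgroup H G}"
    using assms(1) unfolding chabauty_def openin_pullback_topology by blast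
  then have "?f H \<in> V" using assms(2) by blast
  from bspec[OF V(1)[unfolded openin_product_topology_alt] this]
  obtain B where B: "finite {i \<in> carrier G. B i \<noteq> UNIV}" "?f H \<in> Pi\<^sub>E (carrier G) B" "Pi\<^sub>E (carrier G) B \<subseteq> V"
    unfolding topspace_discrete_topology by (elim exE conjE) (rule that)
  show ?thesis
  proof (rule that[OF B(1)])
    fix K assume K: "subgroup K G" "K \<inter> {i \<in> carrier G. B i \<noteq> UNIV} = H \<inter> {i \<in> carrier G. B i \<noteq> UNIV}"
    have "?f K \<in> Pi\<^sub>E (carrier G) B"
    proof (rule PiE_I)
      fix g assume g: "g \<in> carrier G"
      have "(g \<in> H) \<in> B g" using B(2) g by (auto simp: PiE_iff)
      moreover have "B g \<noteq> UNIV \<Longrightarrow> (g \<in> K \<longleftrightarrow> g \<in> H)" using K(2) g by blast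
      ultimately show "?f K g \<in> B g" using g by (cases "B g = UNIV") auto
    qed auto
    then show "K \<in> U" using V(2) K(1) B(3) by blast
  qed auto
qed

text \<open>Each instance of a subgroup axiom constrains at most three coordinates of an indicator
  function, hence cuts out a closed set, and \<open>I\<close> is the intersection of all of these.
  The resulting compactness is what makes nonempty perfect sets uncountable later.\<close>

lemma (in group) chabauty_homeomorphic:
  defines "T \<equiv> product_topology (\<lambda>_. discrete_topology (UNIV :: bool set)) (carrier G)"
  defines "I \<equiv> (\<lambda>H. \<lambda>g\<in>carrier G. g \<in> H) ` {H. subgroup H G}"
  shows "chabauty G homeomorphic_space subtopology T I" "closedin T I"
proof -
  let ?f = "\<lambda>H. \<lambda>g\<in>carrier G. g \<in> H"
  have top: "topspace (subtopology T I) = I"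
    unfolding T_def I_def by auto
  have "homeomorphic_map (chabauty G) (subtopology T I) ?f"
  proof (rule bijective_open_imp_homeomorphic_map)
    show "continuous_map (chabauty G) (subtopology T I) ?f"
      unfolding continuous_map_in_subtopology
    proof
      show "continuous_map (chabauty G) T ?f"
        using continuous_map_pullback[of T T id "{H. subgroup H G}" ?f] unfolding chabauty_def T_def by simp
      show "?f \<in> topspace (chabauty G) \<rightarrow> I" unfolding I_def topspace_chabauty by auto
    qed
    show "open_map (chabauty G) (subtopology T I) ?f"
      unfolding open_map_def
    proof (intro allI impI)
      fix U assume "openin (chabauty G) U"
      then obtain W where W: "openin T W" "U = ?f -` W \<inter> {H. subgroup H G}"
        unfolding chabauty_def T_def openin_pullback_topology by blast
      then have "?f ` U = W \<inter> I" unfolding I_def by auto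
      then show "openin (subtopology T I) (?f ` U)" using W(1) by (auto simp: openin_subtopology)
    qed
    show "?f ` topspace (chabauty G) = topspace (subtopology T I)"
      by (simp only: top topspace_chabauty) (simp only: I_def)
    show "inj_on ?f (topspace (chabauty G))"
    proof (rule inj_onI)
      fix H K assume HK: "H \<in> topspace (chabauty G)" "K \<in> topspace (chabauty G)" and eq: "?f H = ?f K"
      have "g \<in> H \<longleftrightarrow> g \<in> K" if "g \<in> carrier G" for g using fun_cong[OF eq, of g] that by simp
      moreover have "H \<subseteq> carrier G" "K \<subseteq> carrier G" using HK by (auto simp: topspace_chabauty dest: subgroup.subset)
      ultimately show "H = K" by blast
    qed
  qed
  then show "chabauty G homeomorphic_space subtopology T I" by (rule homeomorphic_map_imp_homeomorphic_space)
  have cl: "closedin T {\<phi> \<in> topspace T. \<phi> g = b}" if "g \<in> carrier G" for g b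
  proof -
    have "closedin T {\<phi> \<in> topspace T. \<phi> g \<in> {b}}"
      unfolding T_def by (rule closedin_continuous_map_preimage[OF continuous_map_product_projection[OF that]]) simp
    then show ?thesis by simp
  qed
  \<comment> \<open>Closure under multiplication as a clause: a factor is absent or the product is
    present. Each of the three alternatives is a closed condition.\<close>
  let ?M = "\<lambda>x y. {\<phi> \<in> topspace T. \<phi> x = False} \<union> {\<phi> \<in> topspace T. \<phi> y = False} \<union> {\<phi> \<in> topspace T. \<phi> (x \<otimes> y) = True}"
  let ?N = "\<lambda>x. {\<phi> \<in> topspace T. \<phi> x = False} \<union> {\<phi> \<in> topspace T. \<phi> (inv x) = True}"
  let ?C = "{\<phi> \<in> topspace T. \<phi> \<one> = True} \<inter> (\<Inter>x\<in>carrier G. \<Inter>y\<in>carrier G. ?M x y) \<inter> (\<Inter>x\<in>carrier G. ?N x)"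
  have M: "closedin T (?M x y)" if "x \<in> carrier G" "y \<in> carrier G" for x y
    by (intro closedin_Un cl) (use that in simp_all)
  have N: "closedin T (?N x)" if "x \<in> carrier G" for x
    by (intro closedin_Un cl) (use that in simp_all)
  have ne: "carrier G \<noteq> {}" using one_closed by blast
  have "closedin T ?C"
    by (intro closedin_Int closedin_INT ne M N) (simp_all add: cl[OF one_closed, of True, simplified])
  moreover have "?C = I"
  proof
    show "I \<subseteq> ?C" unfolding I_def T_def
      by (auto simp: subgroup.one_closed subgroup.m_closed subgroup.m_inv_closed)
    show "?C \<subseteq> I"
    proof
      fix \<phi> assume \<phi>: "\<phi> \<in> ?C"
      let ?H = "{g \<in> carrier G. \<phi> g}"
      have one: "\<phi> \<one>" and m: "\<And>x y. x \<in> carrier G \<Longrightarrow> y \<in> carrier G \<Longrightarrow> \<phi> x \<Longrightarrow> \<phi> y \<Longrightarrow> \<phi> (x \<otimes> y)"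
        and i: "\<And>x. x \<in> carrier G \<Longrightarrow> \<phi> x \<Longrightarrow> \<phi> (inv x)" and t: "\<phi> \<in> topspace T"
        using \<phi> by auto
      have "subgroup ?H G" by (rule subgroupI) (use one m i in auto)
      moreover have "\<phi> = ?f ?H" using t unfolding T_def by (auto simp: fun_eq_iff PiE_iff extensional_def)
      ultimately show "\<phi> \<in> I" unfolding I_def by blast
    qed
  qed
  ultimately show "closedin T I" by simp
qed

lemma (in group) compact_Hausdorff_chabauty: "compact_space (chabauty G)" "Hausdorff_space (chabauty G)"
proof -
  let ?T = "product_topology (\<lambda>_. discrete_topology (UNIV :: bool set)) (carrier G)"
  have "compact_space ?T" by (simp add: compact_space_product_topology compact_space_discrete_topology)
  moreover have "Hausdorff_space ?T" by (simp add: Hausdorff_space_product_topology)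
  moreover note hom = chabauty_homeomorphic
  ultimately show "compact_space (chabauty G)" "Hausdorff_space (chabauty G)"
    unfolding homeomorphic_compact_space[OF hom(1)] homeomorphic_Hausdorff_space[OF hom(1)]
    by (auto intro: closedin_compact_space compact_space_subtopology Hausdorff_space_subtopology)
qed

text \<open>The complement of \<open>S\<close> is open and countable: its members are determined by
  finite generating sets, and \<open>up\<close> keeps their overgroups in it. A nonempty perfect set
  in a locally compact Hausdorff space has at least the size of the continuum, so the perfect kernel
  cannot reach into the complement.\<close>

lemma (in group) perfect_kernel_eqI:
  assumes countable: "countable (carrier G)"
    and S: "\<And>H. H \<in> S \<Longrightarrow> subgroup H G"
    and fg: "\<And>H. subgroup H G \<Longrightarrow> H \<notin> S \<Longrightarrow> \<exists>P. finite P \<and> P \<subseteq> H \<and> (\<forall>K. subgroup K G \<longrightarrow> P \<subseteq> K \<longrightarrow> H \<subseteq> K)"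
    and up: "\<And>H K. subgroup H G \<Longrightarrow> subgroup K G \<Longrightarrow> H \<notin> S \<Longrightarrow> H \<subseteq> K \<Longrightarrow> K \<notin> S"
    and lim: "\<And>H W. H \<in> S \<Longrightarrow> finite W \<Longrightarrow> W \<subseteq> carrier G \<Longrightarrow> \<exists>H'\<in>S. H' \<noteq> H \<and> H' \<inter> W = H \<inter> W"
  shows "perfect_kernel G = S"
proof
  let ?X = "chabauty G"
  obtain P where P: "\<And>H. subgroup H G \<Longrightarrow> H \<notin> S \<Longrightarrow> finite (P H) \<and> P H \<subseteq> H \<and> (\<forall>K. subgroup K G \<longrightarrow> P H \<subseteq> K \<longrightarrow> H \<subseteq> K)"
    using fg by metis
  have Pc: "P H \<subseteq> carrier G" if "subgroup H G" "H \<notin> S" for H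
    using P[OF that] subgroup.subset[OF that(1)] by blast
  have above: "K \<notin> S" if "subgroup H G" "H \<notin> S" "subgroup K G" "P H \<subseteq> K" for H K
    using up[OF that(1,3,2)] P[OF that(1,2)] that by blast
  have "openin ?X (\<Union>H\<in>{H. subgroup H G \<and> H \<notin> S}. {K. subgroup K G \<and> P H \<subseteq> K})"
  proof (rule openin_Union)
    fix T assume "T \<in> (\<lambda>H. {K. subgroup K G \<and> P H \<subseteq> K}) ` {H. subgroup H G \<and> H \<notin> S}"
    then obtain H where H: "subgroup H G" "H \<notin> S" "T = {K. subgroup K G \<and> P H \<subseteq> K}" by blast
    show "openin ?X T" unfolding H(3) using P[OF H(1,2)] Pc[OF H(1,2)] by (intro openin_chabauty_supersets) auto
  qed
  moreover have "topspace ?X - S = (\<Union>H\<in>{H. subgroup H G \<and> H \<notin> S}. {K. subgroup K G \<and> P H \<subseteq> K})"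
  proof (intro equalityI subsetI)
    fix K assume "K \<in> topspace ?X - S"
    then have K: "subgroup K G" "K \<notin> S" by (auto simp: topspace_chabauty)
    then show "K \<in> (\<Union>H\<in>{H. subgroup H G \<and> H \<notin> S}. {K. subgroup K G \<and> P H \<subseteq> K})"
      using P[OF K] by blast
  next
    fix K assume "K \<in> (\<Union>H\<in>{H. subgroup H G \<and> H \<notin> S}. {K. subgroup K G \<and> P H \<subseteq> K})"
    then show "K \<in> topspace ?X - S" using above by (auto simp: topspace_chabauty)
  qed
  ultimately have "closedin ?X S" unfolding closedin_def using S by (auto simp: topspace_chabauty)
  moreover have "S \<subseteq> ?X derived_set_of S"
  proof
    fix H assume H: "H \<in> S"
    show "H \<in> ?X derived_set_of S"
      unfolding in_derived_set_of
    proof (intro conjI allI impI)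
      show "H \<in> topspace ?X" using S[OF H] by (simp add: topspace_chabauty)
      fix T assume T: "H \<in> T \<and> openin ?X T"
      then obtain W where W: "finite W" "W \<subseteq> carrier G" "\<And>K. subgroup K G \<Longrightarrow> K \<inter> W = H \<inter> W \<Longrightarrow> K \<in> T"
        using chabauty_neighbourhood by metis
      from lim[OF H W(1,2)] show "\<exists>y. y \<noteq> H \<and> y \<in> S \<and> y \<in> T" using W(3) S by blast
    qed
  qed
  ultimately show "S \<subseteq> perfect_kernel G" by (rule perfect_kernel_of_greatest)
  show "perfect_kernel G \<subseteq> S"
  proof
    fix H assume HK: "H \<in> perfect_kernel G"
    let ?C = "perfect_kernel G"
    have C: "closedin ?X ?C" "?C \<subseteq> ?X derived_set_of ?C"
      by (rule closedin_perfect_kernel_of, rule perfect_kernel_of_subset_derived)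
    have sub: "subgroup H G" using HK closedin_subset[OF C(1)] by (auto simp: topspace_chabauty)
    show "H \<in> S"
    proof (rule ccontr)
      assume nS: "H \<notin> S"
      let ?U = "{K. subgroup K G \<and> P H \<subseteq> K}"
      have U: "openin ?X ?U" "closedin ?X ?U"
        using P[OF sub nS] Pc[OF sub nS] openin_chabauty_supersets closedin_chabauty_supersets by blast+
      \<comment> \<open>Intersecting with the clopen set \<open>?U\<close> keeps the set closed and
        free of isolated points, and confines it to the countable complement of
        \<open>S\<close>.\<close>
      let ?D = "?C \<inter> ?U"
      have "H \<in> ?D" using HK sub P[OF sub nS] by blast
      have "closedin ?X ?D" using C U by blast
      moreover have "?D \<subseteq> ?X derived_set_of ?D"
      proof
        fix K assume K: "K \<in> ?D"
        show "K \<in> ?X derived_set_of ?D" unfolding in_derived_set_of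
        proof (intro conjI allI impI)
          show "K \<in> topspace ?X" using K by (auto simp: topspace_chabauty)
          fix T assume "K \<in> T \<and> openin ?X T"
          then have T: "K \<in> T \<inter> ?U \<and> openin ?X (T \<inter> ?U)" using K U(1) openin_Int by blast
          have "K \<in> ?X derived_set_of ?C" using C(2) K by blast
          then have "\<exists>y. y \<noteq> K \<and> y \<in> ?C \<and> y \<in> T \<inter> ?U" using T unfolding in_derived_set_of by metis
          then show "\<exists>y. y \<noteq> K \<and> y \<in> ?D \<and> y \<in> T" by blast
        qed
      qed
      ultimately have "?X derived_set_of ?D = ?D"
        unfolding closedin_contains_derived_set by blast
      then have "(UNIV :: real set) \<lesssim> ?D"
        using \<open>H \<in> ?D\<close> compact_Hausdorff_chabauty compact_imp_locally_compact_space
        by (intro lepoll_perfect_set[of ?X] disjI2 conjI) blast+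
      moreover have "countable ?D"
      proof -
        \<comment> \<open>Two subgroups outside \<open>S\<close> with the same generating set
          contain each other.\<close>
        have "inj_on P ?D"
        proof (rule inj_onI)
          fix K K' assume K: "K \<in> ?D" "K' \<in> ?D" "P K = P K'"
          then have sK: "subgroup K G" "K \<notin> S" and sK': "subgroup K' G" "K' \<notin> S" using above[OF sub nS] by auto
          show "K = K'"
            using P[OF sK] P[OF sK'] K(3) sK(1) sK'(1) by (intro subset_antisym) auto
        qed
        moreover have "P ` ?D \<subseteq> {A. finite A \<and> A \<subseteq> carrier G}"
        proof (rule image_subsetI)
          fix K assume "K \<in> ?D"
          then have sK: "subgroup K G" "K \<notin> S" using above[OF sub nS] by auto
          show "P K \<in> {A. finite A \<and> A \<subseteq> carrier G}" using P[OF sK] Pc[OF sK] by blast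
        qed
        then have "countable (P ` ?D)"
          by (rule countable_subset[OF _ countable_Collect_finite_subset[OF countable]])
        ultimately show ?thesis using countable_image_inj_on by blast
      qed
      ultimately have "countable (UNIV :: real set)"
        using countable_lepoll by blast
      then show False using uncountable_UNIV_real by blast
    qed
  qed
qed

subsection \<open>Amenability\<close>

lemma continuous_map_mean_projection:
  assumes "A \<in> P"
  shows "continuous_map (product_topology (\<lambda>_. subtopology euclideanreal {0..1}) P) euclideanreal (\<lambda>\<mu>. \<mu> A)"
  using continuous_map_product_projection[OF assms, of "\<lambda>_. subtopology euclideanreal {0..1}"]
  by (rule continuous_map_into_fulltopology)

text \<open>The means form a closed subset of the compact cube of functions from subsets to [0,1].
  Invariance is first imposed up to \<open>1 / Suc n\<close> only, so that any finitely many of the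
  closed conditions hold for the normalized counting measure of an almost invariant family;
  compactness then gives exact invariance. The family may repeat elements, hence the index set
  \<open>I\<close>.\<close>

lemma (in group) amenable_if_almost_invariant:
  fixes S :: "'a set"
  assumes S: "S \<subseteq> carrier G" and gen: "\<And>K. subgroup K G \<Longrightarrow> S \<subseteq> K \<Longrightarrow> carrier G \<subseteq> K"
    and ai: "\<And>S\<^sub>0 \<epsilon> :: real. finite S\<^sub>0 \<Longrightarrow> S\<^sub>0 \<subseteq> S \<Longrightarrow> \<epsilon> > 0 \<Longrightarrow>
      \<exists>(I :: 'i set) x. finite I \<and> I \<noteq> {} \<and> x \<in> I \<rightarrow> carrier G \<and>
        (\<forall>s\<in>S\<^sub>0. \<forall>A\<subseteq>carrier G. \<bar>real (card {i \<in> I. s \<otimes> x i \<in> A}) - real (card {i \<in> I. x i \<in> A})\<bar> \<le> \<epsilon> * card I)"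
  shows "amenable G"
proof -
  define X where "X = product_topology (\<lambda>_. subtopology euclideanreal {0..1}) (Pow (carrier G))"
  have comp: "compact_space X"
    unfolding X_def compact_space_product_topology by (simp add: compact_space_subtopology)
  define N where "N = {\<mu> \<in> topspace X. \<mu> (carrier G) = 1}"
  define AD where "AD A B = {\<mu> \<in> topspace X. \<mu> (A \<union> B) = \<mu> A + \<mu> B}" for A B
  define AI where "AI s n A = {\<mu> \<in> topspace X. \<bar>\<mu> (s <# A) - \<mu> A\<bar> \<le> 1 / real (Suc n)}" for s n A
  define U where "U = {N} \<union> {AD A B | A B. A \<subseteq> carrier G \<and> B \<subseteq> carrier G \<and> A \<inter> B = {}} \<union>
    {AI s n A | s n A. s \<in> S \<and> A \<subseteq> carrier G}"
  have "closedin X N"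
  proof -
    have "closedin X {\<mu> \<in> topspace X. \<mu> (carrier G) \<in> {1}}" unfolding X_def
      by (rule closedin_continuous_map_preimage[OF continuous_map_mean_projection]) auto
    then show ?thesis by (simp add: N_def)
  qed
  moreover have "closedin X (AD A B)" if "A \<subseteq> carrier G" "B \<subseteq> carrier G" for A B
  proof -
    have "continuous_map X euclideanreal (\<lambda>\<mu>. \<mu> (A \<union> B) - (\<mu> A + \<mu> B))"
      unfolding X_def using that
      by (intro continuous_map_add continuous_map_diff continuous_map_mean_projection) auto
    then have "closedin X {\<mu> \<in> topspace X. \<mu> (A \<union> B) - (\<mu> A + \<mu> B) \<in> {0}}"
      by (rule closedin_continuous_map_preimage) simp
    then show ?thesis by (simp add: AD_def)
  qed
  moreover have "closedin X (AI s n A)" if "s \<in> S" "A \<subseteq> carrier G" for s n A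
  proof -
    have "s <# A \<subseteq> carrier G" using that S l_coset_subset_G by blast
    then have "continuous_map X euclideanreal (\<lambda>\<mu>. \<bar>\<mu> (s <# A) - \<mu> A\<bar>)"
      unfolding X_def using that
      by (intro continuous_map_real_abs continuous_map_diff continuous_map_mean_projection) auto
    then have "closedin X {\<mu> \<in> topspace X. \<bar>\<mu> (s <# A) - \<mu> A\<bar> \<in> {..1 / real (Suc n)}}"
      by (rule closedin_continuous_map_preimage) simp
    then show ?thesis by (simp add: AI_def)
  qed
  ultimately have closed: "closedin X C" if "C \<in> U" for C
    using that unfolding U_def by blast
  have fip: "\<Inter>F \<noteq> {}" if F: "finite F" "F \<subseteq> U" for F
  proof -
    \<comment> \<open>Each condition in the finite set \<open>F\<close> involves at most one
      generator and one tolerance. Choosing them makes the relevant generators a finite set and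
      bounds the index of the tolerance, as \<open>ai\<close> demands.\<close>
    have "\<forall>C\<in>F. \<exists>sn. C \<in> {N} \<union> {AD A B | A B. A \<subseteq> carrier G \<and> B \<subseteq> carrier G \<and> A \<inter> B = {}} \<union>
        {AI (fst sn) (snd sn) A | A. fst sn \<in> S \<and> A \<subseteq> carrier G}"
    proof
      fix C assume "C \<in> F"
      then have "C \<in> U" using F(2) by blast
      then consider "C = N" | A B where "C = AD A B" "A \<subseteq> carrier G" "B \<subseteq> carrier G" "A \<inter> B = {}"
        | s n A where "C = AI s n A" "s \<in> S" "A \<subseteq> carrier G"
        unfolding U_def by blast
      then show "\<exists>sn. C \<in> {N} \<union> {AD A B | A B. A \<subseteq> carrier G \<and> B \<subseteq> carrier G \<and> A \<inter> B = {}} \<union>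
        {AI (fst sn) (snd sn) A | A. fst sn \<in> S \<and> A \<subseteq> carrier G}"
      proof cases
        case (3 s n A)
        then have "C \<in> {AI (fst (s, n)) (snd (s, n)) A | A. fst (s, n) \<in> S \<and> A \<subseteq> carrier G}" by auto
        then show ?thesis by blast
      qed blast+
    qed
    from bchoice[OF this] obtain f where f: "\<forall>C\<in>F. C \<in> {N} \<union> {AD A B | A B. A \<subseteq> carrier G \<and> B \<subseteq> carrier G \<and> A \<inter> B = {}} \<union>
        {AI (fst (f C)) (snd (f C)) A | A. fst (f C) \<in> S \<and> A \<subseteq> carrier G}" ..
    define S0 where "S0 = S \<inter> fst ` f ` F"
    define n where "n = Max (insert 0 (snd ` f ` F))"
    have n: "snd (f C) \<le> n" if "C \<in> F" for C
      unfolding n_def using that F(1) by (intro Max_ge) auto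
    obtain I :: "'i set" and x where I: "finite I" "I \<noteq> {}" "x \<in> I \<rightarrow> carrier G"
      "\<forall>s\<in>S0. \<forall>A\<subseteq>carrier G. \<bar>real (card {i \<in> I. s \<otimes> x i \<in> A}) - real (card {i \<in> I. x i \<in> A})\<bar> \<le> (1 / real (Suc n)) * card I"
      using ai[of S0 "1 / real (Suc n)"] F(1) unfolding S0_def by auto
    have cI: "real (card I) > 0" using I by (simp add: card_gt_0_iff)
    define \<mu> where "\<mu> = (\<lambda>A\<in>Pow (carrier G). real (card {i \<in> I. x i \<in> A}) / card I)"
    have top: "\<mu> \<in> topspace X"
    proof -
      have "real (card {i \<in> I. x i \<in> A}) / card I \<in> {0..1}" for A
      proof -
        have "card {i \<in> I. x i \<in> A} \<le> card I" using I(1) by (intro card_mono) auto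
        then show ?thesis using cI by simp
      qed
      then show ?thesis
        unfolding X_def \<mu>_def topspace_product_topology topspace_subtopology by (intro PiE_I) auto
    qed
    have "\<mu> \<in> C" if C: "C \<in> F" for C
    proof -
      from bspec[OF f C] consider "C = N" | "C \<in> {AD A B | A B. A \<subseteq> carrier G \<and> B \<subseteq> carrier G \<and> A \<inter> B = {}}"
        | "C \<in> {AI (fst (f C)) (snd (f C)) A | A. fst (f C) \<in> S \<and> A \<subseteq> carrier G}"
        by (elim UnE) simp_all
      then show ?thesis
      proof cases
        case 1
        have "{i \<in> I. x i \<in> carrier G} = I" using I(3) by auto
        then show ?thesis unfolding 1 N_def using top cI by (simp add: \<mu>_def)
      next
        case 2
        then obtain A B where 2: "C = AD A B" "A \<subseteq> carrier G" "B \<subseteq> carrier G" "A \<inter> B = {}"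
          unfolding mem_Collect_eq by (elim exE conjE)
        have "{i \<in> I. x i \<in> A \<union> B} = {i \<in> I. x i \<in> A} \<union> {i \<in> I. x i \<in> B}" by auto
        moreover have "{i \<in> I. x i \<in> A} \<inter> {i \<in> I. x i \<in> B} = {}" using 2 by auto
        ultimately have "card {i \<in> I. x i \<in> A \<union> B} = card {i \<in> I. x i \<in> A} + card {i \<in> I. x i \<in> B}"
          using I(1) by (simp add: card_Un_disjoint)
        then have "\<mu> (A \<union> B) = \<mu> A + \<mu> B" using 2 by (simp add: \<mu>_def add_divide_distrib)
        then show ?thesis unfolding 2(1) AD_def using top by simp
      next
        case 3
        then obtain A where 3: "C = AI (fst (f C)) (snd (f C)) A" "fst (f C) \<in> S" "A \<subseteq> carrier G"
          unfolding mem_Collect_eq by (elim exE conjE)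
        let ?s = "fst (f C)"
        have s: "?s \<in> S0" "?s \<in> carrier G" unfolding S0_def using 3 C S by auto
        have sA: "?s <# A \<subseteq> carrier G" using l_coset_subset_G 3 s by blast
        \<comment> \<open>The hypothesis on the family counts preimages under translation. Applied
          to the set \<open>?s <# A\<close> it therefore compares \<open>A\<close> with its
          translate.\<close>
        have "?s \<otimes> x i \<in> ?s <# A \<longleftrightarrow> x i \<in> A" if i: "i \<in> I" for i
        proof
          assume "?s \<otimes> x i \<in> ?s <# A"
          then obtain a where a: "a \<in> A" "?s \<otimes> x i = ?s \<otimes> a" unfolding l_coset_def by blast
          have "x i \<in> carrier G" "a \<in> carrier G" using I(3) i a(1) 3(3) by auto
          then show "x i \<in> A" using a s(2) by simp
        next
          assume "x i \<in> A"
          then show "?s \<otimes> x i \<in> ?s <# A" unfolding l_coset_def by blast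
        qed
        then have "{i \<in> I. ?s \<otimes> x i \<in> ?s <# A} = {i \<in> I. x i \<in> A}" by auto
        then have "\<bar>real (card {i \<in> I. x i \<in> A}) - real (card {i \<in> I. x i \<in> ?s <# A})\<bar> \<le> (1 / real (Suc n)) * card I"
          using bspec[OF I(4) s(1), rule_format, OF sA] by simp
        then have "\<bar>real (card {i \<in> I. x i \<in> ?s <# A}) - real (card {i \<in> I. x i \<in> A})\<bar> / card I \<le> 1 / real (Suc n)"
          using cI by (simp add: divide_le_eq abs_minus_commute)
        moreover have "\<bar>\<mu> (?s <# A) - \<mu> A\<bar> = \<bar>real (card {i \<in> I. x i \<in> ?s <# A}) - real (card {i \<in> I. x i \<in> A})\<bar> / card I"
          using sA 3(3) cI by (simp add: \<mu>_def flip: diff_divide_distrib)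
        moreover have "1 / real (Suc n) \<le> 1 / real (Suc (snd (f C)))"
          using n[OF C] by (intro divide_left_mono) auto
        ultimately have "\<mu> \<in> AI ?s (snd (f C)) A" unfolding AI_def using top by simp
        then show ?thesis by (rule ssubst[OF 3(1)])
      qed
    qed
    then show ?thesis by blast
  qed
  have "\<Inter>U \<noteq> {}"
    using comp[unfolded compact_space_fip, rule_format, of U] closed fip by blast
  then obtain \<mu> where \<mu>: "\<And>C. C \<in> U \<Longrightarrow> \<mu> \<in> C" by blast
  have N: "\<mu> \<in> N" using \<mu> unfolding U_def by blast
  have inv: "\<mu> (s <# A) = \<mu> A" if "s \<in> S" "A \<subseteq> carrier G" for s A
  proof -
    have "\<bar>\<mu> (s <# A) - \<mu> A\<bar> \<le> 1 / real (Suc n)" for n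
    proof -
      have "AI s n A \<in> U" unfolding U_def using that by blast
      then show ?thesis using \<mu> unfolding AI_def by blast
    qed
    then have "\<bar>\<mu> (s <# A) - \<mu> A\<bar> \<le> 0"
      by (metis not_le nat_approx_posE)
    then show ?thesis by simp
  qed
  \<comment> \<open>The elements that preserve the mean form a subgroup, so invariance under the
    generators \<open>S\<close> is enough.\<close>
  let ?K = "{g \<in> carrier G. \<forall>A\<subseteq>carrier G. \<mu> (g <# A) = \<mu> A}"
  have "subgroup ?K G"
  proof (rule subgroupI)
    have "\<one> \<in> ?K" by (simp add: lcos_mult_one)
    then show "?K \<noteq> {}" by blast
    fix a assume a: "a \<in> ?K"
    have "\<mu> (inv a <# A) = \<mu> A" if A: "A \<subseteq> carrier G" for A
    proof -
      have "inv a <# A \<subseteq> carrier G" using a A l_coset_subset_G by blast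
      then have "\<mu> (a <# (inv a <# A)) = \<mu> (inv a <# A)" using a by blast
      then show ?thesis using a A by (simp add: lcos_m_assoc lcos_mult_one)
    qed
    then show "inv a \<in> ?K" using a by simp
    fix b assume b: "b \<in> ?K"
    have "\<mu> ((a \<otimes> b) <# A) = \<mu> A" if A: "A \<subseteq> carrier G" for A
    proof -
      have "b <# A \<subseteq> carrier G" using b A l_coset_subset_G by blast
      then have "\<mu> (a <# (b <# A)) = \<mu> A" using a b A by auto
      then show ?thesis using a b A by (simp add: lcos_m_assoc)
    qed
    then show "a \<otimes> b \<in> ?K" using a b by simp
  qed auto
  moreover have "S \<subseteq> ?K" using S inv by blast
  ultimately have K: "carrier G \<subseteq> ?K" by (rule gen)
  have top: "\<mu> \<in> topspace X" using N unfolding N_def by simp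
  show ?thesis unfolding amenable_def
  proof (intro exI[of _ \<mu>] conjI allI impI ballI)
    show "0 \<le> \<mu> A" if "A \<subseteq> carrier G" for A
      using top that unfolding X_def by (auto simp: PiE_iff)
    show "\<mu> (carrier G) = 1" using N unfolding N_def by simp
    show "\<mu> (A \<union> B) = \<mu> A + \<mu> B" if "A \<subseteq> carrier G" "B \<subseteq> carrier G" "A \<inter> B = {}" for A B
    proof -
      have "AD A B \<in> U" unfolding U_def using that by blast
      then show ?thesis using \<mu> unfolding AD_def by blast
    qed
    show "\<mu> (g <# A) = \<mu> A" if "g \<in> carrier G" "A \<subseteq> carrier G" for g A using K that by blast
  qed
qed

section \<open>Folner sets in \<int>^d and in unions of its cosets\<close>

lemma card_vec_box: "card {b :: int ^ 'n. \<forall>i. b $ i \<in> A} = card A ^ CARD('n)" and finite_vec_box: "finite A \<Longrightarrow> finite {b :: int ^ 'n. \<forall>i. b $ i \<in> A}"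
proof -
  have eq: "{b :: int ^ 'n. \<forall>i. b $ i \<in> A} = (\<lambda>f. \<chi> i. f i) ` (UNIV \<rightarrow>\<^sub>E A)"
  proof (intro equalityI subsetI)
    fix b :: "int ^ 'n" assume "b \<in> {b. \<forall>i. b $ i \<in> A}"
    then show "b \<in> (\<lambda>f. \<chi> i. f i) ` (UNIV \<rightarrow>\<^sub>E A)"
      by (intro image_eqI[of _ _ "\<lambda>i. b $ i"]) auto
  qed auto
  have "inj_on (\<lambda>f. (\<chi> i. f i) :: int ^ 'n) (UNIV \<rightarrow>\<^sub>E A)"
    by (auto simp: inj_on_def vec_eq_iff fun_eq_iff)
  then show "card {b :: int ^ 'n. \<forall>i. b $ i \<in> A} = card A ^ CARD('n)"
    unfolding eq by (simp add: card_image card_PiE)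
  show "finite A \<Longrightarrow> finite {b :: int ^ 'n. \<forall>i. b $ i \<in> A}"
    unfolding eq by (intro finite_imageI finite_PiE) auto
qed

text \<open>A cube of radius \<open>N\<close>, translated by vectors whose coordinates are at most
  \<open>R\<close> in absolute value, stays inside the cube of radius \<open>N + R\<close>, and the
  quotient of the two cardinalities tends to 1 as \<open>N\<close> grows.\<close>

lemma int_box_almost_invariant:
  fixes C :: "(int ^ 'n) set" and \<epsilon> :: real
  assumes "finite C" "\<epsilon> > 0"
  obtains B :: "(int ^ 'n) set" where "finite B" "B \<noteq> {}" "\<And>c. c \<in> C \<Longrightarrow> real (card {b \<in> B. c + b \<notin> B}) \<le> \<epsilon> * card B"
proof -
  define box :: "nat \<Rightarrow> (int ^ 'n) set" where "box N = {b. \<forall>i. b $ i \<in> {- int N..int N}}" for N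
  have card: "card (box N) = (2 * N + 1) ^ CARD('n)" for N
    unfolding box_def card_vec_box by (simp add: nat_add_distrib nat_mult_distrib)
  have fin: "finite (box N)" for N unfolding box_def by (rule finite_vec_box) simp
  define R where "R = Max (insert 0 ((\<lambda>(c, i). nat \<bar>c $ i\<bar>) ` (C \<times> UNIV)))"
  have R: "\<bar>c $ i\<bar> \<le> int R" if "c \<in> C" for c i
  proof -
    have "nat \<bar>c $ i\<bar> \<le> R" unfolding R_def using that assms(1) by (intro Max_ge) auto
    then show ?thesis by simp
  qed
  have "(\<lambda>N. (1 + 2 * real R / (2 * real N + 1)) ^ CARD('n)) \<longlonglongrightarrow> (1 + 0) ^ CARD('n)"
  proof (intro tendsto_power tendsto_add tendsto_const)
    have "filterlim (\<lambda>N. 2 * real N + 1) at_top sequentially"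
      by (rule filterlim_at_top_mono[OF filterlim_real_sequentially]) (simp add: always_eventually)
    then show "(\<lambda>N. 2 * real R / (2 * real N + 1)) \<longlonglongrightarrow> 0"
      by (intro tendsto_divide_0[OF tendsto_const] filterlim_at_top_imp_at_infinity)
  qed
  then have "eventually (\<lambda>N. (1 + 2 * real R / (2 * real N + 1)) ^ CARD('n) < 1 + \<epsilon>) sequentially"
    using assms(2) by (intro order_tendstoD(2)) auto
  then obtain N where N: "(1 + 2 * real R / (2 * real N + 1)) ^ CARD('n) < 1 + \<epsilon>"
    by (auto simp: eventually_sequentially)
  have "1 + 2 * real R / (2 * real N + 1) = (2 * real (N + R) + 1) / (2 * real N + 1)"
    by (simp add: field_simps)
  then have "(2 * real (N + R) + 1) ^ CARD('n) < (1 + \<epsilon>) * (2 * real N + 1) ^ CARD('n)"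
    using N by (simp add: power_divide divide_less_eq algebra_simps)
  then have big: "real (card (box (N + R))) < (1 + \<epsilon>) * real (card (box N))"
    unfolding card by (simp add: algebra_simps)
  show ?thesis
  proof (rule that[of "box N"])
    show "finite (box N)" by (rule fin)
    have "0 \<in> box N" by (simp add: box_def)
    then show "box N \<noteq> {}" by blast
    fix c assume c: "c \<in> C"
    have sub: "box N \<subseteq> box (N + R)"
    proof
      fix b assume "b \<in> box N"
      then have "- int N \<le> b $ i \<and> b $ i \<le> int N" for i unfolding box_def by auto
      then have "- int (N + R) \<le> b $ i \<and> b $ i \<le> int (N + R)" for i by (smt (verit) of_nat_add of_nat_0_le_iff)
      then show "b \<in> box (N + R)" unfolding box_def by simp
    qed
    have "(\<lambda>b. c + b) ` {b \<in> box N. c + b \<notin> box N} \<subseteq> box (N + R) - box N"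
    proof
      fix y assume "y \<in> (\<lambda>b. c + b) ` {b \<in> box N. c + b \<notin> box N}"
      then obtain b where b: "b \<in> box N" "y = c + b" "y \<notin> box N" by blast
      have "- int (N + R) \<le> y $ i \<and> y $ i \<le> int (N + R)" for i
      proof -
        have "- int N \<le> b $ i" "b $ i \<le> int N" using b(1) by (auto simp: box_def)
        then show ?thesis using R[OF c, of i] b(2) by (simp add: abs_le_iff)
      qed
      then show "y \<in> box (N + R) - box N" using b(3) unfolding box_def by simp
    qed
    then have "card ((\<lambda>b. c + b) ` {b \<in> box N. c + b \<notin> box N}) \<le> card (box (N + R) - box N)"
      using fin by (intro card_mono) auto
    then have "card {b \<in> box N. c + b \<notin> box N} \<le> card (box (N + R)) - card (box N)"
      using sub fin by (simp add: card_image card_Diff_subset)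
    then show "real (card {b \<in> box N. c + b \<notin> box N}) \<le> \<epsilon> * card (box N)"
      using big card_mono[OF fin sub] by (simp add: algebra_simps)
  qed
qed

text \<open>The family \<open>g\<close> plays the role of an almost invariant set of cosets of the abelian group \<open>range \<kappa>\<close>.\<close>

lemma (in group) amenable_if_almost_invariant_cosets:
  fixes \<kappa> :: "int ^ 'n \<Rightarrow> 'a"
  assumes S: "S \<subseteq> carrier G" and gen: "\<And>K. subgroup K G \<Longrightarrow> S \<subseteq> K \<Longrightarrow> carrier G \<subseteq> K"
    and \<kappa>: "\<And>a. \<kappa> a \<in> carrier G" "\<And>a b. \<kappa> a \<otimes> \<kappa> b = \<kappa> (a + b)"
    and ai: "\<And>\<epsilon> :: real. \<epsilon> > 0 \<Longrightarrow> \<exists>(J :: int set) g. finite J \<and> J \<noteq> {} \<and> g \<in> J \<rightarrow> carrier G \<and>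
      (\<forall>s\<in>S. \<exists>\<pi> c. inj_on \<pi> J \<and> real (card {j \<in> J. \<not> (\<pi> j \<in> J \<and> s \<otimes> g j = g (\<pi> j) \<otimes> \<kappa> (c j))}) \<le> \<epsilon> * card J)"
  shows "amenable G"
proof (rule amenable_if_almost_invariant[where 'i = "int \<times> (int ^ 'n)", OF S gen])
  fix S0 :: "'a set" and \<epsilon> :: real
  assume S0: "finite S0" "S0 \<subseteq> S" and \<epsilon>: "\<epsilon> > 0"
  obtain J :: "int set" and g where J: "finite J" "J \<noteq> {}" "g \<in> J \<rightarrow> carrier G"
    and ex: "\<forall>s\<in>S. \<exists>\<pi> c. inj_on \<pi> J \<and> real (card {j \<in> J. \<not> (\<pi> j \<in> J \<and> s \<otimes> g j = g (\<pi> j) \<otimes> \<kappa> (c j))}) \<le> (\<epsilon> / 2) * card J"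
    using ai[OF half_gt_zero[OF \<epsilon>]] by (elim exE conjE) (rule that, assumption+)
  from bchoice[OF ex] obtain \<pi> where ex': "\<forall>s\<in>S. \<exists>c. inj_on (\<pi> s) J \<and> real (card {j \<in> J. \<not> (\<pi> s j \<in> J \<and> s \<otimes> g j = g (\<pi> s j) \<otimes> \<kappa> (c j))}) \<le> (\<epsilon> / 2) * card J" ..
  from bchoice[OF ex'] obtain c where ex'': "\<forall>s\<in>S. inj_on (\<pi> s) J \<and> real (card {j \<in> J. \<not> (\<pi> s j \<in> J \<and> s \<otimes> g j = g (\<pi> s j) \<otimes> \<kappa> (c s j))}) \<le> (\<epsilon> / 2) * card J" ..
  have \<pi>: "inj_on (\<pi> s) J" if "s \<in> S" for s using bspec[OF ex'' that] by (rule conjunct1)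
  have bad: "real (card {j \<in> J. \<not> (\<pi> s j \<in> J \<and> s \<otimes> g j = g (\<pi> s j) \<otimes> \<kappa> (c s j))}) \<le> (\<epsilon> / 2) * card J"
    if "s \<in> S" for s using bspec[OF ex'' that] by (rule conjunct2)
  \<comment> \<open>\<open>J\<close> has to be fixed first: only then are the displacements
    \<open>c s j\<close> finitely many, so that a box \<open>B\<close> almost invariant under them
    exists. One half of \<epsilon> pays for the bad indices in \<open>J\<close>, the other half for
    leaving \<open>B\<close>.\<close>
  obtain B where B: "finite B" "B \<noteq> {}"
    and Bc: "\<And>y. y \<in> (\<lambda>(s, j). c s j) ` (S0 \<times> J) \<Longrightarrow> real (card {b \<in> B. y + b \<notin> B}) \<le> (\<epsilon> / 2) * card B"
    using int_box_almost_invariant[of "(\<lambda>(s, j). c s j) ` (S0 \<times> J)" "\<epsilon> / 2"] S0 J \<epsilon> by auto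
  define x where "x = (\<lambda>(j, b). g j \<otimes> \<kappa> b)"
  let ?I = "J \<times> B"
  have xc: "x \<in> ?I \<rightarrow> carrier G" unfolding x_def using J \<kappa> by auto
  have "\<bar>real (card {i \<in> ?I. s \<otimes> x i \<in> A}) - real (card {i \<in> ?I. x i \<in> A})\<bar> \<le> \<epsilon> * card ?I"
    if s: "s \<in> S0" and A: "A \<subseteq> carrier G" for s A
  proof -
    have sS: "s \<in> S" "s \<in> carrier G" using s S0 S by auto
    define good where "good = {j \<in> J. \<pi> s j \<in> J \<and> s \<otimes> g j = g (\<pi> s j) \<otimes> \<kappa> (c s j)}"
    \<comment> \<open>On \<open>P\<close>, left multiplication by \<open>s\<close> is realized
      inside \<open>?I\<close> by the injection \<open>\<Phi>\<close>. Both counts can differ only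
      by what happens on the complement, so its size bounds their difference.\<close>
    define P where "P = {(j, b) \<in> ?I. j \<in> good \<and> c s j + b \<in> B}"
    define \<Phi> where "\<Phi> = (\<lambda>(j, b). (\<pi> s j, c s j + b))"
    have fI: "finite ?I" using J B by simp
    have PI: "P \<subseteq> ?I" unfolding P_def by auto
    have inj: "inj_on \<Phi> P"
      using \<pi>[OF sS(1)] unfolding inj_on_def \<Phi>_def P_def good_def by fastforce
    have \<Phi>I: "\<Phi> ` P \<subseteq> ?I" unfolding \<Phi>_def P_def good_def by auto
    have x\<Phi>: "s \<otimes> x i = x (\<Phi> i)" if "i \<in> P" for i
    proof -
      obtain j b where i: "i = (j, b)" by (cases i)
      then have j: "j \<in> J" "\<pi> s j \<in> J" "s \<otimes> g j = g (\<pi> s j) \<otimes> \<kappa> (c s j)" using that by (auto simp: P_def good_def)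
      have gc: "g j \<in> carrier G" "g (\<pi> s j) \<in> carrier G" using j J by auto
      have "s \<otimes> x i = s \<otimes> g j \<otimes> \<kappa> b" using i sS gc \<kappa> by (simp add: x_def m_assoc)
      also have "\<dots> = x (\<Phi> i)" using i j gc \<kappa> by (simp add: x_def \<Phi>_def m_assoc)
      finally show ?thesis .
    qed
    have rest: "real (card (?I - P)) \<le> \<epsilon> * card ?I"
    proof -
      have "?I - P \<subseteq> (J - good) \<times> B \<union> (SIGMA j:J. {b \<in> B. c s j + b \<notin> B})" unfolding P_def by auto
      then have "card (?I - P) \<le> card ((J - good) \<times> B \<union> (SIGMA j:J. {b \<in> B. c s j + b \<notin> B}))"
        using J B by (intro card_mono) auto
      also have "\<dots> \<le> card ((J - good) \<times> B) + card (SIGMA j:J. {b \<in> B. c s j + b \<notin> B})" by (rule card_Un_le)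
      also have "\<dots> = card (J - good) * card B + (\<Sum>j\<in>J. card {b \<in> B. c s j + b \<notin> B})"
        using J B by (simp add: card_cartesian_product)
      finally have "real (card (?I - P)) \<le> real (card (J - good)) * card B + (\<Sum>j\<in>J. real (card {b \<in> B. c s j + b \<notin> B}))"
        by (metis (no_types, lifting) of_nat_add of_nat_le_iff of_nat_mult of_nat_sum sum.cong)
      also have "real (card (J - good)) \<le> (\<epsilon> / 2) * card J"
      proof -
        have "J - good = {j \<in> J. \<not> (\<pi> s j \<in> J \<and> s \<otimes> g j = g (\<pi> s j) \<otimes> \<kappa> (c s j))}" unfolding good_def by auto
        then show ?thesis using bad[OF sS(1)] by simp
      qed
      also have "(\<Sum>j\<in>J. real (card {b \<in> B. c s j + b \<notin> B})) \<le> (\<Sum>j\<in>J. (\<epsilon> / 2) * card B)"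
        using s by (intro sum_mono Bc) auto
      finally show ?thesis by (simp add: card_cartesian_product mult_right_mono)
    qed
    have fin: "finite {i \<in> ?I. Q i}" for Q using fI by simp
    have fP: "finite P" using PI fI finite_subset by blast
    have "card {i \<in> ?I. s \<otimes> x i \<in> A} \<le> card ({i \<in> P. s \<otimes> x i \<in> A} \<union> (?I - P))"
      using fI fP by (intro card_mono) auto
    also have "\<dots> \<le> card {i \<in> P. s \<otimes> x i \<in> A} + card (?I - P)" by (rule card_Un_le)
    also have "card {i \<in> P. s \<otimes> x i \<in> A} = card (\<Phi> ` {i \<in> P. s \<otimes> x i \<in> A})"
      using inj by (intro card_image[symmetric]) (auto intro: inj_on_subset)
    also have "\<dots> \<le> card {i \<in> ?I. x i \<in> A}"
      using \<Phi>I x\<Phi> fI by (intro card_mono) auto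
    finally have 1: "card {i \<in> ?I. s \<otimes> x i \<in> A} \<le> card {i \<in> ?I. x i \<in> A} + card (?I - P)" by simp
    have "card {i \<in> ?I. x i \<in> A} \<le> card ({i \<in> \<Phi> ` P. x i \<in> A} \<union> (?I - \<Phi> ` P))"
      using fI fP by (intro card_mono) auto
    also have "\<dots> \<le> card {i \<in> \<Phi> ` P. x i \<in> A} + card (?I - \<Phi> ` P)" by (rule card_Un_le)
    also have "{i \<in> \<Phi> ` P. x i \<in> A} = \<Phi> ` {i \<in> P. s \<otimes> x i \<in> A}" using x\<Phi> by auto
    also have "card (\<Phi> ` {i \<in> P. s \<otimes> x i \<in> A}) \<le> card {i \<in> P. s \<otimes> x i \<in> A}" using fP by (intro card_image_le) auto
    also have "card {i \<in> P. s \<otimes> x i \<in> A} \<le> card {i \<in> ?I. s \<otimes> x i \<in> A}" using PI fI by (intro card_mono) auto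
    also have "card (?I - \<Phi> ` P) = card (?I - P)"
      using fP fI PI \<Phi>I inj by (simp add: card_Diff_subset card_image finite_imageI)
    finally have 2: "card {i \<in> ?I. x i \<in> A} \<le> card {i \<in> ?I. s \<otimes> x i \<in> A} + card (?I - P)" by simp
    show ?thesis using 1 2 rest by linarith
  qed
  then show "\<exists>(I :: (int \<times> (int ^ 'n)) set) x. finite I \<and> I \<noteq> {} \<and> x \<in> I \<rightarrow> carrier G \<and>
        (\<forall>s\<in>S0. \<forall>A\<subseteq>carrier G. \<bar>real (card {i \<in> I. s \<otimes> x i \<in> A}) - real (card {i \<in> I. x i \<in> A})\<bar> \<le> \<epsilon> * card I)"
    using J B xc by (intro exI[of _ ?I] exI[of _ x]) auto
qed

section \<open>Actions of words\<close>

context gbs_graph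
begin

sublocale F: group "path_group \<Gamma>"
  by (rule group_path_group)

abbreviation mul (infixl "\<cdot>" 70) where "x \<cdot> y \<equiv> x \<otimes>\<^bsub>path_group \<Gamma>\<^esub> y"

definition V :: "'v \<Rightarrow> int ^ 'd \<Rightarrow> ('v, 'e, 'd) word set" where
  "V v a = word_class \<Gamma> [Vtx v a]"

definition E :: "'e \<Rightarrow> ('v, 'e, 'd) word set" where
  "E e = word_class \<Gamma> [Edg e]"

abbreviation cl :: "('v, 'e, 'd) word \<Rightarrow> ('v, 'e, 'd) word set" where
  "cl w \<equiv> word_class \<Gamma> w"

lemma cl_closed [simp, intro]: "w \<in> words \<Gamma> \<Longrightarrow> cl w \<in> carrier (path_group \<Gamma>)"
  by (simp add: carrier_path_group)

lemma V_closed [simp, intro]: "v \<in> verts \<Gamma> \<Longrightarrow> V v a \<in> carrier (path_group \<Gamma>)"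
  by (simp add: V_def)

lemma E_closed [simp, intro]: "e \<in> edges \<Gamma> \<Longrightarrow> E e \<in> carrier (path_group \<Gamma>)"
  by (simp add: E_def)

lemma cl_Nil: "cl [] = \<one>\<^bsub>path_group \<Gamma>\<^esub>"
  by (simp add: one_path_group)

lemma cl_append: "x \<in> words \<Gamma> \<Longrightarrow> y \<in> words \<Gamma> \<Longrightarrow> cl (x @ y) = cl x \<cdot> cl y"
  by (simp add: mult_word_class)

lemma cl_Vtx: "v \<in> verts \<Gamma> \<Longrightarrow> y \<in> words \<Gamma> \<Longrightarrow> cl (Vtx v a # y) = V v a \<cdot> cl y"
  by (simp add: V_def mult_word_class)

lemma cl_Edg: "e \<in> edges \<Gamma> \<Longrightarrow> y \<in> words \<Gamma> \<Longrightarrow> cl (Edg e # y) = E e \<cdot> cl y"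
  by (simp add: E_def mult_word_class)

lemma V_zero: "v \<in> verts \<Gamma> \<Longrightarrow> V v 0 = \<one>\<^bsub>path_group \<Gamma>\<^esub>"
  unfolding V_def one_path_group by (rule word_class_eqI[OF word_cong.unit])

lemma V_add: "v \<in> verts \<Gamma> \<Longrightarrow> V v a \<cdot> V v b = V v (a + b)"
  unfolding V_def by (simp add: mult_word_class word_class_eqI[OF word_cong.add])

lemma V_minus: "v \<in> verts \<Gamma> \<Longrightarrow> inv\<^bsub>path_group \<Gamma>\<^esub> V v a = V v (- a)"
  by (rule F.inv_equality) (simp_all add: V_add V_zero)

lemma E_opp: "e \<in> edges \<Gamma> \<Longrightarrow> E e \<cdot> E (opp \<Gamma> e) = \<one>\<^bsub>path_group \<Gamma>\<^esub>"
  unfolding E_def one_path_group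
  by (simp add: mult_word_class opp_in word_class_eqI[OF word_cong.opp])

lemma E_opp': "e \<in> edges \<Gamma> \<Longrightarrow> E (opp \<Gamma> e) \<cdot> E e = \<one>\<^bsub>path_group \<Gamma>\<^esub>"
  using E_opp[OF opp_in] by (simp add: opp_opp)

lemma E_inv: "e \<in> edges \<Gamma> \<Longrightarrow> inv\<^bsub>path_group \<Gamma>\<^esub> E e = E (opp \<Gamma> e)"
  by (rule F.inv_equality) (simp_all add: E_opp' opp_in)

lemma E_V: "e \<in> edges \<Gamma> \<Longrightarrow>
    E e \<cdot> V (tgt \<Gamma> e) (lab_tgt \<Gamma> e *v z) = V (src \<Gamma> e) (lab_src \<Gamma> e *v z) \<cdot> E e"
  unfolding E_def V_def
  by (simp add: mult_word_class src_in tgt_in word_class_eqI[OF word_cong.edge])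

lemma E_V': "e \<in> edges \<Gamma> \<Longrightarrow>
    E (opp \<Gamma> e) \<cdot> V (src \<Gamma> e) (lab_src \<Gamma> e *v z) = V (tgt \<Gamma> e) (lab_tgt \<Gamma> e *v z) \<cdot> E (opp \<Gamma> e)"
  using E_V[OF opp_in, of e z] by (simp add: tgt_opp src_opp lab_src_opp lab_tgt_opp)

text \<open>The letters act on \<open>X\<close> from the right and satisfy the defining relations of the path group.\<close>

definition letter_action :: "'x set \<Rightarrow> (('v, 'e, 'd) letter \<Rightarrow> 'x \<Rightarrow> 'x) \<Rightarrow> bool" where
  "letter_action X act \<longleftrightarrow>
     (\<forall>l x. [l] \<in> words \<Gamma> \<longrightarrow> x \<in> X \<longrightarrow> act l x \<in> X) \<and>
     (\<forall>v\<in>verts \<Gamma>. \<forall>x\<in>X. act (Vtx v 0) x = x) \<and>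
     (\<forall>v\<in>verts \<Gamma>. \<forall>x\<in>X. \<forall>a b. act (Vtx v b) (act (Vtx v a) x) = act (Vtx v (a + b)) x) \<and>
     (\<forall>e\<in>edges \<Gamma>. \<forall>x\<in>X. act (Edg (opp \<Gamma> e)) (act (Edg e) x) = x) \<and>
     (\<forall>e\<in>edges \<Gamma>. \<forall>x\<in>X. \<forall>z. act (Vtx (tgt \<Gamma> e) (lab_tgt \<Gamma> e *v z)) (act (Edg e) x) =
        act (Edg e) (act (Vtx (src \<Gamma> e) (lab_src \<Gamma> e *v z)) x))"

lemma letter_actionD:
  assumes "letter_action X act"
  shows "[l] \<in> words \<Gamma> \<Longrightarrow> x \<in> X \<Longrightarrow> act l x \<in> X"
    and "v \<in> verts \<Gamma> \<Longrightarrow> x \<in> X \<Longrightarrow> act (Vtx v a) x \<in> X"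
    and "e \<in> edges \<Gamma> \<Longrightarrow> x \<in> X \<Longrightarrow> act (Edg e) x \<in> X"
    and "v \<in> verts \<Gamma> \<Longrightarrow> x \<in> X \<Longrightarrow> act (Vtx v 0) x = x"
    and "v \<in> verts \<Gamma> \<Longrightarrow> x \<in> X \<Longrightarrow> act (Vtx v b) (act (Vtx v a) x) = act (Vtx v (a + b)) x"
    and "e \<in> edges \<Gamma> \<Longrightarrow> x \<in> X \<Longrightarrow> act (Edg (opp \<Gamma> e)) (act (Edg e) x) = x"
    and "e \<in> edges \<Gamma> \<Longrightarrow> x \<in> X \<Longrightarrow> act (Edg e) (act (Edg (opp \<Gamma> e)) x) = x"
    and "e \<in> edges \<Gamma> \<Longrightarrow> x \<in> X \<Longrightarrow> act (Vtx (tgt \<Gamma> e) (lab_tgt \<Gamma> e *v z)) (act (Edg e) x) =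
        act (Edg e) (act (Vtx (src \<Gamma> e) (lab_src \<Gamma> e *v z)) x)"
proof -
  show cl: "[l] \<in> words \<Gamma> \<Longrightarrow> x \<in> X \<Longrightarrow> act l x \<in> X" for l x
    using assms unfolding letter_action_def by blast
  show "v \<in> verts \<Gamma> \<Longrightarrow> x \<in> X \<Longrightarrow> act (Vtx v a) x \<in> X"
       "e \<in> edges \<Gamma> \<Longrightarrow> x \<in> X \<Longrightarrow> act (Edg e) x \<in> X"
    by (auto intro: cl)
  show "v \<in> verts \<Gamma> \<Longrightarrow> x \<in> X \<Longrightarrow> act (Vtx v 0) x = x"
    "v \<in> verts \<Gamma> \<Longrightarrow> x \<in> X \<Longrightarrow> act (Vtx v b) (act (Vtx v a) x) = act (Vtx v (a + b)) x"
    "e \<in> edges \<Gamma> \<Longrightarrow> x \<in> X \<Longrightarrow> act (Vtx (tgt \<Gamma> e) (lab_tgt \<Gamma> e *v z)) (act (Edg e) x) =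
        act (Edg e) (act (Vtx (src \<Gamma> e) (lab_src \<Gamma> e *v z)) x)"
    using assms unfolding letter_action_def by blast+
  show o: "e \<in> edges \<Gamma> \<Longrightarrow> x \<in> X \<Longrightarrow> act (Edg (opp \<Gamma> e)) (act (Edg e) x) = x" for e
    using assms unfolding letter_action_def by blast
  show "e \<in> edges \<Gamma> \<Longrightarrow> x \<in> X \<Longrightarrow> act (Edg e) (act (Edg (opp \<Gamma> e)) x) = x"
    using o[of "opp \<Gamma> e"] by (simp add: opp_in opp_opp)
qed

text \<open>The first letter acts first, so words act from the right; on right cosets
  \<open>K g\<close> this is multiplication by the class of the word.\<close>

definition run :: "(('v, 'e, 'd) letter \<Rightarrow> 'x \<Rightarrow> 'x) \<Rightarrow> ('v, 'e, 'd) word \<Rightarrow> 'x \<Rightarrow> 'x" where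
  "run act w x = fold act w x"

lemma run_simps [simp]:
  "run act [] x = x" "run act (l # w) x = run act w (act l x)"
  "run act (u @ w) x = run act w (run act u x)"
  by (simp_all add: run_def)

lemma words_ConsD: "l # w \<in> words \<Gamma> \<Longrightarrow> [l] \<in> words \<Gamma> \<and> w \<in> words \<Gamma>"
  by (cases l) auto

lemma run_closed: "letter_action X act \<Longrightarrow> w \<in> words \<Gamma> \<Longrightarrow> x \<in> X \<Longrightarrow> run act w x \<in> X"
proof (induction w arbitrary: x)
  case (Cons l w)
  then show ?case using words_ConsD[OF Cons.prems(2)] letter_actionD(1)[OF Cons.prems(1)] by simp
qed simp

text \<open>The clauses of \<open>letter_action\<close> are the defining relations. The
  contrapositive separates words: a different effect in some action shows that two words are not
  congruent.\<close>

lemma run_cong: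
  assumes "letter_action X act" "(w, w') \<in> word_cong \<Gamma>" "x \<in> X"
  shows "run act w x = run act w' x"
  using assms(2,3)
proof (induction arbitrary: x rule: word_cong.induct)
  case (ctxt w w' l r)
  then show ?case using run_closed[OF assms(1) ctxt.hyps(2)] by simp
qed (auto simp: letter_actionD[OF assms(1)])

lemma run_inj:
  assumes "letter_action X act" "w \<in> words \<Gamma>" "x \<in> X" "y \<in> X" "run act w x = run act w y"
  shows "x = y"
proof -
  have "(inv_word (inv_word w) @ inv_word w, []) \<in> word_cong \<Gamma>"
    using assms(2) by (intro inv_word_cancel inv_word_words)
  moreover have "inv_word (inv_word w) = w" using assms(2)
  proof (induction w)
    case (Cons l w)
    then show ?case by (cases l) (auto simp: inv_word_def opp_opp rev_map)
  qed (simp add: inv_word_def)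
  ultimately have "(w @ inv_word w, []) \<in> word_cong \<Gamma>" by simp
  then have "run act (inv_word w) (run act w z) = z" if "z \<in> X" for z
    using run_cong[OF assms(1) _ that] by fastforce
  then show ?thesis using assms(3-5) by metis
qed

subsection \<open>Integer matrices\<close>

definition ratm :: "int ^ 'd ^ 'd \<Rightarrow> rat ^ 'd ^ 'd" where
  "ratm M = (\<chi> i j. rat_of_int (M $ i $ j))"

definition ratv :: "int ^ 'd \<Rightarrow> rat ^ 'd" where
  "ratv x = (\<chi> i. rat_of_int (x $ i))"

lemma ratv_mult: "ratv (M *v x) = ratm M *v ratv x"
  by (simp add: ratv_def ratm_def matrix_vector_mult_def vec_eq_iff)

lemma ratv_add: "ratv (x + y) = ratv x + ratv y"
  by (simp add: ratv_def vec_eq_iff)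

lemma ratv_zero: "ratv 0 = 0"
  by (simp add: ratv_def vec_eq_iff)

lemma ratv_inj: "ratv x = ratv y \<longleftrightarrow> x = y"
  by (simp add: ratv_def vec_eq_iff)

lemma ratm_inv:
  assumes "invertible (ratm M)"
  shows "matrix_inv (ratm M) *v (ratm M *v x) = x" "ratm M *v (matrix_inv (ratm M) *v x) = x"
proof -
  obtain N where "ratm M ** N = mat 1 \<and> N ** ratm M = mat 1"
    using assms unfolding invertible_def by blast
  then have "ratm M ** matrix_inv (ratm M) = mat 1 \<and> matrix_inv (ratm M) ** ratm M = mat 1"
    unfolding matrix_inv_def by (rule someI)
  then show "matrix_inv (ratm M) *v (ratm M *v x) = x" "ratm M *v (matrix_inv (ratm M) *v x) = x"
    by (simp_all add: matrix_vector_mul_assoc)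
qed

lemma invertible_ratm_lab:
  "e \<in> edges \<Gamma> \<Longrightarrow> invertible (ratm (lab_src \<Gamma> e))"
  "e \<in> edges \<Gamma> \<Longrightarrow> invertible (ratm (lab_tgt \<Gamma> e))"
  using lab_src_GL lab_tgt_GL by (simp_all add: ratm_def)

lemma lab_inj:
  "e \<in> edges \<Gamma> \<Longrightarrow> lab_src \<Gamma> e *v x = lab_src \<Gamma> e *v y \<longleftrightarrow> x = y"
  "e \<in> edges \<Gamma> \<Longrightarrow> lab_tgt \<Gamma> e *v x = lab_tgt \<Gamma> e *v y \<longleftrightarrow> x = y"
  by (metis ratm_inv(1) invertible_ratm_lab(1) ratv_inj ratv_mult,
      metis ratm_inv(1) invertible_ratm_lab(2) ratv_inj ratv_mult)

text \<open>Translations together with the linear maps attached to the edges satisfy the relations, which shows that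
  the vertex groups embed.\<close>

primrec affine_act :: "('v, 'e, 'd) letter \<Rightarrow> rat ^ 'd \<Rightarrow> rat ^ 'd" where
  "affine_act (Vtx v a) x = x + ratv a"
| "affine_act (Edg e) x = ratm (lab_tgt \<Gamma> e) *v (matrix_inv (ratm (lab_src \<Gamma> e)) *v x)"

lemma letter_action_affine: "letter_action UNIV affine_act"
  unfolding letter_action_def
  by (auto simp: ratv_add lab_src_opp lab_tgt_opp ratm_inv invertible_ratm_lab ratv_mult
      matrix_vector_right_distrib ratv_zero)

text \<open>Under \<open>affine_act\<close> a single vertex letter moves 0 to its own
  vector.\<close>

lemma V_inj: "v \<in> verts \<Gamma> \<Longrightarrow> V v a = V v b \<longleftrightarrow> a = b"
  using run_cong[OF letter_action_affine, of "[Vtx v a]" "[Vtx v b]" 0]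
  by (auto simp: V_def word_class_eq_iff ratv_inj intro: word_cong.refl)

subsection \<open>Crossings\<close>

text \<open>The coset that represents an edge over \<open>e\<close> in
  \<open>bass_serre_tree\<close>, written as a plain set of elements.\<close>

definition edge_coset :: "('v, 'e, 'd) word set \<Rightarrow> 'e \<Rightarrow> ('v, 'e, 'd) word set set" where
  "edge_coset g e = {g \<cdot> V (src \<Gamma> e) (lab_src \<Gamma> e *v z) | z. True}"

text \<open>The letter \<open>e\<close> is read at the position \<open>g\<close>. If it crosses the
  tree edge \<open>B\<close> forwards, the position before it lies in \<open>B\<close>; if it
  crosses backwards, the position after it does.\<close>

definition crossing :: "('v, 'e, 'd) word set set \<Rightarrow> 'e \<Rightarrow> 'e \<Rightarrow> ('v, 'e, 'd) word set \<Rightarrow> bool" where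
  "crossing B e\<^sub>0 e g \<longleftrightarrow> e = e\<^sub>0 \<and> g \<in> B \<or> e = opp \<Gamma> e\<^sub>0 \<and> g \<cdot> E e \<in> B"

text \<open>The flag counts modulo 2 the crossings of the tree edge \<open>B\<close>. As it only depends on the class of the word, a
  closed word which crosses an edge has to cross it again.\<close>

primrec parity_act ::
  "('v, 'e, 'd) word set set \<Rightarrow> 'e \<Rightarrow> ('v, 'e, 'd) letter \<Rightarrow>
    ('v, 'e, 'd) word set \<times> bool \<Rightarrow> ('v, 'e, 'd) word set \<times> bool" where
  "parity_act B e\<^sub>0 (Vtx v a) gb = (fst gb \<cdot> V v a, snd gb)"
| "parity_act B e\<^sub>0 (Edg e) gb = (fst gb \<cdot> E e, snd gb \<noteq> crossing B e\<^sub>0 e (fst gb))"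

lemma edge_coset_mult:
  assumes "g\<^sub>0 \<in> carrier (path_group \<Gamma>)" "e \<in> edges \<Gamma>" "g \<in> carrier (path_group \<Gamma>)"
  shows "g \<cdot> V (src \<Gamma> e) (lab_src \<Gamma> e *v z) \<in> edge_coset g\<^sub>0 e \<longleftrightarrow> g \<in> edge_coset g\<^sub>0 e"
proof -
  have 1: "g \<cdot> V (src \<Gamma> e) (lab_src \<Gamma> e *v z) \<in> edge_coset g\<^sub>0 e" if "g \<in> edge_coset g\<^sub>0 e" for g z
    using that assms
    by (auto simp: edge_coset_def F.m_assoc V_add src_in simp flip: matrix_vector_right_distrib)
  have "g \<cdot> V (src \<Gamma> e) (lab_src \<Gamma> e *v z) \<cdot> V (src \<Gamma> e) (lab_src \<Gamma> e *v (- z)) = g"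
    using assms by (simp add: F.m_assoc V_add src_in V_zero flip: matrix_vector_right_distrib)
  then show ?thesis using 1 by metis
qed

text \<open>An edge letter followed by its opposite crosses \<open>B\<close> twice or never, and
  multiplication by the edge group does not lead into or out of \<open>B\<close>. Hence the parity
  of crossings is compatible with the relations.\<close>

lemma letter_action_parity:
  assumes g: "g\<^sub>0 \<in> carrier (path_group \<Gamma>)" and e\<^sub>0: "e\<^sub>0 \<in> edges \<Gamma>"
  shows "letter_action (carrier (path_group \<Gamma>) \<times> UNIV) (parity_act (edge_coset g\<^sub>0 e\<^sub>0) e\<^sub>0)"
  unfolding letter_action_def
proof (intro conjI ballI allI impI)
  let ?B = "edge_coset g\<^sub>0 e\<^sub>0"
  fix l x assume "[l] \<in> words \<Gamma>" "x \<in> carrier (path_group \<Gamma>) \<times> (UNIV :: bool set)"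
  then show "parity_act ?B e\<^sub>0 l x \<in> carrier (path_group \<Gamma>) \<times> UNIV" by (cases l) auto
next
  let ?B = "edge_coset g\<^sub>0 e\<^sub>0"
  fix e x assume e: "e \<in> edges \<Gamma>" and x: "x \<in> carrier (path_group \<Gamma>) \<times> (UNIV :: bool set)"
  have "fst x \<cdot> E e \<cdot> E (opp \<Gamma> e) = fst x" using e x by (auto simp: F.m_assoc opp_in E_opp)
  moreover have "crossing ?B e\<^sub>0 (opp \<Gamma> e) (fst x \<cdot> E e) = crossing ?B e\<^sub>0 e (fst x)"
    using e e\<^sub>0 opp_opp opp_neq calculation unfolding crossing_def by metis
  ultimately show "parity_act ?B e\<^sub>0 (Edg (opp \<Gamma> e)) (parity_act ?B e\<^sub>0 (Edg e) x) = x"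
    by (auto simp: prod_eq_iff)
next
  let ?B = "edge_coset g\<^sub>0 e\<^sub>0"
  fix e x z assume e: "e \<in> edges \<Gamma>" and x: "x \<in> carrier (path_group \<Gamma>) \<times> (UNIV :: bool set)"
  let ?s = "V (src \<Gamma> e) (lab_src \<Gamma> e *v z)" and ?t = "V (tgt \<Gamma> e) (lab_tgt \<Gamma> e *v z)"
  obtain h where h: "fst x = h" "h \<in> carrier (path_group \<Gamma>)" using x by auto
  have c: "h \<cdot> ?s \<cdot> E e = h \<cdot> E e \<cdot> ?t" using e h by (simp add: F.m_assoc src_in tgt_in E_V)
  have "crossing ?B e\<^sub>0 e (h \<cdot> ?s) = crossing ?B e\<^sub>0 e h"
  proof (cases "e = opp \<Gamma> e\<^sub>0")
    case True
    then have "?t = V (src \<Gamma> e\<^sub>0) (lab_src \<Gamma> e\<^sub>0 *v z)" using e\<^sub>0 by (simp add: tgt_opp lab_tgt_opp)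
    then show ?thesis using True e h e\<^sub>0 g edge_coset_mult[OF g e\<^sub>0, of "h \<cdot> E e" z] opp_neq[OF e\<^sub>0]
      unfolding crossing_def c by simp
  next
    case False
    then show ?thesis using e h edge_coset_mult[OF g e\<^sub>0, of h z] unfolding crossing_def by auto
  qed
  then show "parity_act ?B e\<^sub>0 (Vtx (tgt \<Gamma> e) (lab_tgt \<Gamma> e *v z)) (parity_act ?B e\<^sub>0 (Edg e) x) =
    parity_act ?B e\<^sub>0 (Edg e) (parity_act ?B e\<^sub>0 (Vtx (src \<Gamma> e) (lab_src \<Gamma> e *v z)) x)"
    using c h by (simp add: prod_eq_iff)
qed (auto simp: prod_eq_iff V_zero F.m_assoc V_add)

subsection \<open>Reduced syllable lists\<close>

text \<open>The list \<open>[(a\<^sub>1, e\<^sub>1), \<dots>, (a\<^sub>n, e\<^sub>n)]\<close> stands for the word \<open>a\<^sub>1 e\<^sub>1 \<dots> a\<^sub>n e\<^sub>n\<close>.\<close>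

primrec syl_word :: "((int ^ 'd) \<times> 'e) list \<Rightarrow> ('v, 'e, 'd) word" where
  "syl_word [] = []"
| "syl_word (s # S) = Vtx (src \<Gamma> (snd s)) (fst s) # Edg (snd s) # syl_word S"

primrec syl_path :: "'v \<Rightarrow> ((int ^ 'd) \<times> 'e) list \<Rightarrow> 'v \<Rightarrow> bool" where
  "syl_path u [] w \<longleftrightarrow> u = w \<and> u \<in> verts \<Gamma>"
| "syl_path u (s # S) w \<longleftrightarrow> snd s \<in> edges \<Gamma> \<and> src \<Gamma> (snd s) = u \<and> syl_path (tgt \<Gamma> (snd s)) S w"

definition no_backtrack :: "(int ^ 'd) \<times> 'e \<Rightarrow> (int ^ 'd) \<times> 'e \<Rightarrow> bool" where
  "no_backtrack s s' \<longleftrightarrow> (snd s' = opp \<Gamma> (snd s) \<longrightarrow> fst s' \<notin> range ((*v) (lab_tgt \<Gamma> (snd s))))"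

abbreviation reduced_path :: "((int ^ 'd) \<times> 'e) list \<Rightarrow> bool" where
  "reduced_path \<equiv> successively no_backtrack"

lemma syl_word_append [simp]: "syl_word (S @ T) = syl_word S @ syl_word T"
  by (induction S) auto

lemma syl_path_append: "syl_path u (S @ T) w \<longleftrightarrow> (\<exists>v. syl_path u S v \<and> syl_path v T w)"
proof (induction S arbitrary: u)
  case Nil
  then show ?case by (cases T) (auto simp: src_in)
qed auto

lemma syl_path_verts: "syl_path u S w \<Longrightarrow> u \<in> verts \<Gamma> \<and> w \<in> verts \<Gamma>"
  by (induction S arbitrary: u) (auto simp: src_in)

lemma syl_path_words: "syl_path u S w \<Longrightarrow> syl_word S \<in> words \<Gamma>"
  by (induction S arbitrary: u) (auto simp: src_in)

lemma syl_path_path_word: "syl_path u S w \<Longrightarrow> path_word \<Gamma> u (syl_word S) w"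
  by (induction S arbitrary: u) (auto intro!: path_word.intros src_in)

text \<open>Only a crossing changes the flag, so a changed flag exhibits one.\<close>

lemma parity_crossing:
  assumes "syl_path u S w" "gb \<in> carrier (path_group \<Gamma>) \<times> UNIV"
    and "snd (run (parity_act B e\<^sub>0) (syl_word S) gb) \<noteq> snd gb"
  shows "\<exists>m a e r. S = m @ (a, e) # r \<and> crossing B e\<^sub>0 e (fst gb \<cdot> cl (syl_word m) \<cdot> V (src \<Gamma> e) a)"
  using assms
proof (induction S arbitrary: u gb)
  case (Cons s S)
  obtain a e where s: "s = (a, e)" by (cases s)
  have e: "e \<in> edges \<Gamma>" and S: "syl_path (tgt \<Gamma> e) S w" using Cons.prems s by auto
  show ?case
  proof (cases "crossing B e\<^sub>0 e (fst gb \<cdot> V (src \<Gamma> e) a)")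
    case True
    then show ?thesis using s Cons.prems by (intro exI[of _ "[]"]) (auto simp: cl_Nil)
  next
    case False
    let ?gb = "parity_act B e\<^sub>0 (Edg e) (parity_act B e\<^sub>0 (Vtx (src \<Gamma> e) a) gb)"
    have g: "?gb \<in> carrier (path_group \<Gamma>) \<times> UNIV" "snd ?gb = snd gb"
      "fst ?gb = fst gb \<cdot> V (src \<Gamma> e) a \<cdot> E e"
      using Cons.prems(2) e False by (auto simp: src_in)
    have "snd (run (parity_act B e\<^sub>0) (syl_word S) ?gb) \<noteq> snd ?gb" using Cons.prems(3) s g by simp
    then obtain m a' e' r where m: "S = m @ (a', e') # r"
      "crossing B e\<^sub>0 e' (fst ?gb \<cdot> cl (syl_word m) \<cdot> V (src \<Gamma> e') a')"
      using Cons.IH[OF S g(1)] by blast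
    have "syl_word m \<in> words \<Gamma>" using S m by (auto simp: syl_path_append dest: syl_path_words)
    then have "fst ?gb \<cdot> cl (syl_word m) = fst gb \<cdot> cl (syl_word (s # m))"
      using e s Cons.prems(2) by (auto simp: g cl_Vtx cl_Edg src_in F.m_assoc)
    then show ?thesis using m s by (intro exI[of _ "s # m"]) auto
  qed
qed simp

lemma cl_closed_path:
  assumes "syl_path u S w" shows "cl (syl_word S) \<in> carrier (path_group \<Gamma>)"
  using assms by (auto dest: syl_path_words)

lemma cl_syl_word_Cons: "syl_path (tgt \<Gamma> e) S w \<Longrightarrow> e \<in> edges \<Gamma> \<Longrightarrow>
    cl (syl_word ((a, e) # S)) = V (src \<Gamma> e) a \<cdot> E e \<cdot> cl (syl_word S)"
  by (simp add: cl_Vtx cl_Edg src_in syl_path_words F.m_assoc cl_closed_path)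

lemma V_solve:
  assumes "v \<in> verts \<Gamma>" "g \<in> carrier (path_group \<Gamma>)" "g \<cdot> V v a = V v b"
  shows "g = V v (b - a)"
proof -
  have "g = g \<cdot> V v a \<cdot> V v (- a)" using assms(1,2) by (simp add: F.m_assoc V_add V_zero)
  also have "\<dots> = V v (b - a)" using assms by (simp add: V_add)
  finally show ?thesis .
qed

text \<open>The first syllable crosses the tree edge. At a second crossing the two positions lie in
  the same edge coset, so the piece in between closes up to a vertex group element: with the first
  edge included if the directions agree, without it if they are opposite.\<close>

lemma later_crossing:
  assumes p: "syl_path u ((a, e) # m) (src \<Gamma> e')" and e': "e' \<in> edges \<Gamma>"
    and c: "crossing (edge_coset (V u a) e) e e' (cl (syl_word ((a, e) # m)) \<cdot> V (src \<Gamma> e') a')"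
  shows "(\<exists>x. e' = e \<and> cl (syl_word ((a, e) # m)) = V u x) \<or>
    (\<exists>z. e' = opp \<Gamma> e \<and> cl (syl_word m) = V (tgt \<Gamma> e) (lab_tgt \<Gamma> e *v z - a'))"
proof -
  have u: "u = src \<Gamma> e" and e: "e \<in> edges \<Gamma>" and m: "syl_path (tgt \<Gamma> e) m (src \<Gamma> e')" using p by auto
  note C = cl_closed_path[OF p] cl_closed_path[OF m] src_in[OF e] src_in[OF e'] tgt_in[OF e]
  let ?g = "cl (syl_word ((a, e) # m)) \<cdot> V (src \<Gamma> e') a'"
  have g: "?g = V u a \<cdot> E e \<cdot> (cl (syl_word m) \<cdot> V (src \<Gamma> e') a')"
    using cl_syl_word_Cons[OF m e, of a] C u e by (simp add: F.m_assoc)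
  from c consider "e' = e" "?g \<in> edge_coset (V u a) e"
    | "e' = opp \<Gamma> e" "?g \<cdot> E e' \<in> edge_coset (V u a) e" by (auto simp: crossing_def)
  then show ?thesis
  proof cases
    case 1
    then obtain z where "?g = V u (a + lab_src \<Gamma> e *v z)" using u C by (auto simp: edge_coset_def V_add)
    then show ?thesis using V_solve[of u "cl (syl_word ((a, e) # m))" a'] 1 u C by auto
  next
    case 2
    then obtain z where z: "?g \<cdot> E e' = V u a \<cdot> V u (lab_src \<Gamma> e *v z)" using u by (auto simp: edge_coset_def)
    let ?h = "cl (syl_word m) \<cdot> V (tgt \<Gamma> e) a'"
    have s: "src \<Gamma> e' = tgt \<Gamma> e" using 2 e src_opp by simp
    have h: "?h \<in> carrier (path_group \<Gamma>)" using C by simp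
    have "V u a \<cdot> (E e \<cdot> ?h \<cdot> E e') = V u a \<cdot> V u (lab_src \<Gamma> e *v z)"
      using z g h C u e e' s by (simp add: F.m_assoc)
    then have "E e \<cdot> ?h \<cdot> E (opp \<Gamma> e) = V u (lab_src \<Gamma> e *v z)"
      using 2 h C u e e' by (simp add: F.m_assoc)
    then have "E (opp \<Gamma> e) \<cdot> (E e \<cdot> ?h \<cdot> E (opp \<Gamma> e)) \<cdot> E e = E (opp \<Gamma> e) \<cdot> V u (lab_src \<Gamma> e *v z) \<cdot> E e"
      by simp
    moreover have "E (opp \<Gamma> e) \<cdot> (E e \<cdot> ?h \<cdot> E (opp \<Gamma> e)) \<cdot> E e = ?h"
      using h e opp_in[OF e] E_opp'[OF e] by (simp add: F.m_assoc) (simp flip: F.m_assoc)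
    moreover have "E (opp \<Gamma> e) \<cdot> V u (lab_src \<Gamma> e *v z) \<cdot> E e = V (tgt \<Gamma> e) (lab_tgt \<Gamma> e *v z)"
      using e u C E_V'[OF e, of z] by (simp add: opp_in F.m_assoc E_opp')
    ultimately have "?h = V (tgt \<Gamma> e) (lab_tgt \<Gamma> e *v z)" by simp
    then show ?thesis using V_solve[of "tgt \<Gamma> e" "cl (syl_word m)" a'] 2 C by auto
  qed
qed

text \<open>This is the core of the normal form theorem for graphs of groups. A vertex element
  crosses no edge, so by parity the first edge of \<open>S\<close> is crossed again later. Between
  the crossings there is a shorter reduced path that equals a vertex element, unless the second
  crossing is an immediate backtrack, which \<open>no_backtrack\<close> forbids.\<close>

theorem reduced_not_vertex:
  assumes "syl_path u S w" "reduced_path S" "S \<noteq> []" "v \<in> verts \<Gamma>"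
  shows "cl (syl_word S) \<noteq> V v b"
  using assms
proof (induction "length S" arbitrary: u S w v b rule: less_induct)
  case less
  obtain a e t where S: "S = (a, e) # t" using less.prems(3) by (cases S) auto
  have u: "u = src \<Gamma> e" and e: "e \<in> edges \<Gamma>" and t: "syl_path (tgt \<Gamma> e) t w" using less.prems(1) S by auto
  have uv: "u \<in> verts \<Gamma>" using e u src_in by simp
  show ?case
  proof
    assume eq: "cl (syl_word S) = V v b"
    let ?B = "edge_coset (V u a) e" and ?p = "parity_act (edge_coset (V u a) e) e"
    note fs = letter_action_parity[OF V_closed[OF uv, of a] e]
    have "syl_word S \<in> words \<Gamma>" using syl_path_words less.prems by blast
    then have "(syl_word S, [Vtx v b]) \<in> word_cong \<Gamma>"
      using eq less.prems(4) by (simp add: V_def word_class_eq_iff)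
    then have "snd (run ?p (syl_word S) (\<one>\<^bsub>path_group \<Gamma>\<^esub>, False)) = False"
      using run_cong[OF fs, of "syl_word S" "[Vtx v b]" "(\<one>\<^bsub>path_group \<Gamma>\<^esub>, False)"] by simp
    moreover have "crossing ?B e e (V u a)"
      using uv u by (auto simp: crossing_def edge_coset_def V_add intro!: exI[of _ 0])
    ultimately have "snd (run ?p (syl_word t) (V u a \<cdot> E e, True)) \<noteq> True"
      using S u uv by simp
    then obtain m a' e' r where m: "t = m @ (a', e') # r"
      and c: "crossing ?B e e' (V u a \<cdot> E e \<cdot> cl (syl_word m) \<cdot> V (src \<Gamma> e') a')"
      using parity_crossing[OF t, of "(V u a \<cdot> E e, True)" ?B e] e uv by auto
    have pm: "syl_path u ((a, e) # m) (src \<Gamma> e')" and e': "e' \<in> edges \<Gamma>" and pm': "syl_path (tgt \<Gamma> e) m (src \<Gamma> e')"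
      using t m u e by (auto simp: syl_path_append)
    have rm: "reduced_path ((a, e) # m)" "reduced_path m" and j: "no_backtrack (last ((a,e) # m)) (a', e')"
      using less.prems(2) S m successively_append_iff[of no_backtrack "(a, e) # m" "(a', e') # r"] by (auto simp: successively_Cons)
    have "crossing ?B e e' (cl (syl_word ((a, e) # m)) \<cdot> V (src \<Gamma> e') a')"
      using c cl_syl_word_Cons[OF pm' e, of a] u by simp
    from later_crossing[OF pm e' this] show False
    proof (elim disjE exE conjE)
      fix x assume "cl (syl_word ((a, e) # m)) = V u x"
      then show False using less.hyps[of "(a, e) # m", OF _ pm rm(1) _ uv] S m by auto
    next
      fix z assume z: "e' = opp \<Gamma> e" "cl (syl_word m) = V (tgt \<Gamma> e) (lab_tgt \<Gamma> e *v z - a')"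
      show False
      proof (cases "m = []")
        case True
        then have "V (tgt \<Gamma> e) (lab_tgt \<Gamma> e *v z - a') = V (tgt \<Gamma> e) 0"
          using z e by (simp add: V_zero tgt_in cl_Nil)
        then have "a' = lab_tgt \<Gamma> e *v z" using e by (simp add: V_inj tgt_in)
        then show False using j True z by (auto simp: no_backtrack_def)
      next
        case False
        then show False using less.hyps[of m, OF _ pm' rm(2) _ tgt_in[OF e]] S m z by auto
      qed
    qed
  qed
qed

text \<open>The words \<open>x S a\<close> and \<open>S' a'\<close> agree after pushing vertex group elements to the right through the edges,
  starting with \<open>x\<close>.\<close>

fun slide :: "int ^ 'd \<Rightarrow> ((int ^ 'd) \<times> 'e) list \<Rightarrow> int ^ 'd \<Rightarrow> ((int ^ 'd) \<times> 'e) list \<Rightarrow> int ^ 'd \<Rightarrow> bool" where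
  "slide x [] a [] a' \<longleftrightarrow> a' = x + a"
| "slide x (s # S) a (s' # S') a' \<longleftrightarrow> snd s = snd s' \<and>
     (\<exists>z. lab_src \<Gamma> (snd s) *v z = x + fst s - fst s' \<and> slide (lab_tgt \<Gamma> (snd s) *v z) S a S' a')"
| "slide _ _ _ _ _ \<longleftrightarrow> False"

text \<open>The argument of \<open>reduced_not_vertex\<close> once more, now with that theorem in
  place of the induction: a reduced path never returns to the tree edge of its first
  syllable.\<close>

lemma no_later_crossing:
  assumes "syl_path u ((a, e) # t) w" "reduced_path ((a, e) # t)"
  shows "snd (run (parity_act (edge_coset (V u a) e) e) (syl_word t) (V u a \<cdot> E e, b)) = b"
proof (rule ccontr)
  let ?B = "edge_coset (V u a) e"
  assume ne: "\<not> ?thesis"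
  have u: "u = src \<Gamma> e" and e: "e \<in> edges \<Gamma>" and t: "syl_path (tgt \<Gamma> e) t w" using assms by auto
  have uv: "u \<in> verts \<Gamma>" using e u src_in by simp
  obtain m a' e' r where m: "t = m @ (a', e') # r"
    and c: "crossing ?B e e' (V u a \<cdot> E e \<cdot> cl (syl_word m) \<cdot> V (src \<Gamma> e') a')"
    using parity_crossing[OF t, of "(V u a \<cdot> E e, b)" ?B e] e uv ne by auto
  have pm: "syl_path u ((a, e) # m) (src \<Gamma> e')" and e': "e' \<in> edges \<Gamma>" and pm': "syl_path (tgt \<Gamma> e) m (src \<Gamma> e')"
    using t m u e by (auto simp: syl_path_append)
  have rm: "reduced_path ((a, e) # m)" "reduced_path m" and j: "no_backtrack (last ((a,e) # m)) (a', e')"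
    using assms(2) m successively_append_iff[of no_backtrack "(a, e) # m" "(a', e') # r"] by (auto simp: successively_Cons)
  have "crossing ?B e e' (cl (syl_word ((a, e) # m)) \<cdot> V (src \<Gamma> e') a')"
    using c cl_syl_word_Cons[OF pm' e, of a] u by simp
  from later_crossing[OF pm e' this] show False
  proof (elim disjE exE conjE)
    fix x assume "cl (syl_word ((a, e) # m)) = V u x"
    then show False using reduced_not_vertex[OF pm rm(1) _ uv] by auto
  next
    fix z assume z: "e' = opp \<Gamma> e" "cl (syl_word m) = V (tgt \<Gamma> e) (lab_tgt \<Gamma> e *v z - a')"
    then have "m = []" using reduced_not_vertex[OF pm' rm(2) _ tgt_in[OF e]] by auto
    then have "V (tgt \<Gamma> e) (lab_tgt \<Gamma> e *v z - a') = V (tgt \<Gamma> e) 0"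
      using z e by (simp add: V_zero tgt_in cl_Nil)
    then have "a' = lab_tgt \<Gamma> e *v z" using e by (simp add: V_inj tgt_in)
    then show False using j \<open>m = []\<close> z by (auto simp: no_backtrack_def)
  qed
qed

text \<open>Induction on \<open>S'\<close>. This path crosses its first edge exactly once, so by
  parity \<open>S\<close> crosses it too. Nothing can precede this crossing in \<open>S\<close>, so
  the first syllables agree up to an edge group element, which is handed over to the tails as the
  new \<open>x\<close>.\<close>

theorem reduced_unique:
  assumes "syl_path u S w" "reduced_path S" "syl_path u S' w" "reduced_path S'"
    and "V u x \<cdot> cl (syl_word S) \<cdot> V w a = cl (syl_word S') \<cdot> V w a'"
  shows "slide x S a S' a'"
  using assms
proof (induction S' arbitrary: u S x)
  case Nil
  have w: "w = u" "u \<in> verts \<Gamma>" using Nil.prems by auto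
  have C: "cl (syl_word S) \<in> carrier (path_group \<Gamma>)" using Nil.prems cl_closed_path by blast
  have eq: "V u x \<cdot> cl (syl_word S) \<cdot> V u a = V u a'" using Nil.prems w by (simp add: cl_Nil)
  then have "V u x \<cdot> cl (syl_word S) = V u (a' - a)" using w C by (intro V_solve) auto
  then have "V u (- x) \<cdot> (V u x \<cdot> cl (syl_word S)) = V u (- x + (a' - a))" using w by (simp add: V_add)
  then have "cl (syl_word S) = V u (- x + (a' - a))"
    using w C by (simp add: V_add V_zero flip: F.m_assoc)
  then have S: "S = []" using reduced_not_vertex[OF Nil.prems(1,2) _ w(2)] by auto
  then have "a' = x + a" using eq w by (simp add: V_add V_inj cl_Nil)
  then show ?case using S by simp
next
  case (Cons s' t')
  obtain a1' e' where s': "s' = (a1', e')" by (cases s')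
  have u: "u = src \<Gamma> e'" and e': "e' \<in> edges \<Gamma>" and t': "syl_path (tgt \<Gamma> e') t' w" using Cons.prems s' by auto
  have uv: "u \<in> verts \<Gamma>" using e' u src_in by simp
  have wv: "w \<in> verts \<Gamma>" using t' syl_path_verts by blast
  let ?B = "edge_coset (V u a1') e'" and ?p = "parity_act (edge_coset (V u a1') e') e'"
  note fs = letter_action_parity[OF V_closed[OF uv, of a1'] e']
  let ?W = "Vtx u x # syl_word S @ [Vtx w a]" and ?W' = "syl_word (s' # t') @ [Vtx w a']"
  have ww: "syl_word S \<in> words \<Gamma>" "syl_word (s' # t') \<in> words \<Gamma>" using Cons.prems syl_path_words by blast+
  then have "(?W, ?W') \<in> word_cong \<Gamma>"
    using Cons.prems(5) uv wv ww
    by (subst word_class_eq_iff[symmetric]) (auto simp: V_def mult_word_class)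
  then have "snd (run ?p ?W (\<one>\<^bsub>path_group \<Gamma>\<^esub>, False)) = snd (run ?p ?W' (\<one>\<^bsub>path_group \<Gamma>\<^esub>, False))"
    using run_cong[OF fs, of ?W ?W' "(\<one>\<^bsub>path_group \<Gamma>\<^esub>, False)"] by simp
  moreover have "snd (run ?p ?W' (\<one>\<^bsub>path_group \<Gamma>\<^esub>, False)) = True"
  proof -
    have "crossing ?B e' e' (V u a1')"
      using uv u by (auto simp: crossing_def edge_coset_def V_add intro!: exI[of _ 0])
    then show ?thesis
      using no_later_crossing[of u a1' e' t' w True] Cons.prems(3,4) s' u uv by simp
  qed
  ultimately have "snd (run ?p (syl_word S) (V u x, False)) \<noteq> False" using uv by simp
  then obtain m a1 e r where m: "S = m @ (a1, e) # r"
    and c: "crossing ?B e' e (V u x \<cdot> cl (syl_word m) \<cdot> V (src \<Gamma> e) a1)"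
    using parity_crossing[OF Cons.prems(1), of "(V u x, False)" ?B e'] uv by auto
  have pm: "syl_path u m (src \<Gamma> e)" and e: "e \<in> edges \<Gamma>" and r: "syl_path (tgt \<Gamma> e) r w"
    using Cons.prems(1) m by (auto simp: syl_path_append)
  have rm: "reduced_path m" "reduced_path (m @ [(a1, e)])" "reduced_path r"
    using Cons.prems(2) m by (auto simp: successively_append_iff successively_Cons)
  note C = cl_closed_path[OF pm] src_in[OF e]
  \<comment> \<open>If the directions agree, \<open>m\<close> itself would be a vertex element; if
    they are opposite, \<open>m\<close> together with the crossing syllable would be one.\<close>
  have "m = [] \<and> e = e' \<and> (\<exists>z. x + a1 = a1' + lab_src \<Gamma> e *v z)"
    using c[unfolded crossing_def]
  proof (elim disjE conjE)
    assume e: "e = e'" and "V u x \<cdot> cl (syl_word m) \<cdot> V (src \<Gamma> e) a1 \<in> ?B"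
    then obtain z where z: "V u x \<cdot> cl (syl_word m) \<cdot> V u a1 = V u (a1' + lab_src \<Gamma> e *v z)"
      using u uv by (auto simp: edge_coset_def V_add)
    then have "V u x \<cdot> cl (syl_word m) = V u (a1' + lab_src \<Gamma> e *v z - a1)"
      using uv C by (intro V_solve) auto
    then have "V u (- x) \<cdot> (V u x \<cdot> cl (syl_word m)) = V u (- x + (a1' + lab_src \<Gamma> e *v z - a1))"
      using uv by (simp add: V_add)
    then have "cl (syl_word m) = V u (- x + (a1' + lab_src \<Gamma> e *v z - a1))"
      using uv C by (simp add: V_add V_zero flip: F.m_assoc)
    then have "m = []" using reduced_not_vertex[OF pm rm(1) _ uv] by auto
    then show ?thesis using e z uv by (auto simp: V_add V_inj cl_Nil)
  next
    assume eo: "e = opp \<Gamma> e'" and "V u x \<cdot> cl (syl_word m) \<cdot> V (src \<Gamma> e) a1 \<cdot> E e \<in> ?B"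
    then obtain y where "V u x \<cdot> (cl (syl_word m) \<cdot> V (src \<Gamma> e) a1 \<cdot> E e) = V u y"
      using u uv C e by (auto simp: edge_coset_def V_add F.m_assoc)
    then have "V u (- x) \<cdot> (V u x \<cdot> (cl (syl_word m) \<cdot> V (src \<Gamma> e) a1 \<cdot> E e)) = V u (- x + y)"
      using uv by (simp add: V_add)
    then have "cl (syl_word m) \<cdot> V (src \<Gamma> e) a1 \<cdot> E e = V u (- x + y)"
      using uv C e by (simp add: V_add V_zero flip: F.m_assoc)
    moreover have "cl (syl_word (m @ [(a1, e)])) = cl (syl_word m) \<cdot> V (src \<Gamma> e) a1 \<cdot> E e"
      using syl_path_words[OF pm] C e by (simp add: cl_append cl_Vtx cl_Edg cl_Nil F.m_assoc)
    moreover have "syl_path u (m @ [(a1, e)]) (tgt \<Gamma> e)" using pm e by (auto simp: syl_path_append tgt_in)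
    ultimately show ?thesis using reduced_not_vertex[OF _ rm(2) _ uv, of u "tgt \<Gamma> e" "- x + y"] by auto
  qed
  then obtain z where m0: "m = []" "e = e'" and z: "x + a1 = a1' + lab_src \<Gamma> e *v z" by auto
  have S: "S = (a1, e) # r" using m m0 by simp
  have rc: "cl (syl_word r) \<in> carrier (path_group \<Gamma>)" "cl (syl_word t') \<in> carrier (path_group \<Gamma>)"
    using r t' cl_closed_path by auto
  have "V u x \<cdot> cl (syl_word S) \<cdot> V w a = V u x \<cdot> V u a1 \<cdot> E e \<cdot> cl (syl_word r) \<cdot> V w a"
    using cl_syl_word_Cons[OF r e, of a1] S rc uv wv u m0 e by (simp add: F.m_assoc)
  also have "V u x \<cdot> V u a1 \<cdot> E e = V u a1' \<cdot> (V u (lab_src \<Gamma> e *v z) \<cdot> E e)"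
    using uv e z by (simp add: V_add flip: F.m_assoc)
  also have "\<dots> = V u a1' \<cdot> E e \<cdot> V (tgt \<Gamma> e) (lab_tgt \<Gamma> e *v z)"
    using uv e E_V[OF e, of z] u m0 by (simp add: F.m_assoc tgt_in)
  finally have 1: "V u x \<cdot> cl (syl_word S) \<cdot> V w a =
    V u a1' \<cdot> E e \<cdot> (V (tgt \<Gamma> e) (lab_tgt \<Gamma> e *v z) \<cdot> cl (syl_word r) \<cdot> V w a)"
    using uv e rc wv by (simp add: F.m_assoc tgt_in)
  have "cl (syl_word (s' # t')) \<cdot> V w a' = V u a1' \<cdot> E e \<cdot> (cl (syl_word t') \<cdot> V w a')"
    using cl_syl_word_Cons[OF t' e', of a1'] s' rc uv wv u m0 e by (simp add: F.m_assoc)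
  then have "V (tgt \<Gamma> e) (lab_tgt \<Gamma> e *v z) \<cdot> cl (syl_word r) \<cdot> V w a = cl (syl_word t') \<cdot> V w a'"
    using 1 Cons.prems(5) uv e rc wv F.Units_l_cancel[of "V u a1' \<cdot> E e"] by (simp add: tgt_in)
  then have "slide (lab_tgt \<Gamma> e *v z) r a t' a'"
    using Cons.IH[of "tgt \<Gamma> e" r] r t' rm m0 Cons.prems(4) by (auto simp: successively_Cons)
  moreover have "lab_src \<Gamma> e *v z = x + a1 - a1'" using z by (simp add: algebra_simps)
  ultimately show ?case using S s' m0 by auto
qed

section \<open>Cutting and regluing an action along edges\<close>

definition edge_stab_act :: "(('v, 'e, 'd) letter \<Rightarrow> 'x \<Rightarrow> 'x) \<Rightarrow> 'e \<Rightarrow> int ^ 'd \<Rightarrow> 'x \<Rightarrow> 'x" where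
  "edge_stab_act act e z = act (Vtx (src \<Gamma> e) (lab_src \<Gamma> e *v z))"

text \<open>In the coset space of a subgroup \<open>K\<close>, the orbit of \<open>K g\<close>
  corresponds to the double coset of \<open>g\<close> modulo \<open>K\<close> and the edge group,
  hence to an edge over \<open>e\<close> of the quotient graph.\<close>

definition edge_orbit :: "(('v, 'e, 'd) letter \<Rightarrow> 'x \<Rightarrow> 'x) \<Rightarrow> 'e \<Rightarrow> 'x \<Rightarrow> 'x set" where
  "edge_orbit act e x = range (\<lambda>z. edge_stab_act act e z x)"

text \<open>The choice of \<open>z\<close> is immaterial as soon as \<open>x\<close> and \<open>y\<close> have the same stabilizer in the edge group.\<close>

definition exchange :: "(('v, 'e, 'd) letter \<Rightarrow> 'x \<Rightarrow> 'x) \<Rightarrow> 'e \<Rightarrow> 'x \<Rightarrow> 'x \<Rightarrow> 'x \<Rightarrow> 'x" where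
  "exchange act e x y p =
     (if p \<in> edge_orbit act e x then edge_stab_act act e (SOME z. p = edge_stab_act act e z x) y
      else if p \<in> edge_orbit act e y then edge_stab_act act e (SOME z. p = edge_stab_act act e z y) x
      else p)"

text \<open>Putting the same involution before \<open>e\<close> and after \<open>opp e\<close> keeps
  the two letters inverse to each other, and the edge relation survives because the involution
  commutes with the edge group. Geometrically, two edges over \<open>e\<close> exchange their
  targets.\<close>

primrec swap :: "(('v, 'e, 'd) letter \<Rightarrow> 'x \<Rightarrow> 'x) \<Rightarrow> 'e \<Rightarrow> 'x \<Rightarrow> 'x \<Rightarrow> ('v, 'e, 'd) letter \<Rightarrow> 'x \<Rightarrow> 'x" where
  "swap act e x y (Vtx v a) p = act (Vtx v a) p"
| "swap act e x y (Edg e') p =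
     (if e' = e then act (Edg e') (exchange act e x y p)
      else if e' = opp \<Gamma> e then exchange act e x y (act (Edg e') p)
      else act (Edg e') p)"

context
  fixes X :: "'x set" and act e x y
  assumes fs: "letter_action X act" and e: "e \<in> edges \<Gamma>" and x: "x \<in> X" and y: "y \<in> X"
    and stab: "\<And>z. edge_stab_act act e z x = x \<longleftrightarrow> edge_stab_act act e z y = y"
    and disj: "y \<notin> edge_orbit act e x"
begin

lemma stab_act_closed: "p \<in> X \<Longrightarrow> edge_stab_act act e z p \<in> X"
  unfolding edge_stab_act_def using letter_actionD(2)[OF fs src_in[OF e]] by blast

lemma stab_act_add: "p \<in> X \<Longrightarrow> edge_stab_act act e z (edge_stab_act act e z' p) = edge_stab_act act e (z' + z) p"
  unfolding edge_stab_act_def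
  by (simp add: letter_actionD(5)[OF fs src_in[OF e]] matrix_vector_right_distrib)

lemma stab_act_zero: "p \<in> X \<Longrightarrow> edge_stab_act act e 0 p = p"
  unfolding edge_stab_act_def by (simp add: letter_actionD(4)[OF fs src_in[OF e]])

lemma stab_act_eq: "p \<in> X \<Longrightarrow> edge_stab_act act e z p = edge_stab_act act e z' p \<longleftrightarrow> edge_stab_act act e (z - z') p = p"
proof
  assume p: "p \<in> X" and "edge_stab_act act e z p = edge_stab_act act e z' p"
  then have "edge_stab_act act e (- z') (edge_stab_act act e z p) = edge_stab_act act e (- z') (edge_stab_act act e z' p)" by simp
  then show "edge_stab_act act e (z - z') p = p" using p by (simp add: stab_act_add stab_act_zero)
next
  assume p: "p \<in> X" and "edge_stab_act act e (z - z') p = p"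
  then have "edge_stab_act act e z' (edge_stab_act act e (z - z') p) = edge_stab_act act e z' p" by simp
  then show "edge_stab_act act e z p = edge_stab_act act e z' p" using p by (simp add: stab_act_add)
qed

lemma orbits_disjoint: "edge_stab_act act e z y \<noteq> edge_stab_act act e z' x"
proof
  assume "edge_stab_act act e z y = edge_stab_act act e z' x"
  then have "edge_stab_act act e (- z) (edge_stab_act act e z y) = edge_stab_act act e (- z) (edge_stab_act act e z' x)" by simp
  then have "y = edge_stab_act act e (z' - z) x" using x y by (simp add: stab_act_add stab_act_zero)
  then show False using disj unfolding edge_orbit_def by blast
qed

lemma exchange_simps:
  "exchange act e x y (edge_stab_act act e z x) = edge_stab_act act e z y"
  "exchange act e x y (edge_stab_act act e z y) = edge_stab_act act e z x"
  "p \<notin> edge_orbit act e x \<Longrightarrow> p \<notin> edge_orbit act e y \<Longrightarrow> exchange act e x y p = p"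
proof -
  have transfer: "edge_stab_act act e z x = edge_stab_act act e z' x \<longleftrightarrow>
      edge_stab_act act e z y = edge_stab_act act e z' y" for z z'
    using stab[of "z - z'"] x y by (simp add: stab_act_eq[of x z z'] stab_act_eq[of y z z'])
  have "edge_stab_act act e z x = edge_stab_act act e (SOME z'. edge_stab_act act e z x = edge_stab_act act e z' x) x"
    by (rule someI) simp
  then show "exchange act e x y (edge_stab_act act e z x) = edge_stab_act act e z y"
    unfolding exchange_def edge_orbit_def transfer by auto
  have "edge_stab_act act e z y = edge_stab_act act e (SOME z'. edge_stab_act act e z y = edge_stab_act act e z' y) y"
    by (rule someI) simp
  then show "exchange act e x y (edge_stab_act act e z y) = edge_stab_act act e z x"
    unfolding exchange_def edge_orbit_def transfer[symmetric] using orbits_disjoint by auto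
qed (simp add: exchange_def)

lemma exchange_cases:
  obtains z where "p = edge_stab_act act e z x" | z where "p = edge_stab_act act e z y"
  | "p \<notin> edge_orbit act e x" "p \<notin> edge_orbit act e y"
  unfolding edge_orbit_def by blast

lemma exchange_closed: "p \<in> X \<Longrightarrow> exchange act e x y p \<in> X"
  by (rule exchange_cases[of p]) (auto simp: exchange_simps stab_act_closed x y)

lemma exchange_exchange: "exchange act e x y (exchange act e x y p) = p"
  by (rule exchange_cases[of p]) (auto simp: exchange_simps)

lemma exchange_stab_act:
  assumes p: "p \<in> X"
  shows "exchange act e x y (edge_stab_act act e z p) = edge_stab_act act e z (exchange act e x y p)"
proof (rule exchange_cases[of p])
  assume n: "p \<notin> edge_orbit act e x" "p \<notin> edge_orbit act e y"
  have "edge_stab_act act e z p \<notin> edge_orbit act e q" if "q \<in> X" "p \<notin> edge_orbit act e q" for q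
  proof
    assume "edge_stab_act act e z p \<in> edge_orbit act e q"
    then obtain z' where "edge_stab_act act e z p = edge_stab_act act e z' q" unfolding edge_orbit_def by blast
    then have "edge_stab_act act e (- z) (edge_stab_act act e z p) = edge_stab_act act e (- z) (edge_stab_act act e z' q)" by simp
    then show False using that p unfolding edge_orbit_def by (auto simp: stab_act_add stab_act_zero)
  qed
  then show ?thesis using n x y by (simp add: exchange_simps)
qed (auto simp: stab_act_add x y exchange_simps)

lemma letter_action_swap: "letter_action X (swap act e x y)"
  unfolding letter_action_def
proof (intro conjI ballI allI impI)
  fix l p assume "[l] \<in> words \<Gamma>" "p \<in> X"
  then show "swap act e x y l p \<in> X"
    by (cases l) (auto intro: letter_actionD[OF fs] exchange_closed)
next
  fix \<epsilon> p assume "\<epsilon> \<in> edges \<Gamma>" "p \<in> X"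
  then show "swap act e x y (Edg (opp \<Gamma> \<epsilon>)) (swap act e x y (Edg \<epsilon>) p) = p"
    using e opp_opp[of \<epsilon>] opp_opp[OF e] opp_neq[OF e] opp_neq[of \<epsilon>]
    by (auto simp: letter_actionD[OF fs] exchange_closed exchange_exchange)
next
  fix \<epsilon> p z assume \<epsilon>: "\<epsilon> \<in> edges \<Gamma>" and p: "p \<in> X"
  let ?s = "act (Vtx (src \<Gamma> \<epsilon>) (lab_src \<Gamma> \<epsilon> *v z))" and ?t = "act (Vtx (tgt \<Gamma> \<epsilon>) (lab_tgt \<Gamma> \<epsilon> *v z))"
  have 1: "?t (act (Edg \<epsilon>) r) = act (Edg \<epsilon>) (?s r)" if "r \<in> X" for r using letter_actionD(8)[OF fs \<epsilon> that] .
  have "?t (exchange act e x y r) = exchange act e x y (?t r)" if "\<epsilon> = opp \<Gamma> e" "r \<in> X" for r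
    using exchange_stab_act[of r z] that e by (simp add: edge_stab_act_def tgt_opp lab_tgt_opp)
  moreover have "?s (exchange act e x y p) = exchange act e x y (?s p)" if "\<epsilon> = e"
    using exchange_stab_act[of p z] that p e by (simp add: edge_stab_act_def)
  ultimately show "swap act e x y (Vtx (tgt \<Gamma> \<epsilon>) (lab_tgt \<Gamma> \<epsilon> *v z)) (swap act e x y (Edg \<epsilon>) p) =
      swap act e x y (Edg \<epsilon>) (swap act e x y (Vtx (src \<Gamma> \<epsilon>) (lab_src \<Gamma> \<epsilon> *v z)) p)"
    using 1 p \<epsilon> by (auto simp: exchange_closed letter_actionD[OF fs])
qed (use letter_actionD[OF fs] in auto)

lemma swap_Edg: "swap act e x y (Edg e) x = act (Edg e) y"
  using exchange_simps(1)[of 0] x y by (simp add: stab_act_zero)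

end

lemma swap_other:
  assumes "\<epsilon> = e \<Longrightarrow> p \<notin> edge_orbit act e x \<and> p \<notin> edge_orbit act e y"
    and "\<epsilon> = opp \<Gamma> e \<Longrightarrow> act (Edg \<epsilon>) p \<notin> edge_orbit act e x \<and> act (Edg \<epsilon>) p \<notin> edge_orbit act e y"
  shows "swap act e x y (Edg \<epsilon>) p = act (Edg \<epsilon>) p"
  using assms by (auto simp: exchange_def)

text \<open>Vertex letters are untouched by a swap. The orbits and stabilizers needed for a second
  swap can therefore be computed in the original action.\<close>

lemma edge_stab_act_swap [simp]: "edge_stab_act (swap act e x y) e' = edge_stab_act act e'"
  by (auto simp: edge_stab_act_def fun_eq_iff)

lemma edge_orbit_swap [simp]: "edge_orbit (swap act e x y) e' = edge_orbit act e'"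
  by (auto simp: edge_orbit_def fun_eq_iff)

subsection \<open>Coset spaces\<close>

primrec coset_act :: "('v, 'e, 'd) letter \<Rightarrow> 'i \<times> ('v, 'e, 'd) word set set \<Rightarrow> 'i \<times> ('v, 'e, 'd) word set set" where
  "coset_act (Vtx v a) p = (fst p, snd p #>\<^bsub>path_group \<Gamma>\<^esub> V v a)"
| "coset_act (Edg e) p = (fst p, snd p #>\<^bsub>path_group \<Gamma>\<^esub> E e)"

declare coset_act.simps [simp del]

text \<open>The index is a tag that keeps the copies in a disjoint union of coset spaces apart, even
  where the subgroups or cosets coincide.\<close>

definition coset_pt :: "('i \<Rightarrow> ('v, 'e, 'd) word set set) \<Rightarrow> 'i \<Rightarrow> ('v, 'e, 'd) word set \<Rightarrow> 'i \<times> ('v, 'e, 'd) word set set" where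
  "coset_pt K i g = (i, K i #>\<^bsub>path_group \<Gamma>\<^esub> g)"

text \<open>All elements of the path group occur, not only classes of paths from a base point, so
  that every letter acts at every point.\<close>

definition coset_space :: "('i \<Rightarrow> ('v, 'e, 'd) word set set) \<Rightarrow> ('i \<times> ('v, 'e, 'd) word set set) set" where
  "coset_space K = {coset_pt K i g | i g. g \<in> carrier (path_group \<Gamma>)}"

text \<open>The analogue of \<open>crossing\<close> modulo \<open>K\<close>: the letter
  \<open>e\<close>, read at the coset of \<open>h\<close>, crosses the image of a tree edge in the
  quotient by \<open>K\<close>.\<close>

definition crosses :: "('v, 'e, 'd) word set set \<Rightarrow> ('v, 'e, 'd) word set \<Rightarrow> 'e \<Rightarrow> 'e \<Rightarrow> ('v, 'e, 'd) word set \<Rightarrow> bool" where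
  "crosses K g\<^sub>0 e\<^sub>0 e h \<longleftrightarrow>
     (\<exists>k\<in>K. \<exists>z. e = e\<^sub>0 \<and> h = k \<cdot> g\<^sub>0 \<cdot> V (src \<Gamma> e\<^sub>0) (lab_src \<Gamma> e\<^sub>0 *v z) \<or>
       e = opp \<Gamma> e\<^sub>0 \<and> h \<cdot> E e = k \<cdot> g\<^sub>0 \<cdot> V (src \<Gamma> e\<^sub>0) (lab_src \<Gamma> e\<^sub>0 *v z))"

definition clear :: "('v, 'e, 'd) word set set \<Rightarrow> ('v, 'e, 'd) word set \<Rightarrow> 'e \<Rightarrow> ('v, 'e, 'd) word \<Rightarrow> ('v, 'e, 'd) word set \<Rightarrow> bool" where
  "clear K g\<^sub>0 e\<^sub>0 w h \<longleftrightarrow> (\<forall>u e r. w = u @ Edg e # r \<longrightarrow> \<not> crosses K g\<^sub>0 e\<^sub>0 e (h \<cdot> cl u))"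

text \<open>An edge and its reverse are crossed by the same letters. This is used for an edge that
  is reached from its far end.\<close>

lemma crosses_opp:
  assumes "K \<subseteq> carrier (path_group \<Gamma>)" "g\<^sub>0 \<in> carrier (path_group \<Gamma>)" "h \<in> carrier (path_group \<Gamma>)"
    and e\<^sub>0: "e\<^sub>0 \<in> edges \<Gamma>" and "crosses K (g\<^sub>0 \<cdot> E e\<^sub>0) (opp \<Gamma> e\<^sub>0) e h"
  shows "crosses K g\<^sub>0 e\<^sub>0 e h"
proof -
  let ?A = "\<lambda>z. V (src \<Gamma> e\<^sub>0) (lab_src \<Gamma> e\<^sub>0 *v z)" and ?B = "\<lambda>z. V (tgt \<Gamma> e\<^sub>0) (lab_tgt \<Gamma> e\<^sub>0 *v z)"
  obtain k z where k: "k \<in> K" and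
    "e = opp \<Gamma> e\<^sub>0 \<and> h = k \<cdot> (g\<^sub>0 \<cdot> E e\<^sub>0) \<cdot> ?B z \<or> e = e\<^sub>0 \<and> h \<cdot> E e = k \<cdot> (g\<^sub>0 \<cdot> E e\<^sub>0) \<cdot> ?B z"
    using assms by (auto simp: crosses_def opp_opp src_opp lab_src_opp)
  moreover have kc: "k \<in> carrier (path_group \<Gamma>)" using k assms by auto
  moreover have "k \<cdot> (g\<^sub>0 \<cdot> E e\<^sub>0) \<cdot> ?B z = k \<cdot> g\<^sub>0 \<cdot> ?A z \<cdot> E e\<^sub>0"
    using e\<^sub>0 kc assms(2) by (simp add: F.m_assoc E_V src_in tgt_in)
  ultimately consider "e = opp \<Gamma> e\<^sub>0" "h = k \<cdot> g\<^sub>0 \<cdot> ?A z \<cdot> E e\<^sub>0"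
    | "e = e\<^sub>0" "h \<cdot> E e\<^sub>0 = k \<cdot> g\<^sub>0 \<cdot> ?A z \<cdot> E e\<^sub>0" by auto
  then show ?thesis
  proof cases
    case 1
    then have "h \<cdot> E e = k \<cdot> g\<^sub>0 \<cdot> ?A z"
      using e\<^sub>0 kc assms(2) by (simp add: F.m_assoc E_opp src_in opp_in)
    then show ?thesis using 1 k unfolding crosses_def by blast
  next
    case 2
    then have "h \<cdot> E e\<^sub>0 \<cdot> E (opp \<Gamma> e\<^sub>0) = k \<cdot> g\<^sub>0 \<cdot> ?A z \<cdot> E e\<^sub>0 \<cdot> E (opp \<Gamma> e\<^sub>0)" by simp
    then have "h = k \<cdot> g\<^sub>0 \<cdot> ?A z"
      using e\<^sub>0 kc assms(2,3) by (simp add: F.m_assoc E_opp src_in opp_in)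
    then show ?thesis using 2 k unfolding crosses_def by blast
  qed
qed

context
  fixes K :: "'i \<Rightarrow> ('v, 'e, 'd) word set set"
  assumes K: "\<And>i. subgroup (K i) (path_group \<Gamma>)"
begin

lemma K_sub: "K i \<subseteq> carrier (path_group \<Gamma>)"
  using subgroup.subset[OF K] .

lemma coset_pt_closed [simp, intro]: "g \<in> carrier (path_group \<Gamma>) \<Longrightarrow> coset_pt K i g \<in> coset_space K"
  by (auto simp: coset_space_def)

lemma coset_act_coset_pt:
  "g \<in> carrier (path_group \<Gamma>) \<Longrightarrow> v \<in> verts \<Gamma> \<Longrightarrow> coset_act (Vtx v a) (coset_pt K i g) = coset_pt K i (g \<cdot> V v a)"
  "g \<in> carrier (path_group \<Gamma>) \<Longrightarrow> e \<in> edges \<Gamma> \<Longrightarrow> coset_act (Edg e) (coset_pt K i g) = coset_pt K i (g \<cdot> E e)"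
  by (simp_all add: coset_pt_def coset_act.simps F.coset_mult_assoc K_sub)

lemma letter_action_coset: "letter_action (coset_space K) coset_act"
  unfolding letter_action_def
proof (intro conjI ballI allI impI)
  fix l p assume l: "[l] \<in> words \<Gamma>" and "p \<in> coset_space K"
  then obtain i g where "p = coset_pt K i g" "g \<in> carrier (path_group \<Gamma>)" by (auto simp: coset_space_def)
  then show "coset_act l p \<in> coset_space K" using l by (cases l) (auto simp: coset_act_coset_pt)
qed (auto simp: coset_space_def coset_act_coset_pt V_zero F.m_assoc V_add E_opp E_V src_in tgt_in opp_in)

lemma coset_pt_eq_iff:
  assumes "g \<in> carrier (path_group \<Gamma>)" "h \<in> carrier (path_group \<Gamma>)"
  shows "coset_pt K i g = coset_pt K j h \<longleftrightarrow> i = j \<and> (\<exists>k\<in>K i. g = k \<cdot> h)"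
proof
  assume "coset_pt K i g = coset_pt K j h"
  then have ij: "i = j" "K i #>\<^bsub>path_group \<Gamma>\<^esub> g = K i #>\<^bsub>path_group \<Gamma>\<^esub> h" by (auto simp: coset_pt_def)
  have "g \<in> K i #>\<^bsub>path_group \<Gamma>\<^esub> h" using F.rcos_self[OF assms(1) K, of i] ij(2) by simp
  then show "i = j \<and> (\<exists>k\<in>K i. g = k \<cdot> h)" using ij by (auto simp: r_coset_def)
next
  assume "i = j \<and> (\<exists>k\<in>K i. g = k \<cdot> h)"
  then show "coset_pt K i g = coset_pt K j h" using assms F.repr_independence[of g "K i" h, OF _ assms(2) K]
    by (auto simp: coset_pt_def r_coset_def)
qed

lemma edge_stab_act_coset_pt: "e \<in> edges \<Gamma> \<Longrightarrow> g \<in> carrier (path_group \<Gamma>) \<Longrightarrow>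
    edge_stab_act coset_act e z (coset_pt K i g) = coset_pt K i (g \<cdot> V (src \<Gamma> e) (lab_src \<Gamma> e *v z))"
  by (simp add: edge_stab_act_def coset_act_coset_pt(1) src_in)

lemma coset_pt_orbit_iff:
  assumes "e \<in> edges \<Gamma>" "g \<in> carrier (path_group \<Gamma>)" "h \<in> carrier (path_group \<Gamma>)"
  shows "coset_pt K i h \<in> edge_orbit coset_act e (coset_pt K j g) \<longleftrightarrow>
    i = j \<and> (\<exists>k\<in>K i. \<exists>z. h = k \<cdot> g \<cdot> V (src \<Gamma> e) (lab_src \<Gamma> e *v z))"
proof -
  have "coset_pt K i h \<in> edge_orbit coset_act e (coset_pt K j g) \<longleftrightarrow>
    (\<exists>z. coset_pt K i h = coset_pt K j (g \<cdot> V (src \<Gamma> e) (lab_src \<Gamma> e *v z)))"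
    using assms by (auto simp: edge_orbit_def edge_stab_act_coset_pt)
  also have "\<dots> \<longleftrightarrow> i = j \<and> (\<exists>k\<in>K i. \<exists>z. h = k \<cdot> (g \<cdot> V (src \<Gamma> e) (lab_src \<Gamma> e *v z)))"
    using assms by (auto simp: coset_pt_eq_iff src_in)
  also have "\<dots> \<longleftrightarrow> i = j \<and> (\<exists>k\<in>K i. \<exists>z. h = k \<cdot> g \<cdot> V (src \<Gamma> e) (lab_src \<Gamma> e *v z))"
    using assms K_sub[of i] by (intro conj_cong refl bex_cong ex_cong1) (auto simp: F.m_assoc src_in)
  finally show ?thesis .
qed

text \<open>The action \<open>act\<close> only has to have the right value at this point and the
  edge orbits of \<open>coset_act\<close>, so the lemma applies to a swap of a swap as well.\<close>

lemma swap_coset_pt: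
  assumes "e \<in> edges \<Gamma>" "g \<in> carrier (path_group \<Gamma>)" "g' \<in> carrier (path_group \<Gamma>)"
    and "\<epsilon> \<in> edges \<Gamma>" "h \<in> carrier (path_group \<Gamma>)"
    and same: "act (Edg \<epsilon>) (coset_pt K i h) = coset_pt K i (h \<cdot> E \<epsilon>)"
    and orb: "edge_orbit act e = edge_orbit coset_act e"
    and "i = j \<Longrightarrow> \<not> crosses (K i) g e \<epsilon> h" "i = j' \<Longrightarrow> \<not> crosses (K i) g' e \<epsilon> h"
  shows "swap act e (coset_pt K j g) (coset_pt K j' g') (Edg \<epsilon>) (coset_pt K i h) = coset_pt K i (h \<cdot> E \<epsilon>)"
proof -
  have "swap act e (coset_pt K j g) (coset_pt K j' g') (Edg \<epsilon>) (coset_pt K i h) = act (Edg \<epsilon>) (coset_pt K i h)"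
  proof (rule swap_other)
    assume "\<epsilon> = e"
    then show "coset_pt K i h \<notin> edge_orbit act e (coset_pt K j g) \<and> coset_pt K i h \<notin> edge_orbit act e (coset_pt K j' g')"
      using assms unfolding orb by (auto simp: coset_pt_orbit_iff crosses_def)
  next
    assume "\<epsilon> = opp \<Gamma> e"
    then show "act (Edg \<epsilon>) (coset_pt K i h) \<notin> edge_orbit act e (coset_pt K j g) \<and> act (Edg \<epsilon>) (coset_pt K i h) \<notin> edge_orbit act e (coset_pt K j' g')"
      using assms unfolding orb same by (auto simp: coset_pt_orbit_iff crosses_def)
  qed
  then show ?thesis using same by simp
qed

lemma run_clear:
  assumes "\<And>u e r. w = u @ Edg e # r \<Longrightarrow> act (Edg e) (coset_pt K i (h \<cdot> cl u)) = coset_pt K i (h \<cdot> cl u \<cdot> E e)"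
    and "\<And>v a p. act (Vtx v a) p = coset_act (Vtx v a) p"
    and "w \<in> words \<Gamma>" "h \<in> carrier (path_group \<Gamma>)"
  shows "run act w (coset_pt K i h) = coset_pt K i (h \<cdot> cl w)"
  using assms(1,3,4)
proof (induction w arbitrary: h)
  case Nil
  then show ?case by (simp add: cl_Nil)
next
  case (Cons l w)
  have lw: "[l] \<in> words \<Gamma>" "w \<in> words \<Gamma>" using words_ConsD[OF Cons.prems(2)] by auto
  have step: "act l (coset_pt K i h) = coset_pt K i (h \<cdot> cl [l])"
  proof (cases l)
    case (Vtx v a)
    then show ?thesis using lw Cons.prems(3) by (simp add: assms(2) coset_act_coset_pt(1) V_def)
  next
    case (Edg e)
    then show ?thesis using Cons.prems(1)[of "[]" e w] Cons.prems(3) lw by (simp add: cl_Nil E_def)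
  qed
  have "run act w (coset_pt K i (h \<cdot> cl [l])) = coset_pt K i (h \<cdot> cl [l] \<cdot> cl w)"
  proof (rule Cons.IH)
    fix u e r assume w: "w = u @ Edg e # r"
    then have "cl (l # u) = cl [l] \<cdot> cl u" using lw cl_append[of "[l]" u] by simp
    then show "act (Edg e) (coset_pt K i (h \<cdot> cl [l] \<cdot> cl u)) = coset_pt K i (h \<cdot> cl [l] \<cdot> cl u \<cdot> E e)"
      using Cons.prems(1)[of "l # u" e r] w Cons.prems(3) lw by (simp add: F.m_assoc)
  qed (use lw Cons.prems in auto)
  moreover have "cl (l # w) = cl [l] \<cdot> cl w" using lw cl_append[of "[l]" w] by simp
  ultimately show ?case using step Cons.prems lw by (simp add: F.m_assoc)
qed

end

section \<open>Point stabilizers as subgroups of the fundamental group\<close>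

definition stabilizer ::
  "(('v, 'e, 'd) letter \<Rightarrow> 'x \<Rightarrow> 'x) \<Rightarrow> 'x \<Rightarrow> 'v \<Rightarrow> ('v, 'e, 'd) word set set" where
  "stabilizer act x v\<^sub>0 = {cl w | w. path_word \<Gamma> v\<^sub>0 w v\<^sub>0 \<and> run act w x = x}"

lemma fundamental_group_simps:
  "carrier (fundamental_group \<Gamma> v\<^sub>0) = path_classes \<Gamma> v\<^sub>0 v\<^sub>0"
  "x \<otimes>\<^bsub>fundamental_group \<Gamma> v\<^sub>0\<^esub> y = x \<cdot> y"
  "\<one>\<^bsub>fundamental_group \<Gamma> v\<^sub>0\<^esub> = \<one>\<^bsub>path_group \<Gamma>\<^esub>"
  by (simp_all add: fundamental_group_def)

lemma path_classes_carrier: "path_classes \<Gamma> u v \<subseteq> carrier (path_group \<Gamma>)"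
  by (auto simp: path_classes_def dest: path_word_words)

lemma fundamental_group_inv:
  assumes v: "v\<^sub>0 \<in> verts \<Gamma>" and x: "x \<in> path_classes \<Gamma> v\<^sub>0 v\<^sub>0"
  shows "inv\<^bsub>fundamental_group \<Gamma> v\<^sub>0\<^esub> x = inv\<^bsub>path_group \<Gamma>\<^esub> x"
  unfolding fundamental_group_def
  using F.m_inv_consistent[OF subgroup_path_classes[OF v] x] by simp

text \<open>Products and inverses are the same in both groups. Arguments about subgroups can thus be
  carried out in the path group, where paths with any endpoints may be multiplied.\<close>

lemma subgroup_fundamental_group:
  assumes v: "v\<^sub>0 \<in> verts \<Gamma>"
  shows "subgroup H (fundamental_group \<Gamma> v\<^sub>0) \<longleftrightarrow> subgroup H (path_group \<Gamma>) \<and> H \<subseteq> path_classes \<Gamma> v\<^sub>0 v\<^sub>0"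
proof
  interpret G: group "fundamental_group \<Gamma> v\<^sub>0" using v by (rule group_fundamental_group)
  assume "subgroup H (fundamental_group \<Gamma> v\<^sub>0)"
  then interpret subgroup H "fundamental_group \<Gamma> v\<^sub>0" .
  show "subgroup H (path_group \<Gamma>) \<and> H \<subseteq> path_classes \<Gamma> v\<^sub>0 v\<^sub>0"
  proof (intro conjI F.subgroupI)
    show "H \<subseteq> path_classes \<Gamma> v\<^sub>0 v\<^sub>0" using subset by (simp add: fundamental_group_simps)
    then show "H \<subseteq> carrier (path_group \<Gamma>)" using path_classes_carrier by blast
    show "H \<noteq> {}" using one_closed by blast
    show "inv\<^bsub>path_group \<Gamma>\<^esub> a \<in> H" if "a \<in> H" for a
      using m_inv_closed[OF that] fundamental_group_inv[OF v, of a] that subset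
      by (metis fundamental_group_simps(1) subsetD)
    show "a \<cdot> b \<in> H" if "a \<in> H" "b \<in> H" for a b
      using m_closed[OF that] by (simp add: fundamental_group_simps)
  qed
next
  interpret G: group "fundamental_group \<Gamma> v\<^sub>0" using v by (rule group_fundamental_group)
  assume "subgroup H (path_group \<Gamma>) \<and> H \<subseteq> path_classes \<Gamma> v\<^sub>0 v\<^sub>0"
  then interpret subgroup H "path_group \<Gamma>" by simp
  have H: "H \<subseteq> path_classes \<Gamma> v\<^sub>0 v\<^sub>0" and HF: "subgroup H (path_group \<Gamma>)" using \<open>_ \<and> _\<close> by simp_all
  show "subgroup H (fundamental_group \<Gamma> v\<^sub>0)"
  proof (rule G.subgroupI)
    show "inv\<^bsub>fundamental_group \<Gamma> v\<^sub>0\<^esub> a \<in> H" if "a \<in> H" for a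
      using F.subgroupE(3)[OF HF that] fundamental_group_inv[OF v, of a] that H by auto
    show "H \<noteq> {}" using one_closed by blast
  qed (use H m_closed in \<open>auto simp: fundamental_group_simps\<close>)
qed

lemma cl_inv_word: "w \<in> words \<Gamma> \<Longrightarrow> cl (inv_word w) = inv\<^bsub>path_group \<Gamma>\<^esub> cl w"
  using word_class_eqI[OF inv_word_cancel, of w]
  by (intro F.inv_equality[symmetric]) (simp_all add: inv_word_words cl_Nil cl_append)

lemma run_inv_word:
  assumes "letter_action X act" "w \<in> words \<Gamma>" "x \<in> X"
  shows "run act (inv_word w) (run act w x) = x"
proof -
  have "cl (w @ inv_word w) = cl []"
    using assms(2) by (simp add: cl_append inv_word_words cl_inv_word cl_Nil)
  then have "(w @ inv_word w, []) \<in> word_cong \<Gamma>"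
    using assms(2) by (simp add: word_class_eq_iff inv_word_words)
  then show ?thesis using run_cong[OF assms(1) _ assms(3)] by fastforce
qed

lemma stabilizer_iff:
  assumes "letter_action X act" "x \<in> X" "path_word \<Gamma> v\<^sub>0 w v\<^sub>0"
  shows "cl w \<in> stabilizer act x v\<^sub>0 \<longleftrightarrow> run act w x = x"
proof
  assume "cl w \<in> stabilizer act x v\<^sub>0"
  then obtain w' where w': "path_word \<Gamma> v\<^sub>0 w' v\<^sub>0" "run act w' x = x" "cl w = cl w'"
    by (auto simp: stabilizer_def)
  then have "(w, w') \<in> word_cong \<Gamma>"
    using path_word_words[OF w'(1)] path_word_words[OF assms(3)] by (simp add: word_class_eq_iff)
  then show "run act w x = x" using run_cong[OF assms(1) _ assms(2)] w' by fastforce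
qed (use assms in \<open>auto simp: stabilizer_def\<close>)

lemma subgroup_stabilizer:
  assumes "letter_action X act" "x \<in> X" "v\<^sub>0 \<in> verts \<Gamma>"
  shows "subgroup (stabilizer act x v\<^sub>0) (fundamental_group \<Gamma> v\<^sub>0)"
  unfolding subgroup_fundamental_group[OF assms(3)]
proof (intro conjI F.subgroupI)
  show sub: "stabilizer act x v\<^sub>0 \<subseteq> path_classes \<Gamma> v\<^sub>0 v\<^sub>0"
    by (auto simp: stabilizer_def path_classes_def)
  then show "stabilizer act x v\<^sub>0 \<subseteq> carrier (path_group \<Gamma>)" using path_classes_carrier by blast
  show "stabilizer act x v\<^sub>0 \<noteq> {}"
    using path_word.Nil[OF assms(3)] stabilizer_iff[OF assms(1,2), of v\<^sub>0 "[]"] by auto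
  show "inv\<^bsub>path_group \<Gamma>\<^esub> a \<in> stabilizer act x v\<^sub>0" if a: "a \<in> stabilizer act x v\<^sub>0" for a
  proof -
    obtain w where w: "path_word \<Gamma> v\<^sub>0 w v\<^sub>0" "run act w x = x" "a = cl w"
      using a by (auto simp: stabilizer_def)
    have "w \<in> words \<Gamma>" using w path_word_words by blast
    then show ?thesis
      using w path_word_inv[OF w(1)] run_inv_word[OF assms(1) _ assms(2), of w] cl_inv_word[of w]
      by (auto simp: stabilizer_def)
  qed
  show "a \<cdot> b \<in> stabilizer act x v\<^sub>0" if a: "a \<in> stabilizer act x v\<^sub>0" and b: "b \<in> stabilizer act x v\<^sub>0" for a b
  proof -
    obtain w where w: "path_word \<Gamma> v\<^sub>0 w v\<^sub>0" "run act w x = x" "a = cl w"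
      using a by (auto simp: stabilizer_def)
    obtain w' where w': "path_word \<Gamma> v\<^sub>0 w' v\<^sub>0" "run act w' x = x" "b = cl w'"
      using b by (auto simp: stabilizer_def)
    have "a \<cdot> b = cl (w @ w')" using w w' path_word_words by (simp add: cl_append)
    then show ?thesis using w w' path_word_append by (auto simp: stabilizer_def)
  qed
qed

section \<open>Comparing reduced paths\<close>

lemma slide_length: "slide x S a T a' \<Longrightarrow> length S = length T"
  by (induction x S a T a' rule: slide.induct) auto

lemma slide_snoc:
  "slide x (S @ [s]) a T a' \<Longrightarrow>
    \<exists>T' s'. T = T' @ [s'] \<and> snd s' = snd s \<and> a' - a \<in> range ((*v) (lab_tgt \<Gamma> (snd s)))"
proof (induction S arbitrary: x T)
  case Nil
  then obtain s' T' where T: "T = s' # T'" by (cases T) auto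
  then show ?case using Nil by (cases T') (auto intro!: exI[of _ "[]"])
next
  case (Cons s0 S)
  then obtain s' T1 where T: "T = s' # T1" by (cases T) auto
  then obtain y where "slide y (S @ [s]) a T1 a'" using Cons.prems by auto
  then show ?case using Cons.IH T by (metis append_Cons)
qed

text \<open>After the syllable \<open>k\<close>, the syllables \<open>s\<close> and \<open>s'\<close> cross different edges of the tree.\<close>

definition diverge :: "(int ^ 'd) \<times> 'e \<Rightarrow> (int ^ 'd) \<times> 'e \<Rightarrow> (int ^ 'd) \<times> 'e \<Rightarrow> bool" where
  "diverge k s s' \<longleftrightarrow> snd s = snd s' \<longrightarrow>
     snd s = opp \<Gamma> (snd k) \<and> fst s - fst s' \<notin> range ((*v) (lab_tgt \<Gamma> (snd k)))"

text \<open>What has been pushed through the last syllable of \<open>C\<close> lies in the image of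
  its \<open>lab_tgt\<close>. If the next edge is the way back, this image is also the ambiguity of
  the next coefficient, and \<open>diverge\<close> puts the two coefficients into different cosets
  of it.\<close>

lemma slide_diverge:
  assumes "slide x (C @ s # S) a (C @ s' # S') a'" "C \<noteq> []" "snd (last C) \<in> edges \<Gamma>"
  shows "\<not> diverge (last C) s s'"
  using assms
proof (induction C arbitrary: x)
  case (Cons k C)
  show ?case
  proof (cases "C = []")
    case True
    have k: "snd k \<in> edges \<Gamma>" using Cons.prems True by simp
    obtain z z' where "snd s = snd s'" "lab_src \<Gamma> (snd s) *v z' = lab_tgt \<Gamma> (snd k) *v z + fst s - fst s'"
      using Cons.prems True by auto
    moreover from this(2) have "fst s - fst s' = lab_src \<Gamma> (snd s) *v z' - lab_tgt \<Gamma> (snd k) *v z" by simp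
    ultimately have "snd s = snd s'" "snd s = opp \<Gamma> (snd k) \<Longrightarrow> fst s - fst s' = lab_tgt \<Gamma> (snd k) *v (z' - z)"
      using k by (auto simp: lab_src_opp matrix_vector_mult_diff_distrib)
    then show ?thesis using True by (auto simp: diverge_def)
  next
    case False
    then show ?thesis using Cons by auto
  qed
qed simp

text \<open>Converse to \<open>reduced_unique\<close>. Together they translate equations in the path
  group into linear conditions on vectors.\<close>

lemma slide_sound:
  assumes "slide x S a S' a'" "syl_path u S w" "syl_path u S' w"
  shows "V u x \<cdot> cl (syl_word S) \<cdot> V w a = cl (syl_word S') \<cdot> V w a'"
  using assms
proof (induction S' arbitrary: u S x)
  case Nil
  then have "S = []" by (cases S) auto
  then show ?case using Nil by (simp add: cl_Nil V_add)
next
  case (Cons s' t')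
  obtain a1' e where s': "s' = (a1', e)" by (cases s')
  obtain a1 t where S: "S = (a1, e) # t" using Cons.prems s' by (cases S) auto
  obtain z where z: "lab_src \<Gamma> e *v z = x + a1 - a1'" and slide: "slide (lab_tgt \<Gamma> e *v z) t a t' a'"
    using Cons.prems S s' by auto
  have p: "u = src \<Gamma> e" "e \<in> edges \<Gamma>" "syl_path (tgt \<Gamma> e) t w" "syl_path (tgt \<Gamma> e) t' w" using Cons.prems S s' by auto
  have C: "cl (syl_word t) \<in> carrier (path_group \<Gamma>)" "cl (syl_word t') \<in> carrier (path_group \<Gamma>)" "w \<in> verts \<Gamma>"
    "u \<in> verts \<Gamma>"
    using p cl_closed_path syl_path_verts src_in by auto
  have "V u x \<cdot> cl (syl_word S) \<cdot> V w a = V u x \<cdot> V u a1 \<cdot> E e \<cdot> (cl (syl_word t) \<cdot> V w a)"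
    using p C cl_syl_word_Cons[OF p(3), of a1] S by (simp add: F.m_assoc)
  also have "V u x \<cdot> V u a1 \<cdot> E e = V u a1' \<cdot> (V u (lab_src \<Gamma> e *v z) \<cdot> E e)"
    using C p z by (simp add: V_add flip: F.m_assoc)
  also have "\<dots> = V u a1' \<cdot> E e \<cdot> V (tgt \<Gamma> e) (lab_tgt \<Gamma> e *v z)"
    using C p E_V[of e z] by (simp add: F.m_assoc tgt_in)
  also have "\<dots> \<cdot> (cl (syl_word t) \<cdot> V w a) = V u a1' \<cdot> E e \<cdot> (V (tgt \<Gamma> e) (lab_tgt \<Gamma> e *v z) \<cdot> cl (syl_word t) \<cdot> V w a)"
    using C p by (simp add: F.m_assoc tgt_in)
  also have "V (tgt \<Gamma> e) (lab_tgt \<Gamma> e *v z) \<cdot> cl (syl_word t) \<cdot> V w a = cl (syl_word t') \<cdot> V w a'"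
    using Cons.IH[OF slide p(3,4)] .
  also have "V u a1' \<cdot> E e \<cdot> (cl (syl_word t') \<cdot> V w a') = cl (syl_word (s' # t')) \<cdot> V w a'"
    using p C cl_syl_word_Cons[OF p(4), of a1'] s' by (simp add: F.m_assoc)
  finally show ?case .
qed

text \<open>No initial piece of \<open>S\<close> crosses the tree edge crossed by the last syllable of \<open>T\<close>.\<close>

definition unmatched :: "((int ^ 'd) \<times> 'e) list \<Rightarrow> ((int ^ 'd) \<times> 'e) list \<Rightarrow> bool" where
  "unmatched T S \<longleftrightarrow> (\<forall>m s r x b b'. S = m @ s # r \<longrightarrow> \<not> slide x T b (m @ [s]) b')"

lemma unmatched_length: "length S < length T \<Longrightarrow> unmatched T S"
  by (auto simp: unmatched_def dest!: slide_length)

lemma unmatched_diverge: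
  assumes "diverge (last C) s s'" "C \<noteq> []" "snd (last C) \<in> edges \<Gamma>"
  shows "unmatched (C @ s # R) (C @ s' # R')"
  unfolding unmatched_def
proof (intro allI impI notI)
  fix m s'' r x b b' assume S: "C @ s' # R' = m @ s'' # r" and slide: "slide x (C @ s # R) b (m @ [s'']) b'"
  have len: "length (m @ [s'']) = length (C @ s # R)" using slide_length[OF slide] by simp
  have "take (length (m @ [s''])) (m @ s'' # r) = m @ [s'']" by simp
  then have "m @ [s''] = take (length (C @ s # R)) (C @ s' # R')" using S len by metis
  also have "\<dots> = C @ s' # take (length R) R'" by simp
  finally show False using slide_diverge[of x C s R b s' "take (length R) R'" b'] slide assms by simp
qed

text \<open>A crossing in the same direction would slide \<open>M @ [(a', \<epsilon>')]\<close> onto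
  an initial piece of \<open>S\<close>, which is excluded. A crossing in the opposite direction
  would slide \<open>M\<close> onto that piece, so \<open>M\<close> would end with the reverse of
  \<open>\<epsilon>'\<close>, and the syllable \<open>(a', \<epsilon>')\<close> would be a
  backtrack.\<close>

lemma crosses_reduced:
  assumes S: "syl_path u S w" "reduced_path S" "S = m @ (a, \<epsilon>) # r"
    and T: "syl_path u (M @ [(a', \<epsilon>')]) w'" "reduced_path (M @ [(a', \<epsilon>')])" and unmatched: "\<And>x b b'. \<not> slide x (M @ [(a', \<epsilon>')]) b (m @ [(a, \<epsilon>)]) b'"
    and L: "L \<subseteq> range (V u)"
  shows "\<not> crosses L (cl (syl_word M) \<cdot> V (src \<Gamma> \<epsilon>') a') \<epsilon>' \<epsilon> (cl (syl_word m) \<cdot> V (src \<Gamma> \<epsilon>) a)"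
proof
  assume "crosses L (cl (syl_word M) \<cdot> V (src \<Gamma> \<epsilon>') a') \<epsilon>' \<epsilon> (cl (syl_word m) \<cdot> V (src \<Gamma> \<epsilon>) a)"
  then obtain x z where "\<epsilon> = \<epsilon>' \<and> cl (syl_word m) \<cdot> V (src \<Gamma> \<epsilon>) a =
      V u x \<cdot> (cl (syl_word M) \<cdot> V (src \<Gamma> \<epsilon>') a') \<cdot> V (src \<Gamma> \<epsilon>') (lab_src \<Gamma> \<epsilon>' *v z) \<or>
    \<epsilon> = opp \<Gamma> \<epsilon>' \<and> cl (syl_word m) \<cdot> V (src \<Gamma> \<epsilon>) a \<cdot> E \<epsilon> =
      V u x \<cdot> (cl (syl_word M) \<cdot> V (src \<Gamma> \<epsilon>') a') \<cdot> V (src \<Gamma> \<epsilon>') (lab_src \<Gamma> \<epsilon>' *v z)"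
    using L unfolding crosses_def by blast
  moreover have pm: "syl_path u m (src \<Gamma> \<epsilon>)" "\<epsilon> \<in> edges \<Gamma>" "syl_path u (m @ [(a, \<epsilon>)]) (tgt \<Gamma> \<epsilon>)"
    using S by (auto simp: syl_path_append tgt_in)
  have pM: "syl_path u M (src \<Gamma> \<epsilon>')" "\<epsilon>' \<in> edges \<Gamma>" "syl_path u (M @ [(a', \<epsilon>')]) (tgt \<Gamma> \<epsilon>')"
    using T by (auto simp: syl_path_append tgt_in)
  have rm: "reduced_path m" "reduced_path (m @ [(a, \<epsilon>)])" "reduced_path M"
    using S(2,3) T(2) by (auto simp: successively_append_iff successively_Cons)
  have C: "cl (syl_word m) \<in> carrier (path_group \<Gamma>)" "cl (syl_word M) \<in> carrier (path_group \<Gamma>)" "u \<in> verts \<Gamma>"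
    using cl_closed_path pm pM syl_path_verts by blast+
  note I = src_in[OF pm(2)] src_in[OF pM(2)] tgt_in[OF pm(2)] tgt_in[OF pM(2)]
  have snoc: "cl (syl_word (N @ [(b, \<delta>)])) = cl (syl_word N) \<cdot> V (src \<Gamma> \<delta>) b \<cdot> E \<delta>"
    if "syl_path u N (src \<Gamma> \<delta>)" "\<delta> \<in> edges \<Gamma>" for N b \<delta>
    using that syl_path_words[OF that(1)] by (simp add: cl_append cl_Vtx cl_Edg cl_Nil F.m_assoc src_in)
  ultimately show False
  proof (elim disjE conjE)
    assume \<epsilon>: "\<epsilon> = \<epsilon>'" and eq: "cl (syl_word m) \<cdot> V (src \<Gamma> \<epsilon>) a =
      V u x \<cdot> (cl (syl_word M) \<cdot> V (src \<Gamma> \<epsilon>') a') \<cdot> V (src \<Gamma> \<epsilon>') (lab_src \<Gamma> \<epsilon>' *v z)"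
    have "V u x \<cdot> cl (syl_word (M @ [(a', \<epsilon>)])) \<cdot> V (tgt \<Gamma> \<epsilon>) (lab_tgt \<Gamma> \<epsilon> *v z) =
      V u x \<cdot> (cl (syl_word M) \<cdot> V (src \<Gamma> \<epsilon>) a') \<cdot> (E \<epsilon> \<cdot> V (tgt \<Gamma> \<epsilon>) (lab_tgt \<Gamma> \<epsilon> *v z))"
      using snoc[of M \<epsilon> a'] pM pm C I \<epsilon> by (simp add: F.m_assoc)
    also have "\<dots> = V u x \<cdot> (cl (syl_word M) \<cdot> V (src \<Gamma> \<epsilon>) a') \<cdot> V (src \<Gamma> \<epsilon>) (lab_src \<Gamma> \<epsilon> *v z) \<cdot> E \<epsilon>"
      using pM pm C I \<epsilon> by (simp add: E_V F.m_assoc)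
    also have "\<dots> = cl (syl_word (m @ [(a, \<epsilon>)])) \<cdot> V (tgt \<Gamma> \<epsilon>) 0"
      using eq \<epsilon> snoc[of m \<epsilon> a] pm C I by (simp add: V_zero)
    finally have "slide x (M @ [(a', \<epsilon>)]) (lab_tgt \<Gamma> \<epsilon> *v z) (m @ [(a, \<epsilon>)]) 0"
      using reduced_unique pM pm rm T(2) \<epsilon> by blast
    then show False using unmatched \<epsilon> by blast
  next
    assume \<epsilon>: "\<epsilon> = opp \<Gamma> \<epsilon>'" and eq: "cl (syl_word m) \<cdot> V (src \<Gamma> \<epsilon>) a \<cdot> E \<epsilon> =
      V u x \<cdot> (cl (syl_word M) \<cdot> V (src \<Gamma> \<epsilon>') a') \<cdot> V (src \<Gamma> \<epsilon>') (lab_src \<Gamma> \<epsilon>' *v z)"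
    have t: "tgt \<Gamma> \<epsilon> = src \<Gamma> \<epsilon>'" "lab_tgt \<Gamma> \<epsilon> = lab_src \<Gamma> \<epsilon>'" "opp \<Gamma> \<epsilon> = \<epsilon>'"
      using \<epsilon> pM(2) by (auto simp: tgt_opp lab_tgt_opp opp_opp)
    let ?b = "a' + lab_src \<Gamma> \<epsilon>' *v z"
    have "V (src \<Gamma> \<epsilon>') a' \<cdot> V (src \<Gamma> \<epsilon>') (lab_src \<Gamma> \<epsilon>' *v z) = V (src \<Gamma> \<epsilon>') ?b" using I by (simp add: V_add)
    then have "V u x \<cdot> cl (syl_word M) \<cdot> V (src \<Gamma> \<epsilon>') ?b = cl (syl_word (m @ [(a, \<epsilon>)])) \<cdot> V (src \<Gamma> \<epsilon>') 0"
      using eq snoc[of m \<epsilon> a] pm C I t by (simp add: V_zero F.m_assoc)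
    then have slide: "slide x M ?b (m @ [(a, \<epsilon>)]) 0"
      using reduced_unique[OF pM(1) rm(3) _ rm(2)] pm(3) t by metis
    then have "M \<noteq> []" using slide_length by fastforce
    then obtain M' a'' \<epsilon>'' where M: "M = M' @ [(a'', \<epsilon>'')]" by (metis append_butlast_last_id surj_pair)
    from slide_snoc[of x M' "(a'', \<epsilon>'')" ?b "m @ [(a, \<epsilon>)]" 0] slide M
    obtain y where "\<epsilon>'' = \<epsilon>" "- ?b = lab_tgt \<Gamma> \<epsilon> *v y" by auto
    then have "a' + lab_tgt \<Gamma> \<epsilon> *v z = - (lab_tgt \<Gamma> \<epsilon> *v y)" using t by (metis add.inverse_inverse)
    then have "a' = - (lab_tgt \<Gamma> \<epsilon> *v y) - lab_tgt \<Gamma> \<epsilon> *v z" by (metis add_diff_cancel_right')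
    then have "a' = lab_tgt \<Gamma> \<epsilon> *v (0 - y - z)"
      unfolding matrix_vector_mult_diff_distrib by simp
    then have "\<not> no_backtrack (a'', \<epsilon>'') (a', \<epsilon>')" using \<open>\<epsilon>'' = \<epsilon>\<close> t by (auto simp: no_backtrack_def)
    then show False using T(2) M by (auto simp: successively_append_iff)
  qed
qed

lemma syl_word_split:
  "syl_word S @ [Vtx v b] = u @ Edg \<epsilon> # r \<Longrightarrow> \<exists>m a t. S = m @ (a, \<epsilon>) # t \<and> u = syl_word m @ [Vtx (src \<Gamma> \<epsilon>) a]"
proof (induction S arbitrary: u)
  case Nil
  then show ?case by (cases u) auto
next
  case (Cons s S)
  obtain a e where s: "s = (a, e)" by (cases s)
  consider "u = [Vtx (src \<Gamma> e) a]" "\<epsilon> = e" | u' where "u = Vtx (src \<Gamma> e) a # Edg e # u'" "syl_word S @ [Vtx v b] = u' @ Edg \<epsilon> # r"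
    using Cons.prems s by (cases u; cases "tl u") (auto simp: Cons_eq_append_conv)
  then show ?case
  proof cases
    case 1
    then show ?thesis using s by (intro exI[of _ "[]"]) auto
  next
    case 2
    then obtain m a' t where "S = m @ (a', \<epsilon>) # t" "u' = syl_word m @ [Vtx (src \<Gamma> \<epsilon>) a']" using Cons.IH by blast
    then show ?thesis using 2 s by (intro exI[of _ "s # m"]) auto
  qed
qed

lemma F_cancel [simp]:
  assumes "x \<in> carrier (path_group \<Gamma>)" "y \<in> carrier (path_group \<Gamma>)"
  shows "inv\<^bsub>path_group \<Gamma>\<^esub> x \<cdot> (x \<cdot> y) = y" "x \<cdot> (inv\<^bsub>path_group \<Gamma>\<^esub> x \<cdot> y) = y"
  using assms by (simp_all flip: F.m_assoc)

lemma int_mult_minus: "(M :: int ^ 'd ^ 'd) *v (- x) = - (M *v x)"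
  by (simp add: matrix_vector_mult_def vec_eq_iff sum_negf)

section \<open>Surgery along one edge of the quotient\<close>

lemma infinite_tree_quotientI:
  fixes w :: "nat \<Rightarrow> 'v" and p :: "nat \<Rightarrow> ('v, 'e, 'd) word set"
  assumes v: "v\<^sub>0 \<in> verts \<Gamma>" and H: "subgroup H (fundamental_group \<Gamma> v\<^sub>0)"
    and p: "\<And>n. p n \<in> path_classes \<Gamma> v\<^sub>0 (w n)" "\<And>n. w n \<in> verts \<Gamma>"
    and inj: "\<And>n m h a. h \<in> H \<Longrightarrow> w n = w m \<Longrightarrow> p n = h \<cdot> p m \<cdot> V (w m) a \<Longrightarrow> n = m"
  shows "infinite_graph (tree_quotient \<Gamma> v\<^sub>0 H)"
proof -
  note HF = H[unfolded subgroup_fundamental_group[OF v]]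
  define orb where "orb n = (\<lambda>h. tree_action \<Gamma> h (w n, p n <#\<^bsub>path_group \<Gamma>\<^esub> vertex_group \<Gamma> (w n))) ` H" for n
  have pc: "p n \<in> carrier (path_group \<Gamma>)" for n using p path_classes_carrier by blast
  have "inj orb"
  proof (rule injI)
    fix n m assume eq: "orb n = orb m"
    have one: "\<one>\<^bsub>path_group \<Gamma>\<^esub> \<in> H" using HF subgroup.one_closed by blast
    then have "tree_action \<Gamma> \<one>\<^bsub>path_group \<Gamma>\<^esub> (w n, p n <#\<^bsub>path_group \<Gamma>\<^esub> vertex_group \<Gamma> (w n)) \<in> orb m"
      using eq unfolding orb_def by blast
    then obtain h where h: "h \<in> H" "w n = w m" and
      c: "\<one>\<^bsub>path_group \<Gamma>\<^esub> <#\<^bsub>path_group \<Gamma>\<^esub> (p n <#\<^bsub>path_group \<Gamma>\<^esub> vertex_group \<Gamma> (w n)) =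
        h <#\<^bsub>path_group \<Gamma>\<^esub> (p m <#\<^bsub>path_group \<Gamma>\<^esub> vertex_group \<Gamma> (w m))"
      unfolding orb_def tree_action_def by auto
    have hc: "h \<in> carrier (path_group \<Gamma>)" using h HF subgroup.subset by blast
    have "V (w n) 0 \<in> vertex_group \<Gamma> (w n)" by (auto simp: vertex_group_def V_def)
    moreover have "\<one>\<^bsub>path_group \<Gamma>\<^esub> \<cdot> (p n \<cdot> V (w n) 0) = p n" using pc p by (simp add: V_zero)
    ultimately have "p n \<in> \<one>\<^bsub>path_group \<Gamma>\<^esub> <#\<^bsub>path_group \<Gamma>\<^esub> (p n <#\<^bsub>path_group \<Gamma>\<^esub> vertex_group \<Gamma> (w n))"
      unfolding l_coset_def by force
    then obtain a where "p n = h \<cdot> (p m \<cdot> V (w m) a)"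
      unfolding c by (auto simp: l_coset_def vertex_group_def V_def)
    then have "p n = h \<cdot> p m \<cdot> V (w m) a" using hc pc p by (simp add: F.m_assoc)
    then show "n = m" using inj h by blast
  qed
  moreover have "range orb \<subseteq> verts (tree_quotient \<Gamma> v\<^sub>0 H)"
    using p by (fastforce simp: tree_quotient_def quotient_graph_def bass_serre_tree_def orb_def)
  ultimately show ?thesis
    unfolding infinite_graph_def by (meson finite_subset range_inj_infinite)
qed

text \<open>The path \<open>c\<close> enters the new piece through \<open>e\<close>. From its end,
  one edge to be exchanged is reached with the coefficient \<open>\<alpha>\<close>, the other one
  from its far side by \<open>d\<close> and \<open>\<delta>\<close>. \<open>S4\<close> starts
  arbitrarily long paths that meet neither, which will keep the quotients infinite.
  \<open>L_match\<close> expresses that the two points to be exchanged have the same stabilizer in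
  the edge group of \<open>e'\<close>.\<close>

context
  fixes H v\<^sub>0 e q Ls c \<alpha> e' w2 d \<delta> w3 S4
  assumes H: "subgroup H (path_group \<Gamma>)"
    and e: "e \<in> edges \<Gamma>" and q: "path_word \<Gamma> v\<^sub>0 q (src \<Gamma> e)"
    and Ls: "Ls = {z. cl q \<cdot> V (src \<Gamma> e) (lab_src \<Gamma> e *v z) \<cdot> inv\<^bsub>path_group \<Gamma>\<^esub> cl q \<in> H}"
    and q_clear: "clear H (cl q) e q \<one>\<^bsub>path_group \<Gamma>\<^esub>"
    and hd_c: "\<exists>c'. c = (0, e) # c'"
    and f2: "syl_path (src \<Gamma> e) (c @ [(\<alpha>, e')]) w2" "reduced_path (c @ [(\<alpha>, e')])"
    and f3: "syl_path (src \<Gamma> e) (c @ d @ [(\<delta>, opp \<Gamma> e')]) w3" "reduced_path (c @ d @ [(\<delta>, opp \<Gamma> e')])"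
    and S4: "\<exists>S'. S4 = (0, e) # S'"
      "\<And>n. \<exists>t w. length t = n \<and> syl_path (src \<Gamma> e) (S4 @ t) w \<and> reduced_path (S4 @ t)"
    and dv23: "d \<noteq> []" "diverge (last c) (\<alpha>, e') (hd d)"
    and nm24: "\<And>t. unmatched (c @ [(\<alpha>, e')]) (S4 @ t)"
    and nm34: "\<And>t. unmatched (c @ d @ [(\<delta>, opp \<Gamma> e')]) (S4 @ t)"
    and L_match: "\<And>z. (\<exists>l\<in>Ls. slide (lab_src \<Gamma> e *v l) c \<alpha> c (\<alpha> + lab_src \<Gamma> e' *v z)) \<longleftrightarrow>
      (\<exists>l\<in>Ls. slide (lab_src \<Gamma> e *v l) (c @ d) \<delta> (c @ d) (\<delta> + lab_tgt \<Gamma> e' *v z))"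
begin

text \<open>The coset spaces of \<open>H\<close> and of the stabilizer \<open>edgeL\<close> of an edge are glued by exchanging two edges over \<open>e\<close>
  (\<open>actA\<close>); in the piece coming from \<open>edgeL\<close> two edges over \<open>e'\<close> may be exchanged as well (\<open>actB\<close>). In both
  spaces the stabilizer of the root agrees with \<open>H\<close> on all words which do not cross the edge at \<open>cl q\<close>.\<close>

abbreviation (input) "edgeL \<equiv> (\<lambda>l. V (src \<Gamma> e) (lab_src \<Gamma> e *v l)) ` Ls"
abbreviation (input) "cosetK \<equiv> case_bool H edgeL"
abbreviation (input) "pos2 \<equiv> cl (syl_word c) \<cdot> V (src \<Gamma> e') \<alpha>"
abbreviation (input) "pos3 \<equiv> cl (syl_word (c @ d)) \<cdot> V (tgt \<Gamma> e') \<delta>"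
abbreviation (input) "actA \<equiv> swap coset_act e (coset_pt cosetK True (cl q)) (coset_pt cosetK False \<one>\<^bsub>path_group \<Gamma>\<^esub>)"
abbreviation (input) "actB \<equiv> swap actA e' (coset_pt cosetK False pos2) (coset_pt cosetK False (pos3 \<cdot> E (opp \<Gamma> e')))"
abbreviation (input) "rootX \<equiv> coset_pt cosetK True \<one>\<^bsub>path_group \<Gamma>\<^esub>"

lemma surg_basic:
  shows "src \<Gamma> e \<in> verts \<Gamma>" "q \<in> words \<Gamma>" "v\<^sub>0 \<in> verts \<Gamma>" "cl q \<in> carrier (path_group \<Gamma>)"
    "e' \<in> edges \<Gamma>" "syl_path (src \<Gamma> e) c (src \<Gamma> e')" "syl_path (src \<Gamma> e) (c @ d) (tgt \<Gamma> e')" "reduced_path c" "reduced_path (c @ d)" "c \<noteq> []"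
    "snd (last c) \<in> edges \<Gamma>"
    "pos2 \<in> carrier (path_group \<Gamma>)" "pos3 \<in> carrier (path_group \<Gamma>)" "pos3 \<cdot> E (opp \<Gamma> e') \<in> carrier (path_group \<Gamma>)"
proof -
  show [simp]: "src \<Gamma> e \<in> verts \<Gamma>" "q \<in> words \<Gamma>" "v\<^sub>0 \<in> verts \<Gamma>"
    using e src_in path_word_words[OF q] by auto
  show "cl q \<in> carrier (path_group \<Gamma>)" by simp
  show e' [simp]: "e' \<in> edges \<Gamma>" using f2 by (auto simp: syl_path_append)
  show 1: "syl_path (src \<Gamma> e) c (src \<Gamma> e')" using f2 by (auto simp: syl_path_append)
  show 2: "syl_path (src \<Gamma> e) (c @ d) (tgt \<Gamma> e')" using f3 src_opp[OF e'] by (auto simp: syl_path_append)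
  show "reduced_path c" using f2 by (simp add: successively_append_iff)
  show "reduced_path (c @ d)" using f3(2) successively_append_iff[of no_backtrack "c @ d" "[(\<delta>, opp \<Gamma> e')]"] by simp
  show "c \<noteq> []" using hd_c by auto
  then obtain c0 k where "c = c0 @ [k]" by (metis append_butlast_last_id)
  then show "snd (last c) \<in> edges \<Gamma>" using 1 by (auto simp: syl_path_append)
  show "pos2 \<in> carrier (path_group \<Gamma>)" using cl_closed_path[OF 1] src_in[OF e'] by auto
  show "pos3 \<in> carrier (path_group \<Gamma>)" using cl_closed_path[OF 2] tgt_in[OF e'] by auto
  then show "pos3 \<cdot> E (opp \<Gamma> e') \<in> carrier (path_group \<Gamma>)" using opp_in[OF e'] by auto
qed

lemma Ls_sub: "0 \<in> Ls" "a \<in> Ls \<Longrightarrow> b \<in> Ls \<Longrightarrow> a + b \<in> Ls" "a \<in> Ls \<Longrightarrow> - a \<in> Ls"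
proof -
  note B = surg_basic
  let ?c = "\<lambda>z. cl q \<cdot> V (src \<Gamma> e) (lab_src \<Gamma> e *v z) \<cdot> inv\<^bsub>path_group \<Gamma>\<^esub> cl q"
  have cc: "?c z \<in> carrier (path_group \<Gamma>)" for z using B by auto
  have add: "?c a \<cdot> ?c b = ?c (a + b)" for a b
  proof -
    have "?c a \<cdot> ?c b = cl q \<cdot> (V (src \<Gamma> e) (lab_src \<Gamma> e *v a) \<cdot> V (src \<Gamma> e) (lab_src \<Gamma> e *v b)) \<cdot> inv\<^bsub>path_group \<Gamma>\<^esub> cl q"
      using B by (simp add: F.m_assoc)
    then show ?thesis using B by (simp add: V_add matrix_vector_right_distrib)
  qed
  have zero: "?c 0 = \<one>\<^bsub>path_group \<Gamma>\<^esub>" using B by (simp add: V_zero)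
  show "0 \<in> Ls" using zero subgroup.one_closed[OF H] by (simp add: Ls)
  show "a \<in> Ls \<Longrightarrow> b \<in> Ls \<Longrightarrow> a + b \<in> Ls" using add[of a b] subgroup.m_closed[OF H] by (metis (mono_tags, lifting) Ls mem_Collect_eq)
  show "- a \<in> Ls" if a: "a \<in> Ls"
  proof -
    have "inv\<^bsub>path_group \<Gamma>\<^esub> ?c a = ?c (- a)"
      using add[of "- a" a] zero cc by (intro F.inv_equality) auto
    then show ?thesis using a subgroup.m_inv_closed[OF H] by (metis (mono_tags, lifting) Ls mem_Collect_eq)
  qed
qed

lemma subgroup_K: "subgroup (cosetK i) (path_group \<Gamma>)"
proof (cases i)
  case False
  have "subgroup edgeL (path_group \<Gamma>)"
  proof (rule F.subgroupI)
    show "inv\<^bsub>path_group \<Gamma>\<^esub> a \<in> edgeL" if a: "a \<in> edgeL" for a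
    proof -
      obtain l where l: "l \<in> Ls" "a = V (src \<Gamma> e) (lab_src \<Gamma> e *v l)" using a by auto
      have "inv\<^bsub>path_group \<Gamma>\<^esub> a = V (src \<Gamma> e) (lab_src \<Gamma> e *v (- l))"
        using l surg_basic(1) by (simp add: V_minus int_mult_minus)
      then show ?thesis using Ls_sub(3)[OF l(1)] by blast
    qed
    show "a \<cdot> b \<in> edgeL" if "a \<in> edgeL" "b \<in> edgeL" for a b
      using that surg_basic(1) Ls_sub(2) by (auto simp: V_add simp flip: matrix_vector_right_distrib)
  qed (use Ls_sub surg_basic(1) in auto)
  then show ?thesis using False by simp
qed (use H in simp)

lemmas coset_pt_eq = coset_pt_eq_iff[of cosetK, OF subgroup_K]

lemma V_Lg_iff: "V (src \<Gamma> e) (lab_src \<Gamma> e *v z) \<in> edgeL \<longleftrightarrow> z \<in> Ls"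
  using surg_basic(1) e by (auto simp: V_inj lab_inj)

text \<open>\<open>Ls\<close> is by definition the stabilizer of the coset of \<open>cl q\<close> in
  the edge group, and the tags keep the two orbits apart.\<close>

lemma swap1:
  shows "edge_stab_act coset_act e z (coset_pt cosetK True (cl q)) = coset_pt cosetK True (cl q) \<longleftrightarrow>
      edge_stab_act coset_act e z (coset_pt cosetK False \<one>\<^bsub>path_group \<Gamma>\<^esub>) = coset_pt cosetK False \<one>\<^bsub>path_group \<Gamma>\<^esub>"
    and "coset_pt cosetK False \<one>\<^bsub>path_group \<Gamma>\<^esub> \<notin> edge_orbit coset_act e (coset_pt cosetK True (cl q))"
proof -
  note B = surg_basic
  show "edge_stab_act coset_act e z (coset_pt cosetK True (cl q)) = coset_pt cosetK True (cl q) \<longleftrightarrow>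
      edge_stab_act coset_act e z (coset_pt cosetK False \<one>\<^bsub>path_group \<Gamma>\<^esub>) = coset_pt cosetK False \<one>\<^bsub>path_group \<Gamma>\<^esub>"
  proof -
    have "edge_stab_act coset_act e z (coset_pt cosetK True (cl q)) = coset_pt cosetK True (cl q) \<longleftrightarrow>
        (\<exists>k\<in>H. cl q \<cdot> V (src \<Gamma> e) (lab_src \<Gamma> e *v z) = k \<cdot> cl q)"
      using B e by (simp add: edge_stab_act_coset_pt[OF subgroup_K] coset_pt_eq)
    also have "\<dots> \<longleftrightarrow> z \<in> Ls"
    proof
      assume "\<exists>k\<in>H. cl q \<cdot> V (src \<Gamma> e) (lab_src \<Gamma> e *v z) = k \<cdot> cl q"
      then obtain k where k: "k \<in> H" "cl q \<cdot> V (src \<Gamma> e) (lab_src \<Gamma> e *v z) = k \<cdot> cl q" by blast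
      then have "k = cl q \<cdot> V (src \<Gamma> e) (lab_src \<Gamma> e *v z) \<cdot> inv\<^bsub>path_group \<Gamma>\<^esub> cl q"
        using B subgroup.subset[OF H] by (auto simp: F.m_assoc)
      then show "z \<in> Ls" using k by (simp add: Ls)
    next
      assume "z \<in> Ls"
      then show "\<exists>k\<in>H. cl q \<cdot> V (src \<Gamma> e) (lab_src \<Gamma> e *v z) = k \<cdot> cl q"
        using B by (intro bexI[of _ "cl q \<cdot> V (src \<Gamma> e) (lab_src \<Gamma> e *v z) \<cdot> inv\<^bsub>path_group \<Gamma>\<^esub> cl q"])
          (auto simp: Ls F.m_assoc)
    qed
    also have "z \<in> Ls \<longleftrightarrow> edge_stab_act coset_act e z (coset_pt cosetK False \<one>\<^bsub>path_group \<Gamma>\<^esub>) = coset_pt cosetK False \<one>\<^bsub>path_group \<Gamma>\<^esub>"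
      using B e V_Lg_iff[of z] by (auto simp: edge_stab_act_coset_pt[OF subgroup_K] coset_pt_eq)
    finally show ?thesis .
  qed
  show "coset_pt cosetK False \<one>\<^bsub>path_group \<Gamma>\<^esub> \<notin> edge_orbit coset_act e (coset_pt cosetK True (cl q))"
    using B e by (simp add: coset_pt_orbit_iff[OF subgroup_K])
qed

lemma pts_closed:
  "coset_pt cosetK True (cl q) \<in> coset_space cosetK" "coset_pt cosetK False \<one>\<^bsub>path_group \<Gamma>\<^esub> \<in> coset_space cosetK" "rootX \<in> coset_space cosetK"
  "coset_pt cosetK False pos2 \<in> coset_space cosetK" "coset_pt cosetK False (pos3 \<cdot> E (opp \<Gamma> e')) \<in> coset_space cosetK"
  using surg_basic by (auto intro!: coset_pt_closed subgroup_K)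

lemma letter_action_act1: "letter_action (coset_space cosetK) actA"
  by (rule letter_action_swap[OF letter_action_coset[of cosetK, OF subgroup_K] e pts_closed(1,2) swap1])

lemma nm2: "unmatched (c @ [(\<alpha>, e')]) (c @ d @ [(\<delta>, opp \<Gamma> e')])"
  and nm2': "unmatched (c @ [(\<alpha>, e')]) (c @ d)"
proof -
  have "d = hd d # tl d" using dv23(1) by simp
  then show "unmatched (c @ [(\<alpha>, e')]) (c @ d @ [(\<delta>, opp \<Gamma> e')])" "unmatched (c @ [(\<alpha>, e')]) (c @ d)"
    using unmatched_diverge[OF dv23(2) _ surg_basic(11), of "[]"] surg_basic(10) by (metis append_Cons)+
qed

text \<open>\<open>crosses_reduced\<close> for the three edges of the new piece at which something
  is cut. The entrance is the edge of a path of length one, so only a first syllable can cross it;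
  the second inner edge is treated through its opposite.\<close>

lemma not_crosses:
  assumes S: "syl_path (src \<Gamma> e) S w" "reduced_path S" "S = m @ (a, \<epsilon>) # r"
  shows "m \<noteq> [] \<Longrightarrow> \<not> crosses edgeL \<one>\<^bsub>path_group \<Gamma>\<^esub> e \<epsilon> (cl (syl_word m) \<cdot> V (src \<Gamma> \<epsilon>) a)"
    and "unmatched (c @ [(\<alpha>, e')]) S \<Longrightarrow> \<not> crosses edgeL pos2 e' \<epsilon> (cl (syl_word m) \<cdot> V (src \<Gamma> \<epsilon>) a)"
    and "unmatched (c @ d @ [(\<delta>, opp \<Gamma> e')]) S \<Longrightarrow> \<not> crosses edgeL (pos3 \<cdot> E (opp \<Gamma> e')) e' \<epsilon> (cl (syl_word m) \<cdot> V (src \<Gamma> \<epsilon>) a)"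
proof -
  note B = surg_basic
  have L: "edgeL \<subseteq> range (V (src \<Gamma> e))" by auto
  have pm: "syl_path (src \<Gamma> e) m (src \<Gamma> \<epsilon>)" and \<epsilon>: "\<epsilon> \<in> edges \<Gamma>" using S by (auto simp: syl_path_append)
  have C: "cl (syl_word m) \<cdot> V (src \<Gamma> \<epsilon>) a \<in> carrier (path_group \<Gamma>)"
    using cl_closed_path[OF pm] src_in[OF \<epsilon>] by auto
  show "\<not> crosses edgeL \<one>\<^bsub>path_group \<Gamma>\<^esub> e \<epsilon> (cl (syl_word m) \<cdot> V (src \<Gamma> \<epsilon>) a)" if m: "m \<noteq> []"
  proof -
    have "\<not> slide x ([] @ [(0, e)]) b (m @ [(a, \<epsilon>)]) b'" for x b b'
      using slide_length[of x "[(0, e)]" b "m @ [(a, \<epsilon>)]" b'] m by auto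
    then have "\<not> crosses edgeL (cl (syl_word []) \<cdot> V (src \<Gamma> e) 0) e \<epsilon> (cl (syl_word m) \<cdot> V (src \<Gamma> \<epsilon>) a)"
      using e tgt_in[OF e] by (intro crosses_reduced[OF S _ _ _ L, of _ _ _ "tgt \<Gamma> e"]) auto
    then show ?thesis using B by (simp add: cl_Nil V_zero)
  qed
  show "\<not> crosses edgeL pos2 e' \<epsilon> (cl (syl_word m) \<cdot> V (src \<Gamma> \<epsilon>) a)" if "unmatched (c @ [(\<alpha>, e')]) S"
    using that S(3) by (intro crosses_reduced[OF S f2 _ L]) (auto simp: unmatched_def)
  show "\<not> crosses edgeL (pos3 \<cdot> E (opp \<Gamma> e')) e' \<epsilon> (cl (syl_word m) \<cdot> V (src \<Gamma> \<epsilon>) a)"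
    if n: "unmatched (c @ d @ [(\<delta>, opp \<Gamma> e')]) S"
  proof
    assume "crosses edgeL (pos3 \<cdot> E (opp \<Gamma> e')) e' \<epsilon> (cl (syl_word m) \<cdot> V (src \<Gamma> \<epsilon>) a)"
    then have "crosses edgeL pos3 (opp \<Gamma> e') \<epsilon> (cl (syl_word m) \<cdot> V (src \<Gamma> \<epsilon>) a)"
      using crosses_opp[of edgeL pos3 "cl (syl_word m) \<cdot> V (src \<Gamma> \<epsilon>) a" "opp \<Gamma> e'" \<epsilon>]
        subgroup.subset[OF subgroup_K[of False]] B C by (simp add: opp_in opp_opp)
    then show False
      using crosses_reduced[OF S, of "c @ d" \<delta> "opp \<Gamma> e'" w3, OF _ _ _ L] f3 n B S(3)
      by (fastforce simp: src_opp unmatched_def)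
  qed
qed

text \<open>The normal form theorem for two copies of one path: it identifies point stabilizers with
  the conditions in \<open>L_match\<close>.\<close>

lemma stab_iff:
  assumes "syl_path (src \<Gamma> e) C w" "reduced_path C"
  shows "(\<exists>k\<in>edgeL. cl (syl_word C) \<cdot> V w b = k \<cdot> (cl (syl_word C) \<cdot> V w a)) \<longleftrightarrow>
    (\<exists>l\<in>Ls. slide (lab_src \<Gamma> e *v l) C a C b)"
proof -
  have C: "cl (syl_word C) \<in> carrier (path_group \<Gamma>)" "w \<in> verts \<Gamma>" "src \<Gamma> e \<in> verts \<Gamma>"
    using assms cl_closed_path syl_path_verts by blast+
  have "cl (syl_word C) \<cdot> V w b = V (src \<Gamma> e) x \<cdot> (cl (syl_word C) \<cdot> V w a) \<longleftrightarrow> slide x C a C b" for x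
    using reduced_unique[OF assms assms, of x a b] slide_sound[OF _ assms(1) assms(1), of x a b] C
    by (auto simp: F.m_assoc)
  then show ?thesis by auto
qed

lemma swap2:
  shows "edge_stab_act actA e' z (coset_pt cosetK False pos2) = coset_pt cosetK False pos2 \<longleftrightarrow>
      edge_stab_act actA e' z (coset_pt cosetK False (pos3 \<cdot> E (opp \<Gamma> e'))) = coset_pt cosetK False (pos3 \<cdot> E (opp \<Gamma> e'))"
    and "coset_pt cosetK False (pos3 \<cdot> E (opp \<Gamma> e')) \<notin> edge_orbit actA e' (coset_pt cosetK False pos2)"
proof -
  note B = surg_basic
  \<comment> \<open>An edge group element passes through \<open>opp e'\<close> and appears at the
    target of \<open>e'\<close>, which is the form in which \<open>L_match\<close> describes the
    stabilizer of this edge.\<close>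
  have E3: "pos3 \<cdot> E (opp \<Gamma> e') \<cdot> V (src \<Gamma> e') (lab_src \<Gamma> e' *v z) =
      cl (syl_word (c @ d)) \<cdot> V (tgt \<Gamma> e') (\<delta> + lab_tgt \<Gamma> e' *v z) \<cdot> E (opp \<Gamma> e')" for z
    using B cl_closed_path[OF B(7)] by (simp add: F.m_assoc E_V' src_in tgt_in opp_in V_add flip: V_add)
  show "edge_stab_act actA e' z (coset_pt cosetK False pos2) = coset_pt cosetK False pos2 \<longleftrightarrow>
      edge_stab_act actA e' z (coset_pt cosetK False (pos3 \<cdot> E (opp \<Gamma> e'))) = coset_pt cosetK False (pos3 \<cdot> E (opp \<Gamma> e'))"
  proof -
    have "edge_stab_act actA e' z (coset_pt cosetK False pos2) = coset_pt cosetK False pos2 \<longleftrightarrow>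
      (\<exists>k\<in>edgeL. cl (syl_word c) \<cdot> V (src \<Gamma> e') (\<alpha> + lab_src \<Gamma> e' *v z) = k \<cdot> pos2)"
      using B cl_closed_path[OF B(6)]
      by (simp add: edge_stab_act_coset_pt[OF subgroup_K] coset_pt_eq src_in F.m_assoc V_add)
    also have "\<dots> \<longleftrightarrow> (\<exists>k\<in>edgeL. cl (syl_word (c @ d)) \<cdot> V (tgt \<Gamma> e') (\<delta> + lab_tgt \<Gamma> e' *v z) = k \<cdot> pos3)"
      using L_match[of z] stab_iff[OF B(6,8)] stab_iff[OF B(7,9)] by simp
    also have "\<dots> \<longleftrightarrow> (\<exists>k\<in>edgeL. pos3 \<cdot> E (opp \<Gamma> e') \<cdot> V (src \<Gamma> e') (lab_src \<Gamma> e' *v z) = k \<cdot> (pos3 \<cdot> E (opp \<Gamma> e')))"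
    proof (rule bex_cong[OF HOL.refl])
      fix k assume "k \<in> edgeL"
      then have "k \<in> carrier (path_group \<Gamma>)" using B by auto
      then show "cl (syl_word (c @ d)) \<cdot> V (tgt \<Gamma> e') (\<delta> + lab_tgt \<Gamma> e' *v z) = k \<cdot> pos3 \<longleftrightarrow>
        pos3 \<cdot> E (opp \<Gamma> e') \<cdot> V (src \<Gamma> e') (lab_src \<Gamma> e' *v z) = k \<cdot> (pos3 \<cdot> E (opp \<Gamma> e'))"
        unfolding E3 using B cl_closed_path[OF B(7)] tgt_in opp_in
          F.right_cancel[of "E (opp \<Gamma> e')" "cl (syl_word (c @ d)) \<cdot> V (tgt \<Gamma> e') (\<delta> + lab_tgt \<Gamma> e' *v z)" "k \<cdot> pos3"]
        by (simp add: F.m_assoc)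
    qed
    also have "\<dots> \<longleftrightarrow> edge_stab_act actA e' z (coset_pt cosetK False (pos3 \<cdot> E (opp \<Gamma> e'))) = coset_pt cosetK False (pos3 \<cdot> E (opp \<Gamma> e'))"
      using B by (simp add: edge_stab_act_coset_pt[OF subgroup_K] coset_pt_eq src_in del: F.m_assoc)
    finally show ?thesis .
  qed
  have "\<not> crosses edgeL pos2 e' (opp \<Gamma> e') (cl (syl_word (c @ d)) \<cdot> V (src \<Gamma> (opp \<Gamma> e')) \<delta>)"
    by (rule not_crosses(2)[OF f3 _ nm2]) simp
  then show "coset_pt cosetK False (pos3 \<cdot> E (opp \<Gamma> e')) \<notin> edge_orbit actA e' (coset_pt cosetK False pos2)"
    using B by (auto simp: coset_pt_orbit_iff[OF subgroup_K] crosses_def src_opp)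
qed

lemma letter_action_act2: "letter_action (coset_space cosetK) actB"
  by (rule letter_action_swap[OF letter_action_act1 surg_basic(5) pts_closed(4,5) swap2])

lemma act_Vtx: "actA (Vtx v a) p = coset_act (Vtx v a) p" "actB (Vtx v a) p = coset_act (Vtx v a) p"
  by simp_all

text \<open>A clear word avoids the outer exchange, and the inner exchange only concerns points with
  the tag False, so neither is noticed on the side of \<open>H\<close>.\<close>

lemma run_True:
  assumes "w \<in> words \<Gamma>" "clear H (cl q) e w \<one>\<^bsub>path_group \<Gamma>\<^esub>"
  shows "run actA w rootX = coset_pt cosetK True (cl w)" "run actB w rootX = coset_pt cosetK True (cl w)"
proof -
  note B = surg_basic
  have 1: "actA (Edg \<epsilon>) (coset_pt cosetK True (cl u)) = coset_pt cosetK True (cl u \<cdot> E \<epsilon>)"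
    and 2: "actB (Edg \<epsilon>) (coset_pt cosetK True (cl u)) = coset_pt cosetK True (cl u \<cdot> E \<epsilon>)"
    if w: "w = u @ Edg \<epsilon> # r" for u \<epsilon> r
  proof -
    have uw: "u \<in> words \<Gamma>" "\<epsilon> \<in> edges \<Gamma>" using w assms(1) by auto
    then have "\<not> crosses H (cl q) e \<epsilon> (cl u)"
      using assms(2)[unfolded clear_def, rule_format, OF w] by simp
    then show 1: "actA (Edg \<epsilon>) (coset_pt cosetK True (cl u)) = coset_pt cosetK True (cl u \<cdot> E \<epsilon>)"
      using uw B e by (intro swap_coset_pt[OF subgroup_K]) (auto simp: coset_act_coset_pt[OF subgroup_K])
    show "actB (Edg \<epsilon>) (coset_pt cosetK True (cl u)) = coset_pt cosetK True (cl u \<cdot> E \<epsilon>)"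
      using uw B e by (intro swap_coset_pt[OF subgroup_K] 1) auto
  qed
  have u: "\<one>\<^bsub>path_group \<Gamma>\<^esub> \<cdot> cl u = cl u" if "w = u @ Edg \<epsilon> # r" for u \<epsilon> r
    using that assms(1) by simp
  have "run actA w rootX = coset_pt cosetK True (\<one>\<^bsub>path_group \<Gamma>\<^esub> \<cdot> cl w)"
    using 1 u assms(1) by (intro run_clear[where K = cosetK, OF subgroup_K]) (auto simp del: swap.simps(2))
  moreover have "run actB w rootX = coset_pt cosetK True (\<one>\<^bsub>path_group \<Gamma>\<^esub> \<cdot> cl w)"
    using 2 u assms(1) by (intro run_clear[where K = cosetK, OF subgroup_K]) (auto simp del: swap.simps(2))
  ultimately show "run actA w rootX = coset_pt cosetK True (cl w)" "run actB w rootX = coset_pt cosetK True (cl w)"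
    using assms(1) by simp_all
qed

lemma run_False:
  assumes S: "syl_path (src \<Gamma> e) S w" "reduced_path S" "S = (0, e) # t"
  shows "run actA (syl_word t @ [Vtx w b]) (coset_pt cosetK False (E e)) = coset_pt cosetK False (cl (syl_word S) \<cdot> V w b)"
    and "unmatched (c @ [(\<alpha>, e')]) S \<Longrightarrow> unmatched (c @ d @ [(\<delta>, opp \<Gamma> e')]) S \<Longrightarrow>
      run actB (syl_word t @ [Vtx w b]) (coset_pt cosetK False (E e)) = coset_pt cosetK False (cl (syl_word S) \<cdot> V w b)"
proof -
  note B = surg_basic
  have t: "syl_path (tgt \<Gamma> e) t w" "w \<in> verts \<Gamma>" using S syl_path_verts by auto
  have wt: "syl_word t @ [Vtx w b] \<in> words \<Gamma>" using syl_path_words[OF t(1)] t(2) by simp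
  have cS: "E e \<cdot> cl (syl_word t @ [Vtx w b]) = cl (syl_word S) \<cdot> V w b"
    using cl_syl_word_Cons[OF t(1) e, of 0] S(3) t syl_path_words[OF t(1)] cl_closed_path[OF t(1)] e B
    by (simp add: cl_append cl_Vtx cl_Nil V_zero F.m_assoc)
  have 1: "actA (Edg \<epsilon>) (coset_pt cosetK False (E e \<cdot> cl u')) = coset_pt cosetK False (E e \<cdot> cl u' \<cdot> E \<epsilon>)"
    and 2: "unmatched (c @ [(\<alpha>, e')]) S \<Longrightarrow> unmatched (c @ d @ [(\<delta>, opp \<Gamma> e')]) S \<Longrightarrow>
      actB (Edg \<epsilon>) (coset_pt cosetK False (E e \<cdot> cl u')) = coset_pt cosetK False (E e \<cdot> cl u' \<cdot> E \<epsilon>)"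
    if w: "syl_word t @ [Vtx w b] = u' @ Edg \<epsilon> # r" for u' \<epsilon> r
  proof -
    obtain m a t' where m: "t = m @ (a, \<epsilon>) # t'" "u' = syl_word m @ [Vtx (src \<Gamma> \<epsilon>) a]"
      using syl_word_split[OF w] by blast
    have S': "S = ((0, e) # m) @ (a, \<epsilon>) # t'" using S(3) m by simp
    have pm: "syl_path (tgt \<Gamma> e) m (src \<Gamma> \<epsilon>)" and \<epsilon>: "\<epsilon> \<in> edges \<Gamma>" using t m by (auto simp: syl_path_append)
    have uw: "u' \<in> words \<Gamma>" using m syl_path_words[OF pm] src_in[OF \<epsilon>] by simp
    have cu: "E e \<cdot> cl u' = cl (syl_word ((0, e) # m)) \<cdot> V (src \<Gamma> \<epsilon>) a"
      using cl_syl_word_Cons[OF pm e, of 0] m syl_path_words[OF pm] cl_closed_path[OF pm] e B src_in[OF \<epsilon>]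
      by (simp add: cl_append cl_Vtx cl_Nil V_zero F.m_assoc)
    note nx = not_crosses[OF S(1,2) S', folded cu]
    show 1: "actA (Edg \<epsilon>) (coset_pt cosetK False (E e \<cdot> cl u')) = coset_pt cosetK False (E e \<cdot> cl u' \<cdot> E \<epsilon>)"
      using nx(1) uw \<epsilon> B e by (intro swap_coset_pt[OF subgroup_K]) (auto simp: coset_act_coset_pt[OF subgroup_K])
    show "actB (Edg \<epsilon>) (coset_pt cosetK False (E e \<cdot> cl u')) = coset_pt cosetK False (E e \<cdot> cl u' \<cdot> E \<epsilon>)"
      if "unmatched (c @ [(\<alpha>, e')]) S" "unmatched (c @ d @ [(\<delta>, opp \<Gamma> e')]) S"
      using nx(2,3) that uw \<epsilon> B e by (intro swap_coset_pt[OF subgroup_K] 1) auto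
  qed
  show "run actA (syl_word t @ [Vtx w b]) (coset_pt cosetK False (E e)) = coset_pt cosetK False (cl (syl_word S) \<cdot> V w b)"
    unfolding cS[symmetric] using wt e by (intro run_clear[OF subgroup_K] 1) auto
  show "run actB (syl_word t @ [Vtx w b]) (coset_pt cosetK False (E e)) = coset_pt cosetK False (cl (syl_word S) \<cdot> V w b)"
    if "unmatched (c @ [(\<alpha>, e')]) S" "unmatched (c @ d @ [(\<delta>, opp \<Gamma> e')]) S"
    unfolding cS[symmetric] using wt e that by (intro run_clear[OF subgroup_K] 2) auto
qed

lemma unmatched_c: "unmatched (c @ [(\<alpha>, e')]) c" "unmatched (c @ d @ [(\<delta>, opp \<Gamma> e')]) c" "unmatched (c @ d @ [(\<delta>, opp \<Gamma> e')]) (c @ d)"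
  by (rule unmatched_length; simp)+

text \<open>The outer exchange sends the letter \<open>e\<close> from the point at
  \<open>cl q\<close> into the new piece. The inner exchange does not disturb this, because
  \<open>c\<close> starts with the entrance and meets none of the inner edges.\<close>

lemma cross_e: "actA (Edg e) (coset_pt cosetK True (cl q)) = coset_pt cosetK False (E e)" "actB (Edg e) (coset_pt cosetK True (cl q)) = coset_pt cosetK False (E e)"
proof -
  note B = surg_basic
  have "actA (Edg e) (coset_pt cosetK True (cl q)) = coset_act (Edg e) (coset_pt cosetK False \<one>\<^bsub>path_group \<Gamma>\<^esub>)"
    by (rule swap_Edg[OF letter_action_coset[of cosetK, OF subgroup_K] e pts_closed(1,2) swap1])
  then show 1: "actA (Edg e) (coset_pt cosetK True (cl q)) = coset_pt cosetK False (E e)"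
    using e by (simp add: coset_act_coset_pt[OF subgroup_K])
  obtain c' where c': "c = (0, e) # c'" using hd_c by blast
  have nx: "\<not> crosses edgeL pos2 e' e \<one>\<^bsub>path_group \<Gamma>\<^esub>" "\<not> crosses edgeL (pos3 \<cdot> E (opp \<Gamma> e')) e' e \<one>\<^bsub>path_group \<Gamma>\<^esub>"
    using not_crosses(2)[OF B(6,8), of "[]" 0 e c'] not_crosses(3)[OF B(6,8), of "[]" 0 e c'] unmatched_c c' B
    by (auto simp: cl_Nil V_zero)
  have "actB (Edg e) (coset_pt cosetK True (cl q)) = actA (Edg e) (coset_pt cosetK True (cl q))"
  proof (rule swap_other)
    show "coset_pt cosetK True (cl q) \<notin> edge_orbit actA e' (coset_pt cosetK False pos2) \<and>
        coset_pt cosetK True (cl q) \<notin> edge_orbit actA e' (coset_pt cosetK False (pos3 \<cdot> E (opp \<Gamma> e')))"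
      using B by (simp add: coset_pt_orbit_iff[OF subgroup_K])
    assume "e = opp \<Gamma> e'"
    then have "E e \<noteq> k \<cdot> g \<cdot> V (src \<Gamma> e') (lab_src \<Gamma> e' *v z)"
      if "\<not> crosses edgeL g e' e \<one>\<^bsub>path_group \<Gamma>\<^esub>" "k \<in> edgeL" for k z g
      using that e unfolding crosses_def by (metis E_closed F.l_one)
    then show "actA (Edg e) (coset_pt cosetK True (cl q)) \<notin> edge_orbit actA e' (coset_pt cosetK False pos2) \<and>
        actA (Edg e) (coset_pt cosetK True (cl q)) \<notin> edge_orbit actA e' (coset_pt cosetK False (pos3 \<cdot> E (opp \<Gamma> e')))"
      unfolding 1 using nx B e
      by (simp add: coset_pt_orbit_iff[OF subgroup_K] del: ball_simps bex_simps image_iff)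
  qed
  then show "actB (Edg e) (coset_pt cosetK True (cl q)) = coset_pt cosetK False (E e)" using 1 by simp
qed

lemma run_through:
  assumes S: "syl_path (src \<Gamma> e) S w" "reduced_path S" "S = (0, e) # t"
  shows "run actA (q @ Edg e # syl_word t @ [Vtx w b]) rootX = coset_pt cosetK False (cl (syl_word S) \<cdot> V w b)"
    and "unmatched (c @ [(\<alpha>, e')]) S \<Longrightarrow> unmatched (c @ d @ [(\<delta>, opp \<Gamma> e')]) S \<Longrightarrow>
      run actB (q @ Edg e # syl_word t @ [Vtx w b]) rootX = coset_pt cosetK False (cl (syl_word S) \<cdot> V w b)"
  using run_True[OF surg_basic(2) q_clear] run_False[OF S] cross_e by (simp_all del: swap.simps)

lemma through_path:
  assumes "syl_path (src \<Gamma> e) ((0, e) # t) w"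
  shows "path_word \<Gamma> v\<^sub>0 (q @ Edg e # syl_word t @ [Vtx w b]) w"
proof -
  have "path_word \<Gamma> (tgt \<Gamma> e) (syl_word t) w" "w \<in> verts \<Gamma>" using assms syl_path_path_word syl_path_verts by auto
  moreover from this have "path_word \<Gamma> w [Vtx w b] w" by (intro path_word.intros)
  ultimately have "path_word \<Gamma> (tgt \<Gamma> e) (syl_word t @ [Vtx w b]) w" using path_word_append by blast
  then show ?thesis using path_word.Edg[OF e] path_word_append[OF q] by blast
qed

text \<open>The words \<open>W n\<close> lead to vertices at different distances from the entrance.
  If two of these were in one orbit, \<open>reduced_unique\<close> would slide paths of different
  lengths onto each other.\<close>

lemma infinite_stabilizers:
  assumes "act \<in> {actA, actB}"
  shows "infinite_graph (tree_quotient \<Gamma> v\<^sub>0 (stabilizer act rootX v\<^sub>0))"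
proof -
  note B = surg_basic
  have fs: "letter_action (coset_space cosetK) act" using assms letter_action_act1 letter_action_act2 by auto
  obtain S' where S': "S4 = (0, e) # S'" using S4(1) by blast
  obtain t w where tw: "\<And>n. length (t n) = n \<and> syl_path (src \<Gamma> e) (S4 @ t n) (w n) \<and> reduced_path (S4 @ t n)"
    using S4(2) by metis
  define W where "W n = q @ Edg e # syl_word (S' @ t n) @ [Vtx (w n) 0]" for n
  have S: "syl_path (src \<Gamma> e) (S4 @ t n) (w n)" "reduced_path (S4 @ t n)" "S4 @ t n = (0, e) # (S' @ t n)" for n
    using tw[of n] S' by auto
  have W: "path_word \<Gamma> v\<^sub>0 (W n) (w n)" "W n \<in> words \<Gamma>" for n
    using through_path[of "S' @ t n" "w n" 0] S path_word_words unfolding W_def by (metis)+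
  have wv: "w n \<in> verts \<Gamma>" for n using S syl_path_verts by blast
  have cS: "cl (syl_word (S4 @ t n)) \<in> carrier (path_group \<Gamma>)" for n using S cl_closed_path by blast
  have run: "run act (W n) rootX = coset_pt cosetK False (cl (syl_word (S4 @ t n)))" for n
    using run_through[OF S, of n 0] nm24 nm34 assms wv cS unfolding W_def by (auto simp: V_zero simp del: syl_word_append)
  show ?thesis
  proof (rule infinite_tree_quotientI[where w = w and p = "\<lambda>n. cl (W n)"])
    show "subgroup (stabilizer act rootX v\<^sub>0) (fundamental_group \<Gamma> v\<^sub>0)"
      by (rule subgroup_stabilizer[OF fs pts_closed(3) B(3)])
    show "cl (W n) \<in> path_classes \<Gamma> v\<^sub>0 (w n)" for n using W by (auto simp: path_classes_def)
    fix n m h a assume h: "h \<in> stabilizer act rootX v\<^sub>0" and unmatched: "w n = w m"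
      and eq: "cl (W n) = h \<cdot> cl (W m) \<cdot> V (w m) a"
    obtain v where v: "path_word \<Gamma> v\<^sub>0 v v\<^sub>0" "run act v rootX = rootX" "h = cl v"
      using h by (auto simp: stabilizer_def)
    have "v \<in> words \<Gamma>" using v path_word_words by blast
    then have "cl (W n) = cl (v @ W m @ [Vtx (w m) a])"
      using eq v W wv by (simp add: cl_append cl_Vtx cl_Nil F.m_assoc)
    then have "(W n, v @ W m @ [Vtx (w m) a]) \<in> word_cong \<Gamma>"
      using W wv \<open>v \<in> words \<Gamma>\<close> by (simp add: word_class_eq_iff)
    then have "run act (W n) rootX = run act [Vtx (w m) a] (run act (W m) rootX)"
      using run_cong[OF fs _ pts_closed(3)] v by fastforce
    also have "\<dots> = coset_act (Vtx (w m) a) (coset_pt cosetK False (cl (syl_word (S4 @ t m))))"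
      using assms run[of m] act_Vtx by auto
    also have "\<dots> = coset_pt cosetK False (cl (syl_word (S4 @ t m)) \<cdot> V (w m) a)"
      using cS wv by (intro coset_act_coset_pt[OF subgroup_K])
    finally have "coset_pt cosetK False (cl (syl_word (S4 @ t m)) \<cdot> V (w m) a) = coset_pt cosetK False (cl (syl_word (S4 @ t n)))"
      using run by simp
    then obtain k where "k \<in> edgeL" "cl (syl_word (S4 @ t m)) \<cdot> V (w m) a = k \<cdot> cl (syl_word (S4 @ t n))"
      using coset_pt_eq cS wv by auto
    then obtain l where "V (src \<Gamma> e) l \<cdot> cl (syl_word (S4 @ t n)) \<cdot> V (w m) 0 = cl (syl_word (S4 @ t m)) \<cdot> V (w m) a"
      using cS wv B by (auto simp: V_zero simp del: syl_word_append)
    then have "slide l (S4 @ t n) 0 (S4 @ t m) a"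
      using reduced_unique S unmatched by metis
    then show "n = m" using slide_length tw by fastforce
  qed (use B wv in auto)
qed

text \<open>The separating element \<open>?r\<close> runs through \<open>c\<close>, crosses
  \<open>e'\<close> and returns from the end of \<open>c @ d\<close>. In \<open>actB\<close> the
  crossing leads exactly to that end. In \<open>actA\<close> it does not, since
  \<open>c @ [(\<alpha>, e')]\<close> cannot be slid onto \<open>c @ d\<close>.\<close>

lemma stabilizers_differ: "stabilizer actA rootX v\<^sub>0 \<noteq> stabilizer actB rootX v\<^sub>0"
proof -
  note B = surg_basic
  obtain c' where c': "c = (0, e) # c'" using hd_c by blast
  let ?w = "q @ Edg e # syl_word c' @ [Vtx (src \<Gamma> e') \<alpha>]" and ?w3 = "q @ Edg e # syl_word (c' @ d) @ [Vtx (tgt \<Gamma> e') \<delta>]"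
  let ?w2 = "?w @ [Edg e']"
  have pe: "path_word \<Gamma> (src \<Gamma> e') [Edg e'] (tgt \<Gamma> e')"
    using B by (auto intro!: path_word.intros tgt_in)
  have "path_word \<Gamma> v\<^sub>0 ?w (src \<Gamma> e')" using B(6) c' through_path by simp
  then have p2: "path_word \<Gamma> v\<^sub>0 ?w2 (tgt \<Gamma> e')" using pe path_word_append by blast
  have p3: "path_word \<Gamma> v\<^sub>0 ?w3 (tgt \<Gamma> e')" using B(7) c' through_path[of "c' @ d"] by simp
  let ?r = "?w2 @ inv_word ?w3"
  have pr: "path_word \<Gamma> v\<^sub>0 ?r v\<^sub>0" using p2 path_word_inv[OF p3] path_word_append by blast
  have w23: "?w2 \<in> words \<Gamma>" "?w3 \<in> words \<Gamma>" using p2 p3 path_word_words by blast+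
  have same: "run act ?r rootX = rootX \<longleftrightarrow> run act ?w2 rootX = run act ?w3 rootX" if fs: "letter_action (coset_space cosetK) act" for act
  proof
    assume "run act ?w2 rootX = run act ?w3 rootX"
    then show "run act ?r rootX = rootX" using run_inv_word[OF fs w23(2) pts_closed(3)] by (metis run_simps(3))
  next
    assume "run act ?r rootX = rootX"
    then have "run act (inv_word ?w3) (run act ?w2 rootX) = run act (inv_word ?w3) (run act ?w3 rootX)"
      using run_inv_word[OF fs w23(2) pts_closed(3)] by (metis run_simps(3))
    then show "run act ?w2 rootX = run act ?w3 rootX"
      using run_inj[OF fs inv_word_words[OF w23(2)]] run_closed[OF fs _ pts_closed(3)] w23 by blast
  qed
  have S3: "c @ d @ [(\<delta>, opp \<Gamma> e')] = (c @ d) @ (\<delta>, opp \<Gamma> e') # []" by simp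
  have g: "pos2 \<in> carrier (path_group \<Gamma>)" "pos3 \<in> carrier (path_group \<Gamma>)" using B by auto
  have r1: "run actA ?w rootX = coset_pt cosetK False pos2" "run actB ?w rootX = coset_pt cosetK False pos2"
    "run actA ?w3 rootX = coset_pt cosetK False pos3" "run actB ?w3 rootX = coset_pt cosetK False pos3"
    using run_through[OF B(6,8) c', of \<alpha>] run_through[OF B(7,9), of "c' @ d" \<delta>] unmatched_c nm2' c' by auto
  have "run actB ?w2 rootX = actB (Edg e') (coset_pt cosetK False pos2)" using r1(2) by (simp del: swap.simps)
  also have "\<dots> = actA (Edg e') (coset_pt cosetK False (pos3 \<cdot> E (opp \<Gamma> e')))"
    by (rule swap_Edg[OF letter_action_act1 B(5) pts_closed(4,5) swap2])
  finally have 1: "run actB ?w2 rootX = actA (Edg e') (coset_pt cosetK False (pos3 \<cdot> E (opp \<Gamma> e')))" .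
  have 2: "coset_pt cosetK False (pos3 \<cdot> E (opp \<Gamma> e')) = actA (Edg (opp \<Gamma> e')) (coset_pt cosetK False pos3)"
    using not_crosses(1)[OF f3 S3] B g e
    by (intro swap_coset_pt[OF subgroup_K, symmetric]) (auto simp: coset_act_coset_pt[OF subgroup_K] opp_in src_opp)
  have "actA (Edg e') (actA (Edg (opp \<Gamma> e')) (coset_pt cosetK False pos3)) = coset_pt cosetK False pos3"
    by (rule letter_actionD(7)[OF letter_action_act1 B(5)], rule coset_pt_closed[of cosetK, OF subgroup_K g(2)])
  then have "run actB ?w2 rootX = coset_pt cosetK False pos3"
    by (rule HOL.trans[OF HOL.trans[OF 1 arg_cong[where f = "actA (Edg e')", OF 2]]])
  then have "run actB ?w2 rootX = run actB ?w3 rootX" unfolding r1(4) .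
  then have "run actB ?r rootX = rootX" by (rule same[OF letter_action_act2, THEN iffD2])
  then have in2: "cl ?r \<in> stabilizer actB rootX v\<^sub>0"
    by (rule stabilizer_iff[OF letter_action_act2 pts_closed(3) pr, THEN iffD2])
  have "cl ?r \<notin> stabilizer actA rootX v\<^sub>0"
  proof
    assume "cl ?r \<in> stabilizer actA rootX v\<^sub>0"
    then have "run actA ?r rootX = rootX" by (rule stabilizer_iff[OF letter_action_act1 pts_closed(3) pr, THEN iffD1])
    then have "run actA ?w2 rootX = run actA ?w3 rootX" by (rule same[OF letter_action_act1, THEN iffD1])
    moreover have "run actA ?w2 rootX = actA (Edg e') (coset_pt cosetK False pos2)" using r1(1) by (simp del: swap.simps)
    moreover have "actA (Edg e') (coset_pt cosetK False pos2) = coset_pt cosetK False (pos2 \<cdot> E e')"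
      using not_crosses(1)[OF f2, of c \<alpha> e' "[]"] B g e
      by (intro swap_coset_pt[OF subgroup_K]) (auto simp: coset_act_coset_pt[OF subgroup_K])
    ultimately have "coset_pt cosetK False pos3 = coset_pt cosetK False (pos2 \<cdot> E e')" using r1(3) by simp
    then obtain k where "k \<in> edgeL" "pos3 = k \<cdot> (pos2 \<cdot> E e')" using coset_pt_eq g B by auto
    moreover have "cl (syl_word (c @ [(\<alpha>, e')])) = pos2 \<cdot> E e'"
      using syl_path_words[OF B(6)] cl_closed_path[OF B(6)] B src_in[OF B(5)] by (simp add: cl_append cl_Vtx cl_Edg cl_Nil F.m_assoc)
    ultimately obtain l where "V (src \<Gamma> e) l \<cdot> cl (syl_word (c @ [(\<alpha>, e')])) \<cdot> V (tgt \<Gamma> e') 0 = pos3"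
      using g B tgt_in[OF B(5)] by (auto simp: V_zero F.m_assoc simp del: syl_word_append)
    moreover have "syl_path (src \<Gamma> e) (c @ [(\<alpha>, e')]) (tgt \<Gamma> e')" using B by (auto simp: syl_path_append tgt_in)
    ultimately have slide: "slide l (c @ [(\<alpha>, e')]) 0 (c @ d) \<delta>"
      using reduced_unique f2(2) B(7,9) by blast
    have "c @ d = (c @ butlast d) @ [last d]" using dv23(1) by simp
    then show False using nm2' slide unfolding unmatched_def by metis
  qed
  then show ?thesis using in2 by blast
qed

lemma stabilizer_agree:
  assumes "act \<in> {actA, actB}" "path_word \<Gamma> v\<^sub>0 w v\<^sub>0" "clear H (cl q) e w \<one>\<^bsub>path_group \<Gamma>\<^esub>"
  shows "cl w \<in> stabilizer act rootX v\<^sub>0 \<longleftrightarrow> cl w \<in> H"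
proof -
  have w: "w \<in> words \<Gamma>" using assms path_word_words by blast
  have fs: "letter_action (coset_space cosetK) act" using assms letter_action_act1 letter_action_act2 by auto
  have "run act w rootX = coset_pt cosetK True (cl w)" using run_True[OF w assms(3)] assms(1) by auto
  moreover have "coset_pt cosetK True (cl w) = rootX \<longleftrightarrow> cl w \<in> H"
  proof -
    have "k \<in> carrier (path_group \<Gamma>)" if "k \<in> H" for k using that subgroup.subset[OF H] by blast
    then have "(\<exists>k\<in>H. cl w = k \<cdot> \<one>\<^bsub>path_group \<Gamma>\<^esub>) \<longleftrightarrow> cl w \<in> H" by (metis F.r_one)
    moreover have "coset_pt cosetK True (cl w) = rootX \<longleftrightarrow> (\<exists>k\<in>cosetK True. cl w = k \<cdot> \<one>\<^bsub>path_group \<Gamma>\<^esub>)"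
      using w coset_pt_eq_iff[of cosetK, OF subgroup_K, of "cl w" "\<one>\<^bsub>path_group \<Gamma>\<^esub>" True True] by simp
    ultimately show ?thesis by simp
  qed
  ultimately show ?thesis using stabilizer_iff[OF fs pts_closed(3) assms(2)] by simp
qed

lemma surgery:
  obtains H1 H2 where "subgroup H1 (fundamental_group \<Gamma> v\<^sub>0)" "subgroup H2 (fundamental_group \<Gamma> v\<^sub>0)" "H1 \<noteq> H2"
    "infinite_graph (tree_quotient \<Gamma> v\<^sub>0 H1)" "infinite_graph (tree_quotient \<Gamma> v\<^sub>0 H2)"
    "\<And>w. path_word \<Gamma> v\<^sub>0 w v\<^sub>0 \<Longrightarrow> clear H (cl q) e w \<one>\<^bsub>path_group \<Gamma>\<^esub> \<Longrightarrow>
      (cl w \<in> H1 \<longleftrightarrow> cl w \<in> H) \<and> (cl w \<in> H2 \<longleftrightarrow> cl w \<in> H)"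
proof (rule that[of "stabilizer actA rootX v\<^sub>0" "stabilizer actB rootX v\<^sub>0"])
  show "subgroup (stabilizer actA rootX v\<^sub>0) (fundamental_group \<Gamma> v\<^sub>0)"
    by (rule subgroup_stabilizer[OF letter_action_act1 pts_closed(3) surg_basic(3)])
  show "subgroup (stabilizer actB rootX v\<^sub>0) (fundamental_group \<Gamma> v\<^sub>0)"
    by (rule subgroup_stabilizer[OF letter_action_act2 pts_closed(3) surg_basic(3)])
  show "(cl w \<in> stabilizer actA rootX v\<^sub>0 \<longleftrightarrow> cl w \<in> H) \<and> (cl w \<in> stabilizer actB rootX v\<^sub>0 \<longleftrightarrow> cl w \<in> H)"
    if "path_word \<Gamma> v\<^sub>0 w v\<^sub>0" "clear H (cl q) e w \<one>\<^bsub>path_group \<Gamma>\<^esub>" for w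
    using stabilizer_agree[OF _ that] by simp
qed (use stabilizers_differ infinite_stabilizers in auto)

end

end

subsection \<open>Subgroups of \<open>\<int>\<^sup>d\<close>\<close>

text \<open>Subgroups of \<int>^d as plain sets of vectors; closure under differences is the
  one-step subgroup criterion.\<close>

definition zsub :: "(int ^ 'n) set \<Rightarrow> bool" where
  "zsub L \<longleftrightarrow> 0 \<in> L \<and> (\<forall>x\<in>L. \<forall>y\<in>L. x - y \<in> L)"

lemma zsub_simps:
  assumes "zsub L"
  shows "0 \<in> L" "x \<in> L \<Longrightarrow> y \<in> L \<Longrightarrow> x - y \<in> L" "x \<in> L \<Longrightarrow> - x \<in> L"
    "x \<in> L \<Longrightarrow> y \<in> L \<Longrightarrow> x + y \<in> L"
proof -
  show 0: "0 \<in> L" and d: "x \<in> L \<Longrightarrow> y \<in> L \<Longrightarrow> x - y \<in> L" for x y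
    using assms by (auto simp: zsub_def)
  show m: "x \<in> L \<Longrightarrow> - x \<in> L" for x using d[OF 0, of x] by simp
  show "x \<in> L \<Longrightarrow> y \<in> L \<Longrightarrow> x + y \<in> L" using d[of x "- y"] m[of y] by simp
qed

lemma zsub_smult:
  assumes "zsub L" "x \<in> L"
  shows "k *s x \<in> L"
proof -
  have n: "int n *s x \<in> L" for n
    by (induction n) (use zsub_simps[OF assms(1)] assms(2) in \<open>auto simp: vector_sadd_rdistrib\<close>)
  show ?thesis
  proof (cases "k \<ge> 0")
    case True
    then show ?thesis using n[of "nat k"] by simp
  next
    case False
    have "- (int (nat (- k)) *s x) \<in> L" using zsub_simps(3)[OF assms(1)] n by blast
    moreover have "- (int (nat (- k)) *s x) = k *s x" using False by (simp add: vec_eq_iff)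
    ultimately show ?thesis by simp
  qed
qed

text \<open>The \<open>i\<close>-th coordinates form a subgroup of \<int>, so they all vanish or are
  multiples of the smallest positive one.\<close>

lemma zsub_coordinate_cases:
  fixes L :: "(int ^ 'n) set" and i :: 'n
  assumes "zsub L"
  obtains "\<And>x. x \<in> L \<Longrightarrow> x $ i = 0"
  | l where "l \<in> L" "l $ i > 0" "\<And>x. x \<in> L \<Longrightarrow> l $ i dvd x $ i"
proof (cases "\<forall>x\<in>L. x $ i = 0")
  case False
  then obtain x where x: "x \<in> L" "x $ i \<noteq> 0" by blast
  have "\<exists>n l. l \<in> L \<and> l $ i = int n \<and> n > 0"
  proof (cases "x $ i > 0")
    case True
    then show ?thesis using x by (intro exI[of _ "nat (x $ i)"] exI[of _ x]) auto
  next
    case False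
    then show ?thesis using x zsub_simps(3)[OF assms]
      by (intro exI[of _ "nat (- x $ i)"] exI[of _ "- x"]) auto
  qed
  then obtain n where n: "\<exists>l. l \<in> L \<and> l $ i = int n \<and> n > 0"
    and least: "\<And>m. m < n \<Longrightarrow> \<not> (\<exists>l. l \<in> L \<and> l $ i = int m \<and> m > 0)"
    using exists_least_iff[of "\<lambda>n. \<exists>l. l \<in> L \<and> l $ i = int n \<and> n > 0"] by blast
  then obtain l where l: "l \<in> L" "l $ i = int n" "n > 0" by blast
  have "l $ i dvd y $ i" if "y \<in> L" for y
  proof (rule ccontr)
    assume nd: "\<not> l $ i dvd y $ i"
    let ?r = "y - (y $ i div l $ i) *s l"
    have r: "?r \<in> L" by (rule zsub_simps(2)[OF assms that zsub_smult[OF assms l(1)]])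
    have ri: "?r $ i = y $ i mod l $ i"
      by (simp only: vector_minus_component vector_smult_component minus_div_mult_eq_mod)
    have "y $ i mod l $ i \<noteq> 0" using nd dvd_eq_mod_eq_0 by blast
    moreover have "0 \<le> y $ i mod l $ i" "y $ i mod l $ i < l $ i" using l by simp_all
    ultimately have pos: "0 < ?r $ i" "?r $ i < int n" unfolding ri l(2)[symmetric] by linarith+
    then have "nat (?r $ i) < n" "?r $ i = int (nat (?r $ i))" "nat (?r $ i) > 0" by linarith+
    then show False using least r by metis
  qed
  then show ?thesis using that(2) l by simp
qed (use that in blast)

lemma zsub_kernel: "zsub L \<Longrightarrow> zsub {x \<in> L. x $ i = 0}"
  by (auto simp: zsub_def)

text \<open>Induction on the set of coordinates that may be nonzero: an element whose
  \<open>i\<close>-th coordinate generates all the others is added to generators of the kernel of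
  that coordinate.\<close>

lemma zsub_finitely_generated:
  fixes L :: "(int ^ 'n) set"
  assumes "zsub L"
  shows "\<exists>P. finite P \<and> P \<subseteq> L \<and> (\<forall>M. zsub M \<longrightarrow> P \<subseteq> M \<longrightarrow> L \<subseteq> M)"
proof -
  have gen: "\<exists>P. finite P \<and> P \<subseteq> L \<and> (\<forall>M. zsub M \<longrightarrow> P \<subseteq> M \<longrightarrow> L \<subseteq> M)"
    if "finite I" "zsub L" "\<forall>x\<in>L. \<forall>i. i \<notin> I \<longrightarrow> x $ i = 0" for I and L :: "(int ^ 'n) set"
    using that
  proof (induction I arbitrary: L rule: finite_induct)
    case empty
    then have "L \<subseteq> {0}" by (auto simp: vec_eq_iff)
    then show ?case by (intro exI[of _ "{}"]) (auto simp: zsub_def)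
  next
    case (insert i I)
    from zsub_coordinate_cases[OF insert.prems(1), of i] show ?case
    proof cases
      case 1
      then have "\<forall>x\<in>L. \<forall>j. j \<notin> I \<longrightarrow> x $ j = 0" using insert.prems(2) by (metis insertE)
      then show ?thesis using insert.IH insert.prems(1) by blast
    next
      case (2 l)
      have "\<forall>x\<in>{x \<in> L. x $ i = 0}. \<forall>j. j \<notin> I \<longrightarrow> x $ j = 0" using insert.prems(2) by auto
      from insert.IH[OF zsub_kernel[OF insert.prems(1)] this]
      obtain P where P: "finite P" "P \<subseteq> {x \<in> L. x $ i = 0}"
        and PM: "\<forall>M. zsub M \<longrightarrow> P \<subseteq> M \<longrightarrow> {x \<in> L. x $ i = 0} \<subseteq> M" by (elim exE conjE) (rule that)
      have "L \<subseteq> M" if M: "zsub M" "insert l P \<subseteq> M" for M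
      proof
        fix x assume x: "x \<in> L"
        let ?y = "x - (x $ i div l $ i) *s l"
        have "?y \<in> L" using zsub_simps(2)[OF insert.prems(1) x zsub_smult[OF insert.prems(1) 2(1)]] .
        moreover have "?y $ i = 0" using 2(3)[OF x] by simp
        moreover have "{x \<in> L. x $ i = 0} \<subseteq> M" using PM M by blast
        ultimately have "?y \<in> M" by blast
        moreover have "(x $ i div l $ i) *s l \<in> M" using zsub_smult[OF M(1)] M(2) by auto
        ultimately have "?y + (x $ i div l $ i) *s l \<in> M" by (rule zsub_simps(4)[OF M(1)])
        then show "x \<in> M" by simp
      qed
      moreover have "finite (insert l P)" "insert l P \<subseteq> L" using P 2(1) by auto
      ultimately show ?thesis by blast
    qed
  qed
  show ?thesis by (rule gen[OF finite_class.finite_UNIV assms]) simp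
qed

text \<open>This is residual finiteness of the finitely generated abelian group \<int>^d modulo
  \<open>L\<close>. It will keep finitely many words out of an enlarged subgroup.\<close>

lemma zsub_separable:
  fixes L :: "(int ^ 'n) set"
  assumes "zsub L" "\<And>m. m > 0 \<Longrightarrow> \<exists>l\<in>L. \<exists>y. z = l + m *s y"
  shows "z \<in> L"
proof -
  have gen: "z \<in> L" if "finite I" "zsub L" "\<forall>x\<in>L. \<forall>i. i \<notin> I \<longrightarrow> x $ i = 0" "\<forall>i. i \<notin> I \<longrightarrow> z $ i = 0"
    "\<And>m. m > 0 \<Longrightarrow> \<exists>l\<in>L. \<exists>y. z = l + m *s y" for I and L :: "(int ^ 'n) set" and z
    using that
  proof (induction I arbitrary: L z rule: finite_induct)
    case empty
    then have "z = 0" by (auto simp: vec_eq_iff)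
    then show ?case using empty zsub_simps(1) by blast
  next
    case (insert i I)
    from zsub_coordinate_cases[OF insert.prems(1), of i] show ?case
    proof cases
      case 1
      \<comment> \<open>The modulus exceeds the absolute value of \<open>z $ i\<close>, so
        divisibility forces this coordinate to be 0.\<close>
      obtain l y where "l \<in> L" "z = l + (\<bar>z $ i\<bar> + 1) *s y" using insert.prems(4)[of "\<bar>z $ i\<bar> + 1"] by auto
      then have "z $ i = (\<bar>z $ i\<bar> + 1) * y $ i" using 1 by (metis add_0 vector_add_component vector_smult_component)
      moreover have "\<bar>z $ i\<bar> < \<bar>(\<bar>z $ i\<bar> + 1) * y $ i\<bar>" if "y $ i \<noteq> 0"
      proof -
        have "(\<bar>z $ i\<bar> + 1) * 1 \<le> (\<bar>z $ i\<bar> + 1) * \<bar>y $ i\<bar>" using that by (intro mult_left_mono) auto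
        moreover have "\<bar>(\<bar>z $ i\<bar> + 1) * y $ i\<bar> = (\<bar>z $ i\<bar> + 1) * \<bar>y $ i\<bar>" by (simp add: abs_mult)
        moreover have "\<bar>z $ i\<bar> < (\<bar>z $ i\<bar> + 1) * 1" by simp
        ultimately show ?thesis by (metis order_less_le_trans)
      qed
      ultimately have "z $ i = 0" by (metis less_irrefl mult_zero_right)
      then have "\<forall>j. j \<notin> I \<longrightarrow> z $ j = 0" "\<forall>x\<in>L. \<forall>j. j \<notin> I \<longrightarrow> x $ j = 0"
        using insert.prems(2,3) 1 by (metis insertE)+
      then show ?thesis using insert.IH insert.prems(1,4) by blast
    next
      case (2 l)
      let ?c = "l $ i"
      obtain l1 y1 where "l1 \<in> L" "z = l1 + ?c *s y1" using insert.prems(4) 2 by blast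
      then have "?c dvd z $ i" using 2 by simp
      then obtain k where k: "z $ i = ?c * k" by blast
      let ?z = "z - k *s l"
      have "?z \<in> {x \<in> L. x $ i = 0}"
      proof (rule insert.IH[OF zsub_kernel[OF insert.prems(1)]])
        show "\<forall>x\<in>{x \<in> L. x $ i = 0}. \<forall>j. j \<notin> I \<longrightarrow> x $ j = 0" using insert.prems(2) by auto
        show "\<forall>j. j \<notin> I \<longrightarrow> ?z $ j = 0"
        proof (intro allI impI)
          fix j assume "j \<notin> I"
          then show "?z $ j = 0" using insert.prems(2,3) 2 k by (cases "j = i") auto
        qed
        fix m :: int assume m: "m > 0"
        \<comment> \<open>The extra factor \<open>?c\<close> leaves room for a correction: adding
          the multiple \<open>m * y $ i\<close> of \<open>l\<close> brings
          \<open>l' - k *s l\<close> into the kernel of the coordinate, while the error stays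
          divisible by \<open>m\<close>.\<close>
        then obtain l' y where l': "l' \<in> L" "z = l' + (m * ?c) *s y"
          using insert.prems(4)[of "m * ?c"] 2 by auto
        let ?l = "l' - k *s l + (m * y $ i) *s l"
        have "?l \<in> L"
          by (intro zsub_simps(2,4)[OF insert.prems(1)] zsub_smult[OF insert.prems(1)] l'(1) 2(1))
        moreover have "?l $ i = 0" using arg_cong[OF l'(2), of "\<lambda>v. v $ i"] k by (simp add: algebra_simps)
        moreover have "?z = ?l + m *s (?c *s y - y $ i *s l)"
          using l'(2) by (simp add: vec_eq_iff algebra_simps)
        ultimately show "\<exists>l\<in>{x \<in> L. x $ i = 0}. \<exists>y. ?z = l + m *s y" by blast
      qed
      then have "?z + k *s l \<in> L"
        by (intro zsub_simps(4)[OF insert.prems(1)] zsub_smult[OF insert.prems(1)] 2(1)) simp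
      then show ?thesis by simp
    qed
  qed
  show ?thesis by (rule gen[OF finite_class.finite_UNIV assms(1) _ _ assms(2)]) simp_all
qed

section \<open>Vertices and edges of the quotient as double cosets\<close>

context gbs_graph
begin

definition vertex_orbit :: "('v, 'e, 'd) word set set \<Rightarrow> 'v \<Rightarrow> ('v, 'e, 'd) word set \<Rightarrow> ('v \<times> ('v, 'e, 'd) word set set) set" where
  "vertex_orbit H v p = (\<lambda>h. tree_action \<Gamma> h (v, p <#\<^bsub>path_group \<Gamma>\<^esub> vertex_group \<Gamma> v)) ` H"

definition edge_orb :: "('v, 'e, 'd) word set set \<Rightarrow> 'e \<Rightarrow> ('v, 'e, 'd) word set \<Rightarrow> ('e \<times> ('v, 'e, 'd) word set set) set" where
  "edge_orb H e p = (\<lambda>h. tree_action \<Gamma> h (e, p <#\<^bsub>path_group \<Gamma>\<^esub> edge_group \<Gamma> e)) ` H"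

lemma tree_quotient_simps:
  "verts (tree_quotient \<Gamma> v\<^sub>0 H) = {vertex_orbit H v p | v p. v \<in> verts \<Gamma> \<and> p \<in> path_classes \<Gamma> v\<^sub>0 v}"
  "edges (tree_quotient \<Gamma> v\<^sub>0 H) = {edge_orb H e p | e p. e \<in> edges \<Gamma> \<and> p \<in> path_classes \<Gamma> v\<^sub>0 (src \<Gamma> e)}"
  by (fastforce simp: tree_quotient_def quotient_graph_def bass_serre_tree_def vertex_orbit_def edge_orb_def)+

text \<open>Together with \<open>orbit_eqD\<close> this reduces the vertices and edges of the
  quotient to double cosets of \<open>H\<close> and a vertex or edge group.\<close>

lemma orbit_translate:
  assumes H: "subgroup H (path_group \<Gamma>)" and A: "subgroup A (path_group \<Gamma>)"
    and k: "k \<in> H" and p: "p \<in> carrier (path_group \<Gamma>)" and a: "a \<in> A"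
  shows "(\<lambda>h. tree_action \<Gamma> h (x, (k \<cdot> p \<cdot> a) <#\<^bsub>path_group \<Gamma>\<^esub> A)) ` H =
    (\<lambda>h. tree_action \<Gamma> h (x, p <#\<^bsub>path_group \<Gamma>\<^esub> A)) ` H"
proof -
  have A': "A \<subseteq> carrier (path_group \<Gamma>)" and H': "H \<subseteq> carrier (path_group \<Gamma>)"
    using A H subgroup.subset by blast+
  have aA: "a <#\<^bsub>path_group \<Gamma>\<^esub> A = A" using F.coset_join3[OF _ A a] A' a by blast
  have "(k \<cdot> p \<cdot> a) <#\<^bsub>path_group \<Gamma>\<^esub> A = (k \<cdot> p) <#\<^bsub>path_group \<Gamma>\<^esub> A"
    using F.lcos_m_assoc[OF A', of "k \<cdot> p" a] aA k p a A' H' by auto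
  then have 1: "tree_action \<Gamma> h (x, (k \<cdot> p \<cdot> a) <#\<^bsub>path_group \<Gamma>\<^esub> A) = tree_action \<Gamma> (h \<cdot> k) (x, p <#\<^bsub>path_group \<Gamma>\<^esub> A)"
    if "h \<in> H" for h
    using that k p H' by (auto simp: tree_action_def F.lcos_m_assoc[OF A'] F.m_assoc subset_eq)
  have "(\<lambda>h. h \<cdot> k) ` H = H"
  proof
    show "(\<lambda>h. h \<cdot> k) ` H \<subseteq> H" using k subgroup.m_closed[OF H] by auto
    show "H \<subseteq> (\<lambda>h. h \<cdot> k) ` H"
    proof
      fix h assume h: "h \<in> H"
      then have "h = h \<cdot> inv\<^bsub>path_group \<Gamma>\<^esub> k \<cdot> k" using k H' by (auto simp: F.m_assoc subset_eq)
      moreover have "h \<cdot> inv\<^bsub>path_group \<Gamma>\<^esub> k \<in> H" using h k subgroup.m_closed[OF H] subgroup.m_inv_closed[OF H] by blast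
      ultimately show "h \<in> (\<lambda>h. h \<cdot> k) ` H" by blast
    qed
  qed
  then have "(\<lambda>h. tree_action \<Gamma> h (x, p <#\<^bsub>path_group \<Gamma>\<^esub> A)) ` H =
      (\<lambda>h. tree_action \<Gamma> h (x, p <#\<^bsub>path_group \<Gamma>\<^esub> A)) ` (\<lambda>h. h \<cdot> k) ` H" by simp
  also have "\<dots> = (\<lambda>h. tree_action \<Gamma> (h \<cdot> k) (x, p <#\<^bsub>path_group \<Gamma>\<^esub> A)) ` H"
    unfolding image_image ..
  finally have "(\<lambda>h. tree_action \<Gamma> h (x, p <#\<^bsub>path_group \<Gamma>\<^esub> A)) ` H =
      (\<lambda>h. tree_action \<Gamma> (h \<cdot> k) (x, p <#\<^bsub>path_group \<Gamma>\<^esub> A)) ` H" .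
  then show ?thesis using 1 by simp
qed

lemma orbit_eqD:
  assumes H: "subgroup H (path_group \<Gamma>)" and A: "subgroup A (path_group \<Gamma>)" "subgroup B (path_group \<Gamma>)"
    and p: "p \<in> carrier (path_group \<Gamma>)" "p' \<in> carrier (path_group \<Gamma>)"
    and eq: "(\<lambda>h. tree_action \<Gamma> h (x, p <#\<^bsub>path_group \<Gamma>\<^esub> A)) ` H = (\<lambda>h. tree_action \<Gamma> h (x', p' <#\<^bsub>path_group \<Gamma>\<^esub> B)) ` H"
  shows "x = x' \<and> (\<exists>h\<in>H. \<exists>a\<in>B. p = h \<cdot> p' \<cdot> a)"
proof -
  have A': "A \<subseteq> carrier (path_group \<Gamma>)" "B \<subseteq> carrier (path_group \<Gamma>)" and H': "H \<subseteq> carrier (path_group \<Gamma>)"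
    using A H subgroup.subset by blast+
  have "tree_action \<Gamma> \<one>\<^bsub>path_group \<Gamma>\<^esub> (x, p <#\<^bsub>path_group \<Gamma>\<^esub> A) \<in> (\<lambda>h. tree_action \<Gamma> h (x', p' <#\<^bsub>path_group \<Gamma>\<^esub> B)) ` H"
    using eq subgroup.one_closed[OF H] by blast
  then obtain h where h: "h \<in> H" "x = x'"
    "\<one>\<^bsub>path_group \<Gamma>\<^esub> <#\<^bsub>path_group \<Gamma>\<^esub> (p <#\<^bsub>path_group \<Gamma>\<^esub> A) = h <#\<^bsub>path_group \<Gamma>\<^esub> (p' <#\<^bsub>path_group \<Gamma>\<^esub> B)"
    by (auto simp: tree_action_def)
  have hc: "h \<in> carrier (path_group \<Gamma>)" using h H' by blast
  have "p <#\<^bsub>path_group \<Gamma>\<^esub> A = \<one>\<^bsub>path_group \<Gamma>\<^esub> <#\<^bsub>path_group \<Gamma>\<^esub> (p <#\<^bsub>path_group \<Gamma>\<^esub> A)"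
    using F.lcos_m_assoc[OF A'(1), of "\<one>\<^bsub>path_group \<Gamma>\<^esub>" p] p by simp
  also have "\<dots> = (h \<cdot> p') <#\<^bsub>path_group \<Gamma>\<^esub> B"
    unfolding h(3) by (rule F.lcos_m_assoc[OF A'(2) hc p(2)])
  finally have "p <#\<^bsub>path_group \<Gamma>\<^esub> A = (h \<cdot> p') <#\<^bsub>path_group \<Gamma>\<^esub> B" .
  moreover have "p \<in> p <#\<^bsub>path_group \<Gamma>\<^esub> A"
    unfolding l_coset_def using p subgroup.one_closed[OF A(1)]
    by (intro UN_I[of "\<one>\<^bsub>path_group \<Gamma>\<^esub>"]) simp_all
  ultimately have "p \<in> (h \<cdot> p') <#\<^bsub>path_group \<Gamma>\<^esub> B" by simp
  then obtain a where "a \<in> B" "p = h \<cdot> p' \<cdot> a" unfolding l_coset_def by blast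
  then show ?thesis using h by blast
qed

lemma vertex_group_eq: "vertex_group \<Gamma> v = range (V v)"
  by (auto simp: vertex_group_def V_def)

lemma subgroup_vertex_group: "v \<in> verts \<Gamma> \<Longrightarrow> subgroup (vertex_group \<Gamma> v) (path_group \<Gamma>)"
  by (rule F.subgroupI) (auto simp: vertex_group_eq V_minus V_add)

lemma edge_group_eq: "edge_group \<Gamma> e = range (\<lambda>z. V (src \<Gamma> e) (lab_src \<Gamma> e *v z))"
  by (auto simp: edge_group_def V_def)

lemma subgroup_edge_group:
  assumes "e \<in> edges \<Gamma>" shows "subgroup (edge_group \<Gamma> e) (path_group \<Gamma>)"
proof (rule F.subgroupI)
  fix a b assume "a \<in> edge_group \<Gamma> e" "b \<in> edge_group \<Gamma> e"
  then obtain x y where xy: "a = V (src \<Gamma> e) (lab_src \<Gamma> e *v x)" "b = V (src \<Gamma> e) (lab_src \<Gamma> e *v y)"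
    by (auto simp: edge_group_eq)
  have "inv\<^bsub>path_group \<Gamma>\<^esub> a = V (src \<Gamma> e) (lab_src \<Gamma> e *v (- x))"
    unfolding xy int_mult_minus by (rule V_minus[OF src_in[OF assms]])
  then show "inv\<^bsub>path_group \<Gamma>\<^esub> a \<in> edge_group \<Gamma> e" unfolding edge_group_eq by blast
  have "a \<cdot> b = V (src \<Gamma> e) (lab_src \<Gamma> e *v (x + y))"
    unfolding xy matrix_vector_right_distrib by (rule V_add[OF src_in[OF assms]])
  then show "a \<cdot> b \<in> edge_group \<Gamma> e" unfolding edge_group_eq by blast
qed (use src_in[OF assms] in \<open>auto simp: edge_group_eq\<close>)

lemma vertex_orbit_translate:
  "subgroup H (path_group \<Gamma>) \<Longrightarrow> v \<in> verts \<Gamma> \<Longrightarrow> k \<in> H \<Longrightarrow> p \<in> carrier (path_group \<Gamma>) \<Longrightarrow>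
    vertex_orbit H v (k \<cdot> p \<cdot> V v a) = vertex_orbit H v p"
  unfolding vertex_orbit_def
  by (rule orbit_translate[OF _ subgroup_vertex_group]) (auto simp: vertex_group_eq)

lemma edge_orb_translate:
  "subgroup H (path_group \<Gamma>) \<Longrightarrow> e \<in> edges \<Gamma> \<Longrightarrow> k \<in> H \<Longrightarrow> p \<in> carrier (path_group \<Gamma>) \<Longrightarrow>
    edge_orb H e (k \<cdot> p \<cdot> V (src \<Gamma> e) (lab_src \<Gamma> e *v z)) = edge_orb H e p"
  unfolding edge_orb_def
  by (rule orbit_translate[OF _ subgroup_edge_group]) (auto simp: edge_group_eq)

lemma vertex_orbit_eqD:
  assumes "subgroup H (path_group \<Gamma>)" "v \<in> verts \<Gamma>" "v' \<in> verts \<Gamma>"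
    "p \<in> carrier (path_group \<Gamma>)" "p' \<in> carrier (path_group \<Gamma>)" "vertex_orbit H v p = vertex_orbit H v' p'"
  shows "v = v' \<and> (\<exists>h\<in>H. \<exists>a. p = h \<cdot> p' \<cdot> V v a)"
  using orbit_eqD[OF assms(1) subgroup_vertex_group[OF assms(2)] subgroup_vertex_group[OF assms(3)] assms(4,5)
      assms(6)[unfolded vertex_orbit_def]]
  by (auto simp: vertex_group_eq)

lemma edge_orb_eqD:
  assumes "subgroup H (path_group \<Gamma>)" "e \<in> edges \<Gamma>" "e' \<in> edges \<Gamma>"
    "p \<in> carrier (path_group \<Gamma>)" "p' \<in> carrier (path_group \<Gamma>)" "edge_orb H e p = edge_orb H e' p'"
  shows "e = e' \<and> (\<exists>h\<in>H. \<exists>z. p = h \<cdot> p' \<cdot> V (src \<Gamma> e) (lab_src \<Gamma> e *v z))"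
  using orbit_eqD[OF assms(1) subgroup_edge_group[OF assms(2)] subgroup_edge_group[OF assms(3)] assms(4,5)
      assms(6)[unfolded edge_orb_def]]
  by (auto simp: edge_group_eq)

text \<open>The part of \<open>K\<close> that fixes a vertex of the tree, read in the coordinates of
  the vertex group.\<close>

lemma zsub_conj:
  assumes K: "subgroup K (path_group \<Gamma>)" and p: "p \<in> carrier (path_group \<Gamma>)" and v: "v \<in> verts \<Gamma>"
  shows "zsub {a. p \<cdot> V v a \<cdot> inv\<^bsub>path_group \<Gamma>\<^esub> p \<in> K}"
  unfolding zsub_def
proof (intro conjI ballI)
  show "0 \<in> {a. p \<cdot> V v a \<cdot> inv\<^bsub>path_group \<Gamma>\<^esub> p \<in> K}"
    using p v subgroup.one_closed[OF K] by (simp add: V_zero)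
  fix a b assume ab: "a \<in> {a. p \<cdot> V v a \<cdot> inv\<^bsub>path_group \<Gamma>\<^esub> p \<in> K}" "b \<in> {a. p \<cdot> V v a \<cdot> inv\<^bsub>path_group \<Gamma>\<^esub> p \<in> K}"
  have "inv\<^bsub>path_group \<Gamma>\<^esub> (p \<cdot> V v b \<cdot> inv\<^bsub>path_group \<Gamma>\<^esub> p) = p \<cdot> V v (- b) \<cdot> inv\<^bsub>path_group \<Gamma>\<^esub> p"
    using p v by (simp add: F.inv_mult_group V_minus F.m_assoc)
  moreover have "p \<cdot> V v a \<cdot> inv\<^bsub>path_group \<Gamma>\<^esub> p \<cdot> (p \<cdot> V v (- b) \<cdot> inv\<^bsub>path_group \<Gamma>\<^esub> p) =
      p \<cdot> (V v a \<cdot> V v (- b)) \<cdot> inv\<^bsub>path_group \<Gamma>\<^esub> p"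
    using p v by (simp add: F.m_assoc)
  ultimately have "p \<cdot> V v (a - b) \<cdot> inv\<^bsub>path_group \<Gamma>\<^esub> p \<in> K"
    using ab subgroup.m_closed[OF K] subgroup.m_inv_closed[OF K] v
    by (metis (no_types, lifting) V_add mem_Collect_eq uminus_add_conv_diff add.commute)
  then show "a - b \<in> {a. p \<cdot> V v a \<cdot> inv\<^bsub>path_group \<Gamma>\<^esub> p \<in> K}" by simp
qed

lemma path_word_appendD: "path_word \<Gamma> u (x @ y) v \<Longrightarrow> \<exists>w. path_word \<Gamma> u x w \<and> path_word \<Gamma> w y v"
proof (induction x arbitrary: u)
  case Nil
  then have "path_word \<Gamma> u [] u" using path_word_words by (blast intro: path_word.Nil)
  then show ?case using Nil by auto
next
  case (Cons l x)
  from Cons.prems show ?case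
    by (cases rule: path_word.cases) (use Cons.IH in \<open>auto intro: path_word.intros\<close>)
qed

lemma path_word_snoc:
  assumes "path_word \<Gamma> u (x @ [l]) v"
  obtains a where "l = Vtx v a" "path_word \<Gamma> u x v"
  | e where "l = Edg e" "e \<in> edges \<Gamma>" "v = tgt \<Gamma> e" "path_word \<Gamma> u x (src \<Gamma> e)"
proof -
  obtain w where w: "path_word \<Gamma> u x w" "path_word \<Gamma> w [l] v" using path_word_appendD[OF assms] by blast
  from w(2) show ?thesis
  proof (cases rule: path_word.cases)
    case (Vtx a)
    then have "w = v" by (auto elim: path_word.cases)
    then show ?thesis using that(1) Vtx w by auto
  next
    case (Edg e)
    then have "v = tgt \<Gamma> e" by (auto elim: path_word.cases)
    then show ?thesis using that(2) Edg w by auto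
  qed
qed

text \<open>The double coset that stands for an edge over \<open>e\<close> of the quotient by
  \<open>H\<close>.\<close>

definition dcoset :: "('v, 'e, 'd) word set set \<Rightarrow> 'e \<Rightarrow> ('v, 'e, 'd) word set \<Rightarrow> ('v, 'e, 'd) word set set" where
  "dcoset H e p = {k \<cdot> p \<cdot> V (src \<Gamma> e) (lab_src \<Gamma> e *v z) | k z. k \<in> H}"

lemma crosses_dcoset: "crosses H g\<^sub>0 e\<^sub>0 e h \<longleftrightarrow> e = e\<^sub>0 \<and> h \<in> dcoset H e\<^sub>0 g\<^sub>0 \<or> e = opp \<Gamma> e\<^sub>0 \<and> h \<cdot> E e \<in> dcoset H e\<^sub>0 g\<^sub>0"
  unfolding crosses_def dcoset_def by blast

section \<open>Infinite quotients leave edges untouched, finite quotients give finite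
  generation\<close>

context
  fixes H v\<^sub>0
  assumes H: "subgroup H (path_group \<Gamma>)" and v0: "v\<^sub>0 \<in> verts \<Gamma>"
begin

lemma Hc: "k \<in> H \<Longrightarrow> k \<in> carrier (path_group \<Gamma>)"
  using subgroup.subset[OF H] by blast

lemma dcoset_self: "e \<in> edges \<Gamma> \<Longrightarrow> p \<in> carrier (path_group \<Gamma>) \<Longrightarrow> p \<in> dcoset H e p"
  unfolding dcoset_def using subgroup.one_closed[OF H]
  by (intro CollectI exI[of _ "\<one>\<^bsub>path_group \<Gamma>\<^esub>"] exI[of _ 0]) (simp add: V_zero src_in)

lemma dcoset_sub:
  assumes e: "e \<in> edges \<Gamma>" and p: "p \<in> carrier (path_group \<Gamma>)" and h: "h \<in> dcoset H e p"
  shows "dcoset H e h \<subseteq> dcoset H e p" and "p \<in> dcoset H e h"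
proof -
  obtain k z where k: "k \<in> H" "h = k \<cdot> p \<cdot> V (src \<Gamma> e) (lab_src \<Gamma> e *v z)"
    using h unfolding dcoset_def by blast
  note s = src_in[OF e] Hc[OF k(1)]
  show "dcoset H e h \<subseteq> dcoset H e p"
  proof
    fix g assume "g \<in> dcoset H e h"
    then obtain k' z' where k': "k' \<in> H" "g = k' \<cdot> h \<cdot> V (src \<Gamma> e) (lab_src \<Gamma> e *v z')"
      unfolding dcoset_def by blast
    then have "g = (k' \<cdot> k) \<cdot> p \<cdot> V (src \<Gamma> e) (lab_src \<Gamma> e *v (z + z'))"
      using s p k Hc[OF k'(1)] by (simp add: F.m_assoc V_add matrix_vector_right_distrib)
    then show "g \<in> dcoset H e p" unfolding dcoset_def using k k' subgroup.m_closed[OF H] by blast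
  qed
  have "p = inv\<^bsub>path_group \<Gamma>\<^esub> k \<cdot> h \<cdot> V (src \<Gamma> e) (lab_src \<Gamma> e *v (- z))"
    using s p k by (simp add: F.m_assoc V_add int_mult_minus V_zero)
  then show "p \<in> dcoset H e h" unfolding dcoset_def using subgroup.m_inv_closed[OF H k(1)] by blast
qed

lemma dcoset_eq:
  assumes e: "e \<in> edges \<Gamma>" and p: "p \<in> carrier (path_group \<Gamma>)" and h: "h \<in> dcoset H e p"
  shows "dcoset H e h = dcoset H e p"
proof
  have "h \<in> carrier (path_group \<Gamma>)" using h e p Hc src_in by (auto simp: dcoset_def)
  then show "dcoset H e p \<subseteq> dcoset H e h" using dcoset_sub[OF e _ dcoset_sub(2)[OF e p h]] by blast
qed (rule dcoset_sub[OF assms])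

lemma dcoset_opp:
  assumes e: "e \<in> edges \<Gamma>" and p: "p \<in> carrier (path_group \<Gamma>)" and h: "h \<in> dcoset H e p"
  shows "h \<cdot> E e \<in> dcoset H (opp \<Gamma> e) (p \<cdot> E e)"
proof -
  obtain k z where k: "k \<in> H" "h = k \<cdot> p \<cdot> V (src \<Gamma> e) (lab_src \<Gamma> e *v z)"
    using h unfolding dcoset_def by blast
  have "h \<cdot> E e = k \<cdot> (p \<cdot> E e) \<cdot> V (src \<Gamma> (opp \<Gamma> e)) (lab_src \<Gamma> (opp \<Gamma> e) *v z)"
    using k Hc[OF k(1)] p e by (simp add: F.m_assoc src_in tgt_in src_opp lab_src_opp E_V)
  then show ?thesis unfolding dcoset_def using k by blast
qed

text \<open>Every crossing is recorded in both orientations, so that the set of edges met by a word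
  is closed under \<open>opp\<close>.\<close>

definition crossings :: "('v, 'e, 'd) word \<Rightarrow> ('e \<times> ('v, 'e, 'd) word set) set" where
  "crossings w = {(\<epsilon>, cl u) | u \<epsilon> r. w = u @ Edg \<epsilon> # r} \<union> {(opp \<Gamma> \<epsilon>, cl u \<cdot> E \<epsilon>) | u \<epsilon> r. w = u @ Edg \<epsilon> # r}"

lemma finite_crossings: "finite (crossings w)"
proof -
  have "finite {(u, \<epsilon>). \<exists>r. w = u @ Edg \<epsilon> # r}"
  proof (rule finite_subset)
    show "{(u, \<epsilon>). \<exists>r. w = u @ Edg \<epsilon> # r} \<subseteq>
      (\<lambda>n. (take n w, case w ! n of Edg \<epsilon> \<Rightarrow> \<epsilon>)) ` {..<length w}"
    proof
      fix x assume "x \<in> {(u, \<epsilon>). \<exists>r. w = u @ Edg \<epsilon> # r}"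
      then obtain u \<epsilon> r where "x = (u, \<epsilon>)" "w = u @ Edg \<epsilon> # r" by blast
      then show "x \<in> (\<lambda>n. (take n w, case w ! n of Edg \<epsilon> \<Rightarrow> \<epsilon>)) ` {..<length w}"
        by (intro image_eqI[of _ _ "length u"]) auto
    qed
  qed simp
  then have "finite ((\<lambda>(u, \<epsilon>). (\<epsilon>, cl u)) ` {(u, \<epsilon>). \<exists>r. w = u @ Edg \<epsilon> # r} \<union>
      (\<lambda>(u, \<epsilon>). (opp \<Gamma> \<epsilon>, cl u \<cdot> E \<epsilon>)) ` {(u, \<epsilon>). \<exists>r. w = u @ Edg \<epsilon> # r})" by simp
  moreover have "crossings w \<subseteq> (\<lambda>(u, \<epsilon>). (\<epsilon>, cl u)) ` {(u, \<epsilon>). \<exists>r. w = u @ Edg \<epsilon> # r} \<union>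
      (\<lambda>(u, \<epsilon>). (opp \<Gamma> \<epsilon>, cl u \<cdot> E \<epsilon>)) ` {(u, \<epsilon>). \<exists>r. w = u @ Edg \<epsilon> # r}"
    unfolding crossings_def by force
  ultimately show ?thesis by (rule finite_subset[rotated])
qed

text \<open>Consider paths from the base point that cross only edges met by \<open>WW\<close>. If
  none of them could be continued by another edge, all edges of the quotient would be met by
  \<open>WW\<close>, and the quotient would be finite. A path \<open>q\<close> and a new edge
  \<open>e\<close> at its end are chosen; by this choice \<open>q\<close> does not cross
  \<open>e\<close> itself.\<close>

lemma select_edge:
  assumes inf: "infinite_graph (tree_quotient \<Gamma> v\<^sub>0 H)"
    and fin: "finite WW" and WW: "\<And>w. w \<in> WW \<Longrightarrow> w \<in> words \<Gamma>"
  obtains e q where "e \<in> edges \<Gamma>" "path_word \<Gamma> v\<^sub>0 q (src \<Gamma> e)" "clear H (cl q) e q \<one>\<^bsub>path_group \<Gamma>\<^esub>"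
    "\<And>w. w \<in> WW \<Longrightarrow> clear H (cl q) e w \<one>\<^bsub>path_group \<Gamma>\<^esub>"
proof -
  define T where "T = (\<lambda>(\<epsilon>, p). (\<epsilon>, dcoset H \<epsilon> p)) ` (\<Union>w\<in>WW. crossings w)"
  have finT: "finite T" unfolding T_def using fin finite_crossings by blast
  have T_opp: "(opp \<Gamma> \<epsilon>, dcoset H (opp \<Gamma> \<epsilon>) (p \<cdot> E \<epsilon>)) \<in> T"
    if pT: "(\<epsilon>, dcoset H \<epsilon> p) \<in> T" and \<epsilon>: "\<epsilon> \<in> edges \<Gamma>" and p: "p \<in> carrier (path_group \<Gamma>)" for \<epsilon> p
  proof -
    obtain w p' where w: "w \<in> WW" "(\<epsilon>, p') \<in> crossings w" "dcoset H \<epsilon> p = dcoset H \<epsilon> p'"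
      using pT unfolding T_def by auto
    have opp: "(opp \<Gamma> \<epsilon>, p' \<cdot> E \<epsilon>) \<in> crossings w \<and> p' \<in> carrier (path_group \<Gamma>)"
      using w(2)[unfolded crossings_def]
    proof (elim UnE CollectE exE conjE)
      fix u \<epsilon>' r assume *: "(\<epsilon>, p') = (\<epsilon>', cl u)" "w = u @ Edg \<epsilon>' # r"
      then have "u \<in> words \<Gamma>" using WW[OF w(1)] by simp
      moreover have "(opp \<Gamma> \<epsilon>', cl u \<cdot> E \<epsilon>') \<in> crossings w" using *(2) unfolding crossings_def by blast
      ultimately show ?thesis using * by simp
    next
      fix u \<epsilon>' r assume *: "(\<epsilon>, p') = (opp \<Gamma> \<epsilon>', cl u \<cdot> E \<epsilon>')" "w = u @ Edg \<epsilon>' # r"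
      then have "u \<in> words \<Gamma>" "\<epsilon>' \<in> edges \<Gamma>" using WW[OF w(1)] by auto
      then have "p' \<cdot> E \<epsilon> = cl u" "opp \<Gamma> \<epsilon> = \<epsilon>'" "p' \<in> carrier (path_group \<Gamma>)"
        using * by (auto simp: F.m_assoc opp_in opp_opp E_opp)
      moreover have "(\<epsilon>', cl u) \<in> crossings w" using *(2) unfolding crossings_def by blast
      ultimately show ?thesis by simp
    qed
    moreover have "p \<in> dcoset H \<epsilon> p'" using dcoset_self[OF \<epsilon> p] w(3) by simp
    ultimately have "dcoset H (opp \<Gamma> \<epsilon>) (p \<cdot> E \<epsilon>) = dcoset H (opp \<Gamma> \<epsilon>) (p' \<cdot> E \<epsilon>)"
      using dcoset_opp \<epsilon> by (intro dcoset_eq) (auto simp: opp_in)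
    then show ?thesis unfolding T_def using w(1) opp by force
  qed
  define touched where "touched q \<longleftrightarrow> (\<forall>u \<epsilon> r. q = u @ Edg \<epsilon> # r \<longrightarrow> (\<epsilon>, dcoset H \<epsilon> (cl u)) \<in> T)" for q
  have clear: "clear H (cl q) e w \<one>\<^bsub>path_group \<Gamma>\<^esub>"
    if e: "e \<in> edges \<Gamma>" and q: "q \<in> words \<Gamma>" and nT: "(e, dcoset H e (cl q)) \<notin> T" and w: "w \<in> words \<Gamma>" "touched w" for e q w
    unfolding clear_def crosses_dcoset
  proof (intro allI impI notI)
    fix u \<epsilon> r assume wu: "w = u @ Edg \<epsilon> # r"
    then have u: "u \<in> words \<Gamma>" "\<epsilon> \<in> edges \<Gamma>" "(\<epsilon>, dcoset H \<epsilon> (cl u)) \<in> T"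
      using w by (auto simp: touched_def)
    assume "\<epsilon> = e \<and> \<one>\<^bsub>path_group \<Gamma>\<^esub> \<cdot> cl u \<in> dcoset H e (cl q) \<or>
      \<epsilon> = opp \<Gamma> e \<and> \<one>\<^bsub>path_group \<Gamma>\<^esub> \<cdot> cl u \<cdot> E \<epsilon> \<in> dcoset H e (cl q)"
    then show False
    proof (elim disjE conjE)
      assume "\<epsilon> = e" "\<one>\<^bsub>path_group \<Gamma>\<^esub> \<cdot> cl u \<in> dcoset H e (cl q)"
      then show False using dcoset_eq[OF e, of "cl q" "cl u"] u q nT by simp
    next
      assume "\<epsilon> = opp \<Gamma> e" "\<one>\<^bsub>path_group \<Gamma>\<^esub> \<cdot> cl u \<cdot> E \<epsilon> \<in> dcoset H e (cl q)"
      then show False using dcoset_eq[OF e, of "cl q" "cl u \<cdot> E \<epsilon>"] T_opp[OF u(3,2)] u q nT e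
        by (simp add: opp_opp)
    qed
  qed
  have "\<exists>e q. e \<in> edges \<Gamma> \<and> path_word \<Gamma> v\<^sub>0 q (src \<Gamma> e) \<and> touched q \<and> (e, dcoset H e (cl q)) \<notin> T"
  proof (rule ccontr)
    assume "\<not> ?thesis"
    then have nT: "(e, dcoset H e (cl q)) \<in> T" if "e \<in> edges \<Gamma>" "path_word \<Gamma> v\<^sub>0 q (src \<Gamma> e)" "touched q" for e q
      using that by blast
    have touched: "touched w" if "path_word \<Gamma> v\<^sub>0 w v" for w v
      using that
    proof (induction w arbitrary: v rule: rev_induct)
      case (snoc l w)
      from snoc.prems show ?case
      proof (cases rule: path_word_snoc)
        case (1 a)
        then have "touched w" using snoc.IH by blast
        then show ?thesis using 1 unfolding touched_def
          by (metis append_butlast_last_id butlast_append butlast_snoc last_appendR last_snoc letter.distinct(1) list.distinct(1) butlast.simps(2) last.simps append_self_conv2 snoc_eq_iff_butlast)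
      next
        case (2 e)
        then have t: "touched w" using snoc.IH by blast
        show ?thesis unfolding touched_def
        proof (intro allI impI)
          fix u \<epsilon> r assume "w @ [l] = u @ Edg \<epsilon> # r"
          then consider r' where "w = u @ Edg \<epsilon> # r'" | "w = u" "l = Edg \<epsilon>"
            by (cases r rule: rev_cases) auto
          then show "(\<epsilon>, dcoset H \<epsilon> (cl u)) \<in> T"
            using t nT[OF 2(2,4) t] 2(1) by cases (auto simp: touched_def)
        qed
      qed
    qed (simp add: touched_def)
    have T_all: "(e, dcoset H e (cl q)) \<in> T" if "e \<in> edges \<Gamma>" "path_word \<Gamma> v\<^sub>0 q (src \<Gamma> e)" for e q
      using nT touched that by blast
    have some: "\<exists>k\<in>H. \<exists>z. (SOME h. h \<in> dcoset H e p) = k \<cdot> p \<cdot> V (src \<Gamma> e) (lab_src \<Gamma> e *v z)"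
      if "e \<in> edges \<Gamma>" "p \<in> carrier (path_group \<Gamma>)" for e p
      using someI[of "\<lambda>h. h \<in> dcoset H e p", OF dcoset_self[OF that]] unfolding dcoset_def by blast
    \<comment> \<open>The finiteness of \<open>T\<close> passes to the quotient: an edge determines
      its target, and every vertex other than the base point is the target of some edge.\<close>
    let ?F1 = "\<lambda>(\<epsilon>, D). vertex_orbit H (tgt \<Gamma> \<epsilon>) ((SOME h. h \<in> D) \<cdot> E \<epsilon>)"
    let ?F2 = "\<lambda>(\<epsilon>, D). edge_orb H \<epsilon> (SOME h. h \<in> D)"
    have "vertex_orbit H v (cl w) \<in> insert (vertex_orbit H v\<^sub>0 \<one>\<^bsub>path_group \<Gamma>\<^esub>) (?F1 ` T)"
      if "path_word \<Gamma> v\<^sub>0 w v" for w v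
      using that
    proof (induction w arbitrary: v rule: rev_induct)
      case Nil
      then have "v = v\<^sub>0" by (auto elim: path_word.cases)
      then show ?case by (simp add: cl_Nil)
    next
      case (snoc l w)
      from snoc.prems show ?case
      proof (cases rule: path_word_snoc)
        case (1 a)
        then have w: "w \<in> words \<Gamma>" "v \<in> verts \<Gamma>" using path_word_words by blast+
        have "cl (w @ [l]) = \<one>\<^bsub>path_group \<Gamma>\<^esub> \<cdot> cl w \<cdot> V v a" using w 1 by (simp add: cl_append cl_Vtx cl_Nil)
        then have "vertex_orbit H v (cl (w @ [l])) = vertex_orbit H v (cl w)"
          using vertex_orbit_translate[OF H w(2) subgroup.one_closed[OF H], of "cl w" a] w by simp
        then show ?thesis using snoc.IH 1 by simp
      next
        case (2 e)
        then have w: "w \<in> words \<Gamma>" using path_word_words by blast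
        obtain k z where k: "k \<in> H" "(SOME h. h \<in> dcoset H e (cl w)) = k \<cdot> cl w \<cdot> V (src \<Gamma> e) (lab_src \<Gamma> e *v z)"
          using some[OF 2(2), of "cl w"] w by blast
        have "k \<cdot> cl w \<cdot> V (src \<Gamma> e) (lab_src \<Gamma> e *v z) \<cdot> E e = k \<cdot> (cl w \<cdot> E e) \<cdot> V (tgt \<Gamma> e) (lab_tgt \<Gamma> e *v z)"
          using w 2 Hc[OF k(1)] by (simp add: F.m_assoc src_in tgt_in E_V)
        then have "vertex_orbit H v (cl (w @ [l])) = ?F1 (e, dcoset H e (cl w))"
          using vertex_orbit_translate[OF H tgt_in[OF 2(2)] k(1), of "cl w \<cdot> E e" "lab_tgt \<Gamma> e *v z"] w 2 k
          by (simp add: cl_append cl_Edg cl_Nil)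
        then show ?thesis by (intro insertI2 image_eqI[OF _ T_all[OF 2(2,4)]])
      qed
    qed
    then have "verts (tree_quotient \<Gamma> v\<^sub>0 H) \<subseteq> insert (vertex_orbit H v\<^sub>0 \<one>\<^bsub>path_group \<Gamma>\<^esub>) (?F1 ` T)"
      unfolding tree_quotient_simps path_classes_def by blast
    then have "finite (verts (tree_quotient \<Gamma> v\<^sub>0 H))" using finT by (meson finite.insertI finite_imageI finite_subset)
    moreover have "edge_orb H e (cl q) \<in> ?F2 ` T" if e: "e \<in> edges \<Gamma>" and eq: "path_word \<Gamma> v\<^sub>0 q (src \<Gamma> e)" for e q
    proof -
      have q: "cl q \<in> carrier (path_group \<Gamma>)" using eq path_word_words by blast
      obtain k z where k: "k \<in> H" "(SOME h. h \<in> dcoset H e (cl q)) = k \<cdot> cl q \<cdot> V (src \<Gamma> e) (lab_src \<Gamma> e *v z)"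
        using some[OF e q] by blast
      then have "edge_orb H e (cl q) = ?F2 (e, dcoset H e (cl q))"
        using edge_orb_translate[OF H e k(1) q] by simp
      then show ?thesis by (intro image_eqI[OF _ T_all[OF e eq]])
    qed
    then have "edges (tree_quotient \<Gamma> v\<^sub>0 H) \<subseteq> ?F2 ` T"
      unfolding tree_quotient_simps path_classes_def by blast
    then have "finite (edges (tree_quotient \<Gamma> v\<^sub>0 H))" using finT by (meson finite_imageI finite_subset)
    ultimately show False using inf unfolding infinite_graph_def by blast
  qed
  then obtain e q where eq: "e \<in> edges \<Gamma>" "path_word \<Gamma> v\<^sub>0 q (src \<Gamma> e)" "touched q" "(e, dcoset H e (cl q)) \<notin> T" by blast
  have q: "q \<in> words \<Gamma>" using eq path_word_words by blast
  have "touched w" if "w \<in> WW" for w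
    using that unfolding touched_def T_def crossings_def by force
  then show ?thesis using that[OF eq(1,2)] clear[OF eq(1) q eq(4)] q eq(3) WW by blast
qed

text \<open>A group acting on a connected graph with finite quotient and finitely generated vertex
  stabilisers is finitely generated: take generators of the stabilisers of representatives of the vertex
  orbits, together with one element for each edge orbit that moves its target to a representative.\<close>

lemma finite_quotient_finitely_generated:
  assumes HG: "H \<subseteq> path_classes \<Gamma> v\<^sub>0 v\<^sub>0" and fin: "\<not> infinite_graph (tree_quotient \<Gamma> v\<^sub>0 H)"
  shows "\<exists>P. finite P \<and> P \<subseteq> H \<and> (\<forall>K. subgroup K (path_group \<Gamma>) \<longrightarrow> P \<subseteq> K \<longrightarrow> H \<subseteq> K)"
proof -
  define VS where "VS = verts (tree_quotient \<Gamma> v\<^sub>0 H)"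
  define ES where "ES = edges (tree_quotient \<Gamma> v\<^sub>0 H)"
  have fVS: "finite VS" and fES: "finite ES" using fin unfolding infinite_graph_def VS_def ES_def by auto
  have pc: "p \<in> carrier (path_group \<Gamma>)" if "p \<in> path_classes \<Gamma> v\<^sub>0 v" for p v
    using that path_classes_carrier by blast
  have mult: "p \<cdot> p' \<in> path_classes \<Gamma> u w" if p: "p \<in> path_classes \<Gamma> u v" and p': "p' \<in> path_classes \<Gamma> v w" for p p' u v w
  proof -
    obtain x where x: "path_word \<Gamma> u x v" "p = cl x" using p by (auto simp: path_classes_def)
    obtain y where y: "path_word \<Gamma> v y w" "p' = cl y" using p' by (auto simp: path_classes_def)
    have "p \<cdot> p' = cl (x @ y)" using x y path_word_words by (simp add: cl_append)
    then show ?thesis using path_word_append[OF x(1) y(1)] by (auto simp: path_classes_def)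
  qed
  have Vp: "V v a \<in> path_classes \<Gamma> v v" if "v \<in> verts \<Gamma>" for v a
    using that by (auto simp: path_classes_def V_def intro!: exI[of _ "[Vtx v a]"] path_word.intros)
  have Ep: "E e \<in> path_classes \<Gamma> (src \<Gamma> e) (tgt \<Gamma> e)" if "e \<in> edges \<Gamma>" for e
    using that by (auto simp: path_classes_def E_def intro!: exI[of _ "[Edg e]"] path_word.intros tgt_in)
  have one: "\<one>\<^bsub>path_group \<Gamma>\<^esub> \<in> path_classes \<Gamma> v\<^sub>0 v\<^sub>0" using Vp[OF v0, of 0] v0 by (simp add: V_zero)
  define o0 where "o0 = vertex_orbit H v\<^sub>0 \<one>\<^bsub>path_group \<Gamma>\<^esub>"
  have "\<exists>rv rp. \<forall>ob\<in>VS. rv ob \<in> verts \<Gamma> \<and> rp ob \<in> path_classes \<Gamma> v\<^sub>0 (rv ob) \<and> ob = vertex_orbit H (rv ob) (rp ob)"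
  proof -
    have "\<forall>ob\<in>VS. \<exists>vp. fst vp \<in> verts \<Gamma> \<and> snd vp \<in> path_classes \<Gamma> v\<^sub>0 (fst vp) \<and> ob = vertex_orbit H (fst vp) (snd vp)"
      unfolding VS_def tree_quotient_simps by fastforce
    from bchoice[OF this] obtain f where "\<forall>ob\<in>VS. fst (f ob) \<in> verts \<Gamma> \<and> snd (f ob) \<in> path_classes \<Gamma> v\<^sub>0 (fst (f ob)) \<and>
      ob = vertex_orbit H (fst (f ob)) (snd (f ob))" ..
    then show ?thesis by (intro exI[of _ "\<lambda>ob. fst (f ob)"] exI[of _ "\<lambda>ob. snd (f ob)"])
  qed
  then obtain rv' rp' where r': "\<forall>ob\<in>VS. rv' ob \<in> verts \<Gamma> \<and> rp' ob \<in> path_classes \<Gamma> v\<^sub>0 (rv' ob) \<and> ob = vertex_orbit H (rv' ob) (rp' ob)"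
    by blast
  \<comment> \<open>The orbit of the base point gets the trivial representative, so that closed
    paths are compared with \<open>K\<close> without a conjugation.\<close>
  define rv where "rv = rv'(o0 := v\<^sub>0)"
  define rp where "rp = rp'(o0 := \<one>\<^bsub>path_group \<Gamma>\<^esub>)"
  have r: "rv ob \<in> verts \<Gamma>" "rp ob \<in> path_classes \<Gamma> v\<^sub>0 (rv ob)" "vertex_orbit H (rv ob) (rp ob) = ob" if "ob \<in> VS" for ob
    using r' that one v0 by (auto simp: rv_def rp_def o0_def)
  have rep: "\<exists>ob\<in>VS. ob = vertex_orbit H v p \<and> rv ob = v \<and> (\<exists>h\<in>H. \<exists>a. p = h \<cdot> rp ob \<cdot> V v a)"
    if "v \<in> verts \<Gamma>" "p \<in> path_classes \<Gamma> v\<^sub>0 v" for v p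
  proof -
    let ?ob = "vertex_orbit H v p"
    have ob: "?ob \<in> VS" unfolding VS_def tree_quotient_simps using that by blast
    have "v = rv ?ob \<and> (\<exists>h\<in>H. \<exists>a. p = h \<cdot> rp ?ob \<cdot> V v a)"
      by (rule vertex_orbit_eqD[OF H that(1) r(1)[OF ob] pc[OF that(2)] pc[OF r(2)[OF ob]] r(3)[OF ob, symmetric]])
    then show ?thesis using ob by metis
  qed
  have "\<exists>D. \<forall>\<epsilon>\<in>ES. case D \<epsilon> of (e, g, ob) \<Rightarrow> e \<in> edges \<Gamma> \<and> ob \<in> VS \<and> rv ob = src \<Gamma> e \<and> \<epsilon> = edge_orb H e (rp ob \<cdot> V (src \<Gamma> e) g)"
  proof (rule bchoice, rule ballI)
    fix \<epsilon> assume "\<epsilon> \<in> ES"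
    then obtain e p where e: "e \<in> edges \<Gamma>" "p \<in> path_classes \<Gamma> v\<^sub>0 (src \<Gamma> e)" "\<epsilon> = edge_orb H e p"
      unfolding ES_def tree_quotient_simps by blast
    from rep[OF src_in[OF e(1)] e(2)] obtain ob h a where ob: "ob \<in> VS" "rv ob = src \<Gamma> e" "h \<in> H" "p = h \<cdot> rp ob \<cdot> V (src \<Gamma> e) a" by blast
    have "p = h \<cdot> (rp ob \<cdot> V (src \<Gamma> e) a) \<cdot> V (src \<Gamma> e) (lab_src \<Gamma> e *v 0)"
      using ob pc[OF r(2)[OF ob(1)]] Hc src_in[OF e(1)] by (simp add: F.m_assoc V_zero)
    then have "\<epsilon> = edge_orb H e (rp ob \<cdot> V (src \<Gamma> e) a)"
      using edge_orb_translate[OF H e(1) ob(3), of "rp ob \<cdot> V (src \<Gamma> e) a" 0] e(3) pc[OF r(2)[OF ob(1)]] src_in[OF e(1)] by simp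
    then show "\<exists>x. case x of (e, g, ob) \<Rightarrow> e \<in> edges \<Gamma> \<and> ob \<in> VS \<and> rv ob = src \<Gamma> e \<and> \<epsilon> = edge_orb H e (rp ob \<cdot> V (src \<Gamma> e) g)"
      using e ob by (intro exI[of _ "(e, a, ob)"]) auto
  qed
  then obtain D where D: "\<forall>\<epsilon>\<in>ES. case D \<epsilon> of (e, g, ob) \<Rightarrow> e \<in> edges \<Gamma> \<and> ob \<in> VS \<and> rv ob = src \<Gamma> e \<and> \<epsilon> = edge_orb H e (rp ob \<cdot> V (src \<Gamma> e) g)" ..
  \<comment> \<open>Crossing the chosen edge of an orbit from the representative of its source may
    end away from the representative of its target; the element \<open>hh\<close> connects the
    two.\<close>
  define move where "move \<epsilon> = (case D \<epsilon> of (e, g, ob) \<Rightarrow> rp ob \<cdot> V (src \<Gamma> e) g \<cdot> E e)" for \<epsilon>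
  define goal where "goal \<epsilon> = (case D \<epsilon> of (e, g, ob) \<Rightarrow> tgt \<Gamma> e)" for \<epsilon>
  have "\<exists>hh. \<forall>\<epsilon>\<in>ES. hh \<epsilon> \<in> H \<and> (\<exists>ob\<in>VS. ob = vertex_orbit H (goal \<epsilon>) (move \<epsilon>) \<and> (\<exists>b. move \<epsilon> = hh \<epsilon> \<cdot> rp ob \<cdot> V (goal \<epsilon>) b))"
  proof (rule bchoice, rule ballI)
    fix \<epsilon> assume \<epsilon>: "\<epsilon> \<in> ES"
    obtain e g ob where d: "D \<epsilon> = (e, g, ob)" by (cases "D \<epsilon>")
    then have e: "e \<in> edges \<Gamma>" "ob \<in> VS" "rv ob = src \<Gamma> e" using D \<epsilon> by fastforce+
    have "move \<epsilon> \<in> path_classes \<Gamma> v\<^sub>0 (goal \<epsilon>)"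
      using mult[OF mult[OF r(2)[OF e(2), unfolded e(3)] Vp[OF src_in[OF e(1)]]] Ep[OF e(1)]] d
      by (simp add: move_def goal_def)
    moreover have "goal \<epsilon> \<in> verts \<Gamma>" using d e tgt_in by (simp add: goal_def)
    ultimately show "\<exists>h. h \<in> H \<and> (\<exists>ob\<in>VS. ob = vertex_orbit H (goal \<epsilon>) (move \<epsilon>) \<and> (\<exists>b. move \<epsilon> = h \<cdot> rp ob \<cdot> V (goal \<epsilon>) b))"
      using rep[of "goal \<epsilon>" "move \<epsilon>"] by blast
  qed
  then obtain hh where hh: "\<forall>\<epsilon>\<in>ES. hh \<epsilon> \<in> H \<and> (\<exists>ob\<in>VS. ob = vertex_orbit H (goal \<epsilon>) (move \<epsilon>) \<and> (\<exists>b. move \<epsilon> = hh \<epsilon> \<cdot> rp ob \<cdot> V (goal \<epsilon>) b))" ..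
  define cj where "cj ob a = rp ob \<cdot> V (rv ob) a \<cdot> inv\<^bsub>path_group \<Gamma>\<^esub> rp ob" for ob a
  have "\<exists>S. \<forall>ob\<in>VS. finite (S ob) \<and> S ob \<subseteq> {a. cj ob a \<in> H} \<and> (\<forall>M. zsub M \<longrightarrow> S ob \<subseteq> M \<longrightarrow> {a. cj ob a \<in> H} \<subseteq> M)"
  proof (rule bchoice, rule ballI)
    fix ob assume "ob \<in> VS"
    then have "zsub {a. cj ob a \<in> H}" unfolding cj_def using r pc by (intro zsub_conj H) blast+
    then show "\<exists>S. finite S \<and> S \<subseteq> {a. cj ob a \<in> H} \<and> (\<forall>M. zsub M \<longrightarrow> S \<subseteq> M \<longrightarrow> {a. cj ob a \<in> H} \<subseteq> M)"
      by (rule zsub_finitely_generated)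
  qed
  then obtain S where S0: "\<forall>ob\<in>VS. finite (S ob) \<and> S ob \<subseteq> {a. cj ob a \<in> H} \<and> (\<forall>M. zsub M \<longrightarrow> S ob \<subseteq> M \<longrightarrow> {a. cj ob a \<in> H} \<subseteq> M)" ..
  have S: "finite (S ob)" "S ob \<subseteq> {a. cj ob a \<in> H}" "zsub M \<Longrightarrow> S ob \<subseteq> M \<Longrightarrow> {a. cj ob a \<in> H} \<subseteq> M"
    if ob: "ob \<in> VS" for ob M
    using bspec[OF S0 ob] by simp_all
  define P where "P = hh ` ES \<union> (\<Union>ob\<in>VS. cj ob ` S ob)"
  show ?thesis
  proof (intro exI[of _ P] conjI allI impI)
    show "finite P" unfolding P_def using fVS fES S(1) by blast
    show PH: "P \<subseteq> H" unfolding P_def using hh S(2) by blast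
    fix K' assume K': "subgroup K' (path_group \<Gamma>)" "P \<subseteq> K'"
    \<comment> \<open>Inside \<open>H\<close>, multiplication by elements of \<open>K\<close>
      preserves the orbits that the representatives refer to.\<close>
    define K where "K = K' \<inter> H"
    have K: "subgroup K (path_group \<Gamma>)" unfolding K_def using K' H F.subgroups_Inter_pair by blast
    have PK: "P \<subseteq> K" and KH: "K \<subseteq> H" unfolding K_def using K' PH by auto
    have cjK: "cj ob a \<in> K" if "ob \<in> VS" "cj ob a \<in> H" for ob a
    proof -
      have "zsub {a. cj ob a \<in> K}" unfolding cj_def using r pc that by (intro zsub_conj K) blast+
      moreover have "S ob \<subseteq> {a. cj ob a \<in> K}" using PK that unfolding P_def by blast
      ultimately show ?thesis using S(3)[OF that(1)] that by blast
    qed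
    \<comment> \<open>The invariant: up to the vertex group, every path class is an element of
      \<open>K\<close> times the representative of its own orbit.\<close>
    have main: "\<exists>k\<in>K. \<exists>ob\<in>VS. \<exists>a. ob = vertex_orbit H v (cl w) \<and> rv ob = v \<and> cl w = k \<cdot> rp ob \<cdot> V v a"
      if "path_word \<Gamma> v\<^sub>0 w v" for w v
      using that
    proof (induction w arbitrary: v rule: rev_induct)
      case Nil
      then have v: "v = v\<^sub>0" by (auto elim: path_word.cases)
      have "o0 \<in> VS" unfolding o0_def VS_def tree_quotient_simps using one v0 by blast
      moreover have "rv o0 = v\<^sub>0" "rp o0 = \<one>\<^bsub>path_group \<Gamma>\<^esub>" by (simp_all add: rv_def rp_def)
      ultimately show ?case using v v0 subgroup.one_closed[OF K]
        by (intro bexI[of _ "\<one>\<^bsub>path_group \<Gamma>\<^esub>"] bexI[of _ o0] exI[of _ 0]) (simp_all add: o0_def cl_Nil V_zero)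
    next
      case (snoc l w)
      from snoc.prems show ?case
      proof (cases rule: path_word_snoc)
        case (1 b)
        then have w: "w \<in> words \<Gamma>" "v \<in> verts \<Gamma>" using path_word_words by blast+
        from snoc.IH[OF 1(2)] obtain k ob a where k: "k \<in> K" "ob \<in> VS" "ob = vertex_orbit H v (cl w)" "rv ob = v" "cl w = k \<cdot> rp ob \<cdot> V v a" by blast
        have wl: "cl (w @ [l]) = \<one>\<^bsub>path_group \<Gamma>\<^esub> \<cdot> cl w \<cdot> V v b" using w 1 by (simp add: cl_append cl_Vtx cl_Nil)
        have cw: "cl w \<in> carrier (path_group \<Gamma>)" using w by simp
        have kc: "k \<in> carrier (path_group \<Gamma>)" using k(1) Hc KH by blast
        have "vertex_orbit H v (cl (w @ [l])) = ob"
          unfolding wl k(3) by (rule vertex_orbit_translate[OF H w(2) subgroup.one_closed[OF H] cw])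
        moreover have "cl (w @ [l]) = k \<cdot> rp ob \<cdot> V v (a + b)"
          unfolding wl F.l_one[OF cw] unfolding k(5)
          using kc w(2) pc[OF r(2)[OF k(2)]] by (simp add: F.m_assoc V_add)
        ultimately show ?thesis using k by blast
      next
        case (2 e)
        then have w: "w \<in> words \<Gamma>" using path_word_words by blast
        have sv: "src \<Gamma> e \<in> verts \<Gamma>" "tgt \<Gamma> e \<in> verts \<Gamma>" using 2 src_in tgt_in by auto
        from snoc.IH[OF 2(4)] obtain k ob a where k: "k \<in> K" "ob \<in> VS" "ob = vertex_orbit H (src \<Gamma> e) (cl w)"
          "rv ob = src \<Gamma> e" "cl w = k \<cdot> rp ob \<cdot> V (src \<Gamma> e) a" by blast
        have rpc: "rp ob \<in> carrier (path_group \<Gamma>)" using pc[OF r(2)[OF k(2)]] .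
        define \<epsilon> where "\<epsilon> = edge_orb H e (rp ob \<cdot> V (src \<Gamma> e) a)"
        have \<epsilon>: "\<epsilon> \<in> ES" unfolding \<epsilon>_def ES_def tree_quotient_simps
          using mult[OF r(2)[OF k(2), unfolded k(4)] Vp[OF sv(1)]] 2(2) by blast
        obtain e1 g ob1 where d: "D \<epsilon> = (e1, g, ob1)" by (cases "D \<epsilon>")
        then have e1: "e1 \<in> edges \<Gamma>" "ob1 \<in> VS" "rv ob1 = src \<Gamma> e1" "\<epsilon> = edge_orb H e1 (rp ob1 \<cdot> V (src \<Gamma> e1) g)"
          using D \<epsilon> by fastforce+
        have rpc1: "rp ob1 \<in> carrier (path_group \<Gamma>)" using pc[OF r(2)[OF e1(2)]] .
        from edge_orb_eqD[OF H 2(2) e1(1) _ _ e1(4)[unfolded \<epsilon>_def]] obtain h z where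
          h: "e = e1" "h \<in> H" "rp ob \<cdot> V (src \<Gamma> e) a = h \<cdot> (rp ob1 \<cdot> V (src \<Gamma> e1) g) \<cdot> V (src \<Gamma> e) (lab_src \<Gamma> e *v z)"
          using rpc rpc1 sv src_in[OF e1(1)] by blast
        let ?b = "g + lab_src \<Gamma> e *v z"
        have h3: "rp ob \<cdot> V (src \<Gamma> e) a = h \<cdot> rp ob1 \<cdot> V (src \<Gamma> e) ?b"
          using h rpc1 sv Hc by (simp add: F.m_assoc V_add)
        have "rp ob = rp ob \<cdot> V (src \<Gamma> e) a \<cdot> V (src \<Gamma> e) (- a)" using rpc sv by (simp add: F.m_assoc V_add V_zero)
        also have "\<dots> = h \<cdot> rp ob1 \<cdot> V (src \<Gamma> e) (?b - a)" using h3 rpc1 sv Hc h by (simp add: F.m_assoc V_add)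
        finally have h4: "rp ob = h \<cdot> rp ob1 \<cdot> V (src \<Gamma> e) (?b - a)" .
        then have "vertex_orbit H (src \<Gamma> e) (rp ob) = vertex_orbit H (src \<Gamma> e) (rp ob1)"
          using vertex_orbit_translate[OF H sv(1) h(2) rpc1] by simp
        then have obs: "ob1 = ob" using r(3)[OF k(2)] r(3)[OF e1(2)] k(4) e1(3) h(1) by simp
        \<comment> \<open>By \<open>h4\<close>, \<open>h\<close> fixes the vertex of the chosen
          representative, so it belongs to a stabilizer whose generators are in
          \<open>P\<close>.\<close>
        have "cj ob (a - ?b) = h"
        proof -
          have "rp ob \<cdot> V (src \<Gamma> e) (a - ?b) = h \<cdot> rp ob"
            using arg_cong[OF h4, of "\<lambda>x. x \<cdot> V (src \<Gamma> e) (a - ?b)"] rpc sv Hc[OF h(2)] obs by (simp add: F.m_assoc V_add V_zero)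
          then show ?thesis unfolding cj_def k(4) using rpc Hc[OF h(2)] by (simp add: F.m_assoc)
        qed
        then have hK: "h \<in> K" using cjK[OF k(2), of "a - ?b"] h by simp
        from hh \<epsilon> obtain ob' b where hh': "hh \<epsilon> \<in> H" "ob' \<in> VS" "ob' = vertex_orbit H (goal \<epsilon>) (move \<epsilon>)" "move \<epsilon> = hh \<epsilon> \<cdot> rp ob' \<cdot> V (goal \<epsilon>) b" by blast
        have hhK: "hh \<epsilon> \<in> K" using PK \<epsilon> unfolding P_def by blast
        have gm: "goal \<epsilon> = tgt \<Gamma> e" "move \<epsilon> = rp ob \<cdot> V (src \<Gamma> e) g \<cdot> E e" using d h(1) obs by (auto simp: goal_def move_def)
        have kc: "k \<in> carrier (path_group \<Gamma>)" "h \<in> carrier (path_group \<Gamma>)" "hh \<epsilon> \<in> carrier (path_group \<Gamma>)"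
          "move \<epsilon> \<in> carrier (path_group \<Gamma>)" "rp ob' \<in> carrier (path_group \<Gamma>)"
          using k(1) h(2) hh'(1) KH Hc pc[OF r(2)[OF hh'(2)]] rpc sv 2(2) unfolding gm(2) by auto
        have "cl (w @ [l]) = k \<cdot> (rp ob \<cdot> V (src \<Gamma> e) a) \<cdot> E e"
          using k(5) 2 w sv rpc kc by (simp add: cl_append cl_Edg cl_Nil F.m_assoc)
        also have "\<dots> = k \<cdot> h \<cdot> rp ob \<cdot> V (src \<Gamma> e) g \<cdot> (V (src \<Gamma> e) (lab_src \<Gamma> e *v z) \<cdot> E e)"
          unfolding h3 obs using rpc sv kc 2(2) by (simp add: F.m_assoc flip: V_add)
        also have "\<dots> = (k \<cdot> h) \<cdot> move \<epsilon> \<cdot> V (tgt \<Gamma> e) (lab_tgt \<Gamma> e *v z)"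
          unfolding gm E_V[OF 2(2), symmetric] using rpc sv kc 2(2) by (simp add: F.m_assoc)
        finally have wl: "cl (w @ [l]) = (k \<cdot> h) \<cdot> move \<epsilon> \<cdot> V (tgt \<Gamma> e) (lab_tgt \<Gamma> e *v z)" .
        have "k \<cdot> h \<in> H" using k h KH subgroup.m_closed[OF H] by blast
        then have "ob' = vertex_orbit H v (cl (w @ [l]))"
          unfolding wl 2(3) hh'(3) gm(1) by (intro vertex_orbit_translate[OF H sv(2) _ kc(4), symmetric])
        moreover have "cl (w @ [l]) = (k \<cdot> h \<cdot> hh \<epsilon>) \<cdot> rp ob' \<cdot> V v (b + lab_tgt \<Gamma> e *v z)"
          unfolding wl hh'(4) gm(1) 2(3) using kc sv by (simp add: F.m_assoc V_add)
        moreover have "rv ob' = v"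
        proof -
          have "move \<epsilon> \<in> path_classes \<Gamma> v\<^sub>0 (tgt \<Gamma> e)"
            using mult[OF mult[OF r(2)[OF k(2), unfolded k(4)] Vp[OF sv(1)]] Ep[OF 2(2)]] gm by simp
          from rep[OF sv(2) this] obtain ob2 where "ob2 = vertex_orbit H (tgt \<Gamma> e) (move \<epsilon>)" "rv ob2 = tgt \<Gamma> e" by blast
          then show ?thesis unfolding hh'(3) gm(1) 2(3) by simp
        qed
        moreover have "k \<cdot> h \<cdot> hh \<epsilon> \<in> K" using k hK hhK subgroup.m_closed[OF K] by blast
        ultimately show ?thesis using hh'(2) by blast
      qed
    qed
    show "H \<subseteq> K'"
    proof
      fix x assume x: "x \<in> H"
      then obtain w where w: "path_word \<Gamma> v\<^sub>0 w v\<^sub>0" "x = cl w" using HG by (auto simp: path_classes_def)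
      from main[OF w(1)] obtain k ob a where k: "k \<in> K" "ob \<in> VS" "ob = vertex_orbit H v\<^sub>0 (cl w)" "rv ob = v\<^sub>0" "cl w = k \<cdot> rp ob \<cdot> V v\<^sub>0 a" by blast
      have "ob = o0" unfolding k(3) o0_def
        using vertex_orbit_translate[OF H v0 x, of "\<one>\<^bsub>path_group \<Gamma>\<^esub>" 0] w Hc[OF x] v0 by (simp add: V_zero)
      then have rp1: "rp ob = \<one>\<^bsub>path_group \<Gamma>\<^esub>" by (simp add: rp_def)
      have kc: "k \<in> carrier (path_group \<Gamma>)" using k KH Hc by blast
      have "V v\<^sub>0 a = inv\<^bsub>path_group \<Gamma>\<^esub> k \<cdot> x" using k(5) rp1 kc v0 w by simp
      then have "V v\<^sub>0 a \<in> H" using x k KH subgroup.m_closed[OF H] subgroup.m_inv_closed[OF H] by (metis subsetD)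
      then have "V v\<^sub>0 a \<in> K" using cjK[OF k(2), of a] rp1 k(4) v0 by (simp add: cj_def)
      then have "x \<in> K" using k rp1 kc w subgroup.m_closed[OF K] by (metis F.r_one)
      then show "x \<in> K'" unfolding K_def by blast
    qed
  qed
qed

end

end

subsection \<open>Amenable graphs of groups\<close>

context gbs_graph
begin

lemma amenable_fundamental_groupI:
  fixes \<kappa> :: "int ^ 'd \<Rightarrow> ('v, 'e, 'd) word set"
  assumes v: "v\<^sub>0 \<in> verts \<Gamma>" and S: "S \<subseteq> path_classes \<Gamma> v\<^sub>0 v\<^sub>0"
    and gen: "\<And>K. subgroup K (path_group \<Gamma>) \<Longrightarrow> S \<subseteq> K \<Longrightarrow> path_classes \<Gamma> v\<^sub>0 v\<^sub>0 \<subseteq> K"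
    and \<kappa>: "\<And>a. \<kappa> a \<in> path_classes \<Gamma> v\<^sub>0 v\<^sub>0" "\<And>a b. \<kappa> a \<cdot> \<kappa> b = \<kappa> (a + b)"
    and ai: "\<And>\<epsilon> :: real. \<epsilon> > 0 \<Longrightarrow> \<exists>(J :: int set) g. finite J \<and> J \<noteq> {} \<and> g \<in> J \<rightarrow> path_classes \<Gamma> v\<^sub>0 v\<^sub>0 \<and>
      (\<forall>s\<in>S. \<exists>\<pi> c. inj_on \<pi> J \<and> real (card {j \<in> J. \<not> (\<pi> j \<in> J \<and> s \<cdot> g j = g (\<pi> j) \<cdot> \<kappa> (c j))}) \<le> \<epsilon> * card J)"
  shows "amenable (fundamental_group \<Gamma> v\<^sub>0)"
proof -
  interpret G: group "fundamental_group \<Gamma> v\<^sub>0" using v by (rule group_fundamental_group)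
  show ?thesis
  proof (rule G.amenable_if_almost_invariant_cosets[of S \<kappa>])
    show "carrier (fundamental_group \<Gamma> v\<^sub>0) \<subseteq> K" if "subgroup K (fundamental_group \<Gamma> v\<^sub>0)" "S \<subseteq> K" for K
      unfolding fundamental_group_simps using that gen by (simp add: subgroup_fundamental_group[OF v])
  qed (unfold fundamental_group_simps, (rule S \<kappa> ai; assumption?)+)
qed

lemma V_path_class: "v \<in> verts \<Gamma> \<Longrightarrow> V v a \<in> path_classes \<Gamma> v v"
  unfolding path_classes_def V_def by (auto intro!: exI[of _ "[Vtx v a]"] path_word.intros)

lemma path_classes_mult: "x \<in> path_classes \<Gamma> u v \<Longrightarrow> y \<in> path_classes \<Gamma> v w \<Longrightarrow> x \<cdot> y \<in> path_classes \<Gamma> u w"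
proof -
  assume "x \<in> path_classes \<Gamma> u v" "y \<in> path_classes \<Gamma> v w"
  then obtain a b where ab: "x = cl a" "path_word \<Gamma> u a v" "y = cl b" "path_word \<Gamma> v b w"
    unfolding path_classes_def by blast
  then have "x \<cdot> y = cl (a @ b)" using path_word_words by (simp add: cl_append)
  then show ?thesis unfolding path_classes_def using path_word_append[OF ab(2,4)] by blast
qed

lemma E_path_class: "e \<in> edges \<Gamma> \<Longrightarrow> E e \<in> path_classes \<Gamma> (src \<Gamma> e) (tgt \<Gamma> e)"
  unfolding path_classes_def E_def using tgt_in by (auto intro!: exI[of _ "[Edg e]"] path_word.intros)

lemma one_path_class: "v \<in> verts \<Gamma> \<Longrightarrow> \<one>\<^bsub>path_group \<Gamma>\<^esub> \<in> path_classes \<Gamma> v v"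
  using V_path_class[of v 0] by (simp add: V_zero)

text \<open>Since \<open>lab_src\<close> is onto, vertex elements can be moved to the right across
  \<open>t\<close>. They therefore fix all cosets of the vertex group at nonnegative powers of
  \<open>t\<close>, while \<open>t\<close> shifts these cosets, so a long interval of powers is
  almost invariant.\<close>

lemma loop_amenable:
  assumes v: "verts \<Gamma> = {v\<^sub>0}" and e: "edges \<Gamma> \<subseteq> {e, opp \<Gamma> e}"
    and surj: "\<And>z. e \<in> edges \<Gamma> \<Longrightarrow> \<exists>z'. lab_src \<Gamma> e *v z' = z"
  shows "amenable (fundamental_group \<Gamma> v\<^sub>0)"
proof -
  have v0: "v\<^sub>0 \<in> verts \<Gamma>" using v by simp
  let ?S = "range (V v\<^sub>0) \<union> E ` ({e} \<inter> edges \<Gamma>)"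
  let ?P = "path_classes \<Gamma> v\<^sub>0 v\<^sub>0"
  have st: "e' \<in> edges \<Gamma> \<Longrightarrow> src \<Gamma> e' = v\<^sub>0 \<and> tgt \<Gamma> e' = v\<^sub>0" for e' using src_in tgt_in v by blast
  have EP: "e \<in> edges \<Gamma> \<Longrightarrow> E e \<in> ?P" using E_path_class[of e] st by simp
  have SP: "?S \<subseteq> ?P" using V_path_class[OF v0] EP by auto
  \<comment> \<open>In a graph without edges \<open>t\<close> is trivial and the family
    \<open>g\<close> repeats a single coset, which an indexed family permits.\<close>
  define t where "t = (if e \<in> edges \<Gamma> then E e else \<one>\<^bsub>path_group \<Gamma>\<^esub>)"
  have tP: "t \<in> ?P" unfolding t_def using EP one_path_class[OF v0] by simp
  have tc: "t \<in> carrier (path_group \<Gamma>)" using tP path_classes_carrier by blast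
  define g where "g j = t [^]\<^bsub>path_group \<Gamma>\<^esub> nat j" for j :: int
  have gP: "g j \<in> ?P" for j
  proof -
    have "t [^]\<^bsub>path_group \<Gamma>\<^esub> (n :: nat) \<in> ?P" for n
      by (induction n) (use one_path_class[OF v0] path_classes_mult tP in auto)
    then show ?thesis by (simp add: g_def)
  qed
  have Vt: "\<exists>b. V v\<^sub>0 a \<cdot> t = t \<cdot> V v\<^sub>0 b" for a
  proof (cases "e \<in> edges \<Gamma>")
    case True
    then obtain z where "lab_src \<Gamma> e *v z = a" using surj by blast
    then have "V v\<^sub>0 a \<cdot> t = t \<cdot> V v\<^sub>0 (lab_tgt \<Gamma> e *v z)"
      using E_V[OF True, of z] st[OF True] True by (simp add: t_def)
    then show ?thesis ..
  qed (use v0 in \<open>auto simp: t_def\<close>)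
  have Vtn: "\<exists>b. V v\<^sub>0 a \<cdot> t [^]\<^bsub>path_group \<Gamma>\<^esub> (n :: nat) = t [^]\<^bsub>path_group \<Gamma>\<^esub> n \<cdot> V v\<^sub>0 b" for a n
  proof (induction n)
    case 0
    then show ?case using v0 by auto
  next
    case (Suc n)
    then obtain b where b: "V v\<^sub>0 a \<cdot> t [^]\<^bsub>path_group \<Gamma>\<^esub> n = t [^]\<^bsub>path_group \<Gamma>\<^esub> n \<cdot> V v\<^sub>0 b" by blast
    obtain b' where b': "V v\<^sub>0 b \<cdot> t = t \<cdot> V v\<^sub>0 b'" using Vt by blast
    have "V v\<^sub>0 a \<cdot> t [^]\<^bsub>path_group \<Gamma>\<^esub> Suc n = t [^]\<^bsub>path_group \<Gamma>\<^esub> n \<cdot> (V v\<^sub>0 b \<cdot> t)"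
      using b v0 tc by (simp flip: F.m_assoc)
    also have "\<dots> = t [^]\<^bsub>path_group \<Gamma>\<^esub> Suc n \<cdot> V v\<^sub>0 b'"
      unfolding b' using v0 tc by (simp add: F.m_assoc)
    finally show ?case ..
  qed
  show ?thesis
  proof (rule amenable_fundamental_groupI[OF v0 SP _ V_path_class[OF v0] V_add[OF v0]])
    fix K assume K: "subgroup K (path_group \<Gamma>)" "?S \<subseteq> K"
    have EK: "E e' \<in> K" if "e' \<in> edges \<Gamma>" for e'
    proof (cases "e' = e")
      case False
      then have "e' = opp \<Gamma> e" using that e by blast
      then have "opp \<Gamma> e' = e" "e \<in> edges \<Gamma>" using that e opp_in[OF that] opp_opp[OF that] opp_neq[OF that] by auto
      then have "E e \<in> K" "E e' = inv\<^bsub>path_group \<Gamma>\<^esub> E e" using K(2) E_inv \<open>e' = opp \<Gamma> e\<close> by auto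
      then show ?thesis using F.subgroupE(3)[OF K(1)] by simp
    qed (use K(2) that in auto)
    have "cl x \<in> K" if "path_word \<Gamma> u x w" for u x w using that
    proof induction
      case (Nil v)
      then show ?case using F.subgroupE(2)[OF K(1)] subgroup.one_closed[OF K(1)] by (simp add: cl_Nil)
    next
      case (Vtx u x v a)
      then show ?case using v K(2) F.subgroupE(4)[OF K(1), of "V u a" "cl x"] path_word_words[OF Vtx(2)]
        by (auto simp: cl_Vtx)
    next
      case (Edg e x v)
      then show ?case using EK F.subgroupE(4)[OF K(1), of "E e" "cl x"] path_word_words[OF Edg(2)]
        by (auto simp: cl_Edg)
    qed
    then show "?P \<subseteq> K" unfolding path_classes_def by blast
  next
    fix \<epsilon> :: real assume "\<epsilon> > 0"
    then obtain n where n: "1 / \<epsilon> < real n" using reals_Archimedean2 by blast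
    then have n0: "n > 0" using \<open>\<epsilon> > 0\<close> by (metis gr0I less_le_not_le of_nat_0 zero_le_divide_1_iff)
    let ?J = "{0..<int n}"
    have "\<exists>\<pi> c. inj_on \<pi> ?J \<and> real (card {j \<in> ?J. \<not> (\<pi> j \<in> ?J \<and> s \<cdot> g j = g (\<pi> j) \<cdot> V v\<^sub>0 (c j))}) \<le> \<epsilon> * card ?J"
      if s: "s \<in> ?S" for s
      using s
    proof
      assume "s \<in> range (V v\<^sub>0)"
      then obtain a where a: "s = V v\<^sub>0 a" by blast
      have "\<exists>b. V v\<^sub>0 a \<cdot> g j = g j \<cdot> V v\<^sub>0 b" for j unfolding g_def by (rule Vtn)
      then obtain c where c: "\<And>j. V v\<^sub>0 a \<cdot> g j = g j \<cdot> V v\<^sub>0 (c j)" by metis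
      have none: "{j \<in> ?J. \<not> (j \<in> ?J \<and> s \<cdot> g j = g j \<cdot> V v\<^sub>0 (c j))} = {}" using a c by blast
      show ?thesis
        by (intro exI[of _ "\<lambda>j. j"] exI[of _ c], unfold none) (use \<open>\<epsilon> > 0\<close> in simp)
    next
      assume "s \<in> E ` ({e} \<inter> edges \<Gamma>)"
      then have s: "s = t" by (auto simp: t_def)
      have "t \<cdot> g j = g (j + 1) \<cdot> V v\<^sub>0 0" if "0 \<le> j" for j
      proof -
        have "nat (j + 1) = Suc (nat j)" using that by simp
        then have "g (j + 1) = t \<cdot> g j" unfolding g_def by (simp only: F.nat_pow_Suc2[OF tc])
        moreover have "g j \<in> carrier (path_group \<Gamma>)" using gP path_classes_carrier by blast
        ultimately show ?thesis using tc v0 by (simp add: V_zero)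
      qed
      then have "{j \<in> ?J. \<not> (j + 1 \<in> ?J \<and> s \<cdot> g j = g (j + 1) \<cdot> V v\<^sub>0 0)} \<subseteq> {int n - 1}" unfolding s by auto
      then have "card {j \<in> ?J. \<not> (j + 1 \<in> ?J \<and> s \<cdot> g j = g (j + 1) \<cdot> V v\<^sub>0 0)} \<le> 1"
        using card_mono[of "{int n - 1}"] by simp
      moreover have "1 \<le> \<epsilon> * card ?J" using n \<open>\<epsilon> > 0\<close> by (simp add: field_simps)
      ultimately show ?thesis
        by (intro exI[of _ "\<lambda>j. j + 1"] exI[of _ "\<lambda>_. 0"]) (auto simp: inj_on_def)
    qed
    then show "\<exists>(J :: int set) g. finite J \<and> J \<noteq> {} \<and> g \<in> J \<rightarrow> ?P \<and>
      (\<forall>s\<in>?S. \<exists>\<pi> c. inj_on \<pi> J \<and> real (card {j \<in> J. \<not> (\<pi> j \<in> J \<and> s \<cdot> g j = g (\<pi> j) \<cdot> V v\<^sub>0 (c j))}) \<le> \<epsilon> * card J)"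
      using n0 gP by (intro exI[of _ ?J] exI[of _ g] conjI ballI) auto
  qed
qed

text \<open>The edge group has index 2 in both vertex groups. As these are abelian, it is central,
  and the quotient by it is the infinite dihedral group generated by the images of \<open>x\<close>
  and \<open>y\<close>. The alternating products are its elements, and the generators act on them as
  reflections of \<int>.\<close>

lemma segment_amenable:
  assumes v: "verts \<Gamma> = {src \<Gamma> e, tgt \<Gamma> e}" and e: "e \<in> edges \<Gamma>" "edges \<Gamma> \<subseteq> {e, opp \<Gamma> e}" and nl: "src \<Gamma> e \<noteq> tgt \<Gamma> e"
    and a0: "a\<^sub>0 \<notin> range ((*v) (lab_src \<Gamma> e))" and b0: "b\<^sub>0 \<notin> range ((*v) (lab_tgt \<Gamma> e))"
    and ia: "\<And>a b. a \<notin> range ((*v) (lab_src \<Gamma> e)) \<Longrightarrow> b \<notin> range ((*v) (lab_src \<Gamma> e)) \<Longrightarrow> a - b \<in> range ((*v) (lab_src \<Gamma> e))"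
    and ib: "\<And>a b. a \<notin> range ((*v) (lab_tgt \<Gamma> e)) \<Longrightarrow> b \<notin> range ((*v) (lab_tgt \<Gamma> e)) \<Longrightarrow> a - b \<in> range ((*v) (lab_tgt \<Gamma> e))"
  shows "amenable (fundamental_group \<Gamma> (src \<Gamma> e))"
proof -
  let ?u = "src \<Gamma> e" and ?w = "tgt \<Gamma> e" and ?P = "path_classes \<Gamma> (src \<Gamma> e) (src \<Gamma> e)"
  have u: "?u \<in> verts \<Gamma>" and w: "?w \<in> verts \<Gamma>" using v by auto
  define W where "W b = E e \<cdot> V ?w b \<cdot> E (opp \<Gamma> e)" for b
  define \<kappa> where "\<kappa> z = V ?u (lab_src \<Gamma> e *v z)" for z
  have Vc: "V ?u a \<in> carrier (path_group \<Gamma>)" "V ?w a \<in> carrier (path_group \<Gamma>)"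
    "E e \<in> carrier (path_group \<Gamma>)" "E (opp \<Gamma> e) \<in> carrier (path_group \<Gamma>)" for a
    using u w e(1) opp_in[OF e(1)] by auto
  have Wc: "W b \<in> carrier (path_group \<Gamma>)" for b unfolding W_def using Vc by simp
  have WP: "W b \<in> ?P" for b
    unfolding W_def using path_classes_mult[OF path_classes_mult[OF E_path_class[OF e(1)] V_path_class[OF w]]]
      E_path_class[OF opp_in[OF e(1)]] e(1) by (simp add: src_opp tgt_opp)
  have VP: "V ?u a \<in> ?P" for a using V_path_class[OF u] .
  have W_add: "W b \<cdot> W b' = W (b + b')" for b b'
  proof -
    have "W b \<cdot> W b' = E e \<cdot> V ?w b \<cdot> (E (opp \<Gamma> e) \<cdot> E e) \<cdot> V ?w b' \<cdot> E (opp \<Gamma> e)"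
      unfolding W_def using Vc by (simp add: F.m_assoc)
    also have "\<dots> = E e \<cdot> (V ?w b \<cdot> V ?w b') \<cdot> E (opp \<Gamma> e)"
      unfolding E_opp'[OF e(1)] using Vc by (simp add: F.m_assoc)
    finally show ?thesis by (simp add: V_add[OF w] W_def)
  qed
  have W\<kappa>: "W (lab_tgt \<Gamma> e *v z) = \<kappa> z" for z
  proof -
    have "W (lab_tgt \<Gamma> e *v z) = \<kappa> z \<cdot> (E e \<cdot> E (opp \<Gamma> e))"
      unfolding W_def \<kappa>_def E_V[OF e(1)] using Vc by (simp add: F.m_assoc)
    then show ?thesis using Vc by (simp add: E_opp[OF e(1)] \<kappa>_def)
  qed
  have \<kappa>c: "\<kappa> z \<in> carrier (path_group \<Gamma>)" "\<kappa> z \<in> ?P" for z unfolding \<kappa>_def using Vc VP by simp_all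
  have \<kappa>_add: "\<kappa> z \<cdot> \<kappa> z' = \<kappa> (z + z')" for z z'
    unfolding \<kappa>_def V_add[OF u] by (simp add: matrix_vector_right_distrib)
  have \<kappa>V: "\<kappa> z \<cdot> V ?u a = V ?u a \<cdot> \<kappa> z" for z a unfolding \<kappa>_def V_add[OF u] by (simp add: add.commute)
  have \<kappa>W: "\<kappa> z \<cdot> W a = W a \<cdot> \<kappa> z" for z a unfolding W\<kappa>[symmetric] W_add by (simp add: add.commute)
  define x where "x = V ?u a\<^sub>0"
  define y where "y = W b\<^sub>0"
  have xc: "x \<in> carrier (path_group \<Gamma>)" "x \<in> ?P" unfolding x_def using Vc VP by auto
  have yc: "y \<in> carrier (path_group \<Gamma>)" "y \<in> ?P" unfolding y_def using Wc WP by auto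
  have neg: "- a \<notin> range ((*v) M)" if "a \<notin> range ((*v) M)" for a and M :: "int ^ 'd ^ 'd"
    using that int_mult_minus[of M] by (metis minus_minus rangeI rangeE)
  obtain \<zeta> where "a\<^sub>0 - (- a\<^sub>0) = lab_src \<Gamma> e *v \<zeta>" using ia[OF a0 neg[OF a0]] by blast
  then have xx: "x \<cdot> x = \<kappa> \<zeta>" unfolding x_def V_add[OF u] \<kappa>_def by simp
  obtain \<eta> where "b\<^sub>0 - (- b\<^sub>0) = lab_tgt \<Gamma> e *v \<eta>" using ib[OF b0 neg[OF b0]] by blast
  then have yy: "y \<cdot> y = \<kappa> \<eta>" unfolding y_def W_add W\<kappa>[symmetric] by simp
  define alt where "alt = rec_nat (\<lambda>_ :: bool. \<one>\<^bsub>path_group \<Gamma>\<^esub>) (\<lambda>_ r b. (if b then x else y) \<cdot> r (\<not> b))"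
  have alt: "alt 0 b = \<one>\<^bsub>path_group \<Gamma>\<^esub>" "alt (Suc n) b = (if b then x else y) \<cdot> alt n (\<not> b)" for n b
    unfolding alt_def by simp_all
  have altP: "alt n b \<in> ?P" for n b
    by (induction n arbitrary: b) (use xc yc path_classes_mult one_path_class[OF u] in \<open>auto simp: alt\<close>)
  then have altc: "alt n b \<in> carrier (path_group \<Gamma>)" for n b using path_classes_carrier by blast
  have alt\<kappa>: "\<kappa> z \<cdot> alt n b = alt n b \<cdot> \<kappa> z" for z n b
  proof (induction n arbitrary: b)
    case 0
    then show ?case using \<kappa>c by (simp add: alt)
  next
    case (Suc n)
    let ?x = "if b then x else y"
    have c: "?x \<in> carrier (path_group \<Gamma>)" using xc yc by simp
    have "\<kappa> z \<cdot> ?x = ?x \<cdot> \<kappa> z" unfolding x_def y_def using \<kappa>V \<kappa>W by simp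
    then have "\<kappa> z \<cdot> (?x \<cdot> alt n (\<not> b)) = ?x \<cdot> (\<kappa> z \<cdot> alt n (\<not> b))"
      using c altc \<kappa>c by (simp flip: F.m_assoc)
    also have "\<dots> = ?x \<cdot> alt n (\<not> b) \<cdot> \<kappa> z" unfolding Suc using c altc \<kappa>c by (simp add: F.m_assoc)
    finally show ?case unfolding alt .
  qed
  \<comment> \<open>Positive \<open>j\<close> index the alternating products of length
    \<open>j\<close> that begin with \<open>x\<close>, negative ones the products of length
    \<open>- j\<close> that begin with \<open>y\<close>. So \<open>x\<close> becomes the reflection
    \<open>1 - j\<close>, and \<open>y\<close> the reflection \<open>- 1 - j\<close>.\<close>
  define g where "g j = (if 0 \<le> j then alt (nat j) True else alt (nat (- j)) False)" for j :: int
  have g0: "j \<le> 0 \<Longrightarrow> g j = alt (nat (- j)) False" for j by (auto simp: g_def alt)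
  have gP: "g j \<in> ?P" for j unfolding g_def using altP by simp
  have gc: "g j \<in> carrier (path_group \<Gamma>)" for j using gP path_classes_carrier by blast
  have g\<kappa>: "\<kappa> z \<cdot> g j = g j \<cdot> \<kappa> z" for z j unfolding g_def using alt\<kappa> by simp
  have xg: "\<exists>c. x \<cdot> g j = g (1 - j) \<cdot> \<kappa> c" for j
  proof (cases "j \<le> 0")
    case True
    then have "nat (1 - j) = Suc (nat (- j))" by simp
    then have "g (1 - j) = x \<cdot> g j" using True g0[OF True] unfolding g_def by (simp add: alt)
    then have "x \<cdot> g j = g (1 - j) \<cdot> \<kappa> 0" using xc gc u by (simp add: \<kappa>_def V_zero)
    then show ?thesis ..
  next
    case False
    then have "nat j = Suc (nat (- (1 - j)))" by simp
    then have "g j = x \<cdot> g (1 - j)" using False g0[of "1 - j"] by (simp add: g_def alt)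
    then have "x \<cdot> g j = x \<cdot> x \<cdot> g (1 - j)" using xc gc by (simp add: F.m_assoc)
    then show ?thesis unfolding xx g\<kappa> by blast
  qed
  have yg: "\<exists>c. y \<cdot> g j = g (- 1 - j) \<cdot> \<kappa> c" for j
  proof (cases "0 \<le> j")
    case True
    then have "nat (- (- 1 - j)) = Suc (nat j)" by simp
    then have "g (- 1 - j) = y \<cdot> g j" using True g0[of "- 1 - j"] by (simp add: g_def alt)
    then have "y \<cdot> g j = g (- 1 - j) \<cdot> \<kappa> 0" using yc gc u by (simp add: \<kappa>_def V_zero)
    then show ?thesis ..
  next
    case False
    then have "nat (- j) = Suc (nat (- 1 - j))" by simp
    then have "g j = y \<cdot> g (- 1 - j)" using False by (simp add: g_def alt)
    then have "y \<cdot> g j = y \<cdot> y \<cdot> g (- 1 - j)" using yc gc by (simp add: F.m_assoc)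
    then show ?thesis unfolding yy g\<kappa> by blast
  qed
  let ?S = "range (V ?u) \<union> range W"
  show ?thesis
  proof (rule amenable_fundamental_groupI[where S = ?S and \<kappa> = \<kappa>])
    show "?u \<in> verts \<Gamma>" by (rule u)
    show "?S \<subseteq> ?P" using VP WP by blast
    show "\<kappa> a \<in> ?P" "\<kappa> a \<cdot> \<kappa> b = \<kappa> (a + b)" for a b using \<kappa>c \<kappa>_add by simp_all
  next
    fix K assume K: "subgroup K (path_group \<Gamma>)" "?S \<subseteq> K"
    \<comment> \<open>The edge \<open>e\<close> is a spanning tree, and \<open>h\<close> completes a
      path with arbitrary ends to a loop at the source of \<open>e\<close>.\<close>
    define h where "h p = (if p = ?u then \<one>\<^bsub>path_group \<Gamma>\<^esub> else E e)" for p
    have hc: "h p \<in> carrier (path_group \<Gamma>)" for p unfolding h_def using Vc by simp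
    have "h p \<cdot> cl z \<cdot> inv\<^bsub>path_group \<Gamma>\<^esub> h q \<in> K" if "path_word \<Gamma> p z q" for p z q using that
    proof induction
      case (Nil v)
      then show ?case using subgroup.one_closed[OF K(1)] hc by (simp add: cl_Nil)
    next
      case (Vtx p z q a)
      have z: "cl z \<in> carrier (path_group \<Gamma>)" using path_word_words[OF Vtx(2)] by simp
      have V: "V p a \<in> carrier (path_group \<Gamma>)" using Vtx(1) by simp
      have "h p \<cdot> V p a \<cdot> inv\<^bsub>path_group \<Gamma>\<^esub> h p \<in> K"
      proof (cases "p = ?u")
        case True
        then show ?thesis using K(2) V by (auto simp: h_def)
      next
        case False
        then have "p = ?w" using Vtx(1) v by blast
        then have "h p \<cdot> V p a \<cdot> inv\<^bsub>path_group \<Gamma>\<^esub> h p = W a" using False by (simp add: h_def W_def E_inv[OF e(1)])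
        then show ?thesis using K(2) by auto
      qed
      from F.subgroupE(4)[OF K(1) this Vtx.IH]
      have "h p \<cdot> (V p a \<cdot> cl z) \<cdot> inv\<^bsub>path_group \<Gamma>\<^esub> h q \<in> K"
        using hc z V by (simp add: F.m_assoc)
      then show ?case using Vtx(1) path_word_words[OF Vtx(2)] by (simp add: cl_Vtx)
    next
      case (Edg f z q)
      have z: "cl z \<in> carrier (path_group \<Gamma>)" using path_word_words[OF Edg(2)] by simp
      have Ef: "E f \<in> carrier (path_group \<Gamma>)" using Edg(1) by simp
      have "h (src \<Gamma> f) \<cdot> E f = h (tgt \<Gamma> f)"
      proof (cases "f = e")
        case True
        then show ?thesis using nl Vc by (simp add: h_def)
      next
        case False
        then have "f = opp \<Gamma> e" using Edg(1) e(2) by blast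
        then show ?thesis using nl e(1) by (simp add: h_def src_opp tgt_opp E_opp)
      qed
      then have "h (src \<Gamma> f) \<cdot> (E f \<cdot> cl z) \<cdot> inv\<^bsub>path_group \<Gamma>\<^esub> h q \<in> K"
        using Edg.IH hc z Ef by (simp flip: F.m_assoc)
      then show ?case using Edg(1) path_word_words[OF Edg(2)] by (simp add: cl_Edg)
    qed
    from this[of ?u _ ?u] have "cl z \<in> K" if z: "path_word \<Gamma> ?u z ?u" for z
    proof -
      have "\<one>\<^bsub>path_group \<Gamma>\<^esub> \<cdot> cl z \<cdot> \<one>\<^bsub>path_group \<Gamma>\<^esub> \<in> K"
        using \<open>\<And>z. path_word \<Gamma> ?u z ?u \<Longrightarrow> _\<close>[OF z] by (simp add: h_def)
      moreover have "cl z \<in> carrier (path_group \<Gamma>)" using path_word_words[OF z] by blast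
      ultimately show ?thesis by simp
    qed
    then show "?P \<subseteq> K" unfolding path_classes_def by blast
  next
    fix \<epsilon> :: real assume "\<epsilon> > 0"
    then obtain n where n: "1 / \<epsilon> < real n" using reals_Archimedean2 by blast
    let ?J = "{- int n..int n}"
    have big: "1 \<le> \<epsilon> * card ?J"
    proof -
      have "1 \<le> \<epsilon> * real n" using n \<open>\<epsilon> > 0\<close> by (simp add: field_simps)
      also have "\<dots> \<le> \<epsilon> * card ?J" using \<open>\<epsilon> > 0\<close> by (intro mult_left_mono) auto
      finally show ?thesis .
    qed
    \<comment> \<open>Each of the reflections moves only one point of the interval \<open>?J\<close>
      out of it, namely an endpoint \<open>m\<close>.\<close>
    have bad: "real (card {j \<in> ?J. \<not> (\<pi> j \<in> ?J \<and> s \<cdot> g j = g (\<pi> j) \<cdot> \<kappa> (c j))}) \<le> \<epsilon> * card ?J"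
      if "\<And>j. s \<cdot> g j = g (\<pi> j) \<cdot> \<kappa> (c j)" "{j \<in> ?J. \<pi> j \<notin> ?J} \<subseteq> {m}" for s \<pi> c m
    proof -
      have "{j \<in> ?J. \<not> (\<pi> j \<in> ?J \<and> s \<cdot> g j = g (\<pi> j) \<cdot> \<kappa> (c j))} \<subseteq> {m}" using that by blast
      from card_mono[OF _ this] have "real (card {j \<in> ?J. \<not> (\<pi> j \<in> ?J \<and> s \<cdot> g j = g (\<pi> j) \<cdot> \<kappa> (c j))}) \<le> 1" by simp
      then show ?thesis using big by linarith
    qed
    have step: "\<exists>\<pi> c. inj_on \<pi> ?J \<and> real (card {j \<in> ?J. \<not> (\<pi> j \<in> ?J \<and> s \<cdot> g j = g (\<pi> j) \<cdot> \<kappa> (c j))}) \<le> \<epsilon> * card ?J"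
      if s: "\<And>j. \<exists>c. s \<cdot> g j = g (\<pi> j) \<cdot> \<kappa> c" and \<pi>: "inj \<pi>" "{j \<in> ?J. \<pi> j \<notin> ?J} \<subseteq> {m}" for s \<pi> m
    proof -
      have "\<forall>j. \<exists>c. s \<cdot> g j = g (\<pi> j) \<cdot> \<kappa> c" using s by (rule allI)
      from choice[OF this] obtain c where "\<And>j. s \<cdot> g j = g (\<pi> j) \<cdot> \<kappa> (c j)" by blast
      from bad[of s \<pi> c m, OF this \<pi>(2)] show ?thesis
        using inj_on_subset[OF \<pi>(1) subset_UNIV] by blast
    qed
    have shift: "\<exists>c. s \<cdot> \<kappa> z \<cdot> g j = g k \<cdot> \<kappa> c" if ex: "\<exists>c. s \<cdot> g j = g k \<cdot> \<kappa> c" and sc: "s \<in> carrier (path_group \<Gamma>)" for s j k z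
    proof -
      obtain c where c: "s \<cdot> g j = g k \<cdot> \<kappa> c" using ex by blast
      have "s \<cdot> \<kappa> z \<cdot> g j = s \<cdot> g j \<cdot> \<kappa> z" using sc \<kappa>c gc g\<kappa> by (simp add: F.m_assoc)
      also have "\<dots> = g k \<cdot> \<kappa> (c + z)" unfolding c using \<kappa>c gc by (simp add: F.m_assoc \<kappa>_add)
      finally show ?thesis ..
    qed
    have "\<exists>\<pi> c. inj_on \<pi> ?J \<and> real (card {j \<in> ?J. \<not> (\<pi> j \<in> ?J \<and> s \<cdot> g j = g (\<pi> j) \<cdot> \<kappa> (c j))}) \<le> \<epsilon> * card ?J"
      if s: "s \<in> ?S" for s
    proof -
      consider z where "s = \<kappa> z" | z where "s = x \<cdot> \<kappa> z" | z where "s = y \<cdot> \<kappa> z"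
      proof (cases "s \<in> range (V ?u)")
        case True
        then obtain a where a: "s = V ?u a" by blast
        show ?thesis
        proof (cases "a \<in> range ((*v) (lab_src \<Gamma> e))")
          case True
          then show ?thesis using that(1) a unfolding \<kappa>_def by blast
        next
          case False
          then obtain z where "a - a\<^sub>0 = lab_src \<Gamma> e *v z" using ia a0 by blast
          then have "a = a\<^sub>0 + lab_src \<Gamma> e *v z" by (simp add: algebra_simps)
          then have "s = x \<cdot> \<kappa> z" unfolding a x_def \<kappa>_def V_add[OF u] by simp
          then show ?thesis by (rule that(2))
        qed
      next
        case False
        then obtain a where a: "s = W a" using s by blast
        show ?thesis
        proof (cases "a \<in> range ((*v) (lab_tgt \<Gamma> e))")
          case True
          then show ?thesis using that(1) a W\<kappa> by blast
        next
          case False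
          then obtain z where "a - b\<^sub>0 = lab_tgt \<Gamma> e *v z" using ib b0 by blast
          then have "a = b\<^sub>0 + lab_tgt \<Gamma> e *v z" by (simp add: algebra_simps)
          then have "s = y \<cdot> \<kappa> z" unfolding a y_def W\<kappa>[symmetric] W_add by simp
          then show ?thesis by (rule that(3))
        qed
      qed
      then show ?thesis
      proof cases
        case (1 z)
        show ?thesis by (rule step[of s "\<lambda>j. j" 0]) (use g\<kappa> in \<open>auto simp: 1\<close>)
      next
        case (2 z)
        show ?thesis
        proof (rule step[of s "\<lambda>j. 1 - j" "- int n"])
          show "\<exists>c. s \<cdot> g j = g (1 - j) \<cdot> \<kappa> c" for j unfolding 2 by (rule shift[OF xg xc(1)])
        qed (auto simp: inj_on_def)
      next
        case (3 z)
        show ?thesis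
        proof (rule step[of s "\<lambda>j. - 1 - j" "int n"])
          show "\<exists>c. s \<cdot> g j = g (- 1 - j) \<cdot> \<kappa> c" for j unfolding 3 by (rule shift[OF yg yc(1)])
        qed (auto simp: inj_on_def)
      qed
    qed
    then show "\<exists>(J :: int set) g. finite J \<and> J \<noteq> {} \<and> g \<in> J \<rightarrow> ?P \<and>
      (\<forall>s\<in>?S. \<exists>\<pi> c. inj_on \<pi> J \<and> real (card {j \<in> J. \<not> (\<pi> j \<in> J \<and> s \<cdot> g j = g (\<pi> j) \<cdot> \<kappa> (c j))}) \<le> \<epsilon> * card J)"
      using gP by (intro exI[of _ ?J] exI[of _ g] conjI ballI) auto
  qed
qed

end

subsection \<open>Gadgets\<close>

lemma invertible_int_surj:
  fixes M :: "int ^ 'n ^ 'n"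
  assumes "invertible M" shows "\<exists>z. M *v z = a"
proof -
  obtain N where "M ** N = mat 1" using assms unfolding invertible_def by blast
  then have "M *v (N *v a) = a" by (simp add: matrix_vector_mul_assoc)
  then show ?thesis ..
qed

text \<open>If \<open>M\<close> were onto, preimages of the unit vectors would be the columns of a
  right inverse, and injectivity would make it a left inverse too.\<close>

lemma not_invertible_int:
  fixes M :: "int ^ 'n ^ 'n"
  assumes inj: "\<And>x y. M *v x = M *v y \<Longrightarrow> x = y" and ninv: "\<not> invertible M"
  shows "\<exists>a. a \<notin> range ((*v) M)"
proof (rule ccontr)
  assume "\<not> ?thesis"
  then have "\<forall>a. \<exists>z. M *v z = a" by (metis rangeE)
  then obtain f where f: "\<And>a. M *v f a = a" by metis
  define N :: "int ^ 'n ^ 'n" where "N = (\<chi> i j. f (axis j 1) $ i)"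
  have MN: "M ** N = mat 1"
  proof -
    have "(M ** N) $ i $ j = (M *v f (axis j 1)) $ i" for i j
      by (simp add: matrix_matrix_mult_def matrix_vector_mult_def N_def)
    then show ?thesis unfolding f by (simp add: vec_eq_iff mat_def axis_def)
  qed
  have "N *v (M *v x) = x" for x
    by (rule inj) (simp add: matrix_vector_mul_assoc MN matrix_mul_assoc)
  then have "N ** M = mat 1"
    by (intro matrix_eq[THEN iffD2]) (simp flip: matrix_vector_mul_assoc)
  then show False using MN ninv unfolding invertible_def by blast
qed

context gbs_graph
begin

text \<open>\<open>transport x es y\<close>: the vertex group element \<open>x\<close> can be pushed through the edges \<open>es\<close>, where it becomes \<open>y\<close>.\<close>

primrec transport :: "int ^ 'd \<Rightarrow> 'e list \<Rightarrow> int ^ 'd \<Rightarrow> bool" where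
  "transport x [] y \<longleftrightarrow> y = x"
| "transport x (e # es) y \<longleftrightarrow> (\<exists>z. lab_src \<Gamma> e *v z = x \<and> transport (lab_tgt \<Gamma> e *v z) es y)"

lemma transport_append: "transport x (es @ fs) y \<longleftrightarrow> (\<exists>w. transport x es w \<and> transport w fs y)"
  by (induction es arbitrary: x) auto

lemma slide_transport: "slide x S a S a' \<longleftrightarrow> transport x (map snd S) (a' - a)"
proof (induction S arbitrary: x)
  case Nil
  then show ?case by (auto simp: algebra_simps)
qed simp

lemma lab_inj': "e \<in> edges \<Gamma> \<Longrightarrow> lab_src \<Gamma> e *v x = lab_src \<Gamma> e *v y \<longleftrightarrow> x = y"
  "e \<in> edges \<Gamma> \<Longrightarrow> lab_tgt \<Gamma> e *v x = lab_tgt \<Gamma> e *v y \<longleftrightarrow> x = y"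
  using lab_inj by auto

lemma proper_lab:
  assumes "e \<in> edges \<Gamma>"
  shows "\<not> invertible (lab_src \<Gamma> e) \<Longrightarrow> \<exists>a. a \<notin> range ((*v) (lab_src \<Gamma> e))"
    and "\<not> invertible (lab_tgt \<Gamma> e) \<Longrightarrow> \<exists>a. a \<notin> range ((*v) (lab_tgt \<Gamma> e))"
  using not_invertible_int lab_inj'[OF assms] by blast+

text \<open>The data and conditions that the surgery requires inside the new piece. They depend on
  \<open>H\<close> only through the edge stabilizer \<open>Ls\<close>.\<close>

definition gadget :: "'e \<Rightarrow> (int ^ 'd) set \<Rightarrow> bool" where
  "gadget e Ls \<longleftrightarrow> (\<exists>c \<alpha> e' w2 d \<delta> w3 S4.
    (\<exists>c'. c = (0, e) # c') \<and>
    syl_path (src \<Gamma> e) (c @ [(\<alpha>, e')]) w2 \<and> reduced_path (c @ [(\<alpha>, e')]) \<and>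
    syl_path (src \<Gamma> e) (c @ d @ [(\<delta>, opp \<Gamma> e')]) w3 \<and> reduced_path (c @ d @ [(\<delta>, opp \<Gamma> e')]) \<and>
    (\<exists>S'. S4 = (0, e) # S') \<and>
    (\<forall>n. \<exists>t w. length t = n \<and> syl_path (src \<Gamma> e) (S4 @ t) w \<and> reduced_path (S4 @ t)) \<and>
    d \<noteq> [] \<and> diverge (last c) (\<alpha>, e') (hd d) \<and>
    (\<forall>t. unmatched (c @ [(\<alpha>, e')]) (S4 @ t)) \<and>
    (\<forall>t. unmatched (c @ d @ [(\<delta>, opp \<Gamma> e')]) (S4 @ t)) \<and>
    (\<forall>z. (\<exists>l\<in>Ls. slide (lab_src \<Gamma> e *v l) c \<alpha> c (\<alpha> + lab_src \<Gamma> e' *v z)) \<longleftrightarrow>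
      (\<exists>l\<in>Ls. slide (lab_src \<Gamma> e *v l) (c @ d) \<delta> (c @ d) (\<delta> + lab_tgt \<Gamma> e' *v z))))"

lemma gadget_surgery:
  assumes "subgroup H (path_group \<Gamma>)" "e \<in> edges \<Gamma>" "path_word \<Gamma> v\<^sub>0 q (src \<Gamma> e)"
    "clear H (cl q) e q \<one>\<^bsub>path_group \<Gamma>\<^esub>"
    "gadget e {z. cl q \<cdot> V (src \<Gamma> e) (lab_src \<Gamma> e *v z) \<cdot> inv\<^bsub>path_group \<Gamma>\<^esub> cl q \<in> H}"
  obtains H1 H2 where "subgroup H1 (fundamental_group \<Gamma> v\<^sub>0)" "subgroup H2 (fundamental_group \<Gamma> v\<^sub>0)" "H1 \<noteq> H2"
    "infinite_graph (tree_quotient \<Gamma> v\<^sub>0 H1)" "infinite_graph (tree_quotient \<Gamma> v\<^sub>0 H2)"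
    "\<And>w. path_word \<Gamma> v\<^sub>0 w v\<^sub>0 \<Longrightarrow> clear H (cl q) e w \<one>\<^bsub>path_group \<Gamma>\<^esub> \<Longrightarrow>
      (cl w \<in> H1 \<longleftrightarrow> cl w \<in> H) \<and> (cl w \<in> H2 \<longleftrightarrow> cl w \<in> H)"
  using assms(5) unfolding gadget_def
proof (elim exE conjE)
  fix c \<alpha> e' w2 d \<delta> w3 S4 c' S'
  assume *: "c = (0, e) # c'"
    "syl_path (src \<Gamma> e) (c @ [(\<alpha>, e')]) w2" "reduced_path (c @ [(\<alpha>, e')])"
    "syl_path (src \<Gamma> e) (c @ d @ [(\<delta>, opp \<Gamma> e')]) w3" "reduced_path (c @ d @ [(\<delta>, opp \<Gamma> e')])"
    "S4 = (0, e) # S'"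
    "\<forall>n. \<exists>t w. length t = n \<and> syl_path (src \<Gamma> e) (S4 @ t) w \<and> reduced_path (S4 @ t)"
    "d \<noteq> []" "diverge (last c) (\<alpha>, e') (hd d)"
    "\<forall>t. unmatched (c @ [(\<alpha>, e')]) (S4 @ t)"
    "\<forall>t. unmatched (c @ d @ [(\<delta>, opp \<Gamma> e')]) (S4 @ t)"
    "\<forall>z. (\<exists>l\<in>{z. cl q \<cdot> V (src \<Gamma> e) (lab_src \<Gamma> e *v z) \<cdot> inv\<^bsub>path_group \<Gamma>\<^esub> cl q \<in> H}. slide (lab_src \<Gamma> e *v l) c \<alpha> c (\<alpha> + lab_src \<Gamma> e' *v z)) \<longleftrightarrow>
      (\<exists>l\<in>{z. cl q \<cdot> V (src \<Gamma> e) (lab_src \<Gamma> e *v z) \<cdot> inv\<^bsub>path_group \<Gamma>\<^esub> cl q \<in> H}. slide (lab_src \<Gamma> e *v l) (c @ d) \<delta> (c @ d) (\<delta> + lab_tgt \<Gamma> e' *v z))"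
  show thesis
    by (rule surgery[OF assms(1-3) HOL.refl assms(4) exI[of "\<lambda>c'. c = (0, e) # c'", OF *(1)] *(2-5)
          exI[of "\<lambda>S'. S4 = (0, e) # S'", OF *(6)] spec[OF *(7)] *(8,9) spec[OF *(10)] spec[OF *(11)] spec[OF *(12)] that])
qed

text \<open>After an edge \<open>f\<close> a reduced path can turn back with a coefficient outside
  the image of \<open>lab_tgt\<close>. If there is no such coefficient, the label is invertible, so
  \<open>f\<close> is a loop and can be repeated.\<close>

lemma extend_reduced:
  assumes R: "reduced_graph \<Gamma>" and S: "syl_path u S w" "reduced_path S" "S \<noteq> []"
  shows "\<exists>t w'. length t = n \<and> syl_path u (S @ t) w' \<and> reduced_path (S @ t)"
proof (induction n)
  case 0
  show ?case using S by (intro exI[of _ "[]"]) auto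
next
  case (Suc n)
  then obtain t w' where t: "length t = n" "syl_path u (S @ t) w'" "reduced_path (S @ t)" by blast
  define T where "T = S @ t"
  obtain T' a f where T: "T = T' @ [(a, f)]" using S(3) unfolding T_def by (metis append_is_Nil_conv rev_exhaust surj_pair)
  have f: "f \<in> edges \<Gamma>" "w' = tgt \<Gamma> f" using t(2) T unfolding T_def[symmetric] by (auto simp: syl_path_append)
  have "\<exists>b f'. f' \<in> edges \<Gamma> \<and> src \<Gamma> f' = tgt \<Gamma> f \<and> no_backtrack (a, f) (b, f')"
  proof (cases "invertible (lab_tgt \<Gamma> f)")
    case True
    then have "src \<Gamma> f = tgt \<Gamma> f" using R f unfolding reduced_graph_def by blast
    then show ?thesis using f opp_neq[OF f(1)] by (intro exI[of _ 0] exI[of _ f]) (auto simp: no_backtrack_def)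
  next
    case False
    then obtain b where "b \<notin> range ((*v) (lab_tgt \<Gamma> f))" using proper_lab f by blast
    then show ?thesis using f opp_in src_opp by (intro exI[of _ b] exI[of _ "opp \<Gamma> f"]) (auto simp: no_backtrack_def)
  qed
  then obtain b f' where f': "f' \<in> edges \<Gamma>" "src \<Gamma> f' = tgt \<Gamma> f" "no_backtrack (a, f) (b, f')" by blast
  have "reduced_path (T @ [(b, f')])" using t(3) f'(3) T unfolding T_def[symmetric] by (simp add: successively_append_iff)
  moreover have "syl_path u (T @ [(b, f')]) (tgt \<Gamma> f')"
    using t(2) f f' unfolding T_def[symmetric] syl_path_append by (auto simp: tgt_in intro!: exI[of _ "tgt \<Gamma> f"])
  ultimately show ?case using t(1) unfolding T_def by (intro exI[of _ "t @ [(b, f')]"] exI[of _ "tgt \<Gamma> f'"]) simp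
qed

text \<open>In the words \<open>c f\<close>, \<open>c d f\<inverse>\<close> and \<open>c S\<close> the first one leaves the two others directly after \<open>c\<close>,
  and the two others part after a common piece \<open>C\<close>.\<close>

lemma gadgetI:
  assumes R: "reduced_graph \<Gamma>" and e: "e \<in> edges \<Gamma>"
    and c: "c \<noteq> []" "hd c = (0, e)" "syl_path (src \<Gamma> e) c u" "reduced_path c"
    and f2: "syl_path u [(\<alpha>, f)] w2" "no_backtrack (last c) (\<alpha>, f)"
    and f3: "syl_path u (d @ [(\<delta>, opp \<Gamma> f)]) w3" "reduced_path (last c # d @ [(\<delta>, opp \<Gamma> f)])"
    and S: "syl_path u S w4" "reduced_path (last c # S)"
    and ne: "d \<noteq> []" "diverge (last c) (\<alpha>, f) (hd d)" "S \<noteq> []" "diverge (last c) (\<alpha>, f) (hd S)"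
    and split: "d @ [(\<delta>, opp \<Gamma> f)] = C @ s # r" "S = C @ s' # r'" "diverge (last (last c # C)) s s'"
    and match: "\<And>z. (\<exists>l\<in>Ls. transport (lab_src \<Gamma> e *v l) (map snd c) (lab_src \<Gamma> f *v z)) \<longleftrightarrow>
      (\<exists>l\<in>Ls. transport (lab_src \<Gamma> e *v l) (map snd c @ map snd d) (lab_tgt \<Gamma> f *v z))"
  shows "gadget e Ls"
proof -
  have redc: "reduced_path (c @ X)" if "reduced_path (last c # X)" for X
    using that c by (cases X) (auto simp: successively_append_iff successively_Cons)
  have lastc: "snd (last c) \<in> edges \<Gamma>"
  proof -
    have "c = butlast c @ [last c]" using c(1) by simp
    then have "syl_path (src \<Gamma> e) (butlast c @ [last c]) u" using c(3) by simp
    then show ?thesis unfolding syl_path_append by auto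
  qed
  have pS: "syl_path (src \<Gamma> e) (c @ S) w4" using c S unfolding syl_path_append by blast
  have hdc: "\<exists>c'. c @ X = (0, e) # c'" for X using c by (cases c) auto
  have nm2: "unmatched (c @ [(\<alpha>, f)]) ((c @ S) @ t)" for t
    using unmatched_diverge[of c "(\<alpha>, f)" "hd S" "[]" "tl S @ t"] ne c(1) lastc by (cases S) simp_all
  have CS: "snd (last (c @ C)) \<in> edges \<Gamma>"
  proof (cases "C = []")
    case False
    then have "syl_path u (butlast C @ [last C] @ s' # r') w4" using S(1) unfolding split(2) by (metis append_assoc append_butlast_last_id)
    then have "snd (last C) \<in> edges \<Gamma>" unfolding syl_path_append by auto
    then show ?thesis using False by simp
  qed (use lastc in simp)
  have "last (c @ C) = last (last c # C)" using c(1) by simp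
  then have nm3: "unmatched (c @ d @ [(\<delta>, opp \<Gamma> f)]) ((c @ S) @ t)" for t
    using unmatched_diverge[of "c @ C" s s' r "r' @ t"] c(1) CS split by simp
  have "slide x c \<alpha> c (\<alpha> + y) \<longleftrightarrow> transport x (map snd c) y" "slide x (c @ d) \<delta> (c @ d) (\<delta> + y) \<longleftrightarrow> transport x (map snd c @ map snd d) y" for x y
    by (simp_all add: slide_transport)
  then have L: "(\<exists>l\<in>Ls. slide (lab_src \<Gamma> e *v l) c \<alpha> c (\<alpha> + lab_src \<Gamma> f *v z)) \<longleftrightarrow>
      (\<exists>l\<in>Ls. slide (lab_src \<Gamma> e *v l) (c @ d) \<delta> (c @ d) (\<delta> + lab_tgt \<Gamma> f *v z))" for z
    using match[of z] by simp
  have ext: "\<exists>t w. length t = n \<and> syl_path (src \<Gamma> e) ((c @ S) @ t) w \<and> reduced_path ((c @ S) @ t)" for n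
    by (rule extend_reduced[OF R pS redc[OF S(2)]]) (use c in simp)
  have p2: "syl_path (src \<Gamma> e) (c @ [(\<alpha>, f)]) w2" and p3: "syl_path (src \<Gamma> e) (c @ d @ [(\<delta>, opp \<Gamma> f)]) w3"
    using c f2 f3 unfolding syl_path_append[of _ c] by blast+
  have r2: "reduced_path (c @ [(\<alpha>, f)])" by (rule redc) (use f2 in simp)
  show ?thesis
    unfolding gadget_def
    using hdc[of "[]", unfolded append_Nil2] p2 r2 p3 redc[OF f3(2)] hdc[of S] ext ne(1,2) nm2 nm3 L by blast
qed

text \<open>The edges that can end a reduced path starting with \<open>e\<close> are explored. Such
  a path cannot turn back after \<open>f\<close> only if the target label of \<open>f\<close> is
  invertible; but then \<open>f\<close> is a loop, and turning back would lead to no new vertex. The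
  assumption on \<open>e'\<close> allows \<open>e'\<close> itself to be the way back.\<close>

lemma reach:
  assumes R: "reduced_graph \<Gamma>" and e: "e \<in> edges \<Gamma>" and e': "e' \<in> edges \<Gamma>" and ni: "\<not> invertible (lab_src \<Gamma> e')"
  obtains c where "c \<noteq> []" "hd c = (0, e)" "syl_path (src \<Gamma> e) c (tgt \<Gamma> e')" "reduced_path c" "snd (last c) = e'"
proof -
  define Q where "Q f \<longleftrightarrow> (\<exists>c. c \<noteq> [] \<and> hd c = (0, e) \<and> syl_path (src \<Gamma> e) c (tgt \<Gamma> f) \<and> reduced_path c \<and> snd (last c) = f)" for f
  have Qe: "Q e" unfolding Q_def using e tgt_in by (intro exI[of _ "[(0, e)]"]) simp
  have ext: "Q g" if f: "Q f" and g: "g \<in> edges \<Gamma>" "src \<Gamma> g = tgt \<Gamma> f" and nb: "\<And>a. no_backtrack (a, f) (b, g)" for f g b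
  proof -
    obtain c where c: "c \<noteq> []" "hd c = (0, e)" "syl_path (src \<Gamma> e) c (tgt \<Gamma> f)" "reduced_path c" "snd (last c) = f"
      using f unfolding Q_def by blast
    have "no_backtrack (last c) (b, g)" using nb[of "fst (last c)"] c(5) by (metis surjective_pairing)
    then have "reduced_path (c @ [(b, g)])" using c by (simp add: successively_append_iff)
    moreover have "syl_path (src \<Gamma> e) (c @ [(b, g)]) (tgt \<Gamma> g)"
      using c g tgt_in unfolding syl_path_append by auto
    ultimately show ?thesis using c unfolding Q_def by (intro exI[of _ "c @ [(b, g)]"]) simp
  qed
  have ext1: "Q g" if "Q f" "g \<in> edges \<Gamma>" "src \<Gamma> g = tgt \<Gamma> f" "g \<noteq> opp \<Gamma> f" for f g
    using ext[OF that(1-3), of 0] that(4) by (simp add: no_backtrack_def)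
  have ext2: "Q (opp \<Gamma> f)" if f: "Q f" "f \<in> edges \<Gamma>" "\<not> invertible (lab_tgt \<Gamma> f)" for f
  proof -
    obtain b where "b \<notin> range ((*v) (lab_tgt \<Gamma> f))" using proper_lab f by blast
    then show ?thesis using ext[OF f(1) opp_in[OF f(2)] src_opp[OF f(2)], of b] by (simp add: no_backtrack_def)
  qed
  let ?U = "{tgt \<Gamma> f | f. f \<in> edges \<Gamma> \<and> Q f}"
  have closed: "tgt \<Gamma> g \<in> ?U" if g: "g \<in> edges \<Gamma>" "src \<Gamma> g \<in> ?U" for g
  proof -
    obtain f where f: "f \<in> edges \<Gamma>" "Q f" "src \<Gamma> g = tgt \<Gamma> f" using g(2) by blast
    consider "g \<noteq> opp \<Gamma> f" | "g = opp \<Gamma> f" "\<not> invertible (lab_tgt \<Gamma> f)" | "g = opp \<Gamma> f" "invertible (lab_tgt \<Gamma> f)" by blast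
    then show ?thesis
    proof cases
      case 1
      then show ?thesis using ext1[OF f(2) g(1) f(3)] g by blast
    next
      case 2
      then show ?thesis using ext2[OF f(2,1)] g by blast
    next
      case 3
      then have "src \<Gamma> f = tgt \<Gamma> f" using R f unfolding reduced_graph_def by blast
      then have "tgt \<Gamma> g = tgt \<Gamma> f" using 3 f by (simp add: tgt_opp)
      then show ?thesis using f by blast
    qed
  qed
  have "(tgt \<Gamma> e, src \<Gamma> e') \<in> {(src \<Gamma> e, tgt \<Gamma> e) | e. e \<in> edges \<Gamma>}\<^sup>*"
    using connected e e' src_in tgt_in unfolding connected_graph_def by blast
  then have "src \<Gamma> e' \<in> ?U"
  proof (induction rule: rtrancl_induct)
    case base
    then show ?case using e Qe by blast
  next
    case (step y z)
    then show ?case using closed by blast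
  qed
  then obtain f where f: "f \<in> edges \<Gamma>" "Q f" "src \<Gamma> e' = tgt \<Gamma> f" by blast
  have "Q e'"
  proof (cases "e' = opp \<Gamma> f")
    case True
    then show ?thesis using ext2[OF f(2,1)] ni lab_src_opp[OF f(1)] by simp
  qed (use ext1[OF f(2) e' f(3)] in blast)
  then show thesis using that unfolding Q_def by blast
qed

text \<open>Here stabilizers match element by element, whatever \<open>Ls\<close> is: the detour
  \<open>ds\<close> has the same effect on vectors that reach it as the single edge
  \<open>f\<close>.\<close>

lemma transport_match:
  assumes "\<And>x w z. transport x cs w \<Longrightarrow> transport w ds (lab_tgt \<Gamma> f *v z) \<longleftrightarrow> w = lab_src \<Gamma> f *v z"
  shows "(\<exists>l\<in>Ls. transport (lab_src \<Gamma> e *v l) cs (lab_src \<Gamma> f *v z)) \<longleftrightarrow>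
    (\<exists>l\<in>Ls. transport (lab_src \<Gamma> e *v l) (cs @ ds) (lab_tgt \<Gamma> f *v z))"
proof -
  have "(\<exists>w. transport x cs w \<and> transport w ds (lab_tgt \<Gamma> f *v z)) \<longleftrightarrow> transport x cs (lab_src \<Gamma> f *v z)" for x
    by (metis assms)
  then show ?thesis unfolding transport_append by simp
qed

lemma transport_last:
  assumes "transport x (map snd c) w" "c \<noteq> []"
  shows "w \<in> range ((*v) (lab_tgt \<Gamma> (snd (last c))))"
proof -
  have "map snd c = map snd (butlast c) @ [snd (last c)]"
    using assms(2) by (metis append_butlast_last_id list.simps(8,9) map_append)
  then have "transport x (map snd (butlast c) @ [snd (last c)]) w" using assms(1) by (rule subst)
  then obtain w' where "transport w' [snd (last c)] w" unfolding transport_append by blast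
  then show ?thesis by auto
qed

text \<open>Three cosets of the image of \<open>lab_tgt\<close> give three tree edges at the end of
  \<open>c\<close>: the way back and those at \<open>\<alpha>\<close> and \<open>\<beta>\<close>.
  The edge at \<open>\<alpha>\<close> is exchanged. The detour takes the one at
  \<open>\<beta>\<close> and comes down to another vertex of the same kind, where the choice between
  \<open>\<alpha>\<close> and \<open>\<beta>\<close> separates it from the infinite part. It only
  uses \<open>e'\<close> and its opposite, so pushing just alternates between the two
  labels.\<close>

lemma gadget_index_3:
  assumes R: "reduced_graph \<Gamma>" and e: "e \<in> edges \<Gamma>" and e': "e' \<in> edges \<Gamma>"
    and ni: "\<not> invertible (lab_src \<Gamma> e')"
    and ab: "\<alpha> \<notin> range ((*v) (lab_tgt \<Gamma> e'))" "\<beta> \<notin> range ((*v) (lab_tgt \<Gamma> e'))"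
      "\<alpha> - \<beta> \<notin> range ((*v) (lab_tgt \<Gamma> e'))"
  shows "gadget e Ls"
proof -
  obtain c where c: "c \<noteq> []" "hd c = (0, e)" "syl_path (src \<Gamma> e) c (tgt \<Gamma> e')" "reduced_path c" "snd (last c) = e'"
    using reach[OF R e e' ni] .
  obtain b where b: "b \<notin> range ((*v) (lab_src \<Gamma> e'))" using proper_lab(1)[OF e' ni] by blast
  obtain a' where l: "last c = (a', e')" using c(5) by (cases "last c") auto
  note simps = src_opp[OF e'] tgt_opp[OF e'] opp_opp[OF e'] opp_in[OF e'] opp_neq[OF e'] src_in[OF e'] tgt_in[OF e']
    lab_src_opp[OF e'] lab_tgt_opp[OF e'] lab_inj'[OF e'] e'
  show ?thesis
  proof (rule gadgetI[OF R e c(1-4), where \<alpha> = \<alpha> and f = "opp \<Gamma> e'" and \<delta> = b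
        and d = "[(\<beta>, opp \<Gamma> e'), (b, e'), (\<alpha>, opp \<Gamma> e')]"
        and S = "[(\<beta>, opp \<Gamma> e'), (b, e'), (\<beta>, opp \<Gamma> e')]"
        and C = "[(\<beta>, opp \<Gamma> e'), (b, e')]" and s = "(\<alpha>, opp \<Gamma> e')" and s' = "(\<beta>, opp \<Gamma> e')"])
    show "(\<exists>l\<in>Ls. transport (lab_src \<Gamma> e *v l) (map snd c) (lab_src \<Gamma> (opp \<Gamma> e') *v z)) \<longleftrightarrow>
      (\<exists>l\<in>Ls. transport (lab_src \<Gamma> e *v l) (map snd c @ map snd [(\<beta>, opp \<Gamma> e'), (b, e'), (\<alpha>, opp \<Gamma> e')]) (lab_tgt \<Gamma> (opp \<Gamma> e') *v z))" for z
      by (rule transport_match) (auto simp: simps)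
  qed (use ab b in \<open>simp_all add: l no_backtrack_def diverge_def simps\<close>)
qed

text \<open>The edge \<open>k\<close> plays the role of a third coset. A vector at the end of
  \<open>c\<close> already lies in the image of \<open>lab_tgt\<close> of \<open>e'\<close>, so the
  excursion along \<open>opp e'\<close> returns it unchanged, and what remains is the passage
  through \<open>k\<close>. The coefficient \<open>x0\<close> permits turning back there.\<close>

lemma gadget_third_edge:
  assumes R: "reduced_graph \<Gamma>" and e: "e \<in> edges \<Gamma>" and e': "e' \<in> edges \<Gamma>"
    and ni: "\<not> invertible (lab_src \<Gamma> e')" "\<not> invertible (lab_tgt \<Gamma> e')"
    and k: "k \<in> edges \<Gamma>" "src \<Gamma> k = tgt \<Gamma> e'" "k \<noteq> opp \<Gamma> e'" "\<not> invertible (lab_tgt \<Gamma> k)"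
  shows "gadget e Ls"
proof -
  obtain c where c: "c \<noteq> []" "hd c = (0, e)" "syl_path (src \<Gamma> e) c (tgt \<Gamma> e')" "reduced_path c" "snd (last c) = e'"
    using reach[OF R e e' ni(1)] .
  obtain a where a: "a \<notin> range ((*v) (lab_tgt \<Gamma> e'))" using proper_lab(2)[OF e' ni(2)] by blast
  obtain b where b: "b \<notin> range ((*v) (lab_src \<Gamma> e'))" using proper_lab(1)[OF e' ni(1)] by blast
  obtain x0 where x0: "x0 \<notin> range ((*v) (lab_tgt \<Gamma> k))" using proper_lab(2)[OF k(1,4)] by blast
  obtain a' where l: "last c = (a', e')" using c(5) by (cases "last c") auto
  note simps = src_opp[OF e'] tgt_opp[OF e'] opp_opp[OF e'] opp_in[OF e'] opp_neq[OF e'] src_in[OF e'] tgt_in[OF e']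
    lab_src_opp[OF e'] lab_tgt_opp[OF e'] lab_inj'[OF e'] e'
    src_opp[OF k(1)] tgt_opp[OF k(1)] opp_opp[OF k(1)] opp_in[OF k(1)] opp_neq[OF k(1)] tgt_in[OF k(1)]
    lab_src_opp[OF k(1)] lab_tgt_opp[OF k(1)] lab_inj'[OF k(1)] k
  show ?thesis
  proof (rule gadgetI[OF R e c(1-4), where \<alpha> = 0 and f = k and \<delta> = x0
        and d = "[(a, opp \<Gamma> e'), (b, e'), (0, k)]"
        and S = "[(a, opp \<Gamma> e'), (b, e'), (a, opp \<Gamma> e')]"
        and C = "[(a, opp \<Gamma> e'), (b, e')]" and s = "(0, k)" and s' = "(a, opp \<Gamma> e')"])
    show "(\<exists>l\<in>Ls. transport (lab_src \<Gamma> e *v l) (map snd c) (lab_src \<Gamma> k *v z)) \<longleftrightarrow>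
      (\<exists>l\<in>Ls. transport (lab_src \<Gamma> e *v l) (map snd c @ map snd [(a, opp \<Gamma> e'), (b, e'), (0, k)]) (lab_tgt \<Gamma> k *v z))" for z
    proof (rule transport_match)
      fix x w z assume "transport x (map snd c) w"
      then obtain y where "w = lab_tgt \<Gamma> e' *v y" using transport_last[OF _ c(1)] l by auto
      then show "transport w (map snd [(a, opp \<Gamma> e'), (b, e'), (0, k)]) (lab_tgt \<Gamma> k *v z) \<longleftrightarrow> w = lab_src \<Gamma> k *v z"
        by (auto simp: simps)
    qed
  qed (use a b x0 opp_in in \<open>simp_all add: l no_backtrack_def diverge_def simps\<close>)
qed

text \<open>As \<open>lab_tgt\<close> of \<open>k\<close> is onto, a reduced path cannot turn back
  right after \<open>k\<close>; an excursion along \<open>opp e'\<close> has to come between. It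
  loses vectors that do not lie in the image of \<open>lab_tgt\<close> of \<open>e'\<close>.
  Therefore \<open>c\<close> is prolonged to \<open>?c\<close>, at whose end only those vectors are
  left that survive the excursion both before and after \<open>k\<close>.\<close>

lemma gadget_invertible_loop:
  assumes R: "reduced_graph \<Gamma>" and e: "e \<in> edges \<Gamma>" and e': "e' \<in> edges \<Gamma>"
    and ni: "\<not> invertible (lab_src \<Gamma> e')" "\<not> invertible (lab_tgt \<Gamma> e')"
    and k: "k \<in> edges \<Gamma>" "src \<Gamma> k = tgt \<Gamma> e'" and inv: "invertible (lab_src \<Gamma> k)" "invertible (lab_tgt \<Gamma> k)"
  shows "gadget e Ls"
proof -
  obtain c where c: "c \<noteq> []" "hd c = (0, e)" "syl_path (src \<Gamma> e) c (tgt \<Gamma> e')" "reduced_path c" "snd (last c) = e'"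
    using reach[OF R e e' ni(1)] .
  obtain a where a: "a \<notin> range ((*v) (lab_tgt \<Gamma> e'))" using proper_lab(2)[OF e' ni(2)] by blast
  obtain b where b: "b \<notin> range ((*v) (lab_src \<Gamma> e'))" using proper_lab(1)[OF e' ni(1)] by blast
  obtain a' where l: "last c = (a', e')" using c(5) by (cases "last c") auto
  have loop: "tgt \<Gamma> k = tgt \<Gamma> e'" using R k inv unfolding reduced_graph_def by metis
  have ne: "k \<noteq> e'" "k \<noteq> opp \<Gamma> e'" "opp \<Gamma> k \<noteq> e'" "e' \<noteq> opp \<Gamma> k" "opp \<Gamma> e' \<noteq> k" "e' \<noteq> k" "opp \<Gamma> e' \<noteq> opp \<Gamma> k" "opp \<Gamma> k \<noteq> opp \<Gamma> e'"
    using inv ni lab_src_opp[OF e'] lab_src_opp[OF k(1)] opp_opp[OF e'] opp_opp[OF k(1)] by metis+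
  note simps = src_opp[OF e'] tgt_opp[OF e'] opp_opp[OF e'] opp_in[OF e'] opp_neq[OF e'] src_in[OF e'] tgt_in[OF e']
    lab_src_opp[OF e'] lab_tgt_opp[OF e'] lab_inj'[OF e'] e'
    src_opp[OF k(1)] tgt_opp[OF k(1)] opp_opp[OF k(1)] opp_in[OF k(1)] opp_neq[OF k(1)]
    lab_src_opp[OF k(1)] lab_tgt_opp[OF k(1)] lab_inj'[OF k(1)] k loop ne
  let ?c = "c @ [(0, k), (0, opp \<Gamma> e'), (b, e'), (0, opp \<Gamma> k), (0, opp \<Gamma> e'), (b, e')]"
  have pc: "syl_path (src \<Gamma> e) ?c (tgt \<Gamma> e')"
    unfolding syl_path_append by (rule exI[of _ "tgt \<Gamma> e'"]) (use c(3) in \<open>simp add: simps\<close>)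
  have rc: "reduced_path ?c" using c b by (simp add: successively_append_iff l no_backtrack_def simps)
  show ?thesis
  proof (rule gadgetI[OF R e _ _ pc rc, where \<alpha> = 0 and f = k and \<delta> = 0
        and d = "[(a, opp \<Gamma> e'), (b, e'), (0, k), (0, opp \<Gamma> e'), (b, e')]"
        and S = "[(a, opp \<Gamma> e'), (b, e'), (a, opp \<Gamma> e')]"
        and C = "[(a, opp \<Gamma> e'), (b, e')]" and s = "(0, k)" and s' = "(a, opp \<Gamma> e')"])
    show "(\<exists>l\<in>Ls. transport (lab_src \<Gamma> e *v l) (map snd ?c) (lab_src \<Gamma> k *v z)) \<longleftrightarrow>
      (\<exists>l\<in>Ls. transport (lab_src \<Gamma> e *v l) (map snd ?c @ map snd [(a, opp \<Gamma> e'), (b, e'), (0, k), (0, opp \<Gamma> e'), (b, e')]) (lab_tgt \<Gamma> k *v z))" for z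
    proof (rule transport_match)
      fix x w z assume "transport x (map snd ?c) w"
      then obtain y y' y'' where "w = lab_tgt \<Gamma> e' *v y" "w = lab_src \<Gamma> k *v y'" "lab_tgt \<Gamma> k *v y' = lab_tgt \<Gamma> e' *v y''"
        unfolding map_append transport_append by (auto simp: simps) metis
      then show "transport w (map snd [(a, opp \<Gamma> e'), (b, e'), (0, k), (0, opp \<Gamma> e'), (b, e')]) (lab_tgt \<Gamma> k *v z) \<longleftrightarrow> w = lab_src \<Gamma> k *v z"
        by (auto simp: simps)
    qed
  qed (use a b c in \<open>simp_all add: l no_backtrack_def diverge_def simps\<close>)
qed

text \<open>An excursion along \<open>e'\<close> and back loses no vector, as \<open>lab_src\<close>
  of \<open>e'\<close> is onto, and the coefficient \<open>a\<close> keeps it reduced. It is used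
  twice: to leave \<open>c\<close> differently from \<open>k\<close>, and to separate
  \<open>k\<close> from \<open>opp k\<close>.\<close>

lemma gadget_ascending_loop:
  assumes R: "reduced_graph \<Gamma>" and e: "e \<in> edges \<Gamma>" and v: "verts \<Gamma> = {v}" and e': "e' \<in> edges \<Gamma>"
    and lab: "invertible (lab_src \<Gamma> e')" "\<not> invertible (lab_tgt \<Gamma> e')"
    and k: "k \<in> edges \<Gamma>" "k \<noteq> e'" "k \<noteq> opp \<Gamma> e'"
  shows "gadget e Ls"
proof -
  obtain a where a: "a \<notin> range ((*v) (lab_tgt \<Gamma> e'))" using proper_lab(2)[OF e' lab(2)] by blast
  have st: "src \<Gamma> f = v" "tgt \<Gamma> f = v" if "f \<in> edges \<Gamma>" for f using that src_in tgt_in v by blast+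
  have surj: "\<exists>z. lab_src \<Gamma> e' *v z = x" for x using invertible_int_surj[OF lab(1)] .
  \<comment> \<open>A letter that does not undo \<open>e\<close> and is not undone by
    \<open>e'\<close> or \<open>k\<close>, so that \<open>c\<close> can be continued by either of
    them.\<close>
  define h where "h = (if e = opp \<Gamma> e' then k else e')"
  have h: "h \<in> edges \<Gamma>" "h \<noteq> opp \<Gamma> e" "h \<noteq> opp \<Gamma> e'" "h \<noteq> opp \<Gamma> k" "opp \<Gamma> h \<noteq> k" "opp \<Gamma> h \<noteq> e'"
    using k e' e opp_opp[OF e'] opp_opp[OF k(1)] opp_opp[OF e] opp_neq[OF e'] opp_neq[OF k(1)] unfolding h_def by metis+
  have ne: "k \<noteq> e'" "k \<noteq> opp \<Gamma> e'" "opp \<Gamma> k \<noteq> e'" "e' \<noteq> opp \<Gamma> k" "opp \<Gamma> e' \<noteq> k" "e' \<noteq> k" "opp \<Gamma> e' \<noteq> opp \<Gamma> k" "opp \<Gamma> k \<noteq> opp \<Gamma> e'"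
     "k \<noteq> opp \<Gamma> k" "e' \<noteq> opp \<Gamma> e'"
    using k e' opp_opp[OF e'] opp_opp[OF k(1)] opp_neq[OF e'] opp_neq[OF k(1)] by metis+
  note simps = st[OF e'] st[OF k(1)] st[OF opp_in[OF e']] st[OF opp_in[OF k(1)]] st[OF e] st[OF h(1)]
    opp_opp[OF e'] opp_in[OF e'] opp_neq[OF e']
    lab_src_opp[OF e'] lab_tgt_opp[OF e'] lab_inj'[OF e'] e' e v
    opp_opp[OF k(1)] opp_in[OF k(1)] opp_neq[OF k(1)]
    lab_src_opp[OF k(1)] lab_tgt_opp[OF k(1)] lab_inj'[OF k(1)] k(1) ne h h(2-6)[symmetric]
  let ?c = "[(0, e), (0, h)] :: ((int ^ 'd) \<times> 'e) list"
  let ?d = "[(0, e'), (a, opp \<Gamma> e'), (0, k), (0, e'), (a, opp \<Gamma> e')] :: ((int ^ 'd) \<times> 'e) list"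
  show ?thesis
  proof (rule gadgetI[OF R e, where c = ?c and u = v and \<alpha> = 0 and f = k and \<delta> = 0
        and d = ?d
        and S = "[(0, e'), (a, opp \<Gamma> e'), (0, opp \<Gamma> k)]"
        and C = "[(0, e'), (a, opp \<Gamma> e')]" and s = "(0, k)" and s' = "(0, opp \<Gamma> k)"])
    show "(\<exists>l\<in>Ls. transport (lab_src \<Gamma> e *v l) (map snd ?c) (lab_src \<Gamma> k *v z)) \<longleftrightarrow>
      (\<exists>l\<in>Ls. transport (lab_src \<Gamma> e *v l) (map snd ?c @ map snd ?d) (lab_tgt \<Gamma> k *v z))" for z
    proof (rule transport_match)
      fix w z
      obtain y where y: "lab_src \<Gamma> e' *v y = w" using surj by blast
      obtain y' where y': "lab_tgt \<Gamma> k *v z = lab_src \<Gamma> e' *v y'" using surj by metis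
      have "transport w (map snd ?d) (lab_tgt \<Gamma> k *v z) \<longleftrightarrow>
        (\<exists>z'. w = lab_src \<Gamma> k *v z' \<and> (\<exists>y'. lab_src \<Gamma> e' *v y' = lab_tgt \<Gamma> k *v z' \<and> lab_tgt \<Gamma> k *v z = lab_src \<Gamma> e' *v y'))"
        unfolding y[symmetric] by (auto simp: simps) metis
      also have "\<dots> \<longleftrightarrow> w = lab_src \<Gamma> k *v z" using lab_inj'[OF k(1)] y' by metis
      finally show "transport w (map snd ?d) (lab_tgt \<Gamma> k *v z) \<longleftrightarrow> w = lab_src \<Gamma> k *v z" .
    qed
  qed (use a in \<open>simp_all add: no_backtrack_def diverge_def simps\<close>)
qed

section \<open>Pushing whole subgroups through edges\<close>

definition image_transport :: "(int ^ 'd) set \<Rightarrow> 'e list \<Rightarrow> (int ^ 'd) set" where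
  "image_transport L es = {y. \<exists>x\<in>L. transport x es y}"

lemma transport_zero: "transport 0 es 0"
  by (induction es) (auto intro: exI[of _ 0])

lemma transport_diff: "transport x es y \<Longrightarrow> transport x' es y' \<Longrightarrow> transport (x - x') es (y - y')"
proof (induction es arbitrary: x x')
  case (Cons e es)
  then obtain z z' where "lab_src \<Gamma> e *v z = x" "transport (lab_tgt \<Gamma> e *v z) es y"
    "lab_src \<Gamma> e *v z' = x'" "transport (lab_tgt \<Gamma> e *v z') es y'" by auto
  then show ?case using Cons.IH
    by (auto intro!: exI[of _ "z - z'"] simp: matrix_vector_mult_diff_distrib)
qed simp

lemma int_mult_smult: "(M :: int ^ 'd ^ 'd) *v (m *s x) = m *s (M *v x)"
  by (simp add: vec_eq_iff matrix_vector_mult_def sum_distrib_left algebra_simps)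

lemma transport_smult: "transport x es y \<Longrightarrow> transport (m *s x) es (m *s y)"
proof (induction es arbitrary: x)
  case (Cons e es)
  then obtain z where "lab_src \<Gamma> e *v z = x" "transport (lab_tgt \<Gamma> e *v z) es y" by auto
  then show ?case using Cons.IH by (auto intro!: exI[of _ "m *s z"] simp: int_mult_smult)
qed simp

lemma transport_inj:
  assumes "set es \<subseteq> edges \<Gamma>"
  shows "transport x es y \<Longrightarrow> transport x es y' \<Longrightarrow> y = y'" "transport x es y \<Longrightarrow> transport x' es y \<Longrightarrow> x = x'"
  using assms
proof (induction es arbitrary: x x')
  case (Cons e es)
  {
    case 1
    then show ?case using Cons.IH(1) lab_inj'[of e] by auto
  next
    case 2
    then obtain z z' where z: "lab_src \<Gamma> e *v z = x" "transport (lab_tgt \<Gamma> e *v z) es y"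
      "lab_src \<Gamma> e *v z' = x'" "transport (lab_tgt \<Gamma> e *v z') es y" by auto
    have "lab_tgt \<Gamma> e *v z = lab_tgt \<Gamma> e *v z'" by (rule Cons.IH(2)[OF z(2,4)]) (use 2 in simp)
    then show ?case using z 2 lab_inj'[of e] by auto
  }
qed simp_all

lemma zsub_image_transport:
  assumes "zsub L" shows "zsub (image_transport L es)"
  using assms unfolding zsub_def image_transport_def by (blast intro: transport_zero transport_diff)

lemma image_transport_append: "image_transport L (es @ fs) = image_transport (image_transport L es) fs"
  unfolding image_transport_def transport_append by blast

text \<open>Such a subgroup is a union of residue classes modulo \<open>m\<close>, so it is
  determined by its trace on the finite box of reduced representatives.\<close>

lemma finite_zsub_above:
  assumes m: "(m :: int) > 0"
  shows "finite {L :: (int ^ 'n) set. zsub L \<and> (\<forall>y. m *s y \<in> L)}"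
proof -
  let ?B = "{b :: int ^ 'n. \<forall>i. b $ i \<in> {0..<m}}"
  have mem: "x \<in> L \<longleftrightarrow> (\<chi> i. x $ i mod m) \<in> L \<inter> ?B" if L: "zsub L" "\<forall>y. m *s y \<in> L" for L and x :: "int ^ 'n"
  proof -
    have x: "x = (\<chi> i. x $ i mod m) + m *s (\<chi> i. x $ i div m)" by (simp add: vec_eq_iff)
    have "(\<chi> i. x $ i mod m) = x - m *s (\<chi> i. x $ i div m)" using x by (simp add: algebra_simps)
    then have "x \<in> L \<longleftrightarrow> (\<chi> i. x $ i mod m) \<in> L"
      using zsub_simps(2)[OF L(1)] zsub_simps(4)[OF L(1)] L(2) x by metis
    moreover have "(\<chi> i. x $ i mod m) \<in> ?B" using m by simp
    ultimately show ?thesis by blast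
  qed
  have "inj_on (\<lambda>L. L \<inter> ?B) {L. zsub L \<and> (\<forall>y. m *s y \<in> L)}"
  proof (rule inj_onI)
    fix L L' :: "(int ^ 'n) set"
    assume L: "L \<in> {L. zsub L \<and> (\<forall>y. m *s y \<in> L)}" "L' \<in> {L. zsub L \<and> (\<forall>y. m *s y \<in> L)}"
      and eq: "L \<inter> ?B = L' \<inter> ?B"
    have "x \<in> L \<longleftrightarrow> x \<in> L'" for x
    proof -
      from L have "zsub L" "\<forall>y. m *s y \<in> L" "zsub L'" "\<forall>y. m *s y \<in> L'" by blast+
      from mem[OF this(1,2), of x] mem[OF this(3,4), of x] show ?thesis unfolding eq by (rule HOL.trans[OF _ HOL.sym])
    qed
    then show "L = L'" by blast
  qed
  moreover have "finite ((\<lambda>L. L \<inter> ?B) ` {L. zsub L \<and> (\<forall>y. m *s y \<in> L)})"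
    by (rule finite_subset[of _ "Pow ?B"], blast) (rule finite_Pow_iff[THEN iffD2, OF finite_vec_box], simp)
  ultimately show ?thesis using finite_image_iff by blast
qed

lemma transport_bij:
  assumes "\<And>e. e \<in> set es \<Longrightarrow> e \<in> edges \<Gamma> \<and> invertible (lab_src \<Gamma> e) \<and> invertible (lab_tgt \<Gamma> e)"
  shows "\<exists>y. transport x es y" "\<exists>y. transport y es x"
proof -
  show "\<exists>y. transport x es y" using assms
  proof (induction es arbitrary: x)
    case Nil
    have "transport x [] x" by simp
    then show ?case ..
  next
    case (Cons e es)
    then obtain z where z: "lab_src \<Gamma> e *v z = x" using invertible_int_surj[of "lab_src \<Gamma> e"] by force
    obtain y where "transport (lab_tgt \<Gamma> e *v z) es y" using Cons by force
    then show ?case using z by auto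
  qed
  show "\<exists>y. transport y es x" using assms
  proof (induction es)
    case Nil
    have "transport x [] x" by simp
    then show ?case ..
  next
    case (Cons e es)
    then obtain y where y: "transport y es x" by force
    then obtain z where "lab_tgt \<Gamma> e *v z = y" using Cons.prems invertible_int_surj[of "lab_tgt \<Gamma> e"] by force
    then show ?case using y by auto
  qed
qed

text \<open>The powers of an automorphism permute the finitely many subgroups containing \<open>m\<int>\<^sup>d\<close>.\<close>

lemma image_transport_periodic:
  assumes e: "e \<in> edges \<Gamma>" and inv: "invertible (lab_src \<Gamma> e)" "invertible (lab_tgt \<Gamma> e)"
    and L: "zsub L" "m > 0" "\<And>y. m *s y \<in> L"
  obtains n where "n > 0" "image_transport L (replicate (Suc n) e) = L"
proof -
  let ?D = "\<lambda>i. image_transport L (replicate i e)"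
  have bij: "\<exists>y. transport x (replicate i e) y" "\<exists>y. transport y (replicate i e) x" for x i
    using transport_bij[of "replicate i e"] e inv by auto
  have D: "zsub (?D i)" "m *s y \<in> ?D i" for i y
  proof -
    show "zsub (?D i)" by (rule zsub_image_transport[OF L(1)])
    obtain x where "transport x (replicate i e) y" using bij by blast
    then show "m *s y \<in> ?D i" unfolding image_transport_def using transport_smult L(3) by blast
  qed
  have "range ?D \<subseteq> {L. zsub L \<and> (\<forall>y. m *s y \<in> L)}" using D by blast
  then have "finite (range ?D)" using finite_zsub_above[OF L(2)] by (rule finite_subset)
  then have "\<not> inj ?D" using finite_imageD infinite_UNIV_nat by blast
  then obtain i j where "i \<noteq> j" "?D i = ?D j" unfolding inj_def by blast
  then obtain i j where ij: "i < j" "?D i = ?D j" by (metis nat_neq_iff)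
  define N where "N = j - i"
  have N: "N > 0" "replicate j e = replicate N e @ replicate i e"
    using ij by (simp_all add: N_def flip: replicate_add)
  have DN: "image_transport (?D N) (replicate i e) = image_transport L (replicate i e)"
    using ij(2) unfolding N(2) image_transport_append by simp
  \<comment> \<open>Pushing through invertible labels is a bijection of vectors. This cancels the
    last \<open>i\<close> passages and makes the sequence of images periodic from its start.\<close>
  have inj: "A = B" if eq: "image_transport A (replicate i e) = image_transport B (replicate i e)" for A B
  proof -
    have mem: "x \<in> A \<longleftrightarrow> w \<in> image_transport A (replicate i e)" if t: "transport x (replicate i e) w" for A x w
    proof
      assume "w \<in> image_transport A (replicate i e)"
      then obtain x' where x': "x' \<in> A" "transport x' (replicate i e) w" unfolding image_transport_def by blast
      have "set (replicate i e) \<subseteq> edges \<Gamma>" using e by (simp add: set_replicate_conv_if)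
      from transport_inj(2)[OF this t x'(2)] show "x \<in> A" using x'(1) by simp
    qed (use t in \<open>auto simp: image_transport_def\<close>)
    show ?thesis
    proof (intro Set.set_eqI)
      fix x
      obtain w where "transport x (replicate i e) w" using bij(1) by blast
      from mem[OF this, of A] mem[OF this, of B] show "x \<in> A \<longleftrightarrow> x \<in> B" unfolding eq by (rule HOL.trans[OF _ HOL.sym])
    qed
  qed
  have D1: "?D N = L" by (rule inj[OF DN])
  \<comment> \<open>The period is doubled because \<open>N\<close> may be 1 while
    \<open>n > 0\<close> requires at least two passages.\<close>
  have "replicate (N + N) e = replicate N e @ replicate N e" by (rule replicate_add)
  then have "?D (N + N) = L" using D1 by (simp only: image_transport_append)
  moreover obtain n where "N + N = Suc n" "n > 0" using N(1) by (cases N) auto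
  ultimately show thesis using that by metis
qed

text \<open>A detour along \<open>opp f\<close> acts on \<int>^d by an automorphism, so vectors do
  not match one by one. The subgroup \<open>D\<close> of vectors that arrive at the end of
  \<open>c\<close> matches as a whole: \<open>n + 1\<close> passages carry it onto itself. The last
  of these passages is the second edge to be exchanged.\<close>

lemma gadget_all_invertible:
  assumes R: "reduced_graph \<Gamma>" and e: "e \<in> edges \<Gamma>" and v: "verts \<Gamma> = {v}"
    and inv: "\<And>f. f \<in> edges \<Gamma> \<Longrightarrow> invertible (lab_src \<Gamma> f) \<and> invertible (lab_tgt \<Gamma> f)"
    and f: "f \<in> edges \<Gamma>" and k: "k \<in> edges \<Gamma>" "k \<noteq> f" "k \<noteq> opp \<Gamma> f"
    and L: "zsub Ls" "m > 0" "\<And>y. m *s y \<in> Ls"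
  shows "gadget e Ls"
proof -
  have st: "src \<Gamma> f = v" "tgt \<Gamma> f = v" if "f \<in> edges \<Gamma>" for f using that src_in tgt_in v by blast+
  \<comment> \<open>Neither orientation of \<open>k\<close> is \<open>f\<close> or its opposite, and
    at least one of them does not undo \<open>e\<close>.\<close>
  define h where "h = (if k = opp \<Gamma> e then opp \<Gamma> k else k)"
  have h: "h \<in> edges \<Gamma>" "h \<noteq> opp \<Gamma> e" "h \<noteq> f" "h \<noteq> opp \<Gamma> f" "f \<noteq> opp \<Gamma> h" "opp \<Gamma> h \<noteq> opp \<Gamma> f"
  proof -
    have "h \<in> edges \<Gamma> \<and> h \<noteq> opp \<Gamma> e \<and> h \<noteq> f \<and> h \<noteq> opp \<Gamma> f"
    proof (cases "k = opp \<Gamma> e")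
      case True
      then have "h = e" unfolding h_def using opp_opp[OF e] by simp
      then show ?thesis using True e k(2,3) opp_opp[OF f] opp_neq[OF e] by auto
    qed (use k h_def in simp)
    then show h: "h \<in> edges \<Gamma>" "h \<noteq> opp \<Gamma> e" "h \<noteq> f" "h \<noteq> opp \<Gamma> f" by blast+
    show "f \<noteq> opp \<Gamma> h" using h(4) opp_opp[OF h(1)] by force
    show "opp \<Gamma> h \<noteq> opp \<Gamma> f" using h(3) opp_opp[OF h(1)] opp_opp[OF f] by force
  qed
  let ?c = "[(0, e), (0, h)] :: ((int ^ 'd) \<times> 'e) list"
  define D where "D = {y. \<exists>l\<in>Ls. transport (lab_src \<Gamma> e *v l) [e, h] y}"
  have D: "zsub D"
    unfolding zsub_def
  proof (intro conjI ballI)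
    have "transport (lab_src \<Gamma> e *v 0) [e, h] 0" using transport_zero[of "[e, h]"] by simp
    then show "0 \<in> D" unfolding D_def using zsub_simps(1)[OF L(1)] by blast
    fix y y' assume "y \<in> D" "y' \<in> D"
    then obtain l l' where l: "l \<in> Ls" "l' \<in> Ls" "transport (lab_src \<Gamma> e *v l) [e, h] y" "transport (lab_src \<Gamma> e *v l') [e, h] y'"
      unfolding D_def by blast
    have "transport (lab_src \<Gamma> e *v (l - l')) [e, h] (y - y')"
      unfolding matrix_vector_mult_diff_distrib by (rule transport_diff[OF l(3,4)])
    then show "y - y' \<in> D" unfolding D_def using zsub_simps(2)[OF L(1) l(1,2)] by blast
  qed
  have Dm: "m *s y \<in> D" for y
  proof -
    obtain x where x: "transport x [e, h] y" using transport_bij(2)[of "[e, h]" y] e h(1) inv by auto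
    obtain z where z: "lab_src \<Gamma> e *v z = x" using invertible_int_surj inv[OF e] by blast
    have "transport (lab_src \<Gamma> e *v (m *s z)) [e, h] (m *s y)" unfolding int_mult_smult z by (rule transport_smult[OF x])
    then show ?thesis unfolding D_def using L(3) by blast
  qed
  obtain n where n: "n > 0" "image_transport D (replicate (Suc n) (opp \<Gamma> f)) = D"
    using image_transport_periodic[OF opp_in[OF f] _ _ D L(2) Dm] inv[OF opp_in[OF f]] by blast
  let ?d = "replicate n (0, opp \<Gamma> f) :: ((int ^ 'd) \<times> 'e) list"
  have d: "?d = (0, opp \<Gamma> f) # replicate (n - 1) (0, opp \<Gamma> f)" using n(1) by (cases n) auto
  have last: "?d @ [(0, opp \<Gamma> f)] = [(0, opp \<Gamma> f)] @ (0, opp \<Gamma> f) # replicate (n - 1) (0, opp \<Gamma> f)"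
    using n(1) by (cases n) (auto simp: replicate_append_same)
  note simps = st[OF f] st[OF k(1)] st[OF opp_in[OF f]] st[OF opp_in[OF k(1)]] st[OF e] st[OF h(1)] st[OF opp_in[OF h(1)]]
    opp_opp[OF f] opp_in[OF f] opp_neq[OF f] lab_src_opp[OF f] lab_tgt_opp[OF f] lab_inj'[OF f] f e v
    opp_neq[OF f, symmetric] opp_in[OF h(1)] opp_neq[OF h(1)] opp_opp[OF h(1)] k(1) h h(2-6)[symmetric]
  have redn: "reduced_path (replicate j (0, opp \<Gamma> f))" for j
    by (induction j) (auto simp: successively_Cons no_backtrack_def simps hd_replicate opp_neq[OF f, symmetric])
  have pthn: "syl_path v (replicate j (0, opp \<Gamma> f)) v" for j
    by (induction j) (auto simp: simps)
  show ?thesis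
  proof (rule gadgetI[OF R e, where c = ?c and u = v and \<alpha> = 0 and f = f and \<delta> = 0 and d = ?d
        and S = "[(0, opp \<Gamma> f), (0, opp \<Gamma> h)]" and C = "[(0, opp \<Gamma> f)]" and s = "(0, opp \<Gamma> f)" and s' = "(0, opp \<Gamma> h)"])
    show "syl_path v (?d @ [(0, opp \<Gamma> f)]) v" using pthn[of "Suc n"] by (simp add: replicate_append_same)
    have "reduced_path (replicate (Suc n) (0, opp \<Gamma> f))" by (rule redn)
    then show "reduced_path (last ?c # ?d @ [(0, opp \<Gamma> f)])"
      unfolding replicate_append_same by (simp add: no_backtrack_def simps)
    show "?d @ [(0, opp \<Gamma> f)] = [(0, opp \<Gamma> f)] @ (0, opp \<Gamma> f) # replicate (n - 1) (0, opp \<Gamma> f)" by (rule last)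
    show "?d \<noteq> []" "diverge (last ?c) (0, f) (hd ?d)" using n(1) by (simp_all add: diverge_def simps)
    show "(\<exists>l\<in>Ls. transport (lab_src \<Gamma> e *v l) (map snd ?c) (lab_src \<Gamma> f *v z)) \<longleftrightarrow>
      (\<exists>l\<in>Ls. transport (lab_src \<Gamma> e *v l) (map snd ?c @ map snd ?d) (lab_tgt \<Gamma> f *v z))" for z
    proof -
      have "(\<exists>l\<in>Ls. transport (lab_src \<Gamma> e *v l) (map snd ?c) (lab_src \<Gamma> f *v z)) \<longleftrightarrow> lab_src \<Gamma> f *v z \<in> D"
        by (simp add: D_def)
      also have "\<dots> \<longleftrightarrow> lab_src \<Gamma> f *v z \<in> image_transport (image_transport D (replicate n (opp \<Gamma> f))) [opp \<Gamma> f]"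
        unfolding image_transport_append[symmetric] replicate_append_same using n(2) by simp
      also have "\<dots> \<longleftrightarrow> lab_tgt \<Gamma> f *v z \<in> image_transport D (replicate n (opp \<Gamma> f))"
        by (auto simp: image_transport_def[of _ "[opp \<Gamma> f]"] simps)
      also have "\<dots> \<longleftrightarrow> (\<exists>l\<in>Ls. transport (lab_src \<Gamma> e *v l) ([e, h] @ replicate n (opp \<Gamma> f)) (lab_tgt \<Gamma> f *v z))"
        unfolding transport_append image_transport_def D_def by blast
      finally show ?thesis by simp
    qed
  qed (simp_all add: no_backtrack_def diverge_def simps)
qed

end

subsection \<open>The perfect kernel\<close>

lemma finite_image_factor:
  assumes "finite {f x | x. P x}" "\<And>x y. P x \<Longrightarrow> P y \<Longrightarrow> f x = f y \<Longrightarrow> g x = g y"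
  shows "finite {g x | x. P x}"
proof (rule finite_subset[OF _ finite_imageI[OF assms(1)]])
  show "{g x | x. P x} \<subseteq> (\<lambda>b. g (SOME x. P x \<and> f x = b)) ` {f x | x. P x}"
  proof clarify
    fix x assume x: "P x"
    have "P (SOME y. P y \<and> f y = f x) \<and> f (SOME y. P y \<and> f y = f x) = f x"
      by (rule someI[of _ x]) (use x in simp)
    then have "g x = g (SOME y. P y \<and> f y = f x)" using assms(2)[OF x] by metis
    then show "g x \<in> (\<lambda>b. g (SOME x. P x \<and> f x = b)) ` {f x | x. P x}" using x by blast
  qed
qed

context gbs_graph
begin

text \<open>By \<open>vert\<close> and \<open>edge\<close>, being in one orbit of \<open>H\<close>
  implies being in one orbit of \<open>K\<close>. This covers overgroups of \<open>H\<close> as well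
  as groups that differ from \<open>K\<close> by elements acting trivially on the tree.\<close>

lemma finite_quotient_transfer:
  assumes H: "subgroup H (path_group \<Gamma>)" and K: "subgroup K (path_group \<Gamma>)"
    and vert: "\<And>v h p a. v \<in> verts \<Gamma> \<Longrightarrow> h \<in> H \<Longrightarrow> p \<in> carrier (path_group \<Gamma>) \<Longrightarrow>
      \<exists>k\<in>K. \<exists>b. h \<cdot> p \<cdot> V v a = k \<cdot> p \<cdot> V v b"
    and edge: "\<And>e h p z. e \<in> edges \<Gamma> \<Longrightarrow> h \<in> H \<Longrightarrow> p \<in> carrier (path_group \<Gamma>) \<Longrightarrow>
      \<exists>k\<in>K. \<exists>z'. h \<cdot> p \<cdot> V (src \<Gamma> e) (lab_src \<Gamma> e *v z) = k \<cdot> p \<cdot> V (src \<Gamma> e) (lab_src \<Gamma> e *v z')"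
    and fin: "\<not> infinite_graph (tree_quotient \<Gamma> v\<^sub>0 H)"
  shows "\<not> infinite_graph (tree_quotient \<Gamma> v\<^sub>0 K)"
proof -
  have pc: "p \<in> carrier (path_group \<Gamma>)" if "p \<in> path_classes \<Gamma> v\<^sub>0 v" for p v
    using that path_classes_carrier by blast
  have V: "verts (tree_quotient \<Gamma> v\<^sub>0 L) = {(\<lambda>(v, p). vertex_orbit L v p) x | x. fst x \<in> verts \<Gamma> \<and> snd x \<in> path_classes \<Gamma> v\<^sub>0 (fst x)}" for L
    unfolding tree_quotient_simps by (auto intro: exI[of _ "(_, _)"])
  have E: "edges (tree_quotient \<Gamma> v\<^sub>0 L) = {(\<lambda>(e, p). edge_orb L e p) x | x. fst x \<in> edges \<Gamma> \<and> snd x \<in> path_classes \<Gamma> v\<^sub>0 (src \<Gamma> (fst x))}" for L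
    unfolding tree_quotient_simps by (auto intro: exI[of _ "(_, _)"])
  have f: "finite (verts (tree_quotient \<Gamma> v\<^sub>0 H))" "finite (edges (tree_quotient \<Gamma> v\<^sub>0 H))"
    using fin unfolding infinite_graph_def by auto
  have "finite (verts (tree_quotient \<Gamma> v\<^sub>0 K))"
    unfolding V
  proof (rule finite_image_factor[OF f(1)[unfolded V]])
    fix x y :: "'v \<times> ('v, 'e, 'd) word set"
    assume xy: "fst x \<in> verts \<Gamma> \<and> snd x \<in> path_classes \<Gamma> v\<^sub>0 (fst x)" "fst y \<in> verts \<Gamma> \<and> snd y \<in> path_classes \<Gamma> v\<^sub>0 (fst y)"
      and eq: "(case x of (v, p) \<Rightarrow> vertex_orbit H v p) = (case y of (v, p) \<Rightarrow> vertex_orbit H v p)"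
    obtain v p w p' where x: "x = (v, p)" and y: "y = (w, p')" by (cases x, cases y)
    have p: "p \<in> carrier (path_group \<Gamma>)" "p' \<in> carrier (path_group \<Gamma>)" and v: "v \<in> verts \<Gamma>" "w \<in> verts \<Gamma>" using xy pc x y by auto
    obtain h a where h: "v = w" "h \<in> H" "p = h \<cdot> p' \<cdot> V v a"
      using vertex_orbit_eqD[OF H v p] eq x y by auto
    obtain k b where "k \<in> K" "p = k \<cdot> p' \<cdot> V v b" using vert[OF v(1) h(2) p(2), of a] h(3) by auto
    then have "vertex_orbit K v p = vertex_orbit K w p'" using vertex_orbit_translate[OF K v(1) _ p(2)] h(1) by simp
    then show "(case x of (v, p) \<Rightarrow> vertex_orbit K v p) = (case y of (v, p) \<Rightarrow> vertex_orbit K v p)" by (simp add: x y)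
  qed
  moreover have "finite (edges (tree_quotient \<Gamma> v\<^sub>0 K))"
    unfolding E
  proof (rule finite_image_factor[OF f(2)[unfolded E]])
    fix x y :: "'e \<times> ('v, 'e, 'd) word set"
    assume xy: "fst x \<in> edges \<Gamma> \<and> snd x \<in> path_classes \<Gamma> v\<^sub>0 (src \<Gamma> (fst x))" "fst y \<in> edges \<Gamma> \<and> snd y \<in> path_classes \<Gamma> v\<^sub>0 (src \<Gamma> (fst y))"
      and eq: "(case x of (v, p) \<Rightarrow> edge_orb H v p) = (case y of (v, p) \<Rightarrow> edge_orb H v p)"
    obtain v p w p' where x: "x = (v, p)" and y: "y = (w, p')" by (cases x, cases y)
    have p: "p \<in> carrier (path_group \<Gamma>)" "p' \<in> carrier (path_group \<Gamma>)" and v: "v \<in> edges \<Gamma>" "w \<in> edges \<Gamma>" using xy pc x y by auto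
    obtain h a where h: "v = w" "h \<in> H" "p = h \<cdot> p' \<cdot> V (src \<Gamma> v) (lab_src \<Gamma> v *v a)"
      using edge_orb_eqD[OF H v p] eq x y by auto
    obtain k b where "k \<in> K" "p = k \<cdot> p' \<cdot> V (src \<Gamma> v) (lab_src \<Gamma> v *v b)" using edge[OF v(1) h(2) p(2), of a] h(3) by auto
    then have "edge_orb K v p = edge_orb K w p'" using edge_orb_translate[OF K v(1) _ p(2)] h(1) by simp
    then show "(case x of (v, p) \<Rightarrow> edge_orb K v p) = (case y of (v, p) \<Rightarrow> edge_orb K v p)" by (simp add: x y)
  qed
  ultimately show ?thesis unfolding infinite_graph_def by blast
qed

lemma verts_closed:
  assumes "u \<in> U" "u \<in> verts \<Gamma>" "\<And>g. g \<in> edges \<Gamma> \<Longrightarrow> src \<Gamma> g \<in> U \<Longrightarrow> tgt \<Gamma> g \<in> U"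
  shows "verts \<Gamma> \<subseteq> U"
proof
  fix w assume "w \<in> verts \<Gamma>"
  then have "(u, w) \<in> {(src \<Gamma> e, tgt \<Gamma> e) | e. e \<in> edges \<Gamma>}\<^sup>*"
    using connected assms(2) unfolding connected_graph_def by blast
  then show "w \<in> U" by (induction rule: rtrancl_induct) (use assms in auto)
qed

text \<open>If the constructions of gadgets fail at \<open>e'\<close> and at its opposite, then both
  labels have index 2, and the only edge that leaves either end is the way back. By connectedness
  the graph is a single segment, whose group is amenable.\<close>

lemma gadget_nonascending:
  assumes R: "reduced_graph \<Gamma>" and v0: "v\<^sub>0 \<in> verts \<Gamma>" and na: "\<not> amenable (fundamental_group \<Gamma> v\<^sub>0)"
    and e': "e' \<in> edges \<Gamma>" and ni: "\<not> invertible (lab_src \<Gamma> e')" "\<not> invertible (lab_tgt \<Gamma> e')"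
    and e: "e \<in> edges \<Gamma>"
  shows "gadget e Ls"
proof (rule ccontr)
  assume ng: "\<not> gadget e Ls"
  have ib: "\<alpha> - \<beta> \<in> range ((*v) (lab_tgt \<Gamma> g))"
    if "g \<in> {e', opp \<Gamma> e'}" "\<alpha> \<notin> range ((*v) (lab_tgt \<Gamma> g))" "\<beta> \<notin> range ((*v) (lab_tgt \<Gamma> g))" for g \<alpha> \<beta>
    using gadget_index_3[OF R e, of g \<alpha> \<beta>] ng that e' ni opp_in[OF e'] lab_src_opp[OF e'] by auto
  have opp: "k = opp \<Gamma> g" if g: "g \<in> {e', opp \<Gamma> e'}" and k: "k \<in> edges \<Gamma>" "src \<Gamma> k = tgt \<Gamma> g" for g k
  proof (rule ccontr)
    assume ne: "k \<noteq> opp \<Gamma> g"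
    have g: "g \<in> edges \<Gamma>" "\<not> invertible (lab_src \<Gamma> g)" "\<not> invertible (lab_tgt \<Gamma> g)"
      using g e' ni opp_in[OF e'] lab_src_opp[OF e'] lab_tgt_opp[OF e'] by auto
    consider "\<not> invertible (lab_tgt \<Gamma> k)" | "invertible (lab_src \<Gamma> k)" "invertible (lab_tgt \<Gamma> k)"
      | "\<not> invertible (lab_src \<Gamma> k)" "invertible (lab_tgt \<Gamma> k)" by blast
    then show False
    proof cases
      case 1
      then show ?thesis using gadget_third_edge[OF R e g k ne] ng by blast
    next
      case 2
      then show ?thesis using gadget_invertible_loop[OF R e g k] ng by blast
    next
      \<comment> \<open>Having one invertible label, \<open>k\<close> is a loop, and its opposite
        has a target label that is not invertible; so the opposite can serve as the third
        edge.\<close>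
      case 3
      then have "src \<Gamma> k = tgt \<Gamma> k" using R k unfolding reduced_graph_def by blast
      then have s: "src \<Gamma> (opp \<Gamma> k) = tgt \<Gamma> g" using src_opp[OF k(1)] k by simp
      have "k \<noteq> g" using 3 g by blast
      then have "opp \<Gamma> k \<noteq> opp \<Gamma> g" using opp_opp[OF k(1)] opp_opp[OF g(1)] by force
      moreover have "\<not> invertible (lab_tgt \<Gamma> (opp \<Gamma> k))" using 3 lab_tgt_opp[OF k(1)] by simp
      ultimately show ?thesis using gadget_third_edge[OF R e g opp_in[OF k(1)] s] ng by blast
    qed
  qed
  have nl: "src \<Gamma> e' \<noteq> tgt \<Gamma> e'" using opp[of e' e'] e' opp_neq[OF e'] by auto
  have at: "k \<in> {e', opp \<Gamma> e'}" if "k \<in> edges \<Gamma>" "src \<Gamma> k \<in> {src \<Gamma> e', tgt \<Gamma> e'}" for k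
    using that opp[of e' k] opp[of "opp \<Gamma> e'" k] tgt_opp[OF e'] opp_opp[OF e'] by auto
  have vs: "verts \<Gamma> \<subseteq> {src \<Gamma> e', tgt \<Gamma> e'}"
  proof (rule verts_closed)
    show "src \<Gamma> e' \<in> verts \<Gamma>" by (rule src_in[OF e'])
    show "tgt \<Gamma> g \<in> {src \<Gamma> e', tgt \<Gamma> e'}" if "g \<in> edges \<Gamma>" "src \<Gamma> g \<in> {src \<Gamma> e', tgt \<Gamma> e'}" for g
      using at[OF that] tgt_opp[OF e'] by auto
  qed simp
  have es: "edges \<Gamma> \<subseteq> {e', opp \<Gamma> e'}" using at vs src_in by blast
  obtain a b where ab: "a \<notin> range ((*v) (lab_src \<Gamma> e'))" "b \<notin> range ((*v) (lab_tgt \<Gamma> e'))"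
    using proper_lab[OF e'] ni by blast
  have isrc: "\<alpha> - \<beta> \<in> range ((*v) (lab_src \<Gamma> e'))"
    if "\<alpha> \<notin> range ((*v) (lab_src \<Gamma> e'))" "\<beta> \<notin> range ((*v) (lab_src \<Gamma> e'))" for \<alpha> \<beta>
    using ib[of "opp \<Gamma> e'" \<alpha> \<beta>] that lab_tgt_opp[OF e'] by simp
  have itgt: "\<alpha> - \<beta> \<in> range ((*v) (lab_tgt \<Gamma> e'))"
    if "\<alpha> \<notin> range ((*v) (lab_tgt \<Gamma> e'))" "\<beta> \<notin> range ((*v) (lab_tgt \<Gamma> e'))" for \<alpha> \<beta>
    using ib[of e' \<alpha> \<beta>] that by simp
  have "v\<^sub>0 = src \<Gamma> e' \<or> v\<^sub>0 = tgt \<Gamma> e'" using vs v0 by blast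
  then show False
  proof
    assume v: "v\<^sub>0 = src \<Gamma> e'"
    have "amenable (fundamental_group \<Gamma> (src \<Gamma> e'))"
      by (rule segment_amenable[OF _ e' es nl ab isrc itgt]) (use vs src_in[OF e'] tgt_in[OF e'] in auto)
    then show False using na v by simp
  next
    assume v: "v\<^sub>0 = tgt \<Gamma> e'"
    have "amenable (fundamental_group \<Gamma> (src \<Gamma> (opp \<Gamma> e')))"
    proof (rule segment_amenable)
      show "verts \<Gamma> = {src \<Gamma> (opp \<Gamma> e'), tgt \<Gamma> (opp \<Gamma> e')}"
        using vs src_in[OF e'] tgt_in[OF e'] src_opp[OF e'] tgt_opp[OF e'] by auto
      show "edges \<Gamma> \<subseteq> {opp \<Gamma> e', opp \<Gamma> (opp \<Gamma> e')}" using es opp_opp[OF e'] by auto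
      show "b \<notin> range ((*v) (lab_src \<Gamma> (opp \<Gamma> e')))" "a \<notin> range ((*v) (lab_tgt \<Gamma> (opp \<Gamma> e')))"
        using ab lab_src_opp[OF e'] lab_tgt_opp[OF e'] by simp_all
    qed (use isrc itgt nl opp_in[OF e'] lab_src_opp[OF e'] lab_tgt_opp[OF e'] src_opp[OF e'] tgt_opp[OF e'] in auto)
    then show False using na v src_opp[OF e'] by simp
  qed
qed

text \<open>If every edge has an invertible label, reducedness makes all edges loops at one vertex.
  With at most one pair of opposite edges the group would be amenable by
  \<open>loop_amenable\<close>, so there is a further edge.\<close>

lemma nonamenable_cases:
  assumes R: "reduced_graph \<Gamma>" and v0: "v\<^sub>0 \<in> verts \<Gamma>" and na: "\<not> amenable (fundamental_group \<Gamma> v\<^sub>0)"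
  obtains (gadgets) "\<And>e Ls. e \<in> edges \<Gamma> \<Longrightarrow> gadget e Ls"
  | (invertible) f k where "verts \<Gamma> = {v\<^sub>0}" "\<And>f. f \<in> edges \<Gamma> \<Longrightarrow> invertible (lab_src \<Gamma> f) \<and> invertible (lab_tgt \<Gamma> f)"
    "f \<in> edges \<Gamma>" "k \<in> edges \<Gamma>" "k \<noteq> f" "k \<noteq> opp \<Gamma> f"
proof (cases "\<exists>e'\<in>edges \<Gamma>. \<not> invertible (lab_src \<Gamma> e') \<and> \<not> invertible (lab_tgt \<Gamma> e')")
  case True
  then show ?thesis using that(1) gadget_nonascending[OF R v0 na] by blast
next
  case False
  then have lp: "src \<Gamma> e = tgt \<Gamma> e" if "e \<in> edges \<Gamma>" for e using R that unfolding reduced_graph_def by blast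
  have vs: "verts \<Gamma> = {v\<^sub>0}" using verts_closed[of v\<^sub>0 "{v\<^sub>0}"] v0 lp by auto
  show ?thesis
  proof (cases "\<exists>e'\<in>edges \<Gamma>. \<not> invertible (lab_src \<Gamma> e') \<or> \<not> invertible (lab_tgt \<Gamma> e')")
    case True
    then obtain e1 where e1: "e1 \<in> edges \<Gamma>" "\<not> invertible (lab_src \<Gamma> e1) \<or> \<not> invertible (lab_tgt \<Gamma> e1)" by blast
    define e' where "e' = (if invertible (lab_src \<Gamma> e1) then e1 else opp \<Gamma> e1)"
    have e': "e' \<in> edges \<Gamma>" "invertible (lab_src \<Gamma> e')" "\<not> invertible (lab_tgt \<Gamma> e')"
      using e1 False opp_in[OF e1(1)] lab_src_opp[OF e1(1)] lab_tgt_opp[OF e1(1)] unfolding e'_def by auto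
    show ?thesis
    proof (cases "edges \<Gamma> \<subseteq> {e', opp \<Gamma> e'}")
      case True
      have "amenable (fundamental_group \<Gamma> v\<^sub>0)"
        by (rule loop_amenable[OF vs True invertible_int_surj[OF e'(2)]])
      then show ?thesis using na by blast
    next
      case False
      then obtain k where "k \<in> edges \<Gamma>" "k \<noteq> e'" "k \<noteq> opp \<Gamma> e'" by blast
      then show ?thesis using gadget_ascending_loop[OF R _ vs e'] that(1) by blast
    qed
  next
    case False
    then have inv: "\<And>f. f \<in> edges \<Gamma> \<Longrightarrow> invertible (lab_src \<Gamma> f) \<and> invertible (lab_tgt \<Gamma> f)" by blast
    show ?thesis
    proof (cases "\<exists>f k. f \<in> edges \<Gamma> \<and> k \<in> edges \<Gamma> \<and> k \<noteq> f \<and> k \<noteq> opp \<Gamma> f")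
      case True
      then show ?thesis using that(2) vs inv by blast
    next
      case False
      then obtain f where f: "edges \<Gamma> \<subseteq> {f, opp \<Gamma> f}" by blast
      have "amenable (fundamental_group \<Gamma> v\<^sub>0)"
        by (rule loop_amenable[OF vs f invertible_int_surj[OF conjunct1[OF inv]]])
      then show ?thesis using na by blast
    qed
  qed
qed

lemma infinite_quotient_subset:
  assumes "subgroup H (path_group \<Gamma>)" "subgroup K (path_group \<Gamma>)" "H \<subseteq> K"
    "\<not> infinite_graph (tree_quotient \<Gamma> v\<^sub>0 H)"
  shows "\<not> infinite_graph (tree_quotient \<Gamma> v\<^sub>0 K)"
  using assms(3) by (intro finite_quotient_transfer[OF assms(1,2) _ _ assms(4)]) blast+

text \<open>Each letter normalizes the only vertex group, because all labels are onto. The vector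
  \<open>b\<close> does not depend on \<open>m\<close>, so the subgroups m\<int>^d are normal as
  well.\<close>

lemma vertex_group_normal:
  assumes v: "verts \<Gamma> = {v}" and inv: "\<And>f. f \<in> edges \<Gamma> \<Longrightarrow> invertible (lab_src \<Gamma> f) \<and> invertible (lab_tgt \<Gamma> f)"
    and g: "g \<in> carrier (path_group \<Gamma>)"
  shows "\<exists>b. \<forall>m. g \<cdot> V v (m *s a) = V v (m *s b) \<cdot> g"
    and "\<exists>b. \<forall>m. V v (m *s a) \<cdot> g = g \<cdot> V v (m *s b)"
proof -
  have vv: "v \<in> verts \<Gamma>" using v by simp
  have st: "src \<Gamma> f = v" "tgt \<Gamma> f = v" if "f \<in> edges \<Gamma>" for f using that src_in tgt_in v by blast+
  have "\<exists>b. \<forall>m. cl w \<cdot> V v (m *s a) = V v (m *s b) \<cdot> cl w" if "w \<in> words \<Gamma>" for w a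
    using that
  proof (induction w)
    case Nil
    show ?case using vv by (intro exI[of _ a]) (simp add: cl_Nil)
  next
    case (Cons l w)
    have w: "w \<in> words \<Gamma>" using Cons.prems words_ConsD by blast
    then obtain b where b: "\<And>m. cl w \<cdot> V v (m *s a) = V v (m *s b) \<cdot> cl w" using Cons.IH by blast
    have wc: "cl w \<in> carrier (path_group \<Gamma>)" using w by blast
    have Vc: "V v x \<in> carrier (path_group \<Gamma>)" for x using vv by blast
    consider x where "l = Vtx v x" | f where "l = Edg f" "f \<in> edges \<Gamma>"
      using Cons.prems v unfolding words_def by auto
    then show ?case
    proof cases
      case (1 x)
      have "cl (l # w) \<cdot> V v (m *s a) = V v (m *s b) \<cdot> cl (l # w)" for m
      proof -
        have "cl (l # w) \<cdot> V v (m *s a) = V v x \<cdot> (cl w \<cdot> V v (m *s a))"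
          using w wc Vc vv by (simp add: 1 cl_Vtx F.m_assoc)
        also have "\<dots> = V v x \<cdot> V v (m *s b) \<cdot> cl w" unfolding b using wc Vc by (simp add: F.m_assoc)
        also have "V v x \<cdot> V v (m *s b) = V v (m *s b) \<cdot> V v x" unfolding V_add[OF vv] by (simp add: add.commute)
        finally show ?thesis using w wc Vc vv by (simp add: 1 cl_Vtx F.m_assoc)
      qed
      then show ?thesis by blast
    next
      case (2 f)
      obtain z where z: "lab_tgt \<Gamma> f *v z = b" using invertible_int_surj inv[OF 2(2)] by blast
      have Ec: "E f \<in> carrier (path_group \<Gamma>)" using 2 by blast
      have "cl (l # w) \<cdot> V v (m *s a) = V v (m *s (lab_src \<Gamma> f *v z)) \<cdot> cl (l # w)" for m
      proof -
        have "cl (l # w) \<cdot> V v (m *s a) = E f \<cdot> (cl w \<cdot> V v (m *s a))"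
          using w wc Vc Ec 2 by (simp add: cl_Edg F.m_assoc)
        also have "\<dots> = E f \<cdot> V v (m *s b) \<cdot> cl w" unfolding b using wc Vc Ec by (simp add: F.m_assoc)
        also have "E f \<cdot> V v (m *s b) = V v (m *s (lab_src \<Gamma> f *v z)) \<cdot> E f"
          using E_V[OF 2(2), of "m *s z"] unfolding int_mult_smult z st[OF 2(2)] .
        finally show ?thesis using w wc Vc Ec 2 by (simp add: cl_Edg F.m_assoc)
      qed
      then show ?thesis by blast
    qed
  qed
  then have left: "\<exists>b. \<forall>m. g \<cdot> V v (m *s a) = V v (m *s b) \<cdot> g" if "g \<in> carrier (path_group \<Gamma>)" for g a
    using that unfolding carrier_path_group by blast
  show "\<exists>b. \<forall>m. g \<cdot> V v (m *s a) = V v (m *s b) \<cdot> g" by (rule left[OF g])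
  obtain b where b: "\<And>m. inv\<^bsub>path_group \<Gamma>\<^esub> g \<cdot> V v (m *s a) = V v (m *s b) \<cdot> inv\<^bsub>path_group \<Gamma>\<^esub> g"
    using left[of "inv\<^bsub>path_group \<Gamma>\<^esub> g" a] g by auto
  have "V v (m *s a) \<cdot> g = g \<cdot> V v (m *s b)" for m
  proof -
    have Vc: "V v x \<in> carrier (path_group \<Gamma>)" for x using vv by blast
    have "V v (m *s a) \<cdot> g = g \<cdot> (inv\<^bsub>path_group \<Gamma>\<^esub> g \<cdot> V v (m *s a)) \<cdot> g"
      using g Vc by (simp flip: F.m_assoc)
    also have "\<dots> = g \<cdot> V v (m *s b)" unfolding b using g Vc by (simp add: F.m_assoc)
    finally show ?thesis .
  qed
  then show "\<exists>b. \<forall>m. V v (m *s a) \<cdot> g = g \<cdot> V v (m *s b)" by blast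
qed

text \<open>The vertex group is normal and acts trivially on the tree, so multiplying \<open>H\<close> by a subgroup of it
  does not change the quotient.\<close>

lemma enlarge_by_vertex_group:
  assumes v: "verts \<Gamma> = {v}" and inv: "\<And>f. f \<in> edges \<Gamma> \<Longrightarrow> invertible (lab_src \<Gamma> f) \<and> invertible (lab_tgt \<Gamma> f)"
    and H: "subgroup H (path_group \<Gamma>)" "infinite_graph (tree_quotient \<Gamma> v H)"
    and no: "\<And>m. m > 0 \<Longrightarrow> \<exists>y. V v (m *s y) \<notin> H"
    and W: "finite W" "W \<subseteq> carrier (path_group \<Gamma>)"
  obtains K where "subgroup K (path_group \<Gamma>)" "infinite_graph (tree_quotient \<Gamma> v K)" "K \<noteq> H" "K \<inter> W = H \<inter> W"
proof -
  have vv: "v \<in> verts \<Gamma>" using v by simp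
  have Vc: "V v x \<in> carrier (path_group \<Gamma>)" for x using vv by blast
  have Hc: "h \<in> carrier (path_group \<Gamma>)" if "h \<in> H" for h using that subgroup.subset[OF H(1)] by blast
  define L where "L = {a. V v a \<in> H}"
  have L: "zsub L"
    using zsub_conj[OF H(1) F.one_closed vv] Vc unfolding L_def by simp
  define K where "K m = {h \<cdot> V v (m *s y) | h y. h \<in> H}" for m
  have K: "subgroup (K m) (path_group \<Gamma>)" for m
  proof (rule F.subgroupI)
    show "K m \<subseteq> carrier (path_group \<Gamma>)" unfolding K_def using Hc Vc by auto
    show "K m \<noteq> {}" unfolding K_def using subgroup.one_closed[OF H(1)] by blast
    fix a assume "a \<in> K m"
    then obtain h y where a: "a = h \<cdot> V v (m *s y)" "h \<in> H" unfolding K_def by blast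
    have i: "inv\<^bsub>path_group \<Gamma>\<^esub> h \<in> H" using subgroup.m_inv_closed[OF H(1) a(2)] .
    obtain b where b: "\<And>m. V v (m *s (- y)) \<cdot> inv\<^bsub>path_group \<Gamma>\<^esub> h = inv\<^bsub>path_group \<Gamma>\<^esub> h \<cdot> V v (m *s b)"
      using vertex_group_normal(2)[OF v inv Hc[OF i], of "- y"] by blast
    have "- (m *s y) = m *s (- y)" by (simp add: vec_eq_iff)
    then have "inv\<^bsub>path_group \<Gamma>\<^esub> a = V v (m *s (- y)) \<cdot> inv\<^bsub>path_group \<Gamma>\<^esub> h"
      unfolding a(1) using Hc[OF a(2)] Vc by (simp add: F.inv_mult_group V_minus[OF vv])
    then show "inv\<^bsub>path_group \<Gamma>\<^esub> a \<in> K m" unfolding b K_def using i by blast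
    fix a' assume "a' \<in> K m"
    then obtain h' y' where a': "a' = h' \<cdot> V v (m *s y')" "h' \<in> H" unfolding K_def by blast
    obtain b' where b': "\<And>m. V v (m *s y) \<cdot> h' = h' \<cdot> V v (m *s b')"
      using vertex_group_normal(2)[OF v inv Hc[OF a'(2)], of y] by blast
    have "a \<cdot> a' = h \<cdot> (V v (m *s y) \<cdot> h') \<cdot> V v (m *s y')"
      unfolding a a' using Hc[OF a(2)] Hc[OF a'(2)] Vc by (simp add: F.m_assoc)
    also have "\<dots> = h \<cdot> h' \<cdot> (V v (m *s b') \<cdot> V v (m *s y'))"
      unfolding b' using Hc[OF a(2)] Hc[OF a'(2)] Vc by (simp add: F.m_assoc)
    also have "V v (m *s b') \<cdot> V v (m *s y') = V v (m *s (b' + y'))"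
      unfolding V_add[OF vv] by (simp add: vector_add_ldistrib)
    finally show "a \<cdot> a' \<in> K m" unfolding K_def using subgroup.m_closed[OF H(1) a(2) a'(2)] by blast
  qed
  have HK: "H \<subseteq> K m" for m
  proof
    fix h assume h: "h \<in> H"
    have "h = h \<cdot> V v (m *s 0)" using Hc[OF h] vv by (simp add: V_zero)
    then show "h \<in> K m" unfolding K_def using h by blast
  qed
  have inf: "infinite_graph (tree_quotient \<Gamma> v (K m))" for m
  proof (rule ccontr)
    assume "\<not> ?thesis"
    then have "\<not> infinite_graph (tree_quotient \<Gamma> v H)"
    proof (rule finite_quotient_transfer[OF K H(1), rotated 2])
      \<comment> \<open>A vertex element is pushed through \<open>p\<close> to the right, where the
        double cosets absorb it.\<close>
      have move: "\<exists>k\<in>H. \<exists>b. h \<cdot> p \<cdot> V v a = k \<cdot> p \<cdot> V v (b + a)" if h: "h \<in> K m" and p: "p \<in> carrier (path_group \<Gamma>)" for h p a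
      proof -
        obtain h' y where h': "h = h' \<cdot> V v (m *s y)" "h' \<in> H" using h unfolding K_def by blast
        obtain b where b: "\<And>m. V v (m *s y) \<cdot> p = p \<cdot> V v (m *s b)"
          using vertex_group_normal(2)[OF v inv p, of y] by blast
        have "h \<cdot> p \<cdot> V v a = h' \<cdot> (V v (m *s y) \<cdot> p) \<cdot> V v a"
          unfolding h' using Hc[OF h'(2)] Vc p by (simp add: F.m_assoc)
        also have "\<dots> = h' \<cdot> p \<cdot> (V v (m *s b) \<cdot> V v a)" unfolding b using Hc[OF h'(2)] Vc p by (simp add: F.m_assoc)
        finally show ?thesis unfolding V_add[OF vv] using h'(2) by blast
      qed
      show "\<exists>k\<in>H. \<exists>b. h \<cdot> p \<cdot> V u a = k \<cdot> p \<cdot> V u b" if "u \<in> verts \<Gamma>" "h \<in> K m" "p \<in> carrier (path_group \<Gamma>)" for u h p a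
      proof -
        have "u = v" using that(1) v by simp
        then show ?thesis using move[OF that(2,3), of a] by blast
      qed
      show "\<exists>k\<in>H. \<exists>z'. h \<cdot> p \<cdot> V (src \<Gamma> e) (lab_src \<Gamma> e *v z) = k \<cdot> p \<cdot> V (src \<Gamma> e) (lab_src \<Gamma> e *v z')"
        if e: "e \<in> edges \<Gamma>" and hp: "h \<in> K m" "p \<in> carrier (path_group \<Gamma>)" for e h p z
      proof -
        have s: "src \<Gamma> e = v" using src_in[OF e] v by simp
        obtain k b where k: "k \<in> H" "h \<cdot> p \<cdot> V v (lab_src \<Gamma> e *v z) = k \<cdot> p \<cdot> V v (b + lab_src \<Gamma> e *v z)"
          using move[OF hp] by blast
        obtain z' where "lab_src \<Gamma> e *v z' = b + lab_src \<Gamma> e *v z" using invertible_int_surj inv[OF e] by blast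
        then show ?thesis unfolding s using k by metis
      qed
    qed
    then show False using H(2) by blast
  qed
  \<comment> \<open>Only products of an element of \<open>H\<close> and a vertex element can enter
    \<open>K m\<close>. After division by the element of \<open>H\<close> the claim is the
    separability of \<open>L\<close>. It is stated for all multiples of the modulus, so that one
    product serves all words in \<open>W\<close> at once.\<close>
  have sep: "\<exists>m>0. \<forall>m'. m dvd m' \<longrightarrow> w \<notin> K m'" if w: "w \<in> W - H" for w
  proof (cases "\<exists>h\<in>H. \<exists>b. w = h \<cdot> V v b")
    case False
    then have "\<forall>m'. w \<notin> K m'" unfolding K_def by blast
    then show ?thesis by (intro exI[of _ 1]) simp
  next
    case True
    then obtain h b where h: "h \<in> H" "w = h \<cdot> V v b" by blast
    have "b \<notin> L" using w h subgroup.m_closed[OF H(1) h(1)] unfolding L_def by auto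
    then obtain m where m: "m > 0" "\<not> (\<exists>l\<in>L. \<exists>y. b = l + m *s y)" using zsub_separable[OF L] by blast
    have "w \<notin> K m'" if m': "m dvd m'" for m'
    proof
      assume "w \<in> K m'"
      then obtain h' y where h': "h' \<in> H" "w = h' \<cdot> V v (m' *s y)" unfolding K_def by blast
      obtain q where q: "m' = m * q" using m' by blast
      have eq: "h \<cdot> V v b = h' \<cdot> V v (m' *s y)" using h(2) h'(2) by simp
      have "V v (b - m' *s y) = inv\<^bsub>path_group \<Gamma>\<^esub> h \<cdot> (h \<cdot> V v b) \<cdot> V v (- (m' *s y))"
        using Hc[OF h(1)] Vc V_add[OF vv, of b "- (m' *s y)"] by (simp flip: F.m_assoc)
      also have "\<dots> = inv\<^bsub>path_group \<Gamma>\<^esub> h \<cdot> h' \<cdot> (V v (m' *s y) \<cdot> V v (- (m' *s y)))"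
        unfolding eq using Hc[OF h(1)] Hc[OF h'(1)] Vc by (simp add: F.m_assoc)
      also have "\<dots> = inv\<^bsub>path_group \<Gamma>\<^esub> h \<cdot> h'"
        using Hc[OF h(1)] Hc[OF h'(1)] by (simp add: V_add[OF vv] V_zero[OF vv])
      finally have "b - m' *s y \<in> L"
        unfolding L_def using subgroup.m_closed[OF H(1) subgroup.m_inv_closed[OF H(1) h(1)] h'(1)] by simp
      moreover have "b = (b - m' *s y) + m *s (q *s y)" unfolding q by (simp add: vector_smult_assoc)
      ultimately show False using m(2) by blast
    qed
    then show ?thesis using m(1) by blast
  qed
  have "\<forall>w\<in>W - H. \<exists>m>0. \<forall>m'. m dvd m' \<longrightarrow> w \<notin> K m'" using sep by (rule ballI)
  from bchoice[OF this] obtain \<mu> where \<mu>: "\<forall>w\<in>W - H. \<mu> w > 0 \<and> (\<forall>m'. \<mu> w dvd m' \<longrightarrow> w \<notin> K m')" ..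
  define m where "m = prod \<mu> (W - H)"
  have m: "m > 0" unfolding m_def by (rule prod_pos) (use \<mu> in simp)
  have "w \<notin> K m" if "w \<in> W - H" for w
  proof -
    have "\<mu> w dvd m" unfolding m_def using that W(1) by (intro dvd_prodI) auto
    then show ?thesis using bspec[OF \<mu> that] by simp
  qed
  then have "K m \<inter> W = H \<inter> W" using HK by blast
  moreover have "K m \<noteq> H"
  proof
    assume eq: "K m = H"
    obtain y where y: "V v (m *s y) \<notin> H" using no[OF m] by blast
    have "\<one>\<^bsub>path_group \<Gamma>\<^esub> \<cdot> V v (m *s y) \<in> K m" unfolding K_def using subgroup.one_closed[OF H(1)] by blast
    then show False using y eq Vc by simp
  qed
  ultimately show thesis using that K inf by blast
qed

text \<open>In the exceptional case the question is whether \<open>H\<close> contains some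
  m\<int>^d. If it does, so does the edge stabilizer \<open>Ls\<close>, by normality, and a gadget
  is available; otherwise \<open>H\<close> can be enlarged inside the product with the vertex
  group.\<close>

lemma infinite_quotient_limit:
  assumes R: "reduced_graph \<Gamma>" and v0: "v\<^sub>0 \<in> verts \<Gamma>" and na: "\<not> amenable (fundamental_group \<Gamma> v\<^sub>0)"
    and H: "subgroup H (fundamental_group \<Gamma> v\<^sub>0)" "infinite_graph (tree_quotient \<Gamma> v\<^sub>0 H)"
    and W: "finite W" "W \<subseteq> path_classes \<Gamma> v\<^sub>0 v\<^sub>0"
  shows "\<exists>K. subgroup K (fundamental_group \<Gamma> v\<^sub>0) \<and> infinite_graph (tree_quotient \<Gamma> v\<^sub>0 K) \<and> K \<noteq> H \<and> K \<inter> W = H \<inter> W"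
proof -
  have HP: "subgroup H (path_group \<Gamma>)" "H \<subseteq> path_classes \<Gamma> v\<^sub>0 v\<^sub>0" using H subgroup_fundamental_group[OF v0] by auto
  have "\<forall>g\<in>W. \<exists>w. path_word \<Gamma> v\<^sub>0 w v\<^sub>0 \<and> cl w = g" using W(2) unfolding path_classes_def by blast
  from bchoice[OF this] obtain r where rr: "\<forall>g\<in>W. path_word \<Gamma> v\<^sub>0 (r g) v\<^sub>0 \<and> cl (r g) = g" ..
  have r: "path_word \<Gamma> v\<^sub>0 (r g) v\<^sub>0" "cl (r g) = g" if "g \<in> W" for g using bspec[OF rr that] by simp_all
  have rw: "w \<in> words \<Gamma>" if "w \<in> r ` W" for w using that r(1) path_word_words by blast
  obtain e q where eq: "e \<in> edges \<Gamma>" "path_word \<Gamma> v\<^sub>0 q (src \<Gamma> e)" "clear H (cl q) e q \<one>\<^bsub>path_group \<Gamma>\<^esub>"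
    and cw: "\<And>w. w \<in> r ` W \<Longrightarrow> clear H (cl q) e w \<one>\<^bsub>path_group \<Gamma>\<^esub>"
    by (rule select_edge[OF HP(1) v0 H(2) finite_imageI[OF W(1)] rw]) (assumption | rule that)+
  define Ls where "Ls = {z. cl q \<cdot> V (src \<Gamma> e) (lab_src \<Gamma> e *v z) \<cdot> inv\<^bsub>path_group \<Gamma>\<^esub> cl q \<in> H}"
  have main: ?thesis if g: "gadget e Ls"
  proof -
    obtain H1 H2 where H12: "subgroup H1 (fundamental_group \<Gamma> v\<^sub>0)" "subgroup H2 (fundamental_group \<Gamma> v\<^sub>0)" "H1 \<noteq> H2"
      "infinite_graph (tree_quotient \<Gamma> v\<^sub>0 H1)" "infinite_graph (tree_quotient \<Gamma> v\<^sub>0 H2)"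
      and agree: "\<And>w. path_word \<Gamma> v\<^sub>0 w v\<^sub>0 \<Longrightarrow> clear H (cl q) e w \<one>\<^bsub>path_group \<Gamma>\<^esub> \<Longrightarrow>
        (cl w \<in> H1 \<longleftrightarrow> cl w \<in> H) \<and> (cl w \<in> H2 \<longleftrightarrow> cl w \<in> H)"
      by (rule gadget_surgery[OF HP(1) eq g[unfolded Ls_def]]) (rule that)
    have ag: "g \<in> H1 \<longleftrightarrow> g \<in> H" "g \<in> H2 \<longleftrightarrow> g \<in> H" if "g \<in> W" for g
      using agree[OF r(1)[OF that] cw[OF imageI[OF that]]] r(2)[OF that] by simp_all
    then have eqW: "H1 \<inter> W = H \<inter> W" "H2 \<inter> W = H \<inter> W" by blast+
    show ?thesis
    proof (cases "H1 = H")
      case True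
      then show ?thesis using H12 eqW by (intro exI[of _ H2] conjI) simp_all
    next
      case False
      then show ?thesis using H12 eqW by (intro exI[of _ H1] conjI) simp_all
    qed
  qed
  from R v0 na show ?thesis
  proof (cases rule: nonamenable_cases)
    case gadgets
    then show ?thesis using main eq(1) by blast
  next
    case (invertible f k)
    show ?thesis
    proof (cases "\<exists>m>0. \<forall>y. V v\<^sub>0 (m *s y) \<in> H")
      case True
      then obtain m where m: "m > 0" "\<And>y. V v\<^sub>0 (m *s y) \<in> H" by blast
      have qc: "cl q \<in> carrier (path_group \<Gamma>)" using path_word_words eq(2) by blast
      have s: "src \<Gamma> e = v\<^sub>0" using src_in[OF eq(1)] invertible(1) by simp
      have "zsub {a. cl q \<cdot> V v\<^sub>0 a \<cdot> inv\<^bsub>path_group \<Gamma>\<^esub> cl q \<in> H}" (is "zsub ?A") by (rule zsub_conj[OF HP(1) qc v0])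
      moreover have Ls_A: "Ls = {z. lab_src \<Gamma> e *v z \<in> ?A}" unfolding Ls_def s by blast
      ultimately have "zsub Ls" unfolding zsub_def by (simp add: matrix_vector_mult_diff_distrib)
      moreover have "m *s y \<in> Ls" for y
      proof -
        obtain b where b: "\<And>m. cl q \<cdot> V v\<^sub>0 (m *s (lab_src \<Gamma> e *v y)) = V v\<^sub>0 (m *s b) \<cdot> cl q"
          using vertex_group_normal(1)[OF invertible(1,2) qc] by blast
        have Vc: "V v\<^sub>0 x \<in> carrier (path_group \<Gamma>)" for x using v0 by blast
        have "cl q \<cdot> V v\<^sub>0 (lab_src \<Gamma> e *v (m *s y)) \<cdot> inv\<^bsub>path_group \<Gamma>\<^esub> cl q = V v\<^sub>0 (m *s b)"
          unfolding int_mult_smult b using qc Vc by (simp add: F.m_assoc)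
        then show ?thesis unfolding Ls_def s using m(2) by simp
      qed
      ultimately have "gadget e Ls"
        by (intro gadget_all_invertible[OF R eq(1) invertible _ m(1)])
      then show ?thesis by (rule main)
    next
      case False
      have WP: "W \<subseteq> carrier (path_group \<Gamma>)" using W(2) path_classes_carrier by blast
      obtain K where K: "subgroup K (path_group \<Gamma>)" "infinite_graph (tree_quotient \<Gamma> v\<^sub>0 K)" "K \<noteq> H" "K \<inter> W = H \<inter> W"
        by (rule enlarge_by_vertex_group[OF invertible(1,2) HP(1) H(2) _ W(1) WP]) (use False that in blast)+
      \<comment> \<open>With a single vertex every word is a closed path, so subgroups of the path
        group are subgroups of the fundamental group.\<close>
      have all: "path_word \<Gamma> v\<^sub>0 w v\<^sub>0" if "w \<in> words \<Gamma>" for w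
        using that
      proof (induction w)
        case Nil
        show ?case by (rule path_word.Nil[OF v0])
      next
        case (Cons l w)
        have IH: "path_word \<Gamma> v\<^sub>0 w v\<^sub>0" using Cons words_ConsD by blast
        consider x where "l = Vtx v\<^sub>0 x" | f where "l = Edg f" "f \<in> edges \<Gamma>"
          using Cons.prems invertible(1) unfolding words_def by auto
        then show ?case
        proof cases
          case (1 x)
          then show ?thesis using path_word.Vtx[OF v0 IH, of x] by simp
        next
          case (2 f)
          then have "src \<Gamma> f = v\<^sub>0" "tgt \<Gamma> f = v\<^sub>0" using src_in tgt_in invertible(1) by blast+
          then show ?thesis using path_word.Edg[OF 2(2), of w v\<^sub>0] IH 2 by simp
        qed
      qed
      have "K \<subseteq> path_classes \<Gamma> v\<^sub>0 v\<^sub>0"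
        using subgroup.subset[OF K(1)] all unfolding carrier_path_group path_classes_def by blast
      then show ?thesis using K subgroup_fundamental_group[OF v0] by blast
    qed
  qed
qed

lemma countable_path_classes: "countable (path_classes \<Gamma> u v)"
proof -
  have vec: "countable (UNIV :: (int ^ 'd) set)"
    by (rule countableI_type)
  have "countable ({Vtx v a | v a. v \<in> verts \<Gamma>} \<union> Edg ` edges \<Gamma> :: ('v, 'e, 'd) letter set)"
  proof (rule countable_Un)
    have "({Vtx v a | v a. v \<in> verts \<Gamma>} :: ('v, 'e, 'd) letter set) = (\<lambda>(v, a). Vtx v a) ` (verts \<Gamma> \<times> UNIV)" by auto
    then show "countable ({Vtx v a | v a. v \<in> verts \<Gamma>} :: ('v, 'e, 'd) letter set)"
      by (simp only:) (intro countable_image countable_SIGMA countable_finite finite_verts vec)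
    show "countable (Edg ` edges \<Gamma>)" using countable_finite[OF finite_edges] by simp
  qed
  then have "countable (words \<Gamma>)" unfolding words_def by (rule countable_lists)
  then have "countable (cl ` words \<Gamma>)" by simp
  moreover have "path_classes \<Gamma> u v \<subseteq> cl ` words \<Gamma>" unfolding path_classes_def using path_word_words by blast
  ultimately show ?thesis using countable_subset by blast
qed

lemma perfect_kernel_fundamental_group:
  assumes R: "reduced_graph \<Gamma>" and v0: "v\<^sub>0 \<in> verts \<Gamma>" and na: "\<not> amenable (fundamental_group \<Gamma> v\<^sub>0)"
  shows "perfect_kernel (fundamental_group \<Gamma> v\<^sub>0) =
    {H. subgroup H (fundamental_group \<Gamma> v\<^sub>0) \<and> infinite_graph (tree_quotient \<Gamma> v\<^sub>0 H)}"
proof (rule group.perfect_kernel_eqI[OF group_fundamental_group[OF v0]])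
  note sub = subgroup_fundamental_group[OF v0]
  show "countable (carrier (fundamental_group \<Gamma> v\<^sub>0))"
    unfolding fundamental_group_simps by (rule countable_path_classes)
  fix H assume "H \<in> {H. subgroup H (fundamental_group \<Gamma> v\<^sub>0) \<and> infinite_graph (tree_quotient \<Gamma> v\<^sub>0 H)}"
  then show "subgroup H (fundamental_group \<Gamma> v\<^sub>0)" by blast
next
  fix H assume H: "subgroup H (fundamental_group \<Gamma> v\<^sub>0)"
    "H \<notin> {H. subgroup H (fundamental_group \<Gamma> v\<^sub>0) \<and> infinite_graph (tree_quotient \<Gamma> v\<^sub>0 H)}"
  note sub = subgroup_fundamental_group[OF v0]
  have fin: "\<not> infinite_graph (tree_quotient \<Gamma> v\<^sub>0 H)" using H by blast
  have HP: "subgroup H (path_group \<Gamma>)" "H \<subseteq> path_classes \<Gamma> v\<^sub>0 v\<^sub>0" using H(1) sub by auto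
  show "\<exists>P. finite P \<and> P \<subseteq> H \<and> (\<forall>K. subgroup K (fundamental_group \<Gamma> v\<^sub>0) \<longrightarrow> P \<subseteq> K \<longrightarrow> H \<subseteq> K)"
    using finite_quotient_finitely_generated[OF HP(1) v0 HP(2) fin] unfolding sub by meson
  fix K assume K: "subgroup K (fundamental_group \<Gamma> v\<^sub>0)" "H \<subseteq> K"
  have "subgroup K (path_group \<Gamma>)" using K(1) sub by simp
  from infinite_quotient_subset[OF HP(1) this K(2) fin]
  show "K \<notin> {H. subgroup H (fundamental_group \<Gamma> v\<^sub>0) \<and> infinite_graph (tree_quotient \<Gamma> v\<^sub>0 H)}" by simp
next
  fix H W assume "H \<in> {H. subgroup H (fundamental_group \<Gamma> v\<^sub>0) \<and> infinite_graph (tree_quotient \<Gamma> v\<^sub>0 H)}"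
    and W: "finite W" "W \<subseteq> carrier (fundamental_group \<Gamma> v\<^sub>0)"
  then have H: "subgroup H (fundamental_group \<Gamma> v\<^sub>0)" "infinite_graph (tree_quotient \<Gamma> v\<^sub>0 H)" by simp_all
  from infinite_quotient_limit[OF R v0 na H W(1) W(2)[unfolded fundamental_group_simps]]
  show "\<exists>H'\<in>{H. subgroup H (fundamental_group \<Gamma> v\<^sub>0) \<and> infinite_graph (tree_quotient \<Gamma> v\<^sub>0 H)}. H' \<noteq> H \<and> H' \<inter> W = H \<inter> W"
    unfolding Bex_def mem_Collect_eq by (simp only: conj_assoc)
qed

end

theorem theorem1:
  fixes \<Gamma> :: "('v, 'e, 'd::finite) zd_graph" and v\<^sub>0 :: 'v
  assumes "gbs_graph \<Gamma>"
    and "reduced_graph \<Gamma>"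
    and "v\<^sub>0 \<in> verts \<Gamma>"
    and "\<not> amenable (fundamental_group \<Gamma> v\<^sub>0)"
  shows "perfect_kernel (fundamental_group \<Gamma> v\<^sub>0) =
    {H. subgroup H (fundamental_group \<Gamma> v\<^sub>0) \<and> infinite_graph (tree_quotient \<Gamma> v\<^sub>0 H)}"
  by (rule gbs_graph.perfect_kernel_fundamental_group[OF assms])

end
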